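(* There are simple separable unital purely infinite (hence tracially $\mathcal{Z}$-absorbing) C*-algebras which are not $\mathcal{Z}$-absorbing.
   Context: For positive elements $a,b$ of a C*-algebra $A$, $a \precsim b$ (Cuntz subequivalence) means there is a sequence $(v_n)$ in $A$ with $\|a - v_n b v_n^*\| \to 0$; $a \sim b$ means $a \precsim b$ and $b \precsim a$. A simple C*-algebra $A$ is purely infinite if $A \not\cong \mathbb{C}$ and $a \sim b$ for all $a,b \in A_+\setminus\{0\}$. $\mathcal{Z}$ denotes the Jiang-Su algebra (the unital separable simple infinite-dimensional nuclear C*-algebra constructed by Jiang and Su as an inductive limit of dimension drop algebras, having a unique tracial state and the same K-theoretic invariant as $\mathbb{C}$). $A$ is $\mathcal{Z}$-absorbing if $A \cong A \otimes \mathcal{Z}$. For self-adjoint $c$ and $\varepsilon>0$, $(c-\varepsilon)_+$ is obtained by applying $t \mapsto \max(t-\varepsilon,0)$. $M_n=M_n(\mathbb{C})$, $[y,z]=yz-zy$. A completely positive contractive (c.p.c.) map $\varphi$ has order zero if $\varphi(y)\varphi(z)=0$ whenever $y,z$ are positive with $yz=0$. A simple C*-algebra $A$ is tracially $\mathcal{Z}$-absorbing if $A \not\cong \mathbb{C}$ and for every $x,a \in A_+$ with $a \neq 0$, every finite set $F \subseteq A$, every $\varepsilon>0$, and every $n \in \mathbb{N}$, there is a c.p.c. order zero map $\varphi\colon M_n \to A$ such that (i) $(x^2 - x\varphi(1)x - \varepsilon)_+ \precsim a$, and (ii) $\|[\varphi(z),b]\| < \varepsilon$ for all $z \in M_n$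 with $\|z\| \le 1$ and all $b \in F$. *)

theory Defs
  imports "HOL-Analysis.Analysis" "HOL-Algebra.Module"
begin

section \<open>C*-algebras\<close>

text \<open>The field \<open>one\<close> inherited from rings is not constrained by the C*-algebra axioms: C*-algebras
  need not be unital.  A C*-algebra is unital, with unit \<open>one\<close>, iff \<open>monoid A\<close> holds.\<close>

record 'a cstar = "(complex, 'a) module" +
  adj :: "'a \<Rightarrow> 'a"
  nrm :: "'a \<Rightarrow> real"

definition cdist :: "'a cstar \<Rightarrow> 'a \<Rightarrow> 'a \<Rightarrow> real" where
  "cdist A x y = (if x \<in> carrier A \<and> y \<in> carrier A then nrm A (x \<ominus>\<^bsub>A\<^esub> y) else 0)"

abbreviation cstar_topology :: "'a cstar \<Rightarrow> 'a topology" where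
  "cstar_topology A \<equiv> Metric_space.mtopology (carrier A) (cdist A)"

locale normed_star_algebra = abelian_group A for A :: "'a cstar" (structure) +
  assumes m_closed: "\<lbrakk>x \<in> carrier A; y \<in> carrier A\<rbrakk> \<Longrightarrow> x \<otimes> y \<in> carrier A"
    and m_assoc: "\<lbrakk>x \<in> carrier A; y \<in> carrier A; z \<in> carrier A\<rbrakk> \<Longrightarrow> (x \<otimes> y) \<otimes> z = x \<otimes> (y \<otimes> z)"
    and l_distr: "\<lbrakk>x \<in> carrier A; y \<in> carrier A; z \<in> carrier A\<rbrakk> \<Longrightarrow> (x \<oplus> y) \<otimes> z = x \<otimes> z \<oplus> y \<otimes> z"
    and r_distr: "\<lbrakk>x \<in> carrier A; y \<in> carrier A; z \<in> carrier A\<rbrakk> \<Longrightarrow> z \<otimes> (x \<oplus> y) = z \<otimes> x \<oplus> z \<otimes> y"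
    and smult_closed: "x \<in> carrier A \<Longrightarrow> c \<odot> x \<in> carrier A"
    and smult_l_distr: "x \<in> carrier A \<Longrightarrow> (c + d) \<odot> x = c \<odot> x \<oplus> d \<odot> x"
    and smult_r_distr: "\<lbrakk>x \<in> carrier A; y \<in> carrier A\<rbrakk> \<Longrightarrow> c \<odot> (x \<oplus> y) = c \<odot> x \<oplus> c \<odot> y"
    and smult_assoc: "x \<in> carrier A \<Longrightarrow> (c * d) \<odot> x = c \<odot> (d \<odot> x)"
    and smult_one: "x \<in> carrier A \<Longrightarrow> 1 \<odot> x = x"
    and smult_mult_left: "\<lbrakk>x \<in> carrier A; y \<in> carrier A\<rbrakk> \<Longrightarrow> (c \<odot> x) \<otimes> y = c \<odot> (x \<otimes> y)"
    and smult_mult_right: "\<lbrakk>x \<in> carrier A; y \<in> carrier A\<rbrakk> \<Longrightarrow> x \<otimes> (c \<odot> y) = c \<odot> (x \<otimes> y)"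
    and adj_closed: "x \<in> carrier A \<Longrightarrow> adj A x \<in> carrier A"
    and adj_adj: "x \<in> carrier A \<Longrightarrow> adj A (adj A x) = x"
    and adj_add: "\<lbrakk>x \<in> carrier A; y \<in> carrier A\<rbrakk> \<Longrightarrow> adj A (x \<oplus> y) = adj A x \<oplus> adj A y"
    and adj_smult: "x \<in> carrier A \<Longrightarrow> adj A (c \<odot> x) = cnj c \<odot> adj A x"
    and adj_mult: "\<lbrakk>x \<in> carrier A; y \<in> carrier A\<rbrakk> \<Longrightarrow> adj A (x \<otimes> y) = adj A y \<otimes> adj A x"
    and nrm_nonneg: "x \<in> carrier A \<Longrightarrow> 0 \<le> nrm A x"
    and nrm_eq_0: "x \<in> carrier A \<Longrightarrow> nrm A x = 0 \<longleftrightarrow> x = \<zero>"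
    and nrm_triangle: "\<lbrakk>x \<in> carrier A; y \<in> carrier A\<rbrakk> \<Longrightarrow> nrm A (x \<oplus> y) \<le> nrm A x + nrm A y"
    and nrm_smult: "x \<in> carrier A \<Longrightarrow> nrm A (c \<odot> x) = cmod c * nrm A x"
    and nrm_mult: "\<lbrakk>x \<in> carrier A; y \<in> carrier A\<rbrakk> \<Longrightarrow> nrm A (x \<otimes> y) \<le> nrm A x * nrm A y"
begin

lemma smult_zero_left: "x \<in> carrier A \<Longrightarrow> 0 \<odot> x = \<zero>"
  using nrm_eq_0[of "0 \<odot> x"] nrm_smult[of x 0] smult_closed[of x 0] by simp

lemma smult_minus_one: "x \<in> carrier A \<Longrightarrow> (-1) \<odot> x = \<ominus> x"
  using smult_l_distr[of x "-1" 1] smult_zero_left smult_one smult_closed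
  by (simp add: minus_equality)

lemma nrm_minus: "x \<in> carrier A \<Longrightarrow> nrm A (\<ominus> x) = nrm A x"
  using nrm_smult[of x "-1"] by (simp add: smult_minus_one)

sublocale metric: Metric_space "carrier A" "cdist A"
proof
  fix x y z
  show "0 \<le> cdist A x y"
    by (simp add: cdist_def nrm_nonneg)
  show "cdist A x y = cdist A y x"
    using nrm_minus[of "x \<ominus> y"]
    by (auto simp: cdist_def minus_eq minus_add a_comm)
  show "cdist A x y = 0 \<longleftrightarrow> x = y" if "x \<in> carrier A" "y \<in> carrier A"
    using that nrm_eq_0[of "x \<ominus> y"] minus_equality[of x "\<ominus> y"]
    by (auto simp: cdist_def minus_eq r_neg)
  show "cdist A x z \<le> cdist A x y + cdist A y z"
    if "x \<in> carrier A" "y \<in> carrier A" "z \<in> carrier A"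
  proof -
    have "x \<ominus> z = (x \<ominus> y) \<oplus> (y \<ominus> z)"
      using that by (simp add: minus_eq a_assoc r_neg1)
    then show ?thesis
      using that nrm_triangle[of "x \<ominus> y" "y \<ominus> z"] by (simp add: cdist_def)
  qed
qed

end

locale cstar_algebra = normed_star_algebra +
  assumes cstar_identity: "x \<in> carrier A \<Longrightarrow> nrm A (adj A x \<otimes> x) = (nrm A x)\<^sup>2"
    and complete: "metric.mcomplete"

definition separable :: "'a cstar \<Rightarrow> bool" where
  "separable A \<longleftrightarrow> separable_space (cstar_topology A)"

definition positive :: "'a cstar \<Rightarrow> 'a \<Rightarrow> bool" where
  "positive A a \<longleftrightarrow> (\<exists>y\<in>carrier A. a = adj A y \<otimes>\<^bsub>A\<^esub> y)"

definition closed_ideal :: "'a cstar \<Rightarrow> 'a set \<Rightarrow> bool" where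
  "closed_ideal A J \<longleftrightarrow> closedin (cstar_topology A) J \<and> \<zero>\<^bsub>A\<^esub> \<in> J \<and>
     (\<forall>x\<in>J. \<forall>y\<in>J. x \<oplus>\<^bsub>A\<^esub> y \<in> J) \<and> (\<forall>x\<in>J. \<forall>c. c \<odot>\<^bsub>A\<^esub> x \<in> J) \<and>
     (\<forall>x\<in>J. \<forall>y\<in>carrier A. x \<otimes>\<^bsub>A\<^esub> y \<in> J \<and> y \<otimes>\<^bsub>A\<^esub> x \<in> J)"

definition simple :: "'a cstar \<Rightarrow> bool" where
  "simple A \<longleftrightarrow> carrier A \<noteq> {\<zero>\<^bsub>A\<^esub>} \<and>
     (\<forall>J. closed_ideal A J \<longrightarrow> J = {\<zero>\<^bsub>A\<^esub>} \<or> J = carrier A)"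

definition finite_dimensional :: "'a cstar \<Rightarrow> bool" where
  "finite_dimensional A \<longleftrightarrow> (\<exists>S. finite S \<and> S \<subseteq> carrier A \<and>
     (\<forall>x\<in>carrier A. \<exists>c. x = (\<Oplus>\<^bsub>A\<^esub>s\<in>S. c s \<odot>\<^bsub>A\<^esub> s)))"

definition linear_map :: "'a cstar \<Rightarrow> 'b cstar \<Rightarrow> ('a \<Rightarrow> 'b) \<Rightarrow> bool" where
  "linear_map A B f \<longleftrightarrow> f \<in> carrier A \<rightarrow> carrier B \<and>
     (\<forall>x\<in>carrier A. \<forall>y\<in>carrier A. f (x \<oplus>\<^bsub>A\<^esub> y) = f x \<oplus>\<^bsub>B\<^esub> f y) \<and>
     (\<forall>x\<in>carrier A. \<forall>c. f (c \<odot>\<^bsub>A\<^esub> x) = c \<odot>\<^bsub>B\<^esub> f x)"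

definition star_hom :: "'a cstar \<Rightarrow> 'b cstar \<Rightarrow> ('a \<Rightarrow> 'b) \<Rightarrow> bool" where
  "star_hom A B f \<longleftrightarrow> linear_map A B f \<and>
     (\<forall>x\<in>carrier A. \<forall>y\<in>carrier A. f (x \<otimes>\<^bsub>A\<^esub> y) = f x \<otimes>\<^bsub>B\<^esub> f y) \<and>
     (\<forall>x\<in>carrier A. f (adj A x) = adj B (f x))"

definition isomorphic :: "'a cstar \<Rightarrow> 'b cstar \<Rightarrow> bool" where
  "isomorphic A B \<longleftrightarrow> (\<exists>f. star_hom A B f \<and> bij_betw f (carrier A) (carrier B))"

definition cstar_subalgebra :: "'a cstar \<Rightarrow> 'a set \<Rightarrow> bool" where
  "cstar_subalgebra A S \<longleftrightarrow> closedin (cstar_topology A) S \<and> \<zero>\<^bsub>A\<^esub> \<in> S \<and>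
     (\<forall>x\<in>S. \<forall>y\<in>S. x \<oplus>\<^bsub>A\<^esub> y \<in> S \<and> x \<otimes>\<^bsub>A\<^esub> y \<in> S) \<and>
     (\<forall>x\<in>S. adj A x \<in> S \<and> (\<forall>c. c \<odot>\<^bsub>A\<^esub> x \<in> S))"

definition cstar_generated :: "'a cstar \<Rightarrow> 'a set \<Rightarrow> 'a set" where
  "cstar_generated A S = \<Inter>{T. cstar_subalgebra A T \<and> S \<subseteq> T}"

definition complex_cstar :: "complex cstar" where
  "complex_cstar = \<lparr>carrier = UNIV, monoid.mult = (*), one = 1, zero = 0, add = (+),
     smult = (*), adj = cnj, nrm = cmod\<rparr>"


section \<open>Bounded operators on Hilbert spaces\<close>

text \<open>\<open>l2 I\<close> is the Hilbert space of square summable functions on \<open>I\<close>, extended by 0 outside \<open>I\<close>.\<close>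

definition l2 :: "'i set \<Rightarrow> ('i \<Rightarrow> complex) set" where
  "l2 I = {x. (\<forall>i. i \<notin> I \<longrightarrow> x i = 0) \<and> (\<lambda>i. (cmod (x i))\<^sup>2) summable_on UNIV}"

definition l2_inner :: "('i \<Rightarrow> complex) \<Rightarrow> ('i \<Rightarrow> complex) \<Rightarrow> complex" where
  "l2_inner x y = (\<Sum>\<^sub>\<infinity>i. cnj (x i) * y i)"

definition l2_norm :: "('i \<Rightarrow> complex) \<Rightarrow> real" where
  "l2_norm x = sqrt (\<Sum>\<^sub>\<infinity>i. (cmod (x i))\<^sup>2)"

type_synonym 'i operator = "('i \<Rightarrow> complex) \<Rightarrow> ('i \<Rightarrow> complex)"

definition bounded_operators :: "'i set \<Rightarrow> 'i operator set" where
  "bounded_operators I = {T \<in> l2 I \<rightarrow>\<^sub>E l2 I.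
     (\<forall>x\<in>l2 I. \<forall>y\<in>l2 I. T (\<lambda>i. x i + y i) = (\<lambda>i. T x i + T y i)) \<and>
     (\<forall>x\<in>l2 I. \<forall>c. T (\<lambda>i. c * x i) = (\<lambda>i. c * T x i)) \<and>
     (\<exists>C. \<forall>x\<in>l2 I. l2_norm (T x) \<le> C * l2_norm x)}"

definition BL2 :: "'i set \<Rightarrow> 'i operator cstar" where
  "BL2 I = \<lparr>carrier = bounded_operators I,
     monoid.mult = (\<lambda>S T. \<lambda>x\<in>l2 I. S (T x)),
     one = (\<lambda>x\<in>l2 I. x),
     zero = (\<lambda>x\<in>l2 I. \<lambda>i. 0),
     add = (\<lambda>S T. \<lambda>x\<in>l2 I. \<lambda>i. S x i + T x i),
     smult = (\<lambda>c T. \<lambda>x\<in>l2 I. \<lambda>i. c * T x i),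
     adj = (\<lambda>T. THE S. S \<in> bounded_operators I \<and>
              (\<forall>x\<in>l2 I. \<forall>y\<in>l2 I. l2_inner (S x) y = l2_inner x (T y))),
     nrm = (\<lambda>T. SUP x\<in>{x \<in> l2 I. l2_norm x \<le> 1}. l2_norm (T x))\<rparr>"

text \<open>The matrix algebra \<open>M_n(\<complex>)\<close> is identified with the operators on \<open>\<complex>^n = l2 {..<n}\<close>.\<close>

abbreviation Mn :: "nat \<Rightarrow> nat operator cstar" where
  "Mn n \<equiv> BL2 {..<n}"

text \<open>\<open>S \<otimes> T\<close>, acting on \<open>l2 I \<otimes> l2 J = l2 (I \<times> J)\<close>.\<close>

definition op_tensor :: "'i set \<Rightarrow> 'j set \<Rightarrow> 'i operator \<Rightarrow> 'j operator \<Rightarrow> ('i \<times> 'j) operator" where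
  "op_tensor I J S T = (THE R. R \<in> bounded_operators (I \<times> J) \<and>
     (\<forall>x\<in>l2 I. \<forall>y\<in>l2 J. R (\<lambda>(i, j). x i * y j) = (\<lambda>(i, j). S x i * T y j)))"


section \<open>The spatial tensor product\<close>

definition faithful_rep :: "'i set \<Rightarrow> 'a cstar \<Rightarrow> ('a \<Rightarrow> 'i operator) \<Rightarrow> bool" where
  "faithful_rep I A \<pi> \<longleftrightarrow> star_hom A (BL2 I) \<pi> \<and> inj_on \<pi> (carrier A)"

definition spatial_tensor ::
  "'i set \<Rightarrow> 'j set \<Rightarrow> ('a \<Rightarrow> 'i operator) \<Rightarrow> ('b \<Rightarrow> 'j operator) \<Rightarrow> 'a cstar \<Rightarrow> 'b cstar
     \<Rightarrow> ('i \<times> 'j) operator cstar" where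
  "spatial_tensor I J \<pi> \<rho> A B = (BL2 (I \<times> J))\<lparr>carrier :=
     cstar_generated (BL2 (I \<times> J)) {op_tensor I J (\<pi> a) (\<rho> b) |a b. a \<in> carrier A \<and> b \<in> carrier B}\<rparr>"


section \<open>Matrices over a C*-algebra\<close>

text \<open>A \<open>k \<times> k\<close> matrix over \<open>A\<close> is a function on pairs of indices that is 0 outside
  \<open>{..<k} \<times> {..<k}\<close>, so that the inclusions of \<open>M_k(A)\<close> in \<open>M_{k+1}(A)\<close> as upper left corners
  are literal inclusions.\<close>

type_synonym 'a matrix = "nat \<Rightarrow> nat \<Rightarrow> 'a"

definition mats :: "'a cstar \<Rightarrow> nat \<Rightarrow> 'a matrix set" where
  "mats A k = {X. (\<forall>i<k. \<forall>j<k. X i j \<in> carrier A) \<and> (\<forall>i j. k \<le> i \<or> k \<le> j \<longrightarrow> X i j = \<zero>\<^bsub>A\<^esub>)}"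

definition mat_mult :: "'a cstar \<Rightarrow> nat \<Rightarrow> 'a matrix \<Rightarrow> 'a matrix \<Rightarrow> 'a matrix" where
  "mat_mult A k X Y = (\<lambda>i j. \<Oplus>\<^bsub>A\<^esub>l\<in>{..<k}. X i l \<otimes>\<^bsub>A\<^esub> Y l j)"

definition mat_adj :: "'a cstar \<Rightarrow> 'a matrix \<Rightarrow> 'a matrix" where
  "mat_adj A X = (\<lambda>i j. adj A (X j i))"

definition mat_one :: "'a cstar \<Rightarrow> nat \<Rightarrow> 'a matrix" where
  "mat_one A k = (\<lambda>i j. if i = j \<and> i < k then \<one>\<^bsub>A\<^esub> else \<zero>\<^bsub>A\<^esub>)"

text \<open>The block diagonal sum of a \<open>k \<times> k\<close> matrix \<open>X\<close> and a matrix \<open>Y\<close>.\<close>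

definition mat_diag :: "'a cstar \<Rightarrow> nat \<Rightarrow> 'a matrix \<Rightarrow> 'a matrix \<Rightarrow> 'a matrix" where
  "mat_diag A k X Y = (\<lambda>i j. if i < k \<and> j < k then X i j
     else if k \<le> i \<and> k \<le> j then Y (i - k) (j - k) else \<zero>\<^bsub>A\<^esub>)"

definition mat_positive :: "'a cstar \<Rightarrow> nat \<Rightarrow> 'a matrix \<Rightarrow> bool" where
  "mat_positive A k X \<longleftrightarrow> (\<exists>Y\<in>mats A k. X = mat_mult A k (mat_adj A Y) Y)"


section \<open>Completely positive contractive maps and nuclearity\<close>

definition cpc :: "'a cstar \<Rightarrow> 'b cstar \<Rightarrow> ('a \<Rightarrow> 'b) \<Rightarrow> bool" where
  "cpc A B \<phi> \<longleftrightarrow> linear_map A B \<phi> \<and>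
     (\<forall>k X. mat_positive A k X \<longrightarrow> mat_positive B k (\<lambda>i j. \<phi> (X i j))) \<and>
     (\<forall>x\<in>carrier A. nrm B (\<phi> x) \<le> nrm A x)"

definition order_zero :: "'a cstar \<Rightarrow> 'b cstar \<Rightarrow> ('a \<Rightarrow> 'b) \<Rightarrow> bool" where
  "order_zero A B \<phi> \<longleftrightarrow> (\<forall>y z. positive A y \<and> positive A z \<and> y \<otimes>\<^bsub>A\<^esub> z = \<zero>\<^bsub>A\<^esub>
     \<longrightarrow> \<phi> y \<otimes>\<^bsub>B\<^esub> \<phi> z = \<zero>\<^bsub>B\<^esub>)"

text \<open>Nuclearity in the form of the completely positive approximation property.\<close>

definition nuclear :: "'a cstar \<Rightarrow> bool" where
  "nuclear A \<longleftrightarrow> (\<forall>F \<epsilon>. finite F \<and> F \<subseteq> carrier A \<and> \<epsilon> > 0 \<longrightarrow>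
     (\<exists>n \<phi> \<psi>. cpc A (Mn n) \<phi> \<and> cpc (Mn n) A \<psi> \<and> (\<forall>x\<in>F. nrm A (\<psi> (\<phi> x) \<ominus>\<^bsub>A\<^esub> x) < \<epsilon>)))"


section \<open>K-theory\<close>

definition projection :: "'a cstar \<Rightarrow> nat \<Rightarrow> 'a matrix \<Rightarrow> bool" where
  "projection A k P \<longleftrightarrow> P \<in> mats A k \<and> mat_mult A k P P = P \<and> mat_adj A P = P"

definition murray_von_neumann :: "'a cstar \<Rightarrow> 'a matrix \<Rightarrow> 'a matrix \<Rightarrow> bool" where
  "murray_von_neumann A P Q \<longleftrightarrow> (\<exists>k. \<exists>V\<in>mats A k.
     mat_mult A k (mat_adj A V) V = P \<and> mat_mult A k V (mat_adj A V) = Q)"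

text \<open>Equality of the \<open>K_0\<close>-classes of the projections \<open>P\<close> in \<open>M_k(A)\<close> and \<open>Q\<close> in \<open>M_l(A)\<close>,
  for unital \<open>A\<close>.\<close>

definition K0_eq :: "'a cstar \<Rightarrow> nat \<Rightarrow> 'a matrix \<Rightarrow> nat \<Rightarrow> 'a matrix \<Rightarrow> bool" where
  "K0_eq A k P l Q \<longleftrightarrow>
     (\<exists>m. murray_von_neumann A (mat_diag A k P (mat_one A m)) (mat_diag A l Q (mat_one A m)))"

text \<open>\<open>K_0(A)\<close> with its positive cone and the class of the unit is isomorphic to \<open>(\<int>, \<nat>, 1)\<close>.
  Such an isomorphism is the same as an isomorphism \<open>d\<close> from the monoid of \<open>K_0\<close>-classes
  of projections, which is the positive cone and generates \<open>K_0(A)\<close>, onto \<open>\<nat>\<close> with \<open>d [1] = 1\<close>;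
  the latter makes \<open>d\<close> surjective.\<close>

definition K0_trivial :: "'a cstar \<Rightarrow> bool" where
  "K0_trivial A \<longleftrightarrow> (\<exists>d :: 'a matrix \<Rightarrow> nat. d (mat_one A 1) = 1 \<and>
     (\<forall>k l P Q. projection A k P \<and> projection A l Q \<longrightarrow>
        d (mat_diag A k P Q) = d P + d Q \<and> (d P = d Q \<longleftrightarrow> K0_eq A k P l Q)))"

definition unitaries :: "'a cstar \<Rightarrow> nat \<Rightarrow> 'a matrix set" where
  "unitaries A k = {u \<in> mats A k. mat_mult A k (mat_adj A u) u = mat_one A k \<and>
     mat_mult A k u (mat_adj A u) = mat_one A k}"

text \<open>\<open>K_1(A) = 0\<close>: every unitary matrix is stably homotopic to the unit.\<close>

definition K1_trivial :: "'a cstar \<Rightarrow> bool" where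
  "K1_trivial A \<longleftrightarrow> (\<forall>k. \<forall>u\<in>unitaries A k. \<exists>m (\<gamma> :: real \<Rightarrow> 'a matrix).
     \<gamma> ` {0..1} \<subseteq> unitaries A (k + m) \<and>
     (\<forall>i<k + m. \<forall>j<k + m. continuous_map (top_of_set {0..1}) (cstar_topology A) (\<lambda>t. \<gamma> t i j)) \<and>
     \<gamma> 0 = mat_diag A k u (mat_one A m) \<and> \<gamma> 1 = mat_one A (k + m))"


section \<open>The Jiang-Su algebra\<close>

definition C01 :: "'a cstar \<Rightarrow> (real \<Rightarrow> 'a) cstar" where
  "C01 B = \<lparr>carrier = {f \<in> extensional {0..1}.
              continuous_map (top_of_set {0..1}) (cstar_topology B) f},
     monoid.mult = (\<lambda>f g. \<lambda>t\<in>{0..1}. f t \<otimes>\<^bsub>B\<^esub> g t),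
     one = (\<lambda>t\<in>{0..1}. \<one>\<^bsub>B\<^esub>),
     zero = (\<lambda>t\<in>{0..1}. \<zero>\<^bsub>B\<^esub>),
     add = (\<lambda>f g. \<lambda>t\<in>{0..1}. f t \<oplus>\<^bsub>B\<^esub> g t),
     smult = (\<lambda>c f. \<lambda>t\<in>{0..1}. c \<odot>\<^bsub>B\<^esub> f t),
     adj = (\<lambda>f. \<lambda>t\<in>{0..1}. adj B (f t)),
     nrm = (\<lambda>f. SUP t\<in>{0..1}. nrm B (f t))\<rparr>"

text \<open>The functions \<open>f : [0,1] \<rightarrow> M_p \<otimes> M_q\<close> with \<open>f(0) \<in> M_p \<otimes> 1\<close> and \<open>f(1) \<in> 1 \<otimes> M_q\<close>.\<close>

definition dimension_drop :: "nat \<Rightarrow> nat \<Rightarrow> (real \<Rightarrow> (nat \<times> nat) operator) cstar" where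
  "dimension_drop p q = (let B = C01 (BL2 ({..<p} \<times> {..<q})) in
     B\<lparr>carrier := {f \<in> carrier B.
       (\<exists>a\<in>carrier (Mn p). f 0 = op_tensor {..<p} {..<q} a \<one>\<^bsub>Mn q\<^esub>) \<and>
       (\<exists>b\<in>carrier (Mn q). f 1 = op_tensor {..<p} {..<q} \<one>\<^bsub>Mn p\<^esub> b)}\<rparr>)"

text \<open>Inductive limits of sequences of prime dimension drop algebras with injective unital
  connecting maps, up to isomorphism: closures of increasing unions.\<close>

definition dimension_drop_limit :: "'a cstar \<Rightarrow> bool" where
  "dimension_drop_limit A \<longleftrightarrow> (\<exists>D :: nat \<Rightarrow> 'a set.
     (\<forall>n. cstar_subalgebra A (D n) \<and> \<one>\<^bsub>A\<^esub> \<in> D n \<and> D n \<subseteq> D (Suc n) \<and>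
        (\<exists>p\<ge>1. \<exists>q\<ge>1. coprime p q \<and> isomorphic (A\<lparr>carrier := D n\<rparr>) (dimension_drop p q))) \<and>
     cstar_topology A closure_of (\<Union>n. D n) = carrier A)"

definition tracial_state :: "'a cstar \<Rightarrow> ('a \<Rightarrow> complex) \<Rightarrow> bool" where
  "tracial_state A \<tau> \<longleftrightarrow> linear_map A complex_cstar \<tau> \<and> \<tau> \<one>\<^bsub>A\<^esub> = 1 \<and>
     (\<forall>x. positive A x \<longrightarrow> \<tau> x \<in> \<real>\<^sub>\<ge>\<^sub>0) \<and>
     (\<forall>x\<in>carrier A. \<forall>y\<in>carrier A. \<tau> (x \<otimes>\<^bsub>A\<^esub> y) = \<tau> (y \<otimes>\<^bsub>A\<^esub> x))"

text \<open>By the classification theorem of Jiang and Su, these properties determine the algebra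
  up to isomorphism.\<close>

definition jiang_su :: "'a cstar \<Rightarrow> bool" where
  "jiang_su Z \<longleftrightarrow> cstar_algebra Z \<and> monoid Z \<and> separable Z \<and> simple Z \<and>
     \<not> finite_dimensional Z \<and> nuclear Z \<and> dimension_drop_limit Z \<and>
     (\<exists>!\<tau>. \<tau> \<in> extensional (carrier Z) \<and> tracial_state Z \<tau>) \<and>
     K0_trivial Z \<and> K1_trivial Z"

text \<open>\<open>A \<cong> A \<otimes> \<Z>\<close>.  A separable C*-algebra has at most continuum many elements, so the Jiang-Su
  algebra can be carried by the type \<open>real\<close>.  A C*-algebra carried by a type \<open>'a\<close> has a faithful
  (possibly degenerate) representation on \<open>l2 (UNIV :: 'a set)\<close>; the spatial tensor product does
  not depend on the choice of the faithful representations.\<close>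

definition Z_absorbing :: "'a cstar \<Rightarrow> bool" where
  "Z_absorbing A \<longleftrightarrow> (\<exists>(Z :: real cstar) (\<pi> :: 'a \<Rightarrow> 'a operator) (\<rho> :: real \<Rightarrow> real operator).
     jiang_su Z \<and> faithful_rep UNIV A \<pi> \<and> faithful_rep UNIV Z \<rho> \<and>
     isomorphic A (spatial_tensor UNIV UNIV \<pi> \<rho> A Z))"


section \<open>Purely infinite and tracially Jiang-Su absorbing C*-algebras\<close>

definition cuntz_le :: "'a cstar \<Rightarrow> 'a \<Rightarrow> 'a \<Rightarrow> bool" where
  "cuntz_le A a b \<longleftrightarrow> (\<exists>v :: nat \<Rightarrow> 'a. range v \<subseteq> carrier A \<and>
     (\<lambda>n. nrm A (a \<ominus>\<^bsub>A\<^esub> v n \<otimes>\<^bsub>A\<^esub> b \<otimes>\<^bsub>A\<^esub> adj A (v n))) \<longlonglongrightarrow> 0)"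

definition cuntz_equiv :: "'a cstar \<Rightarrow> 'a \<Rightarrow> 'a \<Rightarrow> bool" where
  "cuntz_equiv A a b \<longleftrightarrow> cuntz_le A a b \<and> cuntz_le A b a"

definition purely_infinite :: "'a cstar \<Rightarrow> bool" where
  "purely_infinite A \<longleftrightarrow> simple A \<and> \<not> isomorphic A complex_cstar \<and>
     (\<forall>a b. positive A a \<and> a \<noteq> \<zero>\<^bsub>A\<^esub> \<and> positive A b \<and> b \<noteq> \<zero>\<^bsub>A\<^esub> \<longrightarrow> cuntz_equiv A a b)"

text \<open>\<open>pow_Suc A c n\<close> is \<open>c^{n+1}\<close>, which does not involve a unit.\<close>

primrec pow_Suc :: "'a cstar \<Rightarrow> 'a \<Rightarrow> nat \<Rightarrow> 'a" where
  "pow_Suc A c 0 = c"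
| "pow_Suc A c (Suc n) = pow_Suc A c n \<otimes>\<^bsub>A\<^esub> c"

text \<open>\<open>p(c)\<close> for a polynomial \<open>p\<close> with \<open>p(0) = 0\<close>.\<close>

definition poly_apply :: "'a cstar \<Rightarrow> real poly \<Rightarrow> 'a \<Rightarrow> 'a" where
  "poly_apply A p c =
     (\<Oplus>\<^bsub>A\<^esub>i\<in>{..<degree p}. complex_of_real (coeff p (Suc i)) \<odot>\<^bsub>A\<^esub> pow_Suc A c i)"

text \<open>Continuous functional calculus for self-adjoint \<open>c\<close> and continuous \<open>f : \<real> \<rightarrow> \<real>\<close> with
  \<open>f(0) = 0\<close>: the limit of \<open>p_n(c)\<close> for any polynomials \<open>p_n\<close> without constant term converging
  to \<open>f\<close> uniformly on \<open>[-\<parallel>c\<parallel>, \<parallel>c\<parallel>]\<close>, an interval that contains the spectrum of \<open>c\<close>.\<close>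

definition fun_calc :: "'a cstar \<Rightarrow> (real \<Rightarrow> real) \<Rightarrow> 'a \<Rightarrow> 'a" where
  "fun_calc A f c = (THE y. y \<in> carrier A \<and> (\<forall>p :: nat \<Rightarrow> real poly.
     (\<forall>n. poly (p n) 0 = 0) \<and>
     uniform_limit {- nrm A c..nrm A c} (\<lambda>n. poly (p n)) f sequentially \<longrightarrow>
     (\<lambda>n. nrm A (poly_apply A (p n) c \<ominus>\<^bsub>A\<^esub> y)) \<longlonglongrightarrow> 0))"

definition cutdown :: "'a cstar \<Rightarrow> 'a \<Rightarrow> real \<Rightarrow> 'a" where
  "cutdown A c \<epsilon> = fun_calc A (\<lambda>t. max (t - \<epsilon>) 0) c"

text \<open>The matrix size \<open>n\<close> ranges over the positive integers; \<open>n = 0\<close> would force \<open>\<phi> = 0\<close>.\<close>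

definition tracially_Z_absorbing :: "'a cstar \<Rightarrow> bool" where
  "tracially_Z_absorbing A \<longleftrightarrow> simple A \<and> \<not> isomorphic A complex_cstar \<and>
     (\<forall>x a F (\<epsilon> :: real) n. positive A x \<and> positive A a \<and> a \<noteq> \<zero>\<^bsub>A\<^esub> \<and>
        finite F \<and> F \<subseteq> carrier A \<and> \<epsilon> > 0 \<and> n \<ge> 1 \<longrightarrow>
        (\<exists>\<phi>. cpc (Mn n) A \<phi> \<and> order_zero (Mn n) A \<phi> \<and>
           cuntz_le A (cutdown A (x \<otimes>\<^bsub>A\<^esub> x \<ominus>\<^bsub>A\<^esub> x \<otimes>\<^bsub>A\<^esub> \<phi> \<one>\<^bsub>Mn n\<^esub> \<otimes>\<^bsub>A\<^esub> x) \<epsilon>) a \<and>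
           (\<forall>z\<in>carrier (Mn n). nrm (Mn n) z \<le> 1 \<longrightarrow>
              (\<forall>b\<in>F. nrm A (\<phi> z \<otimes>\<^bsub>A\<^esub> b \<ominus>\<^bsub>A\<^esub> b \<otimes>\<^bsub>A\<^esub> \<phi> z) < \<epsilon>))))"

end

theory Submission
 imports Defs "HOL-Analysis.Analysis"
begin

text \<open>The algebra is generated by an isometry \<open>s\<close> and symmetries \<open>u_x\<close> on \<open>l\<^sup>2(L)\<close>, where \<open>L\<close> is the set of
  nonempty lists over the free product \<open>G\<close> of infinitely many copies of \<open>\<int>/2\<close>: \<open>s\<close> prepends the unit of \<open>G\<close>,
  and \<open>u_x\<close> multiplies the head of a list by the \<open>x\<close>-th generator. Let \<open>\<xi>\<close> be the basis vector of the list
  consisting of the unit. Compressing an element \<open>b\<close> to the lists that start with the \<open>k\<close>-th generator yields, for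
  large \<open>k\<close>, almost the scalar \<open>\<langle>\<xi>, b \<xi>\<rangle>\<close>; hence the algebra is simple and purely infinite, and tracially
  Z-absorbing with \<open>\<phi> = 0\<close>. On the other hand, right multiplication of the last entry of a list commutes with the
  algebra, so by the paradoxical decomposition of \<open>G\<close> every element of the algebra that almost commutes with
  \<open>u_0\<close>, \<open>u_1\<close>, \<open>u_2\<close> almost has \<open>\<xi>\<close> as an eigenvector. Absorption of Z would contradict this: it gives a unital
  copy of Z whose almost central elements almost commute with the whole algebra. Since Z is the closure of an increasing
  union of dimension drop algebras, each of which becomes full in the later ones, some of these elements do not almost have
  \<open>\<xi>\<close> as an eigenvector.\<close>

text \<open>What has to be contradicted is a statement about commutators, so both sides are reduced
  to a question about the single vector \<xi>. On lists of length one, multiplying the head on the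
  left and the last entry on the right by the same generator is conjugation in G. It fixes the unit,
  and since right multiplication commutes with the algebra, an element almost commuting with
  \<open>u_x\<close> sends \<xi> to a vector almost invariant under it. Each generator forces about
  half of the mass off \<xi> into one of several disjoint sets; with three generators this is
  impossible. On the side of Z, if \<xi> were almost an eigenvector of all almost central elements,
  the eigenvalues would give an approximate character of a matrix algebra. It would be small on
  nilpotents, whereas the unit of a matrix algebra of size at least two is a sum of products of
  nilpotents. The difficulty is that the fibre in question is known only after the level has been
  chosen, as the point where \<xi> concentrates; simplicity of Z keeps the relevant matrices nonzero
  in every fibre.\<close>

section \<open>Square summable functions as a Hilbert space\<close>

lemma l2_iff_UNIV: "x \<in> l2 I \<longleftrightarrow> x \<in> l2 UNIV & (\<forall>i. i \<notin> I --> x i = 0)"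
 by (auto simp: l2_def)

lemma l2_mult_summable:
 assumes "x \<in> l2 UNIV" "y \<in> l2 UNIV"
 shows "(%i. cnj (x i) * y i) summable_on UNIV"
proof -
 have "(%i. (cmod (x i))\<^sup>2 + (cmod (y i))\<^sup>2) summable_on UNIV"
  using assms by (auto simp: l2_def intro: summable_on_add)
 moreover have "cmod (cnj (x i) * y i) <= (cmod (x i))\<^sup>2 + (cmod (y i))\<^sup>2" for i
 proof -
  have "2 * (cmod (x i) * cmod (y i)) <= (cmod (x i))\<^sup>2 + (cmod (y i))\<^sup>2"
   using sum_squares_bound[of "cmod (x i)" "cmod (y i)"] by (simp add: mult.assoc)
  moreover have "0 <= cmod (x i) * cmod (y i)" by simp
  ultimately show ?thesis unfolding norm_mult complex_mod_cnj by linarith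
 qed
 ultimately have "(%i. cmod (cnj (x i) * y i)) summable_on UNIV"
  by (rule summable_on_comparison_test[where f="%i. (cmod (x i))\<^sup>2 + (cmod (y i))\<^sup>2"]) auto
 thus ?thesis by (rule abs_summable_summable)
qed

lemma l2_add:
 assumes "x \<in> l2 I" "y \<in> l2 I"
 shows "(%i. x i + y i) \<in> l2 I"
proof -
 have "(%i. 2 * (cmod (x i))\<^sup>2 + 2 * (cmod (y i))\<^sup>2) summable_on UNIV"
  using assms by (auto simp: l2_def intro!: summable_on_add summable_on_cmult_right)
 moreover have "(cmod (x i + y i))\<^sup>2 <= 2 * (cmod (x i))\<^sup>2 + 2 * (cmod (y i))\<^sup>2" for i
 proof -
  have "(cmod (x i + y i))\<^sup>2 <= (cmod (x i) + cmod (y i))\<^sup>2" by (simp add: norm_triangle_ineq power_mono)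
  also have "\<dots> <= 2 * (cmod (x i))\<^sup>2 + 2 * (cmod (y i))\<^sup>2"
   using sum_squares_bound[of "cmod (x i)" "cmod (y i)"] by (simp add: power2_sum)
  finally show ?thesis .
 qed
 ultimately have "(%i. (cmod (x i + y i))\<^sup>2) summable_on UNIV"
  by (rule summable_on_comparison_test[where f="%i. 2 * (cmod (x i))\<^sup>2 + 2 * (cmod (y i))\<^sup>2"]) auto
 thus ?thesis using assms by (auto simp: l2_def)
qed

lemma l2_scale:
 assumes "x \<in> l2 I"
 shows "(%i. c * x i) \<in> l2 I"
 using assms by (auto simp: l2_def norm_mult power_mult_distrib intro!: summable_on_cmult_right)

lemma l2_zero [simp]: "(%i. 0) \<in> l2 I"
 by (simp add: l2_def)

lemma l2_finite_support:
 assumes "finite {i. x i ~= 0}"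
 shows "x \<in> l2 UNIV"
proof -
 have "(%i. (cmod (x i))\<^sup>2) summable_on UNIV" by (rule finite_nonzero_values_imp_summable_on) (use assms in auto)
 thus ?thesis by (simp add: l2_def)
qed

text \<open>A type makes \<open>real_inner\<close>, \<open>banach\<close> and
  \<open>bounded_linear\<close> available. It only covers the full index set; the spaces
  \<open>l2 I\<close> reappear as ranges of the projections \<open>proj I\<close>. The classes are
  real, so complex scalars enter through \<open>scaleC\<close>.\<close>

typedef 'i ell2 = "l2 (UNIV :: 'i set)" by (rule exI[of _ "%i. 0"]) simp

lemma Rep_l2 [simp]: "Rep_ell2 x \<in> l2 UNIV"
 using Rep_ell2 by blast

lemma ell2_eqI: "(!!i. Rep_ell2 x i = Rep_ell2 y i) ==> x = y"
 by (metis Rep_ell2_inject ext)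

definition scaleC :: "complex => 'i ell2 => 'i ell2" where
 "scaleC c x = Abs_ell2 (%i. c * Rep_ell2 x i)"

lemma Rep_scaleC [simp]: "Rep_ell2 (scaleC c x) i = c * Rep_ell2 x i"
 by (simp add: scaleC_def Abs_ell2_inverse l2_scale)

instantiation ell2 :: (type) real_vector
begin
definition "0 = Abs_ell2 (%i. 0)"
definition "x + y = Abs_ell2 (%i. Rep_ell2 x i + Rep_ell2 y i)"
definition "- x = Abs_ell2 (%i. - 1 * Rep_ell2 x i)"
definition "x - y = x + - (y :: 'a ell2)"
definition "scaleR r x = Abs_ell2 (%i. complex_of_real r * Rep_ell2 x i)"
lemma Rep_ell2_0 [simp]: "Rep_ell2 0 i = 0"
 by (simp add: zero_ell2_def Abs_ell2_inverse)
lemma Rep_ell2_add [simp]: "Rep_ell2 (x + y) i = Rep_ell2 x i + Rep_ell2 y i"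
 by (simp add: plus_ell2_def Abs_ell2_inverse l2_add)
lemma Rep_ell2_uminus [simp]: "Rep_ell2 (- x) i = - Rep_ell2 x i"
 using l2_scale[of "Rep_ell2 x" UNIV "- 1"] unfolding uminus_ell2_def by (subst Abs_ell2_inverse) auto
lemma Rep_ell2_minus [simp]: "Rep_ell2 (x - y) i = Rep_ell2 x i - Rep_ell2 y i"
 by (simp add: minus_ell2_def)
lemma Rep_ell2_scaleR [simp]: "Rep_ell2 (r *\<^sub>R x) i = complex_of_real r * Rep_ell2 x i"
 by (simp add: scaleR_ell2_def Abs_ell2_inverse l2_scale)
instance by standard (auto intro!: ell2_eqI simp: algebra_simps)
end

instantiation ell2 :: (type) real_inner
begin
definition "inner x y = Re (l2_inner (Rep_ell2 x) (Rep_ell2 y))"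
definition "norm x = l2_norm (Rep_ell2 x)"
definition "dist x y = norm (x - y :: 'a ell2)"
definition "sgn x = x /\<^sub>R norm (x :: 'a ell2)"
definition [code del]: "(uniformity :: ('a ell2 \<times> 'a ell2) filter)
 = (INF e\<in>{0<..}. principal {(x, y). dist x y < e})"
definition [code del]: "open (U :: 'a ell2 set)
 \<longleftrightarrow> (\<forall>x\<in>U. \<forall>\<^sub>F (x', y) in uniformity. x' = x --> y \<in> U)"

lemma cinner_summable: "(%i. cnj (Rep_ell2 x i) * Rep_ell2 y i) summable_on UNIV"
 by (rule l2_mult_summable) auto

instance
proof
 fix x y z :: "'a ell2" and r :: real
 show "dist x y = norm (x - y)" by (simp add: dist_ell2_def)
 show "sgn x = x /\<^sub>R norm x" by (simp add: sgn_ell2_def)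
 show "uniformity = (INF e\<in>{0<..}. principal {(x, y::'a ell2). dist x y < e})" by (simp add: uniformity_ell2_def)
 show "open U \<longleftrightarrow> (\<forall>x\<in>U. \<forall>\<^sub>F (x', y) in uniformity. x' = x --> y \<in> U)" for U :: "'a ell2 set" by (simp add: open_ell2_def)
 have "l2_inner (Rep_ell2 x) (Rep_ell2 y) = cnj (l2_inner (Rep_ell2 y) (Rep_ell2 x))"
  unfolding l2_inner_def by (simp add: mult.commute flip: infsum_cnj)
 thus "inner x y = inner y x" by (simp add: inner_ell2_def)
 show "inner (x + y) z = inner x z + inner y z" using cinner_summable[of x z] cinner_summable[of y z]
  by (simp add: inner_ell2_def l2_inner_def distrib_right infsum_add)
 show "inner (r *\<^sub>R x) y = r * inner x y" by (simp add: inner_ell2_def l2_inner_def mult.assoc infsum_cmult_right')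
 have "Re (l2_inner (Rep_ell2 x) (Rep_ell2 x)) = (\<Sum>\<^sub>\<infinity>i. (cmod (Rep_ell2 x i))\<^sup>2)"
  using infsum_Re[OF cinner_summable[of x x]] unfolding l2_inner_def
  by (simp add: mult.commute complex_mult_cnj cmod_power2)
 hence ip: "inner x x = (\<Sum>\<^sub>\<infinity>i. (cmod (Rep_ell2 x i))\<^sup>2)" by (simp add: inner_ell2_def)
 show "0 <= inner x x" unfolding ip by (rule infsum_nonneg) simp
 show "norm x = sqrt (inner x x)" unfolding ip norm_ell2_def l2_norm_def ..
 show "inner x x = 0 \<longleftrightarrow> x = 0"
 proof
  assume 0: "inner x x = 0"
  have s: "(%i. (cmod (Rep_ell2 x i))\<^sup>2) summable_on UNIV" using Rep_l2[of x] by (simp add: l2_def)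
  have "(cmod (Rep_ell2 x i))\<^sup>2 = 0" for i by (rule nonneg_infsum_le_0D[OF _ s]) (use 0 in \<open>auto simp: ip\<close>)
  thus "x = 0" by (intro ell2_eqI) auto
 qed (simp add: inner_ell2_def l2_inner_def)
qed
end

text \<open>The imaginary part of z is minus the real part of i z. So the real inner product
  determines the complex one, and adjoints can be handled through \<open>inner\<close>
  alone.\<close>

lemma l2_inner_eq: "l2_inner (Rep_ell2 x) (Rep_ell2 y) = Complex (inner x y) (- inner x (scaleC \<i> y))"
proof -
 have "l2_inner (Rep_ell2 x) (Rep_ell2 (scaleC \<i> y)) = \<i> * l2_inner (Rep_ell2 x) (Rep_ell2 y)"
  by (simp add: l2_inner_def mult.left_commute flip: infsum_cmult_right')
 thus ?thesis by (simp add: inner_ell2_def complex_eq_iff)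
qed

lemma norm_scaleC [simp]: "norm (scaleC c x) = cmod c * norm x"
 by (simp add: norm_ell2_def l2_norm_def norm_mult power_mult_distrib infsum_cmult_right' real_sqrt_mult)

lemma scaleC_add: "scaleC c (x + y) = scaleC c x + scaleC c y"
 and scaleC_minus: "scaleC c (x - y) = scaleC c x - scaleC c y"
 and scaleC_add_left: "scaleC (c + d) x = scaleC c x + scaleC d x"
 and scaleC_diff_left: "scaleC (c - d) x = scaleC c x - scaleC d x"
 and scaleC_scaleC [simp]: "scaleC c (scaleC d x) = scaleC (c * d) x"
 and scaleC_of_real [simp]: "scaleC (complex_of_real r) x = r *\<^sub>R x"
 and scaleC_1 [simp]: "scaleC 1 x = x"
 and scaleC_0 [simp]: "scaleC 0 x = 0"
 and scaleC_0_right [simp]: "scaleC c 0 = 0" by (auto intro!: ell2_eqI simp: algebra_simps)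

lemma scaleC_minus_one: "scaleC (- 1) x = - x"
 by (auto intro!: ell2_eqI)

lemma inner_scaleC_left: "inner (scaleC c x) y = inner x (scaleC (cnj c) y)"
 by (simp add: inner_ell2_def l2_inner_def mult.assoc mult.left_commute)

lemma norm_coord_le: "cmod (Rep_ell2 x i) <= norm x"
proof -
 have s: "(%i. (cmod (Rep_ell2 x i))\<^sup>2) summable_on UNIV" using Rep_l2[of x] by (simp add: l2_def)
 have "(cmod (Rep_ell2 x i))\<^sup>2 <= (\<Sum>\<^sub>\<infinity>i. (cmod (Rep_ell2 x i))\<^sup>2)" using finite_sum_le_infsum[OF s, of "{i}"] by simp
 thus ?thesis unfolding norm_ell2_def l2_norm_def by (rule real_le_rsqrt)
qed

lemma norm_sq_eq: "(norm x)\<^sup>2 = (\<Sum>\<^sub>\<infinity>i. (cmod (Rep_ell2 x i))\<^sup>2)"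
 unfolding norm_ell2_def l2_norm_def by (simp add: infsum_nonneg)

lemma finite_sum_le_norm: "finite F ==> (\<Sum>i\<in>F. (cmod (Rep_ell2 x i))\<^sup>2) <= (norm x)\<^sup>2"
 unfolding norm_sq_eq using Rep_l2[of x] by (intro finite_sum_le_infsum) (auto simp: l2_def)

lemma norm_le_if_finite_sums:
 assumes "!!F. finite F ==> (\<Sum>i\<in>F. (cmod (Rep_ell2 x i))\<^sup>2) <= B\<^sup>2" "0 <= B"
 shows "norm x <= B"
proof -
 have "(norm x)\<^sup>2 <= B\<^sup>2"
  unfolding norm_sq_eq using Rep_l2[of x] assms by (intro infsum_le_finite_sums) (auto simp: l2_def)
 thus ?thesis using assms(2) by (rule power2_le_imp_le)
qed

lemma l2_if_finite_sums:
 assumes "!!F. finite F ==> (\<Sum>i\<in>F. (cmod (x i))\<^sup>2) <= B"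
 shows "x \<in> l2 UNIV" unfolding l2_def by (auto intro!: nonneg_bdd_above_summable_on simp: bdd_above_def intro: assms)

definition ket :: "'i => 'i ell2" where
 "ket i = Abs_ell2 (%j. if j = i then 1 else 0)"

lemma Rep_ket [simp]: "Rep_ell2 (ket i) j = (if j = i then 1 else 0)"
 unfolding ket_def by (subst Abs_ell2_inverse) (auto intro!: l2_finite_support)

lemma l2_inner_ket: "l2_inner (Rep_ell2 (ket i)) (Rep_ell2 x) = Rep_ell2 x i"
proof -
 have "l2_inner (Rep_ell2 (ket i)) (Rep_ell2 x)
   = (\<Sum>\<^sub>\<infinity>j\<in>{i}. Rep_ell2 x j)" unfolding l2_inner_def by (rule infsum_cong_neutral) auto
 thus ?thesis by simp
qed

lemma inner_ket: "inner (ket i) x = Re (Rep_ell2 x i)"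
 by (simp add: inner_ell2_def l2_inner_ket)

lemma norm_ket [simp]: "norm (ket i) = 1"
 by (simp add: norm_eq_sqrt_inner inner_ket)

lemma Rep_ell2_sum: "Rep_ell2 (sum f S) i = (\<Sum>s\<in>S. Rep_ell2 (f s) i)"
 by (induction S rule: infinite_finite_induct) auto

lemma ell2_finite_approx:
 assumes "e > 0"
 shows "\<exists>F. finite F & norm (x - (\<Sum>i\<in>F. scaleC (Rep_ell2 x i) (ket i))) < e"
proof -
 have s: "(%i. (cmod (Rep_ell2 x i))\<^sup>2) summable_on UNIV" using Rep_l2[of x] by (simp add: l2_def)
 obtain F where F: "finite F" "dist (\<Sum>i\<in>F. (cmod (Rep_ell2 x i))\<^sup>2) (\<Sum>\<^sub>\<infinity>i. (cmod (Rep_ell2 x i))\<^sup>2) <= e\<^sup>2 / 2"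
  using infsum_finite_approximation[OF s, of "e\<^sup>2/2"] assms by auto
 define y where "y = x - (\<Sum>i\<in>F. scaleC (Rep_ell2 x i) (ket i))"
 have Ry: "Rep_ell2 y i = (if i \<in> F then 0 else Rep_ell2 x i)" for i
 proof -
  have "(\<Sum>j\<in>F. Rep_ell2 x j * (if i = j then 1 else 0)) = (\<Sum>j\<in>F. if j = i then Rep_ell2 x i else 0)"
   by (rule sum.cong) auto
  thus ?thesis using F(1) by (simp add: y_def Rep_ell2_sum)
 qed
 have sF: "(%i. (cmod (Rep_ell2 x i))\<^sup>2) summable_on (- F)" using s by (rule summable_on_subset_banach) simp
 have "(norm y)\<^sup>2 = (\<Sum>\<^sub>\<infinity>i\<in>-F. (cmod (Rep_ell2 x i))\<^sup>2)"
  unfolding norm_sq_eq by (rule infsum_cong_neutral) (auto simp: Ry)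
 moreover have "(\<Sum>\<^sub>\<infinity>i. (cmod (Rep_ell2 x i))\<^sup>2) = (\<Sum>i\<in>F. (cmod (Rep_ell2 x i))\<^sup>2) + (\<Sum>\<^sub>\<infinity>i\<in>-F. (cmod (Rep_ell2 x i))\<^sup>2)"
  using infsum_Un_disjoint[OF summable_on_finite[OF F(1)] sF] F(1) by (simp add: Compl_partition)
 ultimately have "(norm y)\<^sup>2 <= e\<^sup>2 / 2" using F(2) by (simp add: dist_real_def)
 also have "\<dots> < e\<^sup>2" using assms by simp
 finally have "norm y < e" using assms by (simp add: power2_less_imp_less)
 thus ?thesis using F(1) unfolding y_def by blast
qed

instance ell2 :: (type) banach
proof
 fix X :: "nat => 'a ell2"
 assume X: "Cauchy X"
 have c: "Cauchy (%n. Rep_ell2 (X n) i)" for i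
 proof (rule CauchyI)
  fix e :: real assume "e > 0"
  then obtain M where "\<forall>m\<ge>M. \<forall>n\<ge>M. norm (X m - X n) < e" using CauchyD[OF X] by blast
  thus "\<exists>M. \<forall>m\<ge>M. \<forall>n\<ge>M. cmod (Rep_ell2 (X m) i - Rep_ell2 (X n) i) < e"
   by (metis Rep_ell2_minus norm_coord_le order_le_less_trans)
 qed
 define l where "l i = lim (%n. Rep_ell2 (X n) i)" for i
 have l: "(%n. Rep_ell2 (X n) i) \<longlonglongrightarrow> l i" for i
  unfolding l_def using c[of i] by (simp add: Cauchy_convergent_iff convergent_LIMSEQ_iff)
 \<comment> \<open>The Cauchy bound for partial sums does not depend on the finite set
   \<open>F\<close>, so it survives the coordinatewise limit in \<open>n\<close>. This yields both
   square summability of \<open>l\<close> and convergence in norm.\<close>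
 have fin: "(\<Sum>i\<in>F. (cmod (Rep_ell2 (X m) i - l i))\<^sup>2) <= e\<^sup>2"
  if F: "finite F" and e: "\<forall>n\<ge>M. norm (X m - X n) < e" for F m M e
 proof -
  have "(%n. \<Sum>i\<in>F. (cmod (Rep_ell2 (X m) i - Rep_ell2 (X n) i))\<^sup>2) \<longlonglongrightarrow> (\<Sum>i\<in>F. (cmod (Rep_ell2 (X m) i - l i))\<^sup>2)"
   by (intro tendsto_intros l)
  moreover have "(\<Sum>i\<in>F. (cmod (Rep_ell2 (X m) i - Rep_ell2 (X n) i))\<^sup>2) <= e\<^sup>2" if "n \<ge> M" for n
  proof -
   have "(\<Sum>i\<in>F. (cmod (Rep_ell2 (X m - X n) i))\<^sup>2) <= (norm (X m - X n))\<^sup>2" by (rule finite_sum_le_norm[OF F])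
   also have "\<dots> <= e\<^sup>2" using e that by (intro power_mono) (auto simp: less_imp_le)
   finally show ?thesis by simp
  qed
  ultimately show ?thesis by (intro LIMSEQ_le_const2) auto
 qed
 obtain M1 where M1: "\<forall>m\<ge>M1. \<forall>n\<ge>M1. norm (X m - X n) < 1" using CauchyD[OF X, of 1] by auto
 have "(%i. Rep_ell2 (X M1) i - l i) \<in> l2 UNIV" by (rule l2_if_finite_sums[of _ "1\<^sup>2"]) (use fin M1 in blast)
 from l2_add[OF Rep_l2[of "X M1"] l2_scale[OF this, of "- 1"]] have "l \<in> l2 UNIV" by simp
 hence Rl: "Rep_ell2 (Abs_ell2 l) i = l i" for i by (simp add: Abs_ell2_inverse)
 have "X \<longlonglongrightarrow> Abs_ell2 l"
 proof (rule LIMSEQ_I)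
  fix e :: real assume e: "e > 0"
  then obtain M where M: "\<forall>m\<ge>M. \<forall>n\<ge>M. norm (X m - X n) < e/2" using CauchyD[OF X, of "e/2"] by auto
  have "norm (X m - Abs_ell2 l) <= e/2" if "m \<ge> M" for m
   by (rule norm_le_if_finite_sums) (use fin[of _ M m "e/2"] M that e in \<open>auto simp: Rl\<close>)
  thus "\<exists>M. \<forall>m\<ge>M. norm (X m - Abs_ell2 l) < e" using e by (intro exI[of _ M]) force
 qed
 thus "convergent X" by (rule convergentI)
qed

section \<open>Topology of normed star algebras in terms of sequences\<close>

context normed_star_algebra
begin

lemma limitin_iff:
 assumes "!!n. X n \<in> carrier A"
 shows "limitin (cstar_topology A) X l sequentially \<longleftrightarrow> l \<in> carrier A & (%n. nrm A (X n \<ominus> l)) \<longlonglongrightarrow> 0"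
proof (cases "l \<in> carrier A")
 case True
 thus ?thesis using assms by (simp add: metric.limitin_metric_dist_null cdist_def)
qed (simp add: metric.limitin_metric_dist_null)

lemma closedin_iff:
 "closedin (cstar_topology A) S \<longleftrightarrow> S \<subseteq> carrier A &
  (\<forall>X l. (\<forall>n. X n \<in> S) & l \<in> carrier A & (%n. nrm A (X n \<ominus> l)) \<longlonglongrightarrow> 0 --> l \<in> S)"
proof -
 have "range X \<subseteq> S & limitin (cstar_topology A) X l sequentially \<longleftrightarrow>
   (\<forall>n. X n \<in> S) & l \<in> carrier A & (%n. nrm A (X n \<ominus> l)) \<longlonglongrightarrow> 0" if "S \<subseteq> carrier A" for X l
  using that limitin_iff[of X l] by blast
 thus ?thesis unfolding metric.metric_closedin_iff_sequentially_closed by blast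
qed

lemma closure_of_iff:
 assumes "S \<subseteq> carrier A"
 shows "x \<in> cstar_topology A closure_of S \<longleftrightarrow> x \<in> carrier A & (\<forall>e>0. \<exists>y\<in>S. nrm A (x \<ominus> y) < e)"
 using assms by (force simp: metric.metric_closure_of metric.in_mball cdist_def)

lemma mcomplete_iff:
 "metric.mcomplete \<longleftrightarrow> (\<forall>X. (\<forall>n. X n \<in> carrier A) &
   (\<forall>e>0. \<exists>N. \<forall>m\<ge>N. \<forall>n\<ge>N. nrm A (X m \<ominus> X n) < e) -->
   (\<exists>l\<in>carrier A. (%n. nrm A (X n \<ominus> l)) \<longlonglongrightarrow> 0))"
proof -
 have "metric.MCauchy X \<longleftrightarrow> (\<forall>n. X n \<in> carrier A) &
   (\<forall>e>0. \<exists>N. \<forall>m\<ge>N. \<forall>n\<ge>N. nrm A (X m \<ominus> X n) < e)" for X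
 proof (cases "\<forall>n. X n \<in> carrier A")
  case True
  thus ?thesis by (auto simp: metric.MCauchy_def cdist_def)
 qed (auto simp: metric.MCauchy_def)
 moreover have "(\<exists>l. limitin (cstar_topology A) X l sequentially) \<longleftrightarrow>
   (\<exists>l\<in>carrier A. (%n. nrm A (X n \<ominus> l)) \<longlonglongrightarrow> 0)" if "\<forall>n. X n \<in> carrier A" for X using that limitin_iff[of X] by blast
 ultimately show ?thesis unfolding metric.mcomplete_def by (simp cong: imp_cong)
qed

lemma nrm_minus_commute: "x \<in> carrier A ==> y \<in> carrier A ==> nrm A (x \<ominus> y) = nrm A (y \<ominus> x)"
 using metric.commute[of x y] by (simp add: cdist_def)

lemma nrm_zero [simp]: "nrm A \<zero> = 0"
 using nrm_eq_0 by blast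

lemma minus_smult: "x \<in> carrier A ==> y \<in> carrier A ==> x \<ominus> y = x \<oplus> (- 1) \<odot> y"
 by (simp add: minus_eq smult_minus_one)

lemma smult_zero_right [simp]: "c \<odot> \<zero> = \<zero>"
 using nrm_eq_0[of "c \<odot> \<zero>"] nrm_smult[of \<zero> c] smult_closed by simp

lemma mult_zero [simp]: "x \<in> carrier A ==> x \<otimes> \<zero> = \<zero>" "x \<in> carrier A ==> \<zero> \<otimes> x = \<zero>"
 using nrm_eq_0[of "x \<otimes> \<zero>"] nrm_eq_0[of "\<zero> \<otimes> x"] nrm_mult[of x \<zero>] nrm_mult[of \<zero> x]
  nrm_nonneg[of "x \<otimes> \<zero>"] nrm_nonneg[of "\<zero> \<otimes> x"] by (auto simp: m_closed)

lemma adj_minus: "x \<in> carrier A ==> y \<in> carrier A ==> adj A (x \<ominus> y) = adj A x \<ominus> adj A y"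
 by (simp add: minus_smult adj_add adj_smult smult_closed adj_closed)

lemma l_distr_minus: "[|x \<in> carrier A; y \<in> carrier A; z \<in> carrier A|] ==> (x \<ominus> y) \<otimes> z = x \<otimes> z \<ominus> y \<otimes> z"
 by (simp add: minus_smult l_distr smult_closed smult_mult_left m_closed)

lemma r_distr_minus: "[|x \<in> carrier A; y \<in> carrier A; z \<in> carrier A|] ==> z \<otimes> (x \<ominus> y) = z \<otimes> x \<ominus> z \<otimes> y"
 by (simp add: minus_smult r_distr smult_closed smult_mult_right m_closed)

lemma smult_minus: "[|x \<in> carrier A; y \<in> carrier A|] ==> c \<odot> (x \<ominus> y) = c \<odot> x \<ominus> c \<odot> y"
 by (simp add: minus_smult smult_r_distr smult_closed mult.commute flip: smult_assoc)

lemma minus_eq_zero_iff: "x \<in> carrier A ==> y \<in> carrier A ==> x \<ominus> y = \<zero> \<longleftrightarrow> x = y"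
 using nrm_eq_0[of "x \<ominus> y"] metric.zero[of x y] by (simp add: cdist_def)

lemma nrm_diff_triangle:
 "[|x \<in> carrier A; y \<in> carrier A; z \<in> carrier A|] ==> nrm A (x \<ominus> z) <= nrm A (x \<ominus> y) + nrm A (y \<ominus> z)"
 using metric.triangle[of x y z] by (simp add: cdist_def)

lemma add_minus_add:
 assumes "x \<in> carrier A" "y \<in> carrier A" "x' \<in> carrier A" "y' \<in> carrier A"
 shows "(x \<oplus> y) \<ominus> (x' \<oplus> y') = (x \<ominus> x') \<oplus> (y \<ominus> y')"
 using assms by (simp add: minus_smult smult_r_distr smult_closed a_ac)

lemma mult_minus_mult:
 assumes "x \<in> carrier A" "y \<in> carrier A" "x' \<in> carrier A" "y' \<in> carrier A"
 shows "(x \<otimes> y) \<ominus> (x' \<otimes> y') = (x \<ominus> x') \<otimes> y \<oplus> x' \<otimes> (y \<ominus> y')"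
proof -
 have "(x \<ominus> x') \<otimes> y \<oplus> x' \<otimes> (y \<ominus> y') = (x \<otimes> y \<oplus> (- 1) \<odot> (x' \<otimes> y)) \<oplus> (x' \<otimes> y \<oplus> (- 1) \<odot> (x' \<otimes> y'))"
  using assms by (simp add: minus_smult l_distr r_distr smult_closed m_closed smult_mult_left smult_mult_right)
 also have "\<dots> = x \<otimes> y \<oplus> (((- 1) \<odot> (x' \<otimes> y) \<oplus> x' \<otimes> y) \<oplus> (- 1) \<odot> (x' \<otimes> y'))"
  using assms by (simp add: a_assoc smult_closed m_closed)
 also have "(- 1) \<odot> (x' \<otimes> y) \<oplus> x' \<otimes> y = \<zero>" using assms by (simp add: smult_minus_one m_closed l_neg)
 finally show ?thesis using assms by (simp add: minus_smult smult_closed m_closed)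
qed

lemma closure_of_seq:
 assumes S: "S \<subseteq> carrier A"
 shows "x \<in> cstar_topology A closure_of S \<longleftrightarrow> x \<in> carrier A & (\<exists>X. (\<forall>n. X n \<in> S) & (%n. nrm A (X n \<ominus> x)) \<longlonglongrightarrow> 0)"
proof -
 have 1: "range X \<subseteq> S \<inter> carrier A \<longleftrightarrow> (\<forall>n. X n \<in> S)" for X using S by blast
 have 2: "limitin (cstar_topology A) X x sequentially \<longleftrightarrow> x \<in> carrier A & (%n. nrm A (X n \<ominus> x)) \<longlonglongrightarrow> 0"
  if "\<forall>n. X n \<in> S" for X by (rule limitin_iff) (use that S in blast)
 have "range X \<subseteq> S \<inter> carrier A & limitin (cstar_topology A) X x sequentially \<longleftrightarrow>
  (\<forall>n. X n \<in> S) & (%n. nrm A (X n \<ominus> x)) \<longlonglongrightarrow> 0" if "x \<in> carrier A" for X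
  by (simp only: 1 2 that simp_thms cong: conj_cong)
 thus ?thesis unfolding metric.closure_of_sequentially mem_Collect_eq by (rule conj_cong[OF refl ex_cong1])
qed

lemma lim_add:
 assumes X: "!!n. X n \<in> carrier A" "x \<in> carrier A" "(%n. nrm A (X n \<ominus> x)) \<longlonglongrightarrow> 0"
  and Y: "!!n. Y n \<in> carrier A" "y \<in> carrier A" "(%n. nrm A (Y n \<ominus> y)) \<longlonglongrightarrow> 0"
 shows "(%n. nrm A ((X n \<oplus> Y n) \<ominus> (x \<oplus> y))) \<longlonglongrightarrow> 0"
proof (rule Lim_null_comparison)
 show "\<forall>\<^sub>F n in sequentially. norm (nrm A ((X n \<oplus> Y n) \<ominus> (x \<oplus> y))) <= nrm A (X n \<ominus> x) + nrm A (Y n \<ominus> y)"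
  using X Y by (simp add: add_minus_add nrm_nonneg nrm_triangle)
 show "(%n. nrm A (X n \<ominus> x) + nrm A (Y n \<ominus> y)) \<longlonglongrightarrow> 0" using tendsto_add[OF X(3) Y(3)] by simp
qed

lemma lim_unique:
 "(!!n. X n \<in> carrier A) ==> l \<in> carrier A ==> l' \<in> carrier A ==>
  (%n. nrm A (X n \<ominus> l)) \<longlonglongrightarrow> 0 ==> (%n. nrm A (X n \<ominus> l')) \<longlonglongrightarrow> 0 ==> l = l'"
 by (rule metric.limitin_metric_unique[of X _ sequentially]) (simp_all add: limitin_iff)

lemma lim_mult:
 assumes X: "!!n. X n \<in> carrier A" "x \<in> carrier A" "(%n. nrm A (X n \<ominus> x)) \<longlonglongrightarrow> 0"
  and Y: "!!n. Y n \<in> carrier A" "y \<in> carrier A" "(%n. nrm A (Y n \<ominus> y)) \<longlonglongrightarrow> 0"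
 shows "(%n. nrm A (X n \<otimes> Y n \<ominus> x \<otimes> y)) \<longlonglongrightarrow> 0"
proof (rule Lim_null_comparison)
 let ?d = "%n. nrm A (X n \<ominus> x)" and ?e = "%n. nrm A (Y n \<ominus> y)"
 have "nrm A (X n \<otimes> Y n \<ominus> x \<otimes> y) <= ?d n * (?e n + nrm A y) + nrm A x * ?e n" for n
 proof -
  have "nrm A (Y n) <= ?e n + nrm A y" using nrm_triangle[of "Y n \<ominus> y" y] Y(1)[of n] Y(2) by (simp add: minus_eq a_assoc l_neg)
  hence "?d n * nrm A (Y n) <= ?d n * (?e n + nrm A y)" using X(1)[of n] X(2) by (intro mult_left_mono nrm_nonneg) auto
  moreover have "nrm A (X n \<otimes> Y n \<ominus> x \<otimes> y) <= nrm A ((X n \<ominus> x) \<otimes> Y n) + nrm A (x \<otimes> (Y n \<ominus> y))"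
   unfolding mult_minus_mult[OF X(1) Y(1) X(2) Y(2)] using X(1,2) Y(1,2) by (intro nrm_triangle m_closed) auto
  ultimately show ?thesis
   using nrm_mult[of "X n \<ominus> x" "Y n"] nrm_mult[of x "Y n \<ominus> y"] X(1)[of n] X(2) Y(1)[of n] Y(2) by simp
 qed
 thus "\<forall>\<^sub>F n in sequentially. norm (nrm A (X n \<otimes> Y n \<ominus> x \<otimes> y)) <= ?d n * (?e n + nrm A y) + nrm A x * ?e n"
  using X Y by (simp add: nrm_nonneg m_closed)
 have "(%n. ?d n * (?e n + nrm A y) + nrm A x * ?e n) \<longlonglongrightarrow> 0 * (0 + nrm A y) + nrm A x * 0" by (intro tendsto_intros X Y)
 thus "(%n. ?d n * (?e n + nrm A y) + nrm A x * ?e n) \<longlonglongrightarrow> 0" by simp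
qed

end

section \<open>Bounded complex linear operators and their adjoints\<close>

definition cblinear :: "('i ell2 => 'j ell2) => bool" where
 "cblinear B \<longleftrightarrow> bounded_linear B & (\<forall>c x. B (scaleC c x) = scaleC c (B x))"

lemma cblinear_scaleC: "cblinear B ==> B (scaleC c x) = scaleC c (B x)"
 and cblinear_bounded_linear: "cblinear B ==> bounded_linear B" by (simp_all add: cblinear_def)

lemma cblinear_add: "cblinear B ==> B (x + y) = B x + B y"
 and cblinear_diff: "cblinear B ==> B (x - y) = B x - B y"
 and cblinear_0: "cblinear B ==> B 0 = 0"
 and cblinear_sum: "cblinear B ==> B (sum f S) = (\<Sum>s\<in>S. B (f s))"
 using cblinear_bounded_linear[of B] bounded_linear.linear[of B] linear_add linear_diff linear_0 linear_sum by blast+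

lemma cblinearI:
 assumes "!!x y. B (x + y) = B x + B y" "!!c x. B (scaleC c x) = scaleC c (B x)"
  "!!x. norm (B x) <= C * norm x"
 shows "cblinear B"
proof -
 have "B (r *\<^sub>R x) = r *\<^sub>R B x" for r x using assms(2)[of "complex_of_real r" x] by simp
 thus ?thesis
  using assms unfolding cblinear_def by (auto intro!: bounded_linear_intro[where K=C] simp: mult.commute)
qed

lemma cblinear_obtain_bound:
 assumes "cblinear B"
 obtains C where "C \<ge> 0" "!!x. norm (B x) <= C * norm x"
 using bounded_linear.nonneg_bounded[OF cblinear_bounded_linear[OF assms]] by (metis mult.commute)

lemma norm_le_onorm: "cblinear B ==> norm (B x) <= onorm B * norm x"
 by (rule onorm[OF cblinear_bounded_linear])

text \<open>Finite combinations of basis vectors are dense. Since \<open>f\<close> is only real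
  linear (it may be a real inner product), all complex multiples of the basis vectors have to be
  tested.\<close>

lemma bounded_linear_eq_0_ket:
 fixes f :: "'i ell2 => 'b :: real_normed_vector"
 assumes f: "bounded_linear f" and 0: "!!c i. f (scaleC c (ket i)) = 0"
 shows "f x = 0"
proof -
 obtain C where C: "C > 0" "!!x. norm (f x) <= norm x * C" using bounded_linear.pos_bounded[OF f] by blast
 have "norm (f x) <= 0 + e" if e: "e > 0" for e
 proof -
  have "e / C > 0" using e C by simp
  from ell2_finite_approx[OF this, of x] obtain F where
   F: "norm (x - (\<Sum>i\<in>F. scaleC (Rep_ell2 x i) (ket i))) < e / C" by blast
  have "f x = f (x - (\<Sum>i\<in>F. scaleC (Rep_ell2 x i) (ket i)))"
   using bounded_linear.linear[OF f] by (simp add: linear_diff linear_sum 0)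
  thus ?thesis using C(2)[of "x - (\<Sum>i\<in>F. scaleC (Rep_ell2 x i) (ket i))"] F C(1) by (simp add: field_simps)
 qed
 from field_le_epsilon[OF this] show ?thesis by simp
qed

lemma cblinear_eqI:
 assumes B: "cblinear B" and B': "cblinear B'" and eq: "!!i. B (ket i) = B' (ket i)"
 shows "B = B'"
proof
 fix x
 have "B x - B' x = 0" by (rule bounded_linear_eq_0_ket[where f="%x. B x - B' x"])
   (simp_all add: B B' eq cblinear_scaleC bounded_linear_sub cblinear_bounded_linear)
 thus "B x = B' x" by simp
qed

definition cadj :: "('i ell2 => 'j ell2) => 'j ell2 => 'i ell2" where
 "cadj B x = Abs_ell2 (%i. l2_inner (Rep_ell2 (B (ket i))) (Rep_ell2 x))"

lemma cinner_scaleC_left: "l2_inner (Rep_ell2 (scaleC c x)) (Rep_ell2 y) = cnj c * l2_inner (Rep_ell2 x) (Rep_ell2 y)"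
 by (simp add: l2_inner_def mult.assoc infsum_cmult_right')

lemma cinner_add_left: "l2_inner (Rep_ell2 (x + y)) (Rep_ell2 z) = l2_inner (Rep_ell2 x) (Rep_ell2 z) + l2_inner (Rep_ell2 y) (Rep_ell2 z)"
 by (simp add: l2_inner_eq inner_add_left complex_eq_iff)

lemma cinner_sum_left: "l2_inner (Rep_ell2 (sum f S)) (Rep_ell2 z) = (\<Sum>s\<in>S. l2_inner (Rep_ell2 (f s)) (Rep_ell2 z))"
proof -
 have "l2_inner (Rep_ell2 0) (Rep_ell2 z) = 0" by (simp add: l2_inner_def)
 thus ?thesis by (induction S rule: infinite_finite_induct) (auto simp: cinner_add_left)
qed

context
 fixes B :: "'i ell2 => 'j ell2" assumes B: "cblinear B"
begin

text \<open>Duality: with g_i the inner product of \<open>B (ket i)\<close> and \<open>x\<close>,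
  and v the sum of the g_i \<open>ket i\<close> over \<open>F\<close>, the square of the norm of v
  equals the inner product of B v and x, hence is at most C |v| |x|; cancel |v|. This makes the
  coordinates in the definition of \<open>cadj\<close> square summable.\<close>

lemma cadj_bound_aux:
 assumes C: "C \<ge> 0" "!!x. norm (B x) <= C * norm x" and F: "finite F"
 shows "(\<Sum>i\<in>F. (cmod (l2_inner (Rep_ell2 (B (ket i))) (Rep_ell2 x)))\<^sup>2) <= (C * norm x)\<^sup>2"
proof -
 define g where "g i = l2_inner (Rep_ell2 (B (ket i))) (Rep_ell2 x)" for i
 define v where "v = (\<Sum>i\<in>F. scaleC (g i) (ket i))"
 define s where "s = (\<Sum>i\<in>F. (cmod (g i))\<^sup>2)"
 have Rv: "Rep_ell2 v i = (if i \<in> F then g i else 0)" for i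
 proof -
  have "(\<Sum>j\<in>F. g j * (if i = j then 1 else 0)) = (\<Sum>j\<in>F. if j = i then g i else 0)" by (rule sum.cong) auto
  thus ?thesis using F by (simp add: v_def Rep_ell2_sum)
 qed
 have nv: "(norm v)\<^sup>2 = s"
 proof -
  have "(norm v)\<^sup>2 = (\<Sum>\<^sub>\<infinity>i\<in>F. (cmod (g i))\<^sup>2)" unfolding norm_sq_eq by (rule infsum_cong_neutral) (auto simp: Rv)
  thus ?thesis using F by (simp add: s_def)
 qed
 have "l2_inner (Rep_ell2 (B v)) (Rep_ell2 x) = (\<Sum>i\<in>F. cnj (g i) * g i)"
  by (simp add: v_def cblinear_sum[OF B] cblinear_scaleC[OF B] cinner_sum_left cinner_scaleC_left g_def)
 also have "\<dots> = complex_of_real s" by (simp add: s_def mult.commute complex_mult_cnj cmod_power2)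
 finally have "inner (B v) x = s" by (simp add: inner_ell2_def)
 hence "s <= norm (B v) * norm x" by (metis norm_cauchy_schwarz)
 also have "\<dots> <= C * norm v * norm x" by (intro mult_right_mono C) auto
 finally have s: "norm v * norm v <= norm v * (C * norm x)" by (simp add: power2_eq_square mult_ac flip: nv)
 have "norm v <= C * norm x"
 proof (cases "norm v = 0")
  case False
  hence "norm v > 0" by simp
  thus ?thesis using s mult_le_cancel_left_pos by blast
 qed (use C in simp)
 hence "s <= (C * norm x)\<^sup>2" unfolding nv[symmetric] by (rule power_mono) simp
 thus ?thesis by (simp add: s_def g_def)
qed

lemma Rep_cadj: "Rep_ell2 (cadj B x) i = l2_inner (Rep_ell2 (B (ket i))) (Rep_ell2 x)"
proof -
 obtain C where C: "C \<ge> 0" "!!x. norm (B x) <= C * norm x" using cblinear_obtain_bound[OF B] by blast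
 show ?thesis unfolding cadj_def by (subst Abs_ell2_inverse) (auto intro!: l2_if_finite_sums cadj_bound_aux[OF C])
qed

lemma norm_cadj_le:
 assumes C: "C \<ge> 0" "!!x. norm (B x) <= C * norm x"
 shows "norm (cadj B x) <= C * norm x"
 by (rule norm_le_if_finite_sums) (use C in \<open>auto simp: Rep_cadj intro!: cadj_bound_aux\<close>)

lemma inner_cadj_ket: "inner (cadj B x) (scaleC c (ket i)) = inner x (B (scaleC c (ket i)))"
proof -
 have "inner (cadj B x) (scaleC c (ket i)) = Re (cnj c * Rep_ell2 (cadj B x) i)"
  by (subst inner_commute) (simp add: inner_scaleC_left inner_ket)
 moreover have "inner x (B (scaleC c (ket i))) = Re (cnj c * Rep_ell2 (cadj B x) i)"
  by (subst inner_commute) (simp add: cblinear_scaleC[OF B] inner_ell2_def cinner_scaleC_left Rep_cadj)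
 ultimately show ?thesis by simp
qed

lemma inner_cadj: "inner (cadj B x) y = inner x (B y)"
proof -
 have "inner (cadj B x) y - inner x (B y) = 0"
  by (rule bounded_linear_eq_0_ket[where f="%y. inner (cadj B x) y - inner x (B y)"])
   (intro bounded_linear_sub bounded_linear_inner_right
    bounded_linear_compose[OF bounded_linear_inner_right cblinear_bounded_linear[OF B]], simp add: inner_cadj_ket)
 thus ?thesis by simp
qed

lemma cadj_unique:
 assumes "!!x y. inner (B' x) y = inner x (B y)"
 shows "B' = cadj B"
proof
 fix x
 have "inner (B' x - cadj B x) y = 0" for y by (simp add: inner_diff_left assms inner_cadj)
 thus "B' x = cadj B x" by (metis inner_eq_zero_iff right_minus_eq)
qed

lemma cblinear_cadj: "cblinear (cadj B)"
proof -
 obtain C where C: "C \<ge> 0" "!!x. norm (B x) <= C * norm x" using cblinear_obtain_bound[OF B] by blast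
 have e: "x = y" if "!!z. inner x z = inner y z" for x y :: "'i ell2"
  using that by (metis inner_eq_zero_iff right_minus_eq inner_diff_left)
 show ?thesis
 proof (rule cblinearI[where C=C])
  show "cadj B (x + y) = cadj B x + cadj B y" for x y by (rule e) (simp add: inner_cadj inner_add_left)
  show "cadj B (scaleC c x) = scaleC c (cadj B x)" for c x
   by (rule e) (simp add: inner_cadj inner_scaleC_left cblinear_scaleC[OF B])
 qed (rule norm_cadj_le[OF C])
qed

end

lemma cadj_cadj: "cblinear B ==> cadj (cadj B) = B"
 by (rule cadj_unique[symmetric]) (simp_all add: cblinear_cadj inner_cadj[symmetric] inner_commute)

lemma cblinear_comp: "cblinear B ==> cblinear B' ==> cblinear (%x. B (B' x))"
 by (auto simp: cblinear_def intro: bounded_linear_compose)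

lemma cblinear_plus: "cblinear B ==> cblinear B' ==> cblinear (%x. B x + B' x)"
 by (auto simp: cblinear_def scaleC_add intro: bounded_linear_add)

lemma cblinear_smult: "cblinear B ==> cblinear (%x. scaleC c (B x))"
proof -
 have "cblinear (scaleC c)" by (rule cblinearI[where C="cmod c"]) (simp_all add: scaleC_add mult.commute)
 thus "cblinear B ==> cblinear (%x. scaleC c (B x))" by (rule cblinear_comp)
qed

lemma cblinear_id [simp]: "cblinear (%x. x)"
 by (rule cblinearI[where C=1]) auto

lemma cblinear_zero [simp]: "cblinear (%x. 0)"
 by (rule cblinearI[where C=0]) auto

lemma cadj_comp: "cblinear B ==> cblinear B' ==> cadj (%x. B (B' x)) = (%x. cadj B' (cadj B x))"
 by (rule cadj_unique[symmetric]) (auto simp: cblinear_comp inner_cadj)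

lemma cadj_plus: "cblinear B ==> cblinear B' ==> cadj (%x. B x + B' x) = (%x. cadj B x + cadj B' x)"
 by (rule cadj_unique[symmetric]) (auto simp: cblinear_plus inner_cadj inner_add_left inner_add_right)

lemma cadj_smult: "cblinear B ==> cadj (%x. scaleC c (B x)) = (%x. scaleC (cnj c) (cadj B x))"
 by (rule cadj_unique[symmetric]) (auto simp: cblinear_smult inner_scaleC_left inner_cadj cblinear_scaleC)

lemma onorm_le_iff: "cblinear B ==> 0 <= C ==> onorm B <= C \<longleftrightarrow> (\<forall>x. norm (B x) <= C * norm x)"
proof
 assume B: "cblinear B" and C: "onorm B <= C"
 show "\<forall>x. norm (B x) <= C * norm x" using norm_le_onorm[OF B] mult_right_mono[OF C norm_ge_zero] by (meson order_trans)
qed (simp add: onorm_bound)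

lemma cblinear_scaleR: "cblinear B ==> B (r *\<^sub>R x) = r *\<^sub>R B x"
 using cblinear_scaleC[of B "complex_of_real r" x] by simp

section \<open>Bounded operators on subspaces \<open>l2 I\<close>; they form a C*-algebra\<close>

definition proj :: "'i set => 'i ell2 => 'i ell2" where
 "proj I x = Abs_ell2 (%i. if i \<in> I then Rep_ell2 x i else 0)"

lemma l2_restrict: "x \<in> l2 UNIV ==> (%i. if i \<in> I then x i else 0) \<in> l2 I"
proof -
 assume "x \<in> l2 UNIV"
 hence s: "(%i. (cmod (x i))\<^sup>2) summable_on UNIV" by (simp add: l2_def)
 have "(%i. (cmod (if i \<in> I then x i else 0))\<^sup>2) summable_on UNIV" by (rule summable_on_comparison_test[OF s]) auto
 thus ?thesis by (simp add: l2_def)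
qed

lemma l2_sub_UNIV: "x \<in> l2 I ==> x \<in> l2 UNIV"
 by (simp add: l2_def)

lemma Rep_proj [simp]: "Rep_ell2 (proj I x) i = (if i \<in> I then Rep_ell2 x i else 0)"
 unfolding proj_def by (subst Abs_ell2_inverse) (auto intro: l2_sub_UNIV[OF l2_restrict])

lemma Rep_proj_l2 [simp]: "Rep_ell2 (proj I x) \<in> l2 I"
 by (subst l2_iff_UNIV) auto

lemma Rep_l2_iff: "Rep_ell2 x \<in> l2 I \<longleftrightarrow> proj I x = x"
 by (subst l2_iff_UNIV) (metis Rep_l2 Rep_proj ell2_eqI)

lemma proj_proj [simp]: "proj I (proj I x) = proj I x"
 by (rule ell2_eqI) simp

lemma proj_UNIV [simp]: "proj UNIV x = x"
 by (rule ell2_eqI) simp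

lemma proj_ket: "proj I (ket i) = (if i \<in> I then ket i else 0)"
 by (rule ell2_eqI) auto

lemma norm_proj_le: "norm (proj I x) <= norm x"
proof (rule norm_le_if_finite_sums)
 fix F :: "'a set" assume "finite F"
 have "(\<Sum>i\<in>F. (cmod (Rep_ell2 (proj I x) i))\<^sup>2) <= (\<Sum>i\<in>F. (cmod (Rep_ell2 x i))\<^sup>2)" by (rule sum_mono) auto
 also have "\<dots> <= (norm x)\<^sup>2" by (rule finite_sum_le_norm) fact
 finally show "(\<Sum>i\<in>F. (cmod (Rep_ell2 (proj I x) i))\<^sup>2) <= (norm x)\<^sup>2" .
qed simp

lemma cblinear_proj: "cblinear (proj I)"
 by (rule cblinearI[where C=1]) (auto intro!: ell2_eqI simp: norm_proj_le)

lemma inner_proj: "inner (proj I x) y = inner x (proj I y)"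
proof -
 have "(%i. cnj (Rep_ell2 (proj I x) i) * Rep_ell2 y i) = (%i. cnj (Rep_ell2 x i) * Rep_ell2 (proj I y) i)" by auto
 thus ?thesis by (simp add: inner_ell2_def l2_inner_def)
qed

text \<open>The extension of an operator on \<open>l2 I\<close> by zero on the orthogonal
  complement. All algebras \<open>BL2 I\<close> over one index type thereby act on the same Hilbert
  space, with \<open>proj I\<close> as the image of the unit; \<open>rpo\<close> is the way
  back.\<close>

definition opr :: "'i set => 'i operator => 'i ell2 => 'i ell2" where
 "opr I T x = Abs_ell2 (T (Rep_ell2 (proj I x)))"

definition rpo :: "'i set => ('i ell2 => 'i ell2) => 'i operator" where
 "rpo I B = (\<lambda>x\<in>l2 I. Rep_ell2 (B (Abs_ell2 x)))"

lemma bo_closed: "T \<in> bounded_operators I ==> x \<in> l2 I ==> T x \<in> l2 I"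
 by (auto simp: bounded_operators_def)

lemma Rep_opr: "T \<in> bounded_operators I ==> Rep_ell2 (opr I T x) = T (Rep_ell2 (proj I x))"
 unfolding opr_def by (rule Abs_ell2_inverse, rule l2_sub_UNIV, erule bo_closed, rule Rep_proj_l2)

lemma l2_norm_Rep: "l2_norm (Rep_ell2 x) = norm x"
 by (simp add: norm_ell2_def)

lemma l2_norm_Abs: "x \<in> l2 I ==> l2_norm x = norm (Abs_ell2 x)"
 by (simp add: norm_ell2_def Abs_ell2_inverse l2_sub_UNIV)

lemma proj_Abs: "x \<in> l2 I ==> proj I (Abs_ell2 x) = Abs_ell2 x"
 by (metis Abs_ell2_inverse Rep_l2_iff l2_sub_UNIV)

lemma bo_apply: "T \<in> bounded_operators I ==> x \<in> l2 I ==> T x = Rep_ell2 (opr I T (Abs_ell2 x))"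
 by (simp add: Rep_opr proj_Abs Abs_ell2_inverse l2_sub_UNIV)

lemma Abs_bo: "T \<in> bounded_operators I ==> x \<in> l2 I ==> Abs_ell2 (T x) = opr I T (Abs_ell2 x)"
 by (metis Rep_ell2_inverse bo_apply)

lemma bo_eqI:
 assumes "T \<in> bounded_operators I" "S \<in> bounded_operators I" "opr I T = opr I S"
 shows "T = S"
proof
 fix x show "T x = S x"
 proof (cases "x \<in> l2 I")
  case True
  thus ?thesis using assms by (simp add: bo_apply)
 next
  case False
  thus ?thesis using assms(1,2) by (auto simp: bounded_operators_def dest!: PiE_arb[where x=x])
 qed
qed

lemma proj_opr [simp]: "T \<in> bounded_operators I ==> proj I (opr I T x) = opr I T x"
 by (subst Rep_l2_iff[symmetric]) (simp add: Rep_opr bo_closed)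

lemma opr_proj [simp]: "opr I T (proj I x) = opr I T x"
 by (simp add: opr_def)

lemma cblinear_opr [simp]:
 assumes T: "T \<in> bounded_operators I"
 shows "cblinear (opr I T)"
proof -
 from T obtain C where C: "!!x. x \<in> l2 I ==> l2_norm (T x) <= C * l2_norm x"
  and add: "!!x y. x \<in> l2 I ==> y \<in> l2 I ==> T (%i. x i + y i) = (%i. T x i + T y i)"
  and sc: "!!x c. x \<in> l2 I ==> T (%i. c * x i) = (%i. c * T x i)" unfolding bounded_operators_def by blast
 show ?thesis
 proof (rule cblinearI[where C="\<bar>C\<bar>"])
  fix x y c
  have "Rep_ell2 (proj I (x + y)) = (%i. Rep_ell2 (proj I x) i + Rep_ell2 (proj I y) i)" by auto
  thus "opr I T (x + y) = opr I T x + opr I T y" by (intro ell2_eqI) (simp add: Rep_opr[OF T] add del: Rep_proj)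
  have "Rep_ell2 (proj I (scaleC c x)) = (%i. c * Rep_ell2 (proj I x) i)" by auto
  thus "opr I T (scaleC c x) = scaleC c (opr I T x)"
   by (intro ell2_eqI) (simp add: Rep_opr[OF T] sc del: Rep_proj)
  have "norm (opr I T x) <= C * norm (proj I x)"
   using C[of "Rep_ell2 (proj I x)"] by (simp add: Rep_opr[OF T, symmetric] l2_norm_Rep)
  also have "\<dots> <= \<bar>C\<bar> * norm x"
   by (rule order_trans[OF mult_right_mono[OF abs_ge_self norm_ge_zero] mult_left_mono[OF norm_proj_le abs_ge_zero]])
  finally show "norm (opr I T x) <= \<bar>C\<bar> * norm x" .
 qed
qed

lemma rpo_bo:
 assumes B: "cblinear B" and p: "!!x. proj I (B (proj I x)) = B (proj I x)"
 shows "rpo I B \<in> bounded_operators I"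
  and "opr I (rpo I B) = (%x. B (proj I x))"
proof -
 obtain C where C: "C \<ge> 0" "!!x. norm (B x) <= C * norm x" using cblinear_obtain_bound[OF B] by blast
 have ap: "rpo I B x = Rep_ell2 (B (Abs_ell2 x))" if "x \<in> l2 I" for x using that by (simp add: rpo_def)
 have A: "Abs_ell2 (%i. x i + y i) = Abs_ell2 x + Abs_ell2 y" "Abs_ell2 (%i. c * x i) = scaleC c (Abs_ell2 x)"
  if "x \<in> l2 I" "y \<in> l2 I" for x y c
  using that by (auto intro!: ell2_eqI simp: Abs_ell2_inverse l2_add l2_scale l2_sub_UNIV)
 show "rpo I B \<in> bounded_operators I" unfolding bounded_operators_def
 proof (intro CollectI conjI ballI allI exI[of _ C])
  show "rpo I B \<in> l2 I \<rightarrow>\<^sub>E l2 I"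
  proof
   fix x assume x: "x \<in> l2 I"
   hence "proj I (B (Abs_ell2 x)) = B (Abs_ell2 x)" using p[of "Abs_ell2 x"] by (simp add: proj_Abs)
   thus "rpo I B x \<in> l2 I" by (simp add: ap[OF x] Rep_l2_iff)
  qed (simp add: rpo_def)
  fix x y c assume x: "x \<in> l2 I"
  show "rpo I B (%i. c * x i) = (%i. c * rpo I B x i)"
   using x A(2)[OF x x] by (simp add: ap l2_scale cblinear_scaleC[OF B] fun_eq_iff)
  show "l2_norm (rpo I B x) <= C * l2_norm x" using x C(2)[of "Abs_ell2 x"] by (simp add: ap l2_norm_Rep l2_norm_Abs)
  assume y: "y \<in> l2 I"
  show "rpo I B (%i. x i + y i) = (%i. rpo I B x i + rpo I B y i)"
   using x y A(1)[OF x y] by (simp add: ap l2_add cblinear_add[OF B] fun_eq_iff)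
 qed
 show "opr I (rpo I B) = (%x. B (proj I x))" by (rule ext) (simp add: opr_def ap Rep_ell2_inverse)
qed

lemma carrier_BL2 [simp]: "carrier (BL2 I) = bounded_operators I"
 by (simp add: BL2_def)

lemma opr_mult:
 assumes "S \<in> bounded_operators I" "T \<in> bounded_operators I"
 shows "S \<otimes>\<^bsub>BL2 I\<^esub> T \<in> bounded_operators I" "opr I (S \<otimes>\<^bsub>BL2 I\<^esub> T) = (%x. opr I S (opr I T x))"
proof -
 have "S \<otimes>\<^bsub>BL2 I\<^esub> T = (\<lambda>x\<in>l2 I. S (T x))" by (simp add: BL2_def)
 also have "\<dots> = rpo I (%x. opr I S (opr I T x))" unfolding rpo_def
 proof (rule restrict_ext)
  fix x assume x: "x \<in> l2 I"
  show "S (T x) = Rep_ell2 (opr I S (opr I T (Abs_ell2 x)))"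
   using bo_apply[OF assms(1) bo_closed[OF assms(2) x]] by (simp add: Abs_bo[OF assms(2) x])
 qed
 finally have "S \<otimes>\<^bsub>BL2 I\<^esub> T = rpo I (%x. opr I S (opr I T x))" .
 thus "S \<otimes>\<^bsub>BL2 I\<^esub> T \<in> bounded_operators I" "opr I (S \<otimes>\<^bsub>BL2 I\<^esub> T) = (%x. opr I S (opr I T x))"
  using assms by (auto simp: rpo_bo cblinear_comp)
qed

lemma opr_add:
 assumes "S \<in> bounded_operators I" "T \<in> bounded_operators I"
 shows "S \<oplus>\<^bsub>BL2 I\<^esub> T \<in> bounded_operators I" "opr I (S \<oplus>\<^bsub>BL2 I\<^esub> T) = (%x. opr I S x + opr I T x)"
proof -
 have "S \<oplus>\<^bsub>BL2 I\<^esub> T = rpo I (%x. opr I S x + opr I T x)" unfolding BL2_def rpo_def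
  by (auto intro!: restrict_ext ext simp: bo_apply[OF assms(1)] bo_apply[OF assms(2)])
 thus "S \<oplus>\<^bsub>BL2 I\<^esub> T \<in> bounded_operators I" "opr I (S \<oplus>\<^bsub>BL2 I\<^esub> T) = (%x. opr I S x + opr I T x)"
  using assms by (auto simp: rpo_bo cblinear_plus cblinear_add[OF cblinear_proj])
qed

lemma opr_smult:
 assumes "T \<in> bounded_operators I"
 shows "c \<odot>\<^bsub>BL2 I\<^esub> T \<in> bounded_operators I" "opr I (c \<odot>\<^bsub>BL2 I\<^esub> T) = (%x. scaleC c (opr I T x))"
proof -
 have "c \<odot>\<^bsub>BL2 I\<^esub> T = rpo I (%x. scaleC c (opr I T x))" unfolding BL2_def rpo_def
  by (auto intro!: restrict_ext ext simp: bo_apply[OF assms(1)])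
 thus "c \<odot>\<^bsub>BL2 I\<^esub> T \<in> bounded_operators I" "opr I (c \<odot>\<^bsub>BL2 I\<^esub> T) = (%x. scaleC c (opr I T x))"
  using assms by (auto simp: rpo_bo cblinear_smult cblinear_scaleC[OF cblinear_proj])
qed

lemma opr_zero: "\<zero>\<^bsub>BL2 I\<^esub> \<in> bounded_operators I" "opr I \<zero>\<^bsub>BL2 I\<^esub> = (%x. 0)"
proof -
 have "\<zero>\<^bsub>BL2 I\<^esub> = rpo I (%x. 0)" unfolding BL2_def rpo_def by (auto intro!: restrict_ext ext)
 thus "\<zero>\<^bsub>BL2 I\<^esub> \<in> bounded_operators I" "opr I \<zero>\<^bsub>BL2 I\<^esub> = (%x. 0)"
  by (auto simp: rpo_bo cblinear_0[OF cblinear_proj])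
qed

lemma opr_one: "\<one>\<^bsub>BL2 I\<^esub> \<in> bounded_operators I" "opr I \<one>\<^bsub>BL2 I\<^esub> = proj I"
proof -
 have "\<one>\<^bsub>BL2 I\<^esub> = rpo I (%x. x)"
  unfolding BL2_def rpo_def by (auto intro!: restrict_ext ext simp: Abs_ell2_inverse l2_sub_UNIV)
 thus "\<one>\<^bsub>BL2 I\<^esub> \<in> bounded_operators I" "opr I \<one>\<^bsub>BL2 I\<^esub> = proj I" by (auto simp: rpo_bo)
qed

lemma opr_adj:
 assumes T: "T \<in> bounded_operators I"
 shows "adj (BL2 I) T \<in> bounded_operators I" "opr I (adj (BL2 I) T) = cadj (opr I T)"
proof -
 have p1: "proj I (cadj (opr I T) x) = cadj (opr I T) x" for x
 proof -
  have "inner (proj I (cadj (opr I T) x)) y = inner (cadj (opr I T) x) y" for y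
   using T by (simp add: inner_proj inner_cadj)
  hence "inner (proj I (cadj (opr I T) x) - cadj (opr I T) x) y = 0" for y by (simp add: inner_diff_left)
  thus ?thesis by (metis inner_eq_zero_iff right_minus_eq)
 qed
 have p2: "cadj (opr I T) (proj I x) = cadj (opr I T) x" for x
 proof -
  have "inner (cadj (opr I T) (proj I x)) y = inner (cadj (opr I T) x) y" for y
   using T by (simp add: inner_proj inner_cadj)
  hence "inner (cadj (opr I T) (proj I x) - cadj (opr I T) x) y = 0" for y by (simp add: inner_diff_left)
  thus ?thesis by (metis inner_eq_zero_iff right_minus_eq)
 qed
 define S where "S = rpo I (cadj (opr I T))"
 have S: "S \<in> bounded_operators I" "opr I S = cadj (opr I T)"
  unfolding S_def using T by (auto simp: rpo_bo cblinear_cadj p1 p2)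
 \<comment> \<open>The description in \<open>adj\<close> tests vectors of \<open>l2 I\<close> with
   the complex inner product. It is equivalent to being \<open>cadj\<close> after extension to the
   whole space, which gives existence and uniqueness at once.\<close>
 have ci: "(\<forall>x\<in>l2 I. \<forall>y\<in>l2 I. l2_inner (S' x) y = l2_inner x (T y)) \<longleftrightarrow> opr I S' = cadj (opr I T)"
  if S': "S' \<in> bounded_operators I" for S'
 proof
  assume *: "\<forall>x\<in>l2 I. \<forall>y\<in>l2 I. l2_inner (S' x) y = l2_inner x (T y)"
  have "inner (opr I S' x) y = inner x (opr I T y)" for x y
  proof -
   have "inner (opr I S' x) y = inner (opr I S' x) (proj I y)" by (metis S' inner_proj proj_opr)
   also have "\<dots> = inner (proj I x) (opr I T y)" using * by (simp add: inner_ell2_def Rep_opr[OF S'] Rep_opr[OF T])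
   also have "\<dots> = inner x (opr I T y)" using T by (simp add: inner_proj)
   finally show ?thesis .
  qed
  thus "opr I S' = cadj (opr I T)" by (rule cadj_unique[OF cblinear_opr[OF T]])
 next
  assume *: "opr I S' = cadj (opr I T)"
  show "\<forall>x\<in>l2 I. \<forall>y\<in>l2 I. l2_inner (S' x) y = l2_inner x (T y)"
  proof (intro ballI)
   fix x y assume x: "x \<in> l2 I" and y: "y \<in> l2 I"
   define x' where "x' = Abs_ell2 x"
   define y' where "y' = Abs_ell2 y"
   have xy: "x = Rep_ell2 x'" "y = Rep_ell2 y'" using x y by (simp_all add: x'_def y'_def Abs_ell2_inverse l2_sub_UNIV)
   have 1: "S' x = Rep_ell2 (opr I S' x')" "T y = Rep_ell2 (opr I T y')"
    using x y by (simp_all add: bo_apply[OF S'] bo_apply[OF T] x'_def y'_def)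
   have "inner (opr I S' x') z = inner x' (opr I T z)" for z using T by (simp add: * inner_cadj)
   thus "l2_inner (S' x) y = l2_inner x (T y)" unfolding 1 unfolding xy l2_inner_eq
    by (simp add: cblinear_scaleC[OF cblinear_opr[OF T], symmetric])
  qed
 qed
 have "adj (BL2 I) T = S" unfolding BL2_def
 proof (simp, rule the_equality)
  show "S \<in> bounded_operators I & (\<forall>x\<in>l2 I. \<forall>y\<in>l2 I. l2_inner (S x) y = l2_inner x (T y))" using S ci[OF S(1)] by blast
  fix S' assume "S' \<in> bounded_operators I & (\<forall>x\<in>l2 I. \<forall>y\<in>l2 I. l2_inner (S' x) y = l2_inner x (T y))"
  thus "S' = S" using S ci[of S'] bo_eqI[of S' I S] by simp
 qed
 thus "adj (BL2 I) T \<in> bounded_operators I" "opr I (adj (BL2 I) T) = cadj (opr I T)" using S by auto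
qed

lemma onorm_nonneg: "cblinear B ==> 0 <= onorm B"
 by (simp add: onorm_pos_le cblinear_bounded_linear)

text \<open>The supremum in \<open>nrm\<close> runs over the unit ball of \<open>l2 I\<close>, the
  operator norm over all vectors. They agree because \<open>opr I T\<close> does not change when a
  vector is replaced by its projection, which may then be normalised.\<close>

lemma nrm_BL2:
 assumes T: "T \<in> bounded_operators I"
 shows "nrm (BL2 I) T = onorm (opr I T)"
proof -
 let ?S = "{x \<in> l2 I. l2_norm x <= 1}"
 have n: "l2_norm (T x) = norm (opr I T (Abs_ell2 x))" if "x \<in> l2 I" for x
  using that by (simp add: bo_apply[OF T] l2_norm_Rep)
 have le: "l2_norm (T x) <= onorm (opr I T)" if "x \<in> ?S" for x
 proof -
  have "l2_norm (T x) <= onorm (opr I T) * norm (Abs_ell2 x)"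
   using that norm_le_onorm[OF cblinear_opr[OF T], of "Abs_ell2 x"] by (simp add: n)
  also have "\<dots> <= onorm (opr I T) * 1"
   using that by (intro mult_left_mono onorm_nonneg cblinear_opr T) (auto simp: l2_norm_Abs)
  finally show ?thesis by simp
 qed
 have bdd: "bdd_above ((%x. l2_norm (T x)) ` ?S)" using le by (auto simp: bdd_above_def)
 have z: "(%i. 0) \<in> ?S" by (simp add: l2_norm_def)
 have up: "l2_norm (T x) <= (SUP x\<in>?S. l2_norm (T x))" if "x \<in> ?S" for x using cSUP_upper[OF that bdd] .
 have s0: "0 <= (SUP x\<in>?S. l2_norm (T x))"
 proof -
  have "0 <= l2_norm (T (%i. 0))" by (subst n) simp_all
  thus ?thesis using up[OF z] by linarith
 qed
 have "onorm (opr I T) <= (SUP x\<in>?S. l2_norm (T x))"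
 proof (rule onorm_bound[OF s0])
  fix x
  define y where "y = proj I x"
  show "norm (opr I T x) <= (SUP x\<in>?S. l2_norm (T x)) * norm x"
  proof (cases "y = 0")
   case True
   hence "opr I T x = 0" using opr_proj[of I T x] cblinear_0[OF cblinear_opr[OF T]] by (simp add: y_def)
   thus ?thesis using s0 by simp
  next
   case False
   define u where "u = y /\<^sub>R norm y"
   have "proj I u = u" by (simp add: u_def y_def cblinear_scaleR[OF cblinear_proj])
   hence u: "Rep_ell2 u \<in> ?S" using False by (simp add: Rep_l2_iff l2_norm_Rep u_def)
   have "norm (opr I T u) <= (SUP x\<in>?S. l2_norm (T x))" using up[OF u] u by (simp add: n Rep_ell2_inverse)
   moreover have "opr I T x = norm y *\<^sub>R opr I T u"
    using False by (simp add: u_def y_def cblinear_scaleR[OF cblinear_opr[OF T]])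
   ultimately have "norm (opr I T x) <= norm y * (SUP x\<in>?S. l2_norm (T x))" by (simp add: mult_left_mono)
   also have "\<dots> <= norm x * (SUP x\<in>?S. l2_norm (T x))"
    using norm_proj_le s0 by (intro mult_right_mono) (auto simp: y_def)
   finally show ?thesis by (simp add: mult.commute)
  qed
 qed
 moreover have "(SUP x\<in>?S. l2_norm (T x)) <= onorm (opr I T)" using z le by (intro cSUP_least) blast+
 ultimately show ?thesis by (simp add: BL2_def)
qed

lemma nrm_BL2_le:
 "T \<in> bounded_operators I ==> 0 <= C ==> nrm (BL2 I) T <= C \<longleftrightarrow> (\<forall>x. norm (opr I T x) <= C * norm x)"
 by (simp add: nrm_BL2 onorm_le_iff)

lemma norm_opr_le: "T \<in> bounded_operators I ==> norm (opr I T x) <= nrm (BL2 I) T * norm x"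
 by (simp add: nrm_BL2 norm_le_onorm)

lemma nrm_BL2_nonneg: "T \<in> bounded_operators I ==> 0 <= nrm (BL2 I) T"
 by (simp add: nrm_BL2 onorm_nonneg)

lemmas BL2_closed = opr_mult(1) opr_add(1) opr_smult(1) opr_zero(1) opr_one(1) opr_adj(1)
lemmas opr_simps = opr_mult(2) opr_add(2) opr_smult(2) opr_zero(2) opr_one(2) opr_adj(2)

lemma onorm_cadj_le: "cblinear B ==> onorm (cadj B) <= onorm B"
 by (rule onorm_bound) (auto intro: onorm_nonneg norm_cadj_le norm_le_onorm)

lemma abelian_group_BL2: "abelian_group (BL2 I)"
proof (rule abelian_groupI)
 fix x y z assume x: "x \<in> carrier (BL2 I)"
 show "\<exists>y\<in>carrier (BL2 I). y \<oplus>\<^bsub>BL2 I\<^esub> x = \<zero>\<^bsub>BL2 I\<^esub>" using x by (intro bexI[of _ "(- 1) \<odot>\<^bsub>BL2 I\<^esub> x"] bo_eqI[of _ I])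
   (auto simp: BL2_closed opr_simps scaleC_minus_one)
qed (auto intro!: bo_eqI[of _ I] simp: BL2_closed opr_simps add.commute add.assoc)

lemma normed_star_algebra_BL2: "normed_star_algebra (BL2 I)"
proof (rule normed_star_algebra.intro[OF abelian_group_BL2], unfold_locales)
 fix x y z c d assume x: "x \<in> carrier (BL2 I)"
 note s = BL2_closed opr_simps
 show "0 <= nrm (BL2 I) x" using x by (simp add: nrm_BL2_nonneg)
 show "(nrm (BL2 I) x = 0) = (x = \<zero>\<^bsub>BL2 I\<^esub>)"
 proof
  assume 0: "nrm (BL2 I) x = 0"
  have "norm (opr I x v) <= 0" for v using norm_opr_le[of x I v] x 0 by simp
  thus "x = \<zero>\<^bsub>BL2 I\<^esub>" using x by (intro bo_eqI[of _ I]) (auto simp: s)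
 next
  assume "x = \<zero>\<^bsub>BL2 I\<^esub>"
  thus "nrm (BL2 I) x = 0" using nrm_BL2_le[of x I 0] x nrm_BL2_nonneg[of x I] by (simp add: s)
 qed
 show "nrm (BL2 I) (c \<odot>\<^bsub>BL2 I\<^esub> x) = cmod c * nrm (BL2 I) x"
 proof (rule antisym)
  have le: "nrm (BL2 I) (c \<odot>\<^bsub>BL2 I\<^esub> x) <= cmod c * nrm (BL2 I) x" if "x \<in> carrier (BL2 I)" for c x
   using that norm_opr_le[of x I] by (subst nrm_BL2_le) (auto simp: s nrm_BL2_nonneg mult.assoc intro!: mult_left_mono)
  show "nrm (BL2 I) (c \<odot>\<^bsub>BL2 I\<^esub> x) <= cmod c * nrm (BL2 I) x" by (rule le[OF x])
  show "cmod c * nrm (BL2 I) x <= nrm (BL2 I) (c \<odot>\<^bsub>BL2 I\<^esub> x)"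
  proof (cases "c = 0")
   case False
   have "x = inverse c \<odot>\<^bsub>BL2 I\<^esub> (c \<odot>\<^bsub>BL2 I\<^esub> x)" using x False by (intro bo_eqI[of _ I]) (auto simp: s)
   hence "nrm (BL2 I) x <= cmod (inverse c) * nrm (BL2 I) (c \<odot>\<^bsub>BL2 I\<^esub> x)"
    using le[of "c \<odot>\<^bsub>BL2 I\<^esub> x" "inverse c"] x by (simp add: s)
   hence "cmod c * nrm (BL2 I) x <= cmod c * (cmod (inverse c) * nrm (BL2 I) (c \<odot>\<^bsub>BL2 I\<^esub> x))"
    by (rule mult_left_mono) simp
   also have "\<dots> = nrm (BL2 I) (c \<odot>\<^bsub>BL2 I\<^esub> x)" using False by (simp add: norm_mult[symmetric] mult.assoc[symmetric])
   finally show ?thesis .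
  qed (use x in \<open>simp add: s nrm_BL2_nonneg\<close>)
 qed
 assume y: "y \<in> carrier (BL2 I)"
 show "nrm (BL2 I) (x \<oplus>\<^bsub>BL2 I\<^esub> y) <= nrm (BL2 I) x + nrm (BL2 I) y"
 proof (subst nrm_BL2_le)
  show "\<forall>v. norm (opr I (x \<oplus>\<^bsub>BL2 I\<^esub> y) v) <= (nrm (BL2 I) x + nrm (BL2 I) y) * norm v"
  proof
   fix v
   show "norm (opr I (x \<oplus>\<^bsub>BL2 I\<^esub> y) v) <= (nrm (BL2 I) x + nrm (BL2 I) y) * norm v"
    using norm_triangle_ineq[of "opr I x v" "opr I y v"] norm_opr_le[of x I v] norm_opr_le[of y I v] x y
    by (simp add: s distrib_right)
  qed
 qed (use x y in \<open>auto simp: s nrm_BL2_nonneg\<close>)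
 show "nrm (BL2 I) (x \<otimes>\<^bsub>BL2 I\<^esub> y) <= nrm (BL2 I) x * nrm (BL2 I) y"
 proof (subst nrm_BL2_le)
  show "\<forall>v. norm (opr I (x \<otimes>\<^bsub>BL2 I\<^esub> y) v) <= (nrm (BL2 I) x * nrm (BL2 I) y) * norm v"
  proof
   fix v
   have "norm (opr I x (opr I y v)) <= nrm (BL2 I) x * norm (opr I y v)" using norm_opr_le[of x I] x by simp
   also have "\<dots> <= nrm (BL2 I) x * (nrm (BL2 I) y * norm v)"
    using norm_opr_le[of y I v] x y by (intro mult_left_mono) (auto simp: nrm_BL2_nonneg)
   finally show "norm (opr I (x \<otimes>\<^bsub>BL2 I\<^esub> y) v) <= (nrm (BL2 I) x * nrm (BL2 I) y) * norm v"
    using x y by (simp add: s mult.assoc)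
  qed
 qed (use x y in \<open>auto simp: s nrm_BL2_nonneg\<close>)
qed (auto intro!: bo_eqI[of _ I] simp: BL2_closed opr_simps scaleC_add scaleC_add_left cblinear_plus cblinear_smult
  cblinear_comp cblinear_add[OF cblinear_opr] cblinear_scaleC[OF cblinear_opr] cblinear_cadj
  cadj_cadj cadj_smult cadj_plus cadj_comp)

lemma opr_minus:
 assumes "S \<in> bounded_operators I" "T \<in> bounded_operators I"
 shows "S \<ominus>\<^bsub>BL2 I\<^esub> T \<in> bounded_operators I" "opr I (S \<ominus>\<^bsub>BL2 I\<^esub> T) = (%x. opr I S x - opr I T x)"
 using assms normed_star_algebra.minus_smult[OF normed_star_algebra_BL2, of S I T]
 by (auto simp: BL2_closed opr_simps scaleC_minus_one)

lemma cstar_algebra_BL2: "cstar_algebra (BL2 I)"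
proof -
 interpret B: normed_star_algebra "BL2 I" by (rule normed_star_algebra_BL2)
 show ?thesis
 proof
  fix x assume "x \<in> carrier (BL2 I)"
  hence x: "x \<in> bounded_operators I" by simp
  let ?a = "adj (BL2 I) x"
  have a: "?a \<in> bounded_operators I" using x by (simp add: BL2_closed)
  have na: "nrm (BL2 I) ?a <= nrm (BL2 I) x" using x a by (simp add: nrm_BL2 opr_simps onorm_cadj_le)
  have "nrm (BL2 I) (?a \<otimes>\<^bsub>BL2 I\<^esub> x) <= nrm (BL2 I) ?a * nrm (BL2 I) x" using B.nrm_mult[of ?a x] x a by simp
  also have "\<dots> <= (nrm (BL2 I) x)\<^sup>2"
   unfolding power2_eq_square using na x by (intro mult_right_mono) (auto simp: nrm_BL2_nonneg)
  finally have 1: "nrm (BL2 I) (?a \<otimes>\<^bsub>BL2 I\<^esub> x) <= (nrm (BL2 I) x)\<^sup>2" .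
  let ?n = "nrm (BL2 I) (?a \<otimes>\<^bsub>BL2 I\<^esub> x)"
  have c: "?a \<otimes>\<^bsub>BL2 I\<^esub> x \<in> bounded_operators I" using a x by (simp add: BL2_closed)
  have n0: "0 <= ?n" using c by (rule nrm_BL2_nonneg)
  have "norm (opr I x v) <= sqrt ?n * norm v" for v
  proof -
   have "(norm (opr I x v))\<^sup>2 = inner (opr I (?a \<otimes>\<^bsub>BL2 I\<^esub> x) v) v"
    using x a by (simp add: opr_simps inner_cadj power2_norm_eq_inner)
   also have "\<dots> <= norm (opr I (?a \<otimes>\<^bsub>BL2 I\<^esub> x) v) * norm v" by (rule norm_cauchy_schwarz)
   also have "\<dots> <= ?n * norm v * norm v" by (rule mult_right_mono[OF norm_opr_le[OF c] norm_ge_zero])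
   also have "\<dots> = (sqrt ?n * norm v)\<^sup>2" by (simp only: power_mult_distrib real_sqrt_pow2[OF n0] power2_eq_square[of "norm v"] mult.assoc)
   finally show ?thesis by (rule power2_le_imp_le) (simp add: n0)
  qed
  hence "nrm (BL2 I) x <= sqrt ?n" using x n0 by (subst nrm_BL2_le) auto
  hence "(nrm (BL2 I) x)\<^sup>2 <= (sqrt ?n)\<^sup>2" using nrm_BL2_nonneg[OF x] by (rule power_mono)
  hence "(nrm (BL2 I) x)\<^sup>2 <= ?n" using n0 by simp
  with 1 show "?n = (nrm (BL2 I) x)\<^sup>2" by simp
 next
  show "B.metric.mcomplete" unfolding B.mcomplete_iff
  proof (intro allI impI)
   fix X :: "nat => 'a operator" assume "(\<forall>n. X n \<in> carrier (BL2 I)) &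
    (\<forall>e>0. \<exists>N. \<forall>m\<ge>N. \<forall>n\<ge>N. nrm (BL2 I) (X m \<ominus>\<^bsub>BL2 I\<^esub> X n) < e)"
   hence X: "!!n. X n \<in> bounded_operators I"
    and C: "!!e. e > 0 ==> \<exists>N. \<forall>m\<ge>N. \<forall>n\<ge>N. nrm (BL2 I) (X m \<ominus>\<^bsub>BL2 I\<^esub> X n) < e" by auto
   \<comment> \<open>The sequence is moved to the Banach space of bounded real linear maps. Complex
     linearity and compatibility with \<open>proj I\<close> pass to the limit because convergence is
     also pointwise.\<close>
   define U where "U n = Blinfun (opr I (X n))" for n
   have U: "blinfun_apply (U n) = opr I (X n)" for n
    unfolding U_def using X by (simp add: bounded_linear_Blinfun_apply cblinear_bounded_linear)
   have "norm (U m - U n) = nrm (BL2 I) (X m \<ominus>\<^bsub>BL2 I\<^esub> X n)" for m n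
    using X by (simp add: nrm_BL2 opr_minus norm_blinfun.rep_eq minus_blinfun.rep_eq U)
   hence "Cauchy U" using C by (intro CauchyI) simp
   then obtain L where L: "U \<longlonglongrightarrow> L" by (auto simp: Cauchy_convergent_iff convergent_def)
   have lim: "(%n. opr I (X n) v) \<longlonglongrightarrow> blinfun_apply L v" for v unfolding U[symmetric] by (intro tendsto_intros L)
   have "cblinear (blinfun_apply L)" unfolding cblinear_def
   proof (intro conjI allI blinfun.bounded_linear_right LIMSEQ_unique[OF lim])
    fix c v
    have "bounded_linear (scaleC c)" using cblinear_bounded_linear[OF cblinear_smult[OF cblinear_id]] .
    hence "(%n. scaleC c (opr I (X n) v)) \<longlonglongrightarrow> scaleC c (blinfun_apply L v)"
     by (rule bounded_linear.tendsto[OF _ lim])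
    thus "(%n. opr I (X n) (scaleC c v)) \<longlonglongrightarrow> scaleC c (blinfun_apply L v)"
     using X by (simp add: cblinear_scaleC[OF cblinear_opr])
   qed
   moreover have "proj I (blinfun_apply L (proj I v)) = blinfun_apply L v" for v
   proof (rule LIMSEQ_unique[OF _ lim])
    show "(%n. opr I (X n) v) \<longlonglongrightarrow> proj I (blinfun_apply L (proj I v))"
     using bounded_linear.tendsto[OF cblinear_bounded_linear[OF cblinear_proj] lim, of I "proj I v"] X by simp
   qed
   moreover have "blinfun_apply L (proj I v) = blinfun_apply L v" for v
    by (rule LIMSEQ_unique[OF lim]) (use lim[of v] in simp)
   ultimately have l: "rpo I (blinfun_apply L) \<in> bounded_operators I" "opr I (rpo I (blinfun_apply L)) = blinfun_apply L"
    using rpo_bo[of "blinfun_apply L" I] by auto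
   have "nrm (BL2 I) (X n \<ominus>\<^bsub>BL2 I\<^esub> rpo I (blinfun_apply L)) = norm (U n - L)" for n
    using X l by (simp add: nrm_BL2 opr_minus norm_blinfun.rep_eq minus_blinfun.rep_eq U)
   thus "\<exists>l\<in>carrier (BL2 I). (%n. nrm (BL2 I) (X n \<ominus>\<^bsub>BL2 I\<^esub> l)) \<longlonglongrightarrow> 0"
    using l tendsto_norm_zero[OF LIM_zero[OF L]] by (intro bexI[of _ "rpo I (blinfun_apply L)"]) auto
  qed
 qed
qed

lemma monoid_BL2: "monoid (BL2 I)"
proof
 fix x assume "x \<in> carrier (BL2 I)"
 thus "\<one>\<^bsub>BL2 I\<^esub> \<otimes>\<^bsub>BL2 I\<^esub> x = x" "x \<otimes>\<^bsub>BL2 I\<^esub> \<one>\<^bsub>BL2 I\<^esub> = x"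
  by (auto intro!: bo_eqI[of _ I] simp: BL2_closed opr_simps)
qed (auto simp: BL2_closed normed_star_algebra.m_assoc[OF normed_star_algebra_BL2])

section \<open>C*-subalgebras and contractivity of star homomorphisms\<close>

lemma cstar_subalgebraD:
 assumes "cstar_subalgebra A S"
 shows "closedin (cstar_topology A) S" "\<zero>\<^bsub>A\<^esub> \<in> S"
  "!!x y. x \<in> S ==> y \<in> S ==> x \<oplus>\<^bsub>A\<^esub> y \<in> S" "!!x y. x \<in> S ==> y \<in> S ==> x \<otimes>\<^bsub>A\<^esub> y \<in> S"
  "!!x. x \<in> S ==> adj A x \<in> S" "!!c x. x \<in> S ==> c \<odot>\<^bsub>A\<^esub> x \<in> S" using assms unfolding cstar_subalgebra_def by blast+

context normed_star_algebra
begin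

lemma subalgebra_subset: "cstar_subalgebra A S ==> S \<subseteq> carrier A"
 by (drule cstar_subalgebraD(1)) (simp add: closedin_iff)

lemma normed_star_subalgebra:
 assumes S: "cstar_subalgebra A S"
 shows "normed_star_algebra (A\<lparr>carrier := S\<rparr>)"
proof -
 note D = cstar_subalgebraD[OF S]
 have sub: "x \<in> carrier A" if "x \<in> S" for x using subalgebra_subset[OF S] that by blast
 have ag: "abelian_group (A\<lparr>carrier := S\<rparr>)"
 proof (rule abelian_groupI)
  fix x assume x: "x \<in> carrier (A\<lparr>carrier := S\<rparr>)"
  show "\<exists>y\<in>carrier (A\<lparr>carrier := S\<rparr>). y \<oplus>\<^bsub>A\<lparr>carrier := S\<rparr>\<^esub> x = \<zero>\<^bsub>A\<lparr>carrier := S\<rparr>\<^esub>"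
   using x D(6)[of x "- 1"] sub[of x] by (intro bexI[of _ "(- 1) \<odot> x"]) (auto simp: smult_minus_one l_neg)
 qed (use sub in \<open>auto simp: D a_ac\<close>)
 show ?thesis by (rule normed_star_algebra.intro[OF ag], unfold_locales)
   (use sub in \<open>auto simp: D m_assoc l_distr r_distr smult_l_distr smult_r_distr smult_assoc smult_one
    smult_mult_left smult_mult_right adj_adj adj_add adj_smult adj_mult nrm_nonneg nrm_eq_0 nrm_triangle
    nrm_smult nrm_mult\<close>)
qed

lemma subalgebra_minus:
 assumes S: "cstar_subalgebra A S" and "x \<in> S" "y \<in> S"
 shows "x \<ominus>\<^bsub>A\<lparr>carrier := S\<rparr>\<^esub> y = x \<ominus> y"
 using normed_star_algebra.minus_smult[OF normed_star_subalgebra[OF S]] assms subalgebra_subset[OF S]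
 by (simp add: minus_smult subset_iff)

lemma subalgebra_carrier: "cstar_subalgebra A (carrier A)"
 unfolding cstar_subalgebra_def by (auto simp: m_closed adj_closed smult_closed closedin_iff)

lemma subalgebra_generated:
 assumes "G \<subseteq> carrier A"
 shows "cstar_subalgebra A (cstar_generated A G)" unfolding cstar_subalgebra_def[of A "cstar_generated A G"]
proof (intro conjI ballI allI)
 show "closedin (cstar_topology A) (cstar_generated A G)" using subalgebra_carrier assms unfolding cstar_generated_def
  by (intro closedin_Inter) (auto dest: cstar_subalgebraD)
qed (auto simp: cstar_generated_def dest: cstar_subalgebraD)

lemma generated_superset: "G \<subseteq> cstar_generated A G"
 unfolding cstar_generated_def by blast

lemma generated_minimal: "cstar_subalgebra A T ==> G \<subseteq> T ==> cstar_generated A G \<subseteq> T"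
 unfolding cstar_generated_def by blast

end

context cstar_algebra
begin

lemma nrm_adj: assumes x: "x \<in> carrier A" shows "nrm A (adj A x) = nrm A x"
proof -
 have le: "nrm A x <= nrm A (adj A x)" if x: "x \<in> carrier A" for x
 proof (cases "nrm A x = 0")
  case True thus ?thesis using nrm_nonneg[OF adj_closed[OF x]] by simp
 next
  case False
  hence "nrm A x > 0" using nrm_nonneg[OF x] by simp
  moreover have "nrm A x * nrm A x <= nrm A (adj A x) * nrm A x"
   using cstar_identity[OF x] nrm_mult[OF adj_closed[OF x] x] by (simp add: power2_eq_square)
  ultimately show ?thesis by simp
 qed
 show ?thesis using le[OF x] le[OF adj_closed[OF x]] adj_adj[OF x] by simp
qed

lemma cstar_subalgebra_algebra:
 assumes S: "cstar_subalgebra A S"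
 shows "cstar_algebra (A\<lparr>carrier := S\<rparr>)"
proof -
 let ?S = "A\<lparr>carrier := S\<rparr>"
 interpret S: normed_star_algebra "?S" by (rule normed_star_subalgebra[OF S])
 note sub = subsetD[OF subalgebra_subset[OF S]]
 show ?thesis
 proof
  fix x assume "x \<in> carrier ?S"
  thus "nrm ?S (adj ?S x \<otimes>\<^bsub>?S\<^esub> x) = (nrm ?S x)\<^sup>2" using cstar_identity[of x] sub by simp
 next
  show "S.metric.mcomplete" unfolding S.mcomplete_iff
  proof (intro allI impI)
   fix X :: "nat => 'a" assume X: "(\<forall>n. X n \<in> carrier ?S) &
    (\<forall>e>0. \<exists>N. \<forall>m\<ge>N. \<forall>n\<ge>N. nrm ?S (X m \<ominus>\<^bsub>?S\<^esub> X n) < e)"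
   hence XS: "!!n. X n \<in> S" by simp
   have "(\<forall>n. X n \<in> carrier A) & (\<forall>e>0. \<exists>N. \<forall>m\<ge>N. \<forall>n\<ge>N. nrm A (X m \<ominus> X n) < e)"
    using X sub by (simp add: subalgebra_minus[OF S XS XS])
   then obtain l where l: "l \<in> carrier A" "(%n. nrm A (X n \<ominus> l)) \<longlonglongrightarrow> 0"
    using mcomplete_iff[THEN iffD1, OF complete, THEN spec[of _ X]] by blast
   hence "l \<in> S"
    using closedin_iff[THEN iffD1, OF cstar_subalgebraD(1)[OF S], THEN conjunct2, THEN spec[of _ X], THEN spec[of _ l]] XS
    by simp
   thus "\<exists>l\<in>carrier ?S. (%n. nrm ?S (X n \<ominus>\<^bsub>?S\<^esub> l)) \<longlonglongrightarrow> 0"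
    using l(2) by (intro bexI[of _ l]) (auto simp: subalgebra_minus[OF S XS])
  qed
 qed
qed

text \<open>The map has Lipschitz constant \<open>nrm A h < 1\<close>, so Banach's fixed point
  theorem applies. The fixed point plays the role of h (1 - h)^(-1), which makes sense in an algebra
  without unit.\<close>

lemma quasi_inverse:
 assumes h: "h \<in> carrier A" "nrm A h < 1"
 obtains y where "y \<in> carrier A" "h \<oplus> y \<otimes> h = y"
proof (rule metric.Banach_fixedpoint_thm[OF complete, of "%y. h \<oplus> y \<otimes> h" "nrm A h"])
 fix x y assume x: "x \<in> carrier A" and y: "y \<in> carrier A"
 have "(h \<oplus> x \<otimes> h) \<ominus> (h \<oplus> y \<otimes> h) = (x \<ominus> y) \<otimes> h"
  using x y h by (simp add: add_minus_add m_closed l_distr_minus minus_eq_zero_iff[THEN iffD2])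
 thus "cdist A (h \<oplus> x \<otimes> h) (h \<oplus> y \<otimes> h) <= nrm A h * cdist A x y"
  using nrm_mult[of "x \<ominus> y" h] x y h by (simp add: cdist_def m_closed mult.commute)
qed (use h in \<open>auto simp: m_closed\<close>)

end

lemma star_homD:
 assumes "star_hom A B f"
 shows "!!x. x \<in> carrier A ==> f x \<in> carrier B"
  "!!x y. x \<in> carrier A ==> y \<in> carrier A ==> f (x \<oplus>\<^bsub>A\<^esub> y) = f x \<oplus>\<^bsub>B\<^esub> f y"
  "!!c x. x \<in> carrier A ==> f (c \<odot>\<^bsub>A\<^esub> x) = c \<odot>\<^bsub>B\<^esub> f x"
  "!!x y. x \<in> carrier A ==> y \<in> carrier A ==> f (x \<otimes>\<^bsub>A\<^esub> y) = f x \<otimes>\<^bsub>B\<^esub> f y"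
  "!!x. x \<in> carrier A ==> f (adj A x) = adj B (f x)"
 using assms unfolding star_hom_def linear_map_def by (auto simp: Pi_iff)

lemma star_homI:
 assumes "!!x. x \<in> carrier A ==> f x \<in> carrier B"
  "!!x y. x \<in> carrier A ==> y \<in> carrier A ==> f (x \<oplus>\<^bsub>A\<^esub> y) = f x \<oplus>\<^bsub>B\<^esub> f y"
  "!!c x. x \<in> carrier A ==> f (c \<odot>\<^bsub>A\<^esub> x) = c \<odot>\<^bsub>B\<^esub> f x"
  "!!x y. x \<in> carrier A ==> y \<in> carrier A ==> f (x \<otimes>\<^bsub>A\<^esub> y) = f x \<otimes>\<^bsub>B\<^esub> f y"
  "!!x. x \<in> carrier A ==> f (adj A x) = adj B (f x)"
 shows "star_hom A B f" using assms unfolding star_hom_def linear_map_def by (auto simp: Pi_iff)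

lemma star_hom_comp: "star_hom A B f ==> star_hom B C g ==> star_hom A C (%x. g (f x))"
 by (rule star_homI) (auto simp: star_homD[of A B f] star_homD[of B C g])

lemma star_hom_minus:
 assumes f: "star_hom A B f" and A: "normed_star_algebra A" and B: "normed_star_algebra B"
  and x: "x \<in> carrier A" "y \<in> carrier A"
 shows "f (x \<ominus>\<^bsub>A\<^esub> y) = f x \<ominus>\<^bsub>B\<^esub> f y"
 using x by (simp add: normed_star_algebra.minus_smult[OF A] normed_star_algebra.minus_smult[OF B]
   normed_star_algebra.smult_closed[OF A] star_homD[OF f])

text \<open>If \<open>T = f x\<close> had norm \<open>s > \<parallel>x\<parallel>\<close>, the quasi-inverse of \<open>x\<^sup>* x / s\<^sup>2\<close> would keep \<open>b = T\<^sup>* T / s\<^sup>2\<close> away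
 from \<open>1\<close> on vectors where \<open>\<parallel>T v\<parallel>\<close> is nearly \<open>s \<parallel>v\<parallel>\<close>.\<close>

lemma star_hom_contractive_opr:
 fixes A (structure)
 assumes A: "cstar_algebra A" and f: "star_hom A (BL2 I) f" and x: "x \<in> carrier A"
 shows "norm (opr I (f x) v) <= nrm A x * norm v"
proof -
 interpret cstar_algebra A by (rule A)
 note fD = star_homD[OF f, simplified]
 define T where "T = opr I (f x)"
 define s where "s = onorm T"
 have T: "cblinear T" using fD(1)[OF x] by (simp add: T_def)
 note Ts = norm_le_onorm[OF T, folded s_def]
 have "s <= nrm A x"
 proof (rule ccontr)
  assume "\<not> ?thesis"
  hence n: "nrm A x < s" by simp
  hence s: "s > 0" using nrm_nonneg[OF x] by linarith
  define h where "h = complex_of_real (1 / s\<^sup>2) \<odot> (adj A x \<otimes> x)"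
  have c: "adj A x \<otimes> x \<in> carrier A" using x by (simp add: m_closed adj_closed)
  have h: "h \<in> carrier A" using c by (simp add: h_def smult_closed)
  have "nrm A h = (nrm A x)\<^sup>2 / s\<^sup>2" unfolding h_def nrm_smult[OF c] cstar_identity[OF x] norm_of_real by simp
  also have "\<dots> < 1" using power_strict_mono[OF n nrm_nonneg[OF x], of 2] s by simp
  finally obtain y where y: "y \<in> carrier A" "h \<oplus> y \<otimes> h = y" using quasi_inverse[OF h] by blast
  define b where "b v = (1 / s\<^sup>2) *\<^sub>R cadj T (T v)" for v
  have fh: "f h \<in> bounded_operators I" "opr I (f h) = b"
   using fD(1)[OF h] fD(1)[OF x] unfolding h_def fD(3)[OF c] fD(4)[OF adj_closed[OF x] x] fD(5)[OF x]
   by (simp_all only: opr_simps BL2_closed scaleC_of_real b_def[abs_def] T_def simp_thms)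
  have fy: "f y \<in> bounded_operators I" by (rule fD(1)[OF y(1)])
  obtain C where C: "C \<ge> 0" "!!v. norm (opr I (f y) v) <= C * norm v"
   using cblinear_obtain_bound[OF cblinear_opr[OF fy]] by blast
  have bC: "norm (b v) <= C * norm (v - b v)" for v
  proof -
   have "opr I (f y) v = opr I (f (h \<oplus> y \<otimes> h)) v" by (simp only: y(2))
   also have "\<dots> = b v + opr I (f y) (b v)" using y(1) h fh fy by (simp add: fD m_closed BL2_closed opr_simps)
   finally have "b v = opr I (f y) (v - b v)" using fy by (simp add: cblinear_diff algebra_simps)
   thus ?thesis using C(2)[of "v - b v"] by metis
  qed
  \<comment> \<open>Below, a is the square of |v| and d that of |T v| divided by s^2; the estimate
    obtained from the quasi-inverse is d^2 <= 2 C^2 (a - d) a. If d > a/2 this gives a/4 <= k (a -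
    d), that is d <= \<theta> a; if d <= a/2, then \<open>1/2 <= \<theta>\<close> suffices, which is
    why \<open>k\<close> is made at least 2. Hence T would be bounded by sqrt \<theta> s <
    s.\<close>
  define k where "k = 2 * (C + 1)\<^sup>2"
  have k: "k \<ge> 2" "2 * C\<^sup>2 <= k" using C(1) by (auto simp: k_def power2_sum)
  define \<theta> where "\<theta> = 1 - 1 / (4 * k)"
  have \<theta>: "1 / 2 <= \<theta>" "\<theta> < 1" using k by (auto simp: \<theta>_def field_simps)
  have "norm (T v) <= sqrt \<theta> * s * norm v" for v
  proof (rule power2_le_imp_le)
   define a where "a = (norm v)\<^sup>2"
   define d where "d = (norm (T v))\<^sup>2 / s\<^sup>2"
   have d: "inner (b v) v = d" using T by (simp add: b_def d_def inner_cadj power2_norm_eq_inner)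
   have "norm (cadj T (T v)) <= s * (s * norm v)"
    using norm_cadj_le[OF T _ Ts, of "T v"] mult_left_mono[OF Ts[of v], of s] s by linarith
   hence "norm (b v) <= norm v" using s by (simp add: b_def field_simps power2_eq_square)
   hence "inner (b v) (b v) <= a" unfolding a_def power2_norm_eq_inner[symmetric] by (rule power_mono) simp
   hence vb: "(norm (v - b v))\<^sup>2 <= 2 * (a - d)"
    using d by (simp add: power2_norm_eq_inner a_def inner_diff_left inner_diff_right inner_commute)
   have "d <= norm (b v) * norm v" using norm_cauchy_schwarz[of "b v" v] d by simp
   hence "d\<^sup>2 <= (norm (b v) * norm v)\<^sup>2" by (rule power_mono) (simp add: d_def)
   also have "\<dots> <= (C * norm (v - b v) * norm v)\<^sup>2" using bC[of v] by (intro power_mono mult_right_mono) auto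
   also have "\<dots> = C\<^sup>2 * (norm (v - b v))\<^sup>2 * a" by (simp add: a_def power_mult_distrib)
   also have "\<dots> <= C\<^sup>2 * (2 * (a - d)) * a" using vb by (intro mult_right_mono mult_left_mono) (auto simp: a_def)
   finally have dd: "d\<^sup>2 <= 2 * C\<^sup>2 * (a - d) * a" by (simp only: mult.assoc mult.left_commute)
   have ad: "0 <= a - d" using order_trans[OF zero_le_power2 vb] by simp
   have "d <= \<theta> * a"
   proof (cases "d <= a / 2")
    case True
    have "1 / 2 * a <= \<theta> * a" using \<theta> by (intro mult_right_mono) (auto simp: a_def)
    thus ?thesis using True by simp
   next
    case False
    have a: "a > 0" using False ad by linarith
    have "(a / 2)\<^sup>2 <= d\<^sup>2" using False a by (intro power_mono) auto
    also note dd
    also have "2 * C\<^sup>2 * (a - d) * a <= k * (a - d) * a" using k(2) ad a by (intro mult_right_mono) auto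
    finally have "a / 4 * a <= k * (a - d) * a" by (simp add: power2_eq_square)
    hence "a / 4 <= k * (a - d)" using a mult_le_cancel_right_pos by blast
    thus ?thesis using k(1) by (simp add: \<theta>_def field_simps)
   qed
   thus "(norm (T v))\<^sup>2 <= (sqrt \<theta> * s * norm v)\<^sup>2"
    using s \<theta> by (simp add: d_def a_def power_mult_distrib field_simps)
  qed (use s \<theta> in simp)
  hence "s <= sqrt \<theta> * s" unfolding s_def using onorm_bound[of "sqrt \<theta> * s" T] s \<theta> by (simp add: s_def)
  moreover have "sqrt \<theta> * s < 1 * s" using s \<theta> by (intro mult_strict_right_mono) auto
  ultimately show False by simp
 qed
 thus ?thesis using Ts[of v] mult_right_mono[OF _ norm_ge_zero] by (metis T_def order_trans)
qed

lemma star_hom_contractive: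
 assumes A: "cstar_algebra A" and f: "star_hom A (BL2 I) f" and x: "x \<in> carrier A"
 shows "nrm (BL2 I) (f x) <= nrm A x"
proof -
 interpret cstar_algebra A by (rule A)
 show ?thesis using star_homD(1)[OF f x] star_hom_contractive_opr[OF A f x] nrm_nonneg[OF x] by (subst nrm_BL2_le) auto
qed

section \<open>Finite matrices and decomposition into nilpotents\<close>

definition mm :: "'j set => ('i => 'j => complex) => ('j => 'k => complex) => 'i => 'k => complex" where
 "mm S a b = (%i k. \<Sum>j\<in>S. a i j * b j k)"

definition madj :: "('i => 'j => complex) => 'j => 'i => complex" where
 "madj a = (%i j. cnj (a j i))"

definition mone :: "'i set => 'i => 'i => complex" where
 "mone S = (%i j. if i = j & i \<in> S then 1 else 0)"

definition supp :: "'i set => ('i => 'i => complex) => bool" where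
 "supp S a \<longleftrightarrow> (\<forall>i j. i \<notin> S | j \<notin> S --> a i j = 0)"

lemma mm_assoc: "mm S (mm T a b) c = mm T a (mm S b c)"
proof (intro ext)
 fix i k
 have "mm S (mm T a b) c i k = (\<Sum>j\<in>S. \<Sum>l\<in>T. a i l * b l j * c j k)" by (simp add: mm_def sum_distrib_right)
 also have "\<dots> = (\<Sum>l\<in>T. \<Sum>j\<in>S. a i l * b l j * c j k)" by (rule sum.swap)
 also have "\<dots> = mm T a (mm S b c) i k" by (simp add: mm_def sum_distrib_left mult.assoc)
 finally show "mm S (mm T a b) c i k = mm T a (mm S b c) i k" .
qed

lemma madj_madj [simp]: "madj (madj a) = a"
 by (simp add: madj_def)

lemma madj_mm: "madj (mm S a b) = mm S (madj b) (madj a)"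
 by (simp add: mm_def madj_def mult.commute)

lemma mm_one: "finite S ==> supp S a ==> mm S a (mone S) = a" "finite S ==> supp S a ==> mm S (mone S) a = a"
proof -
 assume S: "finite S" "supp S a"
 have "(\<Sum>j\<in>S. a i j * (if j = k & j \<in> S then 1 else 0)) = (\<Sum>j\<in>S. if j = k then a i k else 0)" for i k
  by (rule sum.cong) auto
 thus "mm S a (mone S) = a" using S by (auto simp: mm_def mone_def supp_def fun_eq_iff)
 have "(\<Sum>j\<in>S. (if i = j & i \<in> S then 1 else 0) * a j k) = (\<Sum>j\<in>S. if j = i then a i k else 0)" for i k
  by (rule sum.cong) auto
 thus "mm S (mone S) a = a" using S by (auto simp: mm_def mone_def supp_def fun_eq_iff)
qed

lemma supp_mm: "supp S a ==> supp S b ==> supp S (mm S a b)"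
 by (auto simp: supp_def mm_def)

lemma supp_madj: "supp S a ==> supp S (madj a)"
 by (auto simp: supp_def madj_def)

lemma supp_mone [simp]: "supp S (mone S)"
 by (auto simp: supp_def mone_def)

lemma madj_mone [simp]: "madj (mone S) = mone S"
 by (auto simp: madj_def mone_def fun_eq_iff)

definition vip :: "'j set => ('j => complex) => ('j => complex) => complex" where
 "vip J x y = (\<Sum>j\<in>J. cnj (x j) * y j)"

definition orthonormal :: "'j set => ('j => complex) set => nat => (nat => 'j => complex) => bool" where
 "orthonormal J V r f \<longleftrightarrow> (\<forall>k<r. f k \<in> V) & (\<forall>k<r. \<forall>l<r. vip J (f k) (f l) = (if k = l then 1 else 0))"

lemma vip_self: "vip J x x = complex_of_real (\<Sum>j\<in>J. (cmod (x j))\<^sup>2)"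
proof -
 have "cnj z * z = complex_of_real ((cmod z)\<^sup>2)" for z using complex_norm_square[of z] by (simp only: mult.commute)
 thus ?thesis by (simp add: vip_def)
qed

lemma vip_commute: "vip J y x = cnj (vip J x y)"
 by (simp add: vip_def mult.commute)

lemma vip_add_right: "vip J x (%j. y j + z j) = vip J x y + vip J x z"
 by (simp add: vip_def distrib_left sum.distrib)
lemma vip_diff_right: "vip J x (%j. y j - z j) = vip J x y - vip J x z"
 by (simp add: vip_def right_diff_distrib sum_subtractf)
lemma vip_scale_right: "vip J x (%j. c * y j) = c * vip J x y"
 by (simp add: vip_def sum_distrib_left mult.left_commute)
lemma vip_sum_right: "vip J x (%j. \<Sum>k\<in>K. y k j) = (\<Sum>k\<in>K. vip J x (y k))"
 by (simp add: vip_def sum_distrib_left sum.swap[of _ K])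

text \<open>Bessel's inequality for the unit vector at j bounds the sum of the |f_k(j)|^2 over k by
  1. Summing over j in \<open>J\<close> gives r on one side, since every f_k has norm one, and
  \<open>card J\<close> on the other.\<close>

lemma orthonormal_card:
 assumes J: "finite J" and f: "orthonormal J V r f"
 shows "r <= card J"
proof -
 have bessel: "(\<Sum>k<r. (cmod (f k j))\<^sup>2) <= 1" if j: "j \<in> J" for j
 proof -
  define y where "y i = (if i = j then 1 else 0) - (\<Sum>k<r. cnj (f k j) * f k i)" for i
  have fy: "vip J (f k) y = 0" if "k < r" for k
  proof -
   have d: "vip J (f k) (%i. if i = j then 1 else 0) = cnj (f k j)"
   proof -
    have "vip J (f k) (%i. if i = j then 1 else 0) = (\<Sum>i\<in>J. if i = j then cnj (f k j) else 0)"
     unfolding vip_def by (rule sum.cong) auto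
    thus ?thesis using J j by simp
   qed
   have "vip J (f k) (%i. \<Sum>l<r. cnj (f l j) * f l i) = (\<Sum>l<r. cnj (f l j) * vip J (f k) (f l))"
    by (simp add: vip_sum_right vip_scale_right)
   also have "\<dots> = (\<Sum>l<r. if l = k then cnj (f k j) else 0)"
    using f that by (intro sum.cong) (auto simp: orthonormal_def)
   also have "\<dots> = cnj (f k j)" using that by simp
   finally show ?thesis unfolding y_def by (simp add: vip_diff_right d)
  qed
  have "vip J y y = vip J y (%i. if i = j then 1 else 0) - (\<Sum>k<r. cnj (f k j) * vip J y (f k))"
   unfolding y_def[abs_def] by (subst vip_diff_right) (simp add: vip_sum_right vip_scale_right)
  also have "vip J y (f k) = 0" if "k < r" for k using fy[OF that] vip_commute[of J y "f k"] by simp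
  hence "(\<Sum>k<r. cnj (f k j) * vip J y (f k)) = 0" by simp
  also have "vip J y (%i. if i = j then 1 else 0) = cnj (y j)"
  proof -
   have "vip J y (%i. if i = j then 1 else 0) = (\<Sum>i\<in>J. if i = j then cnj (y j) else 0)"
    unfolding vip_def by (rule sum.cong) auto
   thus ?thesis using J j by simp
  qed
  also have "y j = 1 - complex_of_real (\<Sum>k<r. (cmod (f k j))\<^sup>2)"
  proof -
   have "cnj z * z = complex_of_real ((cmod z)\<^sup>2)" for z using complex_norm_square[of z] by (simp only: mult.commute)
   thus ?thesis by (simp add: y_def)
  qed
  finally have "complex_of_real (\<Sum>i\<in>J. (cmod (y i))\<^sup>2) = complex_of_real (1 - (\<Sum>k<r. (cmod (f k j))\<^sup>2))"
   by (simp add: vip_self)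
  hence "(\<Sum>i\<in>J. (cmod (y i))\<^sup>2) = 1 - (\<Sum>k<r. (cmod (f k j))\<^sup>2)" by (simp only: of_real_eq_iff)
  moreover have "0 <= (\<Sum>i\<in>J. (cmod (y i))\<^sup>2)" by (simp add: sum_nonneg)
  ultimately show ?thesis by linarith
 qed
 have "(\<Sum>j\<in>J. (cmod (f k j))\<^sup>2) = 1" if "k < r" for k
 proof -
  have "complex_of_real (\<Sum>j\<in>J. (cmod (f k j))\<^sup>2) = complex_of_real 1"
   using f that unfolding vip_self[symmetric] by (simp add: orthonormal_def)
  thus ?thesis by (simp only: of_real_eq_iff)
 qed
 hence "real r = (\<Sum>k<r. \<Sum>j\<in>J. (cmod (f k j))\<^sup>2)" by simp
 also have "\<dots> = (\<Sum>j\<in>J. \<Sum>k<r. (cmod (f k j))\<^sup>2)" by (rule sum.swap)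
 also have "\<dots> <= (\<Sum>j\<in>J. 1)" by (rule sum_mono) (rule bessel)
 finally show ?thesis by simp
qed

definition lin_subspace :: "('j => complex) set => bool" where
 "lin_subspace V \<longleftrightarrow> (%j. 0) \<in> V & (\<forall>x\<in>V. \<forall>y\<in>V. (%j. x j + y j) \<in> V) & (\<forall>x\<in>V. \<forall>c. (%j. c * x j) \<in> V)"

lemma lin_subspace_sum:
 "lin_subspace V ==> (!!k. k \<in> K ==> g k \<in> V) ==> (%j. \<Sum>k\<in>K. g k j) \<in> V"
 by (induction K rule: infinite_finite_induct) (auto simp: lin_subspace_def)

text \<open>Sizes of orthonormal families are bounded by \<open>card J\<close>, so one of greatest
  size exists; a vector not equal to its expansion would enlarge it by its normalised remainder. The
  orthogonal pair \<open>x1\<close>, \<open>x2\<close> makes the greatest size at least two.\<close>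

lemma orthonormal_basis_exists:
 assumes J: "finite J" and V: "lin_subspace V" "!!x j. x \<in> V ==> j \<notin> J ==> x j = 0"
  and x: "x1 \<in> V" "x2 \<in> V" "x1 ~= (%j. 0)" "x2 ~= (%j. 0)" "vip J x1 x2 = 0"
 obtains r f where "2 <= r" "orthonormal J V r f" "!!x. x \<in> V ==> x = (%j. \<Sum>k<r. vip J (f k) x * f k j)"
proof -
 have pos: "(\<Sum>j\<in>J. (cmod (x j))\<^sup>2) > 0" if xx: "x \<in> V" "x ~= (%j. 0)" for x
 proof -
  obtain j where j: "x j ~= 0" using xx(2) by (auto simp: fun_eq_iff)
  hence "j \<in> J" using V(2)[OF xx(1)] by blast
  thus ?thesis using J j by (intro sum_pos2[of J j]) auto
 qed
 define nrmz where "nrmz x = (%j. complex_of_real (1 / sqrt (\<Sum>j\<in>J. (cmod (x j))\<^sup>2)) * x j)" for x :: "'a => complex"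
 have nV: "nrmz x \<in> V" if "x \<in> V" for x using that V(1) unfolding lin_subspace_def nrmz_def by blast
 have n1: "vip J (nrmz x) (nrmz x) = 1" if "x \<in> V" "x ~= (%j. 0)" for x
 proof -
  have "(\<Sum>j\<in>J. (cmod (nrmz x j))\<^sup>2) = (1 / (\<Sum>j\<in>J. (cmod (x j))\<^sup>2)) * (\<Sum>j\<in>J. (cmod (x j))\<^sup>2)"
   using pos[OF that] unfolding nrmz_def sum_distrib_left norm_mult norm_of_real power_mult_distrib
   by (intro sum.cong) (auto simp: power_divide sum_nonneg)
  thus ?thesis using pos[OF that] by (simp add: vip_self)
 qed
 have n0: "vip J x (nrmz y) = 0" if "vip J x y = 0" for x y
  unfolding nrmz_def by (subst vip_scale_right) (simp add: that)
 have n0': "vip J (nrmz y) x = 0" if "vip J x y = 0" for x y using n0[OF that] vip_commute[of J "nrmz y" x] by simp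
 define Q where "Q r \<longleftrightarrow> (\<exists>f. orthonormal J V r f)" for r
 have Q2: "Q 2"
 proof -
  have 12: "vip J (nrmz x1) (nrmz x2) = 0" by (rule n0, rule n0', subst vip_commute) (simp add: x)
  define f where "f k = (if k = (0::nat) then nrmz x1 else nrmz x2)" for k
  have "orthonormal J V 2 f" unfolding orthonormal_def
   using 12 n1 x nV vip_commute[of J "nrmz x2" "nrmz x1"] by (auto simp: f_def)
  thus ?thesis unfolding Q_def by blast
 qed
 have "\<exists>r. Q r & (\<forall>r'. Q r' --> r' <= r)"
  by (rule Nat.ex_has_greatest_nat[of Q 2 "card J"]) (use Q2 orthonormal_card[OF J] in \<open>auto simp: Q_def\<close>)
 then obtain r where r: "Q r" "!!r'. Q r' ==> r' <= r" by blast
 then obtain f where f: "orthonormal J V r f" unfolding Q_def by blast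
 have "x = (%j. \<Sum>k<r. vip J (f k) x * f k j)" if xV: "x \<in> V" for x
 proof (rule ccontr)
  assume ne: "x ~= (%j. \<Sum>k<r. vip J (f k) x * f k j)"
  define s where "s = (%j. \<Sum>k<r. vip J (f k) x * f k j)"
  define y where "y = (%j. x j + (- 1) * s j)"
  have sV: "s \<in> V" unfolding s_def
   by (rule lin_subspace_sum[OF V(1)]) (use f V(1) in \<open>auto simp: orthonormal_def lin_subspace_def\<close>)
  hence "(%j. (- 1) * s j) \<in> V" using V(1) unfolding lin_subspace_def by blast
  with V(1) xV have yV: "y \<in> V" unfolding lin_subspace_def y_def by (elim conjE) (drule (1) bspec, drule (1) bspec)
  have y0: "y ~= (%j. 0)"
  proof
   assume "y = (%j. 0)"
   hence "y j = 0" for j by simp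
   hence "x = s" by (intro ext) (simp add: y_def)
   thus False using ne by (simp add: s_def)
  qed
  have fy: "vip J (f k) y = 0" if "k < r" for k
  proof -
   have "vip J (f k) s = (\<Sum>l<r. vip J (f l) x * vip J (f k) (f l))" by (simp add: s_def vip_sum_right vip_scale_right)
   also have "\<dots> = (\<Sum>l<r. if l = k then vip J (f k) x else 0)"
    using f that by (intro sum.cong) (auto simp: orthonormal_def)
   also have "\<dots> = vip J (f k) x" using that by simp
   finally show ?thesis unfolding y_def by (subst vip_add_right, subst vip_scale_right) simp
  qed
  have "orthonormal J V (Suc r) (%k. if k = r then nrmz y else f k)" unfolding orthonormal_def
   using f n1[OF yV y0] nV[OF yV] n0[OF fy] n0'[OF fy] by (auto simp: orthonormal_def less_Suc_eq)
  hence "Suc r <= r" using r(2) unfolding Q_def by blast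
  thus False by simp
 qed
 thus thesis using that r(2)[OF Q2] f by blast
qed

text \<open>On a subspace of dimension at least two the identity is \<open>v\<^sub>1\<^sup>* v\<^sub>1 + v\<^sub>1 v\<^sub>1\<^sup>* + v\<^sub>2 v\<^sub>2\<^sup>*\<close> with \<open>v\<^sub>1\<close>, \<open>v\<^sub>2\<close> nilpotent;
 \<open>v\<^sub>2\<close> is only needed if the dimension is odd.\<close>

lemma nilpotent_decomposition:
 assumes J: "finite J" and B: "supp J B"
  and P: "supp J P1" "supp J P2" "P1 ~= (%i j. 0)" "P2 ~= (%i j. 0)" "mm J (madj P1) P2 = (%i j. 0)"
   "mm J B P1 = P1" "mm J B P2 = P2"
 obtains v1 v2 where "supp J v1" "supp J v2"
  "mm J v1 v1 = (%i j. 0)" "mm J v2 v2 = (%i j. 0)"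
  "!!x. x \<in> {v1, madj v1, v2, madj v2} ==> mm J B x = x & mm J (mm J (madj x) x) (mm J (madj x) x) = mm J (madj x) x"
  "!!q. q = (%i j. mm J (madj v1) v1 i j + mm J v1 (madj v1) i j + mm J v2 (madj v2) i j) ==>
    madj q = q & mm J q q = q & (\<forall>C. supp J C & mm J B C = C --> mm J q C = C)"
proof -
 \<comment> \<open>The vectors fixed by \<open>B\<close>. It contains every column of every matrix C
   with B C = C, in particular the columns of \<open>P1\<close> and \<open>P2\<close>, two nonzero
   ones of which are orthogonal.\<close>
 define V where "V = {x. (\<forall>j. j \<notin> J --> x j = 0) & (\<forall>i. (\<Sum>j\<in>J. B i j * x j) = x i)}"
 have V: "lin_subspace V"
  by (auto simp: lin_subspace_def V_def distrib_left sum.distrib mult.left_commute simp flip: sum_distrib_left)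
 have col: "(%i. C i j) \<in> V" if "supp J C" "mm J B C = C" for C j
  using that unfolding V_def supp_def mm_def by (auto simp: fun_eq_iff)
 obtain i1 j1 where 1: "P1 i1 j1 ~= 0" using P(3) by (auto simp: fun_eq_iff)
 obtain i2 j2 where 2: "P2 i2 j2 ~= 0" using P(4) by (auto simp: fun_eq_iff)
 have orth: "vip J (%i. P1 i j1) (%i. P2 i j2) = 0"
  using fun_cong[OF fun_cong[OF P(5), of j1], of j2] by (simp add: vip_def mm_def madj_def)
 obtain r f where r: "2 <= r" and f: "orthonormal J V r f"
  and ex: "!!x. x \<in> V ==> x = (%j. \<Sum>k<r. vip J (f k) x * f k j)"
  by (rule orthonormal_basis_exists[OF J V _ col[OF P(1,6), of j1] col[OF P(2,7), of j2] _ _ orth])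
   (use 1 2 in \<open>auto simp: V_def fun_eq_iff\<close>)
 \<comment> \<open>Carries an r by r matrix to the operator it defines on V in the orthonormal basis
   f. This is a star homomorphism that sends the unit to the orthogonal projection onto V, so the
   nilpotents can be chosen among r by r matrices.\<close>
 define Phi where "Phi m = (%i j. \<Sum>k<r. \<Sum>l<r. m k l * f k i * cnj (f l j))" for m :: "nat => nat => complex"
 have f0: "f k j = 0" if "k < r" "j \<notin> J" for k j using f that by (auto simp: orthonormal_def V_def)
 have fB: "(\<Sum>j\<in>J. B i j * f k j) = f k i" if "k < r" for k i using f that by (auto simp: orthonormal_def V_def)
 have fo: "(\<Sum>j\<in>J. cnj (f k j) * f l j) = (if k = l then 1 else 0)" if "k < r" "l < r" for k l
  using f that by (auto simp: orthonormal_def vip_def)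
 have Ps: "supp J (Phi m)" for m unfolding supp_def Phi_def by (auto simp: f0 intro!: sum.neutral)
 have Pm: "mm J (Phi m) (Phi n) = Phi (mm {..<r} m n)" for m n
 proof (intro ext)
  fix i j
  have "mm J (Phi m) (Phi n) i j
   = (\<Sum>h\<in>J. \<Sum>k'<r. \<Sum>l'<r. \<Sum>k<r. \<Sum>l<r. (m k l * f k i * cnj (f l h)) * (n k' l' * f k' h * cnj (f l' j)))"
   by (simp add: mm_def Phi_def sum_distrib_left sum_distrib_right)
  also have "\<dots> = (\<Sum>k'<r. \<Sum>l'<r. \<Sum>k<r. \<Sum>l<r. \<Sum>h\<in>J. (m k l * f k i * cnj (f l h)) * (n k' l' * f k' h * cnj (f l' j)))"
   by (simp only: sum.swap[where A=J and B="{..<r}"])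
  also have "\<dots> = (\<Sum>k'<r. \<Sum>l'<r. \<Sum>k<r. \<Sum>l<r. m k l * n k' l' * f k i * cnj (f l' j) * (\<Sum>h\<in>J. cnj (f l h) * f k' h))"
   by (simp add: sum_distrib_left mult_ac)
  also have "\<dots> = (\<Sum>k'<r. \<Sum>l'<r. \<Sum>k<r. \<Sum>l<r. if l = k' then m k k' * n k' l' * f k i * cnj (f l' j) else 0)"
   by (intro sum.cong refl) (auto simp: fo)
  also have "\<dots> = (\<Sum>k'<r. \<Sum>l'<r. \<Sum>k<r. m k k' * n k' l' * f k i * cnj (f l' j))" by simp
  also have "\<dots> = (\<Sum>k'<r. \<Sum>k<r. \<Sum>l'<r. m k k' * n k' l' * f k i * cnj (f l' j))" by (intro sum.cong refl sum.swap)
  also have "\<dots> = (\<Sum>k<r. \<Sum>k'<r. \<Sum>l'<r. m k k' * n k' l' * f k i * cnj (f l' j))" by (rule sum.swap)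
  also have "\<dots> = (\<Sum>k<r. \<Sum>l'<r. \<Sum>k'<r. m k k' * n k' l' * f k i * cnj (f l' j))" by (intro sum.cong refl sum.swap)
  also have "\<dots> = Phi (mm {..<r} m n) i j" by (simp add: Phi_def mm_def sum_distrib_right)
  finally show "mm J (Phi m) (Phi n) i j = Phi (mm {..<r} m n) i j" .
 qed
 have Pa: "madj (Phi m) = Phi (madj m)" for m
 proof (intro ext)
  fix i j
  have "madj (Phi m) i j = (\<Sum>k<r. \<Sum>l<r. cnj (m k l) * cnj (f k j) * f l i)" by (simp add: madj_def Phi_def)
  also have "\<dots> = (\<Sum>l<r. \<Sum>k<r. cnj (m k l) * cnj (f k j) * f l i)" by (rule sum.swap)
  also have "\<dots> = Phi (madj m) i j" by (simp add: Phi_def madj_def mult_ac)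
  finally show "madj (Phi m) i j = Phi (madj m) i j" .
 qed
 have PB: "mm J B (Phi m) = Phi m" for m
 proof (intro ext)
  fix i j
  have "mm J B (Phi m) i j = (\<Sum>h\<in>J. \<Sum>k<r. \<Sum>l<r. B i h * (m k l * f k h * cnj (f l j)))"
   by (simp add: mm_def Phi_def sum_distrib_left)
  also have "\<dots> = (\<Sum>k<r. \<Sum>l<r. \<Sum>h\<in>J. B i h * (m k l * f k h * cnj (f l j)))"
   by (simp only: sum.swap[where A=J and B="{..<r}"])
  also have "\<dots> = (\<Sum>k<r. \<Sum>l<r. m k l * cnj (f l j) * (\<Sum>h\<in>J. B i h * f k h))" by (simp add: sum_distrib_left mult_ac)
  also have "\<dots> = Phi m i j" unfolding Phi_def by (intro sum.cong refl) (simp add: fB mult_ac)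
  finally show "mm J B (Phi m) i j = Phi m i j" .
 qed
 have Padd: "Phi (%k l. m k l + n k l) = (%i j. Phi m i j + Phi n i j)" for m n
  by (simp add: Phi_def distrib_right sum.distrib)
 have P0: "Phi (%k l. 0) = (%i j. 0)" by (simp add: Phi_def)
 have P1: "mm J (Phi (mone {..<r})) C = C" if C: "supp J C" "mm J B C = C" for C
 proof (intro ext)
  fix i j
  have Phi1: "Phi (mone {..<r}) i h = (\<Sum>k<r. f k i * cnj (f k h))" for h
  proof -
   have "Phi (mone {..<r}) i h = (\<Sum>k<r. \<Sum>l<r. if l = k then f k i * cnj (f k h) else 0)"
    unfolding Phi_def by (intro sum.cong refl) (auto simp: mone_def)
   thus ?thesis by simp
  qed
  have "mm J (Phi (mone {..<r})) C i j = (\<Sum>h\<in>J. \<Sum>k<r. f k i * cnj (f k h) * C h j)"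
   by (simp add: mm_def Phi1 sum_distrib_right)
  also have "\<dots> = (\<Sum>k<r. \<Sum>h\<in>J. f k i * cnj (f k h) * C h j)" by (rule sum.swap)
  also have "\<dots> = (\<Sum>k<r. vip J (f k) (%h. C h j) * f k i)"
   by (simp add: vip_def sum_distrib_left sum_distrib_right mult_ac)
  also have "\<dots> = C i j" using fun_cong[OF ex[OF col[OF C, of j]], of i] by simp
  finally show "mm J (Phi (mone {..<r})) C i j = C i j" .
 qed
 \<comment> \<open>\<open>m1\<close> maps the basis vector 2j to 2j + 1. Its source and range
   projections add up to the unit, except that for odd r the last vector r - 1 has no partner.
   \<open>m2\<close> maps vector 0 to r - 1 and its range projection fills the gap; its square is
   zero because r is at least two.\<close>
 define m1 where "m1 = (%k l. if even l & k = Suc l & k < r then 1 else 0 :: complex)"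
 define m2 where "m2 = (%(k::nat) (l::nat). if odd r & Suc k = r & l = 0 then 1 else 0 :: complex)"
 define dg where "dg Q = (%k l. if k = l & Q k then 1 else 0 :: complex)" for Q :: "nat => bool"
 have sd: "(\<Sum>h<r. if h = a & R then c else 0) = (if a < r & R then c else 0)" for a R and c :: complex
  by (cases R) auto
 have m1m1: "mm {..<r} m1 m1 = (%k l. 0)" by (auto simp: mm_def m1_def fun_eq_iff intro!: sum.neutral)
 have m2m2: "mm {..<r} m2 m2 = (%k l. 0)" using r by (auto simp: mm_def m2_def fun_eq_iff intro!: sum.neutral)
 have m1a: "mm {..<r} (madj m1) m1 = dg (%l. even l & Suc l < r)"
 proof (intro ext)
  fix k l
  have "mm {..<r} (madj m1) m1 k l = (\<Sum>h<r. if h = Suc l & (k = l & even l) then 1 else 0)"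
   unfolding mm_def madj_def m1_def by (rule sum.cong) auto
  thus "mm {..<r} (madj m1) m1 k l = dg (%l. even l & Suc l < r) k l" by (auto simp: sd dg_def)
 qed
 have m1b: "mm {..<r} m1 (madj m1) = dg (%k. odd k & k < r)"
 proof (intro ext)
  fix k l
  have "mm {..<r} m1 (madj m1) k l = (\<Sum>h<r. if h = k - 1 & (k = l & odd k & k < r) then 1 else 0)"
   unfolding mm_def madj_def m1_def by (cases k) (auto intro!: sum.cong)
  thus "mm {..<r} m1 (madj m1) k l = dg (%k. odd k & k < r) k l" by (auto simp: sd dg_def)
 qed
 have m2a: "mm {..<r} (madj m2) m2 = dg (%l. odd r & l = 0)"
 proof (intro ext)
  fix k l
  have "mm {..<r} (madj m2) m2 k l = (\<Sum>h<r. if h = r - 1 & (k = l & odd r & l = 0) then 1 else 0)"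
   unfolding mm_def madj_def m2_def by (rule sum.cong) auto
  thus "mm {..<r} (madj m2) m2 k l = dg (%l. odd r & l = 0) k l" using r by (auto simp: sd dg_def)
 qed
 have m2b: "mm {..<r} m2 (madj m2) = dg (%k. odd r & Suc k = r)"
 proof (intro ext)
  fix k l
  have "mm {..<r} m2 (madj m2) k l = (\<Sum>h<r. if h = 0 & (k = l & odd r & Suc k = r) then 1 else 0)"
   unfolding mm_def madj_def m2_def by (rule sum.cong) auto
  thus "mm {..<r} m2 (madj m2) k l = dg (%k. odd r & Suc k = r) k l" using r by (auto simp: sd dg_def)
 qed
 have Pdg: "Phi (mm {..<r} (dg Q) (dg Q)) = Phi (dg Q)" for Q
 proof -
  have dd: "mm {..<r} (dg Q) (dg Q) k l = (if k < r then dg Q k l else 0)" for k l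
  proof -
   have "mm {..<r} (dg Q) (dg Q) k l = (\<Sum>h<r. if h = k then dg Q k l else 0)"
    unfolding mm_def by (rule sum.cong) (simp_all add: dg_def)
   thus ?thesis by simp
  qed
  have "(\<Sum>k<r. \<Sum>l<r. mm {..<r} (dg Q) (dg Q) k l * f k i * cnj (f l j)) = (\<Sum>k<r. \<Sum>l<r. dg Q k l * f k i * cnj (f l j))" for i j
   by (rule sum.cong[OF refl], rule sum.cong[OF refl]) (simp add: dd)
  thus ?thesis unfolding Phi_def by simp
 qed
 have dga: "madj (dg Q) = dg Q" for Q by (auto simp: madj_def dg_def fun_eq_iff)
 have sum1: "(%k l. dg (%l. even l & Suc l < r) k l + dg (%k. odd k & k < r) k l + dg (%k. odd r & Suc k = r) k l)
  = dg (%k. k < r)"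
 proof (intro ext)
  fix k l
  have "even k ==> k < r ==> \<not> Suc k < r ==> odd r & Suc k = r" by (metis Suc_lessI even_Suc)
  moreover have "odd k ==> k < r ==> \<not> Suc k < r ==> even r" by (metis Suc_lessI even_Suc)
  ultimately show "dg (%l. even l & Suc l < r) k l + dg (%k. odd k & k < r) k l + dg (%k. odd r & Suc k = r) k l
   = dg (%k. k < r) k l" by (auto simp: dg_def)
 qed
 have one: "dg (%k. k < r) = mone {..<r}" by (auto simp: dg_def mone_def fun_eq_iff)
 show thesis
 proof (rule that[of "Phi m1" "Phi m2"])
  fix x assume "x \<in> {Phi m1, madj (Phi m1), Phi m2, madj (Phi m2)}"
  thus "mm J B x = x & mm J (mm J (madj x) x) (mm J (madj x) x) = mm J (madj x) x"
   by (auto simp: Pa PB Pm m1a m1b m2a m2b Pdg)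
 next
  fix q assume "q = (%i j. mm J (madj (Phi m1)) (Phi m1) i j + mm J (Phi m1) (madj (Phi m1)) i j + mm J (Phi m2) (madj (Phi m2)) i j)"
  hence "q = Phi (mone {..<r})" by (simp add: Pa Pm m1a m1b m2b one[symmetric] sum1[symmetric] Padd)
  thus "madj q = q & mm J q q = q & (\<forall>C. supp J C & mm J B C = C --> mm J q C = C)"
   using P1[OF Ps PB] by (simp add: Pa P1)
 qed (simp_all add: Ps Pm m1m1 m2m2 P0)
qed

section \<open>Dimension drop algebras as continuous matrix functions\<close>

declare split_paired_All [simp del] split_paired_Ex [simp del]

type_synonym cmat = "nat \<times> nat => nat \<times> nat => complex"

definition idx :: "nat => nat => (nat \<times> nat) set" where
 "idx p q = {..<p} \<times> {..<q}"

text \<open>The fibre of a dimension drop algebra at \<open>s\<close> is a matrix algebra \<open>M_J\<close>, embedded in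
 \<open>M_p \<otimes> M_q\<close> by \<open>iota\<close>: here \<open>J\<close> is \<open>p \<times> {0}\<close>, \<open>{0} \<times> q\<close> or \<open>p \<times> q\<close>, depending on whether
 \<open>s = 0\<close>, \<open>s = 1\<close> or neither, so that the three cases need not be distinguished later.\<close>

definition fpi :: "real => nat \<times> nat => nat \<times> nat" where
 "fpi s x = (if s = 0 then (fst x, 0) else if s = 1 then (0, snd x) else x)"

text \<open>The multiplicity index: the coordinate that \<open>fpi\<close> discards, along which
  \<open>iota\<close> repeats the small matrix. In the interior nothing is discarded and there is a
  single block, labelled 0.\<close>

definition fka :: "real => nat \<times> nat => nat" where
 "fka s x = (if s = 0 then snd x else if s = 1 then fst x else 0)"

definition fJ :: "real => nat => nat => (nat \<times> nat) set" where
 "fJ s p q = fpi s ` idx p q"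

definition iota :: "real => nat => nat => cmat => cmat" where
 "iota s p q a = (%x y. if x \<in> idx p q & y \<in> idx p q & fka s x = fka s y then a (fpi s x) (fpi s y) else 0)"

definition Fib :: "real => nat => nat => cmat set" where
 "Fib s p q = iota s p q ` {a. supp (fJ s p q) a}"

lemma finite_idx [simp]: "finite (idx p q)"
 by (simp add: idx_def)

lemma finite_fJ [simp]: "finite (fJ s p q)"
 by (simp add: fJ_def)

lemma fpi_fJ: "x \<in> idx p q ==> fpi s x \<in> fJ s p q"
 by (simp add: fJ_def)

lemma fpi_fka_eqD: "fpi s x = fpi s y ==> fka s x = fka s y ==> x = y"
 by (cases x; cases y) (auto simp: fpi_def fka_def split: if_splits)

text \<open>Every block with a fixed multiplicity index is a full copy of \<open>fJ s p q\<close>.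
  This turns the sum over a block in the product of two \<open>iota\<close> matrices into the sum
  over the small index set.\<close>

lemma fpi_bij:
 assumes x: "x \<in> idx p q"
 shows "bij_betw (fpi s) {z \<in> idx p q. fka s z = fka s x} (fJ s p q)"
proof (rule bij_betw_imageI)
 show "inj_on (fpi s) {z \<in> idx p q. fka s z = fka s x}"
 proof (rule inj_onI)
  fix y z assume "y \<in> {z \<in> idx p q. fka s z = fka s x}" "z \<in> {z \<in> idx p q. fka s z = fka s x}" "fpi s y = fpi s z"
  thus "y = z" by (intro fpi_fka_eqD[of s y z]) simp_all
 qed
 have "\<exists>z\<in>idx p q. fka s z = fka s x & fpi s z = fpi s w" if w: "w \<in> idx p q" for w using w x
  by (intro bexI[of _ "if s = 0 then (fst w, snd x) else if s = 1 then (fst x, snd w) else w"])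
   (auto simp: fpi_def fka_def idx_def)
 hence "fJ s p q \<subseteq> fpi s ` {z \<in> idx p q. fka s z = fka s x}"
  unfolding fJ_def image_subset_iff by (metis (mono_tags, lifting) image_eqI mem_Collect_eq)
 thus "fpi s ` {z \<in> idx p q. fka s z = fka s x} = fJ s p q" unfolding fJ_def by blast
qed

lemma iota_mm: "mm (idx p q) (iota s p q a) (iota s p q b) = iota s p q (mm (fJ s p q) a b)"
proof (intro ext)
 fix x y
 show "mm (idx p q) (iota s p q a) (iota s p q b) x y = iota s p q (mm (fJ s p q) a b) x y"
 proof (cases "x \<in> idx p q & y \<in> idx p q & fka s x = fka s y")
  case True
  have "mm (idx p q) (iota s p q a) (iota s p q b) x y
    = (\<Sum>z\<in>idx p q. if fka s z = fka s x then a (fpi s x) (fpi s z) * b (fpi s z) (fpi s y) else 0)"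
   unfolding mm_def by (rule sum.cong) (use True in \<open>auto simp: iota_def\<close>)
  also have "\<dots> = (\<Sum>z\<in>{z \<in> idx p q. fka s z = fka s x}. a (fpi s x) (fpi s z) * b (fpi s z) (fpi s y))"
   by (simp add: sum.inter_filter)
  also have "\<dots> = (\<Sum>z\<in>fJ s p q. a (fpi s x) z * b z (fpi s y))" using True by (intro sum.reindex_bij_betw fpi_bij) auto
  also have "\<dots> = iota s p q (mm (fJ s p q) a b) x y" using True by (simp add: iota_def mm_def)
  finally show ?thesis .
 next
  case False
  hence "mm (idx p q) (iota s p q a) (iota s p q b) x y = 0"
   unfolding mm_def by (intro sum.neutral) (auto simp: iota_def)
  thus ?thesis using False by (simp only: iota_def if_False)
 qed
qed

lemma iota_madj: "madj (iota s p q a) = iota s p q (madj a)"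
 by (auto simp: madj_def iota_def fun_eq_iff)

lemma iota_add: "iota s p q (%x y. a x y + b x y) = (%x y. iota s p q a x y + iota s p q b x y)"
 by (intro ext) (simp add: iota_def)

lemma iota_scale: "iota s p q (%x y. c * a x y) = (%x y. c * iota s p q a x y)"
 by (intro ext) (simp add: iota_def)

lemma iota_zero: "iota s p q (%x y. 0) = (%x y. 0)"
 by (auto simp: iota_def)

lemma iota_one: "iota s p q (mone (fJ s p q)) = mone (idx p q)"
 by (auto simp: iota_def mone_def fun_eq_iff fpi_fJ dest: fpi_fka_eqD)

text \<open>The small index set is itself part of \<open>idx p q\<close>, namely the block with
  multiplicity index 0, so the small matrix can be read off there. The bounds on \<open>p\<close>
  and \<open>q\<close> ensure that this block exists.\<close>

lemma iota_fJ:
 assumes "p \<ge> 1" "q \<ge> 1" "x \<in> fJ s p q" "y \<in> fJ s p q"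
 shows "iota s p q a x y = a x y"
proof -
 have "z \<in> idx p q & fpi s z = z & fka s z = 0" if "z \<in> fJ s p q" for z
  using that assms(1,2) by (auto simp: fJ_def fpi_def fka_def idx_def split: if_splits)
 thus ?thesis using assms by (simp add: iota_def)
qed

lemma iota_inj:
 assumes "p \<ge> 1" "q \<ge> 1" "supp (fJ s p q) a" "supp (fJ s p q) b" "iota s p q a = iota s p q b"
 shows "a = b"
proof (intro ext)
 fix x y
 have "a x y = 0 & b x y = 0" if "\<not> (x \<in> fJ s p q & y \<in> fJ s p q)" using assms(3,4) that unfolding supp_def by blast
 thus "a x y = b x y"
  using assms iota_fJ[of p q x s y a] iota_fJ[of p q x s y b] by (cases "x \<in> fJ s p q & y \<in> fJ s p q") simp_all
qed

lemma FibI: "supp (fJ s p q) a ==> iota s p q a \<in> Fib s p q"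
 by (simp add: Fib_def)

lemma Fib_supp: "a \<in> Fib s p q ==> supp (idx p q) a"
 by (auto simp: Fib_def iota_def supp_def)

lemma Fib_mm: "a \<in> Fib s p q ==> b \<in> Fib s p q ==> mm (idx p q) a b \<in> Fib s p q"
 by (auto simp: Fib_def iota_mm intro!: imageI supp_mm)

lemma Fib_madj: "a \<in> Fib s p q ==> madj a \<in> Fib s p q"
 by (auto simp: Fib_def iota_madj intro!: imageI supp_madj)

lemma Fib_add: "a \<in> Fib s p q ==> b \<in> Fib s p q ==> (%x y. a x y + b x y) \<in> Fib s p q"
 by (auto simp: Fib_def iota_add[symmetric] supp_def intro!: imageI)

lemma Fib_scale: "a \<in> Fib s p q ==> (%x y. c * a x y) \<in> Fib s p q"
 by (auto simp: Fib_def iota_scale[symmetric] supp_def intro!: imageI)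

lemma Fib_zero: "(%x y. 0) \<in> Fib s p q"
 unfolding Fib_def by (subst iota_zero[symmetric, of s p q]) (auto simp: supp_def intro!: imageI)

lemma Fib_one: "mone (idx p q) \<in> Fib s p q"
 unfolding iota_one[symmetric, of p q s] by (rule FibI) simp

lemma Fib_interior:
 assumes "s ~= 0" "s ~= 1" "supp (idx p q) a"
 shows "a \<in> Fib s p q"
proof -
 have J: "fJ s p q = idx p q" using assms by (simp add: fJ_def fpi_def)
 have "iota s p q a = a" using assms by (auto simp: iota_def fka_def fpi_def supp_def fun_eq_iff)
 thus ?thesis using FibI[of s p q a] J assms(3) by simp
qed

text \<open>The dimension drop algebra. The value zero outside the unit interval makes equality of
  functions the same as equality in the algebra.\<close>

definition Mfun :: "nat => nat => (real => cmat) set" where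
 "Mfun p q = {M. (\<forall>i j. continuous_on {0..1} (%t. M t i j)) & (\<forall>t\<in>{0..1}. M t \<in> Fib t p q) &
   (\<forall>t. t \<notin> {0..1} --> M t = (%i j. 0))}"

definition fadd :: "(real => cmat) => (real => cmat) => real => cmat" where
 "fadd M N = (%t i j. M t i j + N t i j)"
definition fm :: "nat => nat => (real => cmat) => (real => cmat) => real => cmat" where
 "fm p q M N = (%t. mm (idx p q) (M t) (N t))"
definition fadj :: "(real => cmat) => real => cmat" where
 "fadj M = (%t. madj (M t))"
definition fsc :: "complex => (real => cmat) => real => cmat" where
 "fsc c M = (%t i j. c * M t i j)"
definition hs :: "(real => complex) => cmat => real => cmat" where
 "hs h a = (%t i j. if t \<in> {0..1} then h t * a i j else 0)"
definition fone :: "nat => nat => real => cmat" where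
 "fone p q = hs (%t. 1) (mone (idx p q))"

text \<open>A constant matrix times a scalar function lies in the algebra if the matrix belongs to
  every fibre where the function does not vanish. In the interior the fibre contains all matrices,
  so this is a condition at the two endpoints.\<close>

definition adm :: "nat => nat => (real => complex) => cmat => bool" where
 "adm p q h a \<longleftrightarrow> continuous_on {0..1} h & supp (idx p q) a & (\<forall>t\<in>{0..1}. h t = 0 | a \<in> Fib t p q)"

lemma MfunD:
 assumes "M \<in> Mfun p q"
 shows "continuous_on {0..1} (%t. M t i j)" "t \<in> {0..1} ==> M t \<in> Fib t p q" "t \<notin> {0..1} ==> M t = (%i j. 0)"
  "supp (idx p q) (M t)"
proof -
 show "continuous_on {0..1} (%t. M t i j)" "t \<in> {0..1} ==> M t \<in> Fib t p q" "t \<notin> {0..1} ==> M t = (%i j. 0)"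
  using assms unfolding Mfun_def by blast+
 thus "supp (idx p q) (M t)" using Fib_supp[of "M t" t p q] by (cases "t \<in> {0..1}") (simp_all add: supp_def)
qed

lemma Mfun_fadd: "M \<in> Mfun p q ==> N \<in> Mfun p q ==> fadd M N \<in> Mfun p q"
 unfolding Mfun_def fadd_def by (auto intro!: continuous_intros Fib_add)

lemma Mfun_fm: "M \<in> Mfun p q ==> N \<in> Mfun p q ==> fm p q M N \<in> Mfun p q"
 unfolding Mfun_def fm_def by (auto intro!: Fib_mm) (auto simp: mm_def intro!: continuous_intros)

lemma Mfun_fadj: "M \<in> Mfun p q ==> fadj M \<in> Mfun p q"
 unfolding Mfun_def fadj_def by (auto intro!: Fib_madj) (auto simp: madj_def intro!: continuous_intros)

lemma Mfun_fsc: "M \<in> Mfun p q ==> fsc c M \<in> Mfun p q"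
 unfolding Mfun_def fsc_def by (auto intro!: continuous_intros Fib_scale)

lemma Mfun_hs: "adm p q h a ==> hs h a \<in> Mfun p q"
 unfolding Mfun_def
proof (intro CollectI conjI allI ballI impI)
 assume a: "adm p q h a"
 have "continuous_on {0..1} (%t. h t * a i j)" for i j using a by (auto simp: adm_def intro!: continuous_intros)
 thus "continuous_on {0..1} (%t. hs h a t i j)" for i j
  by (subst continuous_on_cong[OF refl, where g="%t. h t * a i j"]) (auto simp: hs_def)
 show "hs h a t \<in> Fib t p q" if "t \<in> {0..1}" for t
 proof (cases "h t = 0")
  case True
  hence "hs h a t = (%i j. 0)" by (intro ext) (simp add: hs_def)
  thus ?thesis using Fib_zero[of t p q] by simp
 next
  case False
  hence "a \<in> Fib t p q" using a that unfolding adm_def by blast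
  thus ?thesis using that Fib_scale[of a t p q "h t"] by (simp add: hs_def)
 qed
qed (auto simp: hs_def)

lemma adm_one: "continuous_on {0..1} h ==> adm p q h (mone (idx p q))"
 by (auto simp: adm_def Fib_one)

lemma adm_mm: "adm p q h a ==> adm p q k b ==> adm p q (%t. h t * k t) (mm (idx p q) a b)"
 by (auto simp: adm_def intro!: continuous_intros supp_mm Fib_mm)

lemma adm_madj: "adm p q h a ==> adm p q (%t. cnj (h t)) (madj a)"
 by (auto simp: adm_def intro!: continuous_intros supp_madj Fib_madj)

lemma adm_zero: "continuous_on {0..1} h ==> adm p q h (%i j. 0)"
 by (auto simp: adm_def supp_def Fib_zero)

lemma adm_add: "adm p q h a ==> adm p q h b ==> adm p q h (%i j. a i j + b i j)"
 unfolding adm_def supp_def using Fib_add[of a _ p q b] by simp blast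

lemma fm_hs: "fm p q (hs h a) (hs k b) = hs (%t. h t * k t) (mm (idx p q) a b)"
 by (auto simp: fm_def hs_def mm_def fun_eq_iff sum_distrib_left mult_ac)

lemma fadj_hs: "fadj (hs h a) = hs (%t. cnj (h t)) (madj a)"
 by (auto simp: fadj_def hs_def madj_def fun_eq_iff)

lemma hs_cong: "(!!t. t \<in> {0..1} ==> h t = k t) ==> hs h a = hs k a"
 by (auto simp: hs_def fun_eq_iff)

section \<open>Unital representations of a dimension drop algebra\<close>

abbreviation cx :: "(real => real) => real => complex" where
 "cx h \<equiv> %t. complex_of_real (h t)"

text \<open>Adjoints are expressed through the real inner product of \<open>ell2\<close>.
  Quantitative norm bounds are derived: for elementary functions in \<open>norm_opp_le\<close>, for
  functions vanishing at both endpoints in \<open>small_norm\<close>.\<close>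

locale dd_rep =
 fixes p q :: nat and R :: "(real => cmat) => 'x ell2 => 'x ell2"
 assumes pq: "p \<ge> 1" "q \<ge> 1"
  and lin: "M \<in> Mfun p q ==> cblinear (R M)"
  and R_add: "M \<in> Mfun p q ==> N \<in> Mfun p q ==> R (fadd M N) = (%v. R M v + R N v)"
  and R_mult: "M \<in> Mfun p q ==> N \<in> Mfun p q ==> R (fm p q M N) = (%v. R M (R N v))"
  and R_adj: "M \<in> Mfun p q ==> inner (R M v) w = inner v (R (fadj M) w)"
  and R_sc: "M \<in> Mfun p q ==> R (fsc c M) = (%v. scaleC c (R M v))"
  and R_one: "R (fone p q) = (%v. v)"
begin

abbreviation "I \<equiv> idx p q"

definition opp :: "(real => complex) => cmat => 'x ell2 => 'x ell2" where
 "opp h a = R (hs h a)"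

lemma opp_lin: "adm p q h a ==> cblinear (opp h a)"
 unfolding opp_def by (intro lin Mfun_hs)

lemma opp_mult: "adm p q h a ==> adm p q k b ==> opp h a (opp k b v) = opp (%t. h t * k t) (mm I a b) v"
 unfolding opp_def using R_mult[OF Mfun_hs Mfun_hs, of h a k b] by (simp add: fm_hs)

lemma opp_adj: "adm p q h a ==> inner (opp h a v) w = inner v (opp (%t. cnj (h t)) (madj a) w)"
 unfolding opp_def by (simp add: R_adj Mfun_hs fadj_hs)

lemma opp_add_left: "adm p q h a ==> adm p q k a ==> opp (%t. h t + k t) a v = opp h a v + opp k a v"
proof -
 assume "adm p q h a" "adm p q k a"
 moreover have "hs (%t. h t + k t) a = fadd (hs h a) (hs k a)" by (auto simp: hs_def fadd_def fun_eq_iff distrib_right)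
 ultimately show ?thesis unfolding opp_def by (simp add: R_add Mfun_hs)
qed

lemma opp_add_right: "adm p q h a ==> adm p q h b ==> opp h (%i j. a i j + b i j) v = opp h a v + opp h b v"
proof -
 assume "adm p q h a" "adm p q h b"
 moreover have "hs h (%i j. a i j + b i j) = fadd (hs h a) (hs h b)"
  by (auto simp: hs_def fadd_def fun_eq_iff distrib_left)
 ultimately show ?thesis unfolding opp_def by (simp add: R_add Mfun_hs)
qed

lemma opp_scale: "adm p q h a ==> opp (%t. c * h t) a v = scaleC c (opp h a v)"
proof -
 assume "adm p q h a"
 moreover have "hs (%t. c * h t) a = fsc c (hs h a)" by (auto simp: hs_def fsc_def fun_eq_iff)
 ultimately show ?thesis unfolding opp_def by (simp add: R_sc Mfun_hs)
qed

lemma opp_scale_right: "adm p q h a ==> opp h (%i j. c * a i j) v = scaleC c (opp h a v)"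
proof -
 assume "adm p q h a"
 moreover have "hs h (%i j. c * a i j) = fsc c (hs h a)" by (auto simp: hs_def fsc_def fun_eq_iff)
 ultimately show ?thesis unfolding opp_def by (simp add: R_sc Mfun_hs)
qed

lemma opp_cong: "(!!t. t \<in> {0..1} ==> h t = k t) ==> opp h a v = opp k a v"
 unfolding opp_def using hs_cong[of h k a] by simp

lemma opp_one: "opp (%t. 1) (mone I) v = v"
 unfolding opp_def using R_one unfolding fone_def by simp

lemma R_zero: "R (%t i j. 0) v = 0"
proof -
 have "fsc 0 (fone p q) = (%t i j. 0)" by (simp add: fsc_def)
 thus ?thesis using R_sc[of "fone p q" 0] Mfun_hs[OF adm_one[of "%t. 1"]] by (simp add: fone_def)
qed

lemma opp_zero: "opp h (%i j. 0) v = 0"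
proof -
 have "hs h (%i j. 0) = (%t i j. 0)" by (simp add: hs_def fun_eq_iff)
 thus ?thesis unfolding opp_def using R_zero by simp
qed

lemma R_sum:
 assumes "finite K" "!!k. k \<in> K ==> N k \<in> Mfun p q"
 shows "(%t i j. \<Sum>k\<in>K. N k t i j) \<in> Mfun p q & R (%t i j. \<Sum>k\<in>K. N k t i j) v = (\<Sum>k\<in>K. R (N k) v)" using assms
proof (induction K rule: finite_induct)
 case empty
 have "fsc 0 (fone p q) = (%t i j. 0)" by (simp add: fsc_def)
 hence "(%t i j. 0) \<in> Mfun p q" using Mfun_fsc[of "fone p q" p q 0] Mfun_hs[OF adm_one[of "%t. 1"]] by (simp add: fone_def)
 thus ?case by (simp add: R_zero)
next
 case (insert k K)
 have "(%t i j. \<Sum>k\<in>insert k K. N k t i j) = fadd (N k) (%t i j. \<Sum>k\<in>K. N k t i j)" using insert by (simp add: fadd_def)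
 thus ?case using insert by (simp add: Mfun_fadd R_add)
qed

text \<open>Put E = \<open>mm I (madj a) a\<close>, a projection, and s = sqrt (M^2 - |h|^2) - M.
  Then M + s E is self-adjoint with square M^2 - |h|^2 E, so for the image y of v under it, |y|^2 =
  M^2 |v|^2 - |h a v|^2, which is nonnegative. Subtracting M in s makes s vanish together with h, so
  that s E is admissible whenever h a is.\<close>

lemma norm_opp_le:
 assumes a: "adm p q h a" and M: "0 <= M" "!!t. t \<in> {0..1} ==> cmod (h t) <= M"
  and e: "mm I (mm I (madj a) a) (mm I (madj a) a) = mm I (madj a) a"
 shows "norm (opp h a v) <= M * norm v"
proof -
 define E where "E = mm I (madj a) a"
 define s where "s t = sqrt (M\<^sup>2 - (cmod (h t))\<^sup>2) - M" for t
 let ?s2 = "%t. complex_of_real (s t) * complex_of_real (s t)"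
 have hM: "(cmod (h t))\<^sup>2 <= M\<^sup>2" if "t \<in> {0..1}" for t using M(2)[OF that] by (simp add: power_mono)
 have Ea: "madj E = E" by (simp add: E_def madj_mm)
 have EE: "mm I E E = E" using e by (simp add: E_def)
 have ah: "adm p q (%t. cnj (h t) * h t) E" unfolding E_def by (rule adm_mm[OF adm_madj[OF a] a])
 have ch: "continuous_on {0..1} h" using a by (simp add: adm_def)
 have as: "adm p q (cx s) E" unfolding adm_def
 proof (intro conjI ballI)
  show "continuous_on {0..1} (cx s)" unfolding s_def using ch by (intro continuous_intros)
  show "supp I E" using ah by (simp add: adm_def)
  fix t :: real assume t: "t \<in> {0..1}"
  show "complex_of_real (s t) = 0 | E \<in> Fib t p q"
  proof (cases "h t = 0")
   case True
   thus ?thesis using M(1) by (simp add: s_def)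
  next
   case False
   thus ?thesis using ah t unfolding adm_def by (metis complex_cnj_zero_iff mult_eq_0_iff)
  qed
 qed
 define y where "y = M *\<^sub>R v + opp (cx s) E v"
 have ss: "inner (opp (cx s) E v) (opp (cx s) E v)
  = inner v (opp ?s2 E v)" by (simp add: opp_adj[OF as] opp_mult[OF as as] Ea EE)
 have hh: "inner (opp h a v) (opp h a v) = inner v (opp (%t. cnj (h t) * h t) E v)"
  by (simp add: opp_adj[OF a] opp_mult[OF adm_madj[OF a] a] E_def)
 have as2: "adm p q ?s2 E" using adm_mm[OF as as] EE by simp
 have as3: "adm p q (%t. complex_of_real (2 * M) * complex_of_real (s t)) E"
  using as unfolding adm_def by (auto intro!: continuous_intros)
 have as23: "adm p q (%t. complex_of_real (2 * M) * complex_of_real (s t) + complex_of_real (s t) * complex_of_real (s t)) E"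
  using as2 as3 unfolding adm_def by (auto intro!: continuous_intros)
 have "inner v (opp (%t. complex_of_real (2 * M) * complex_of_real (s t) + complex_of_real (s t) * complex_of_real (s t) + cnj (h t) * h t) E v)
  = 2 * M * inner v (opp (cx s) E v) + inner v (opp ?s2 E v)
   + inner v (opp (%t. cnj (h t) * h t) E v)"
  by (simp only: opp_add_left[OF as23 ah] opp_add_left[OF as3 as2] opp_scale[OF as] scaleC_of_real inner_add_right inner_scaleR_right)
 also have "opp (%t. complex_of_real (2 * M) * complex_of_real (s t) + complex_of_real (s t) * complex_of_real (s t) + cnj (h t) * h t) E v
  = opp (%t. 0) E v"
 proof (rule opp_cong)
  fix t :: real assume t: "t \<in> {0..1}"
  have "(s t + M) * (s t + M) = M\<^sup>2 - (cmod (h t))\<^sup>2" using hM[OF t] by (simp add: s_def)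
  hence "2 * M * s t + s t * s t + (cmod (h t))\<^sup>2 = 0" by (simp add: algebra_simps power2_eq_square)
  moreover have "cnj (h t) * h t = complex_of_real ((cmod (h t))\<^sup>2)"
   using complex_norm_square[of "h t"] by (simp only: mult.commute)
  ultimately show "complex_of_real (2 * M) * complex_of_real (s t) + complex_of_real (s t) * complex_of_real (s t) + cnj (h t) * h t = 0"
   by (simp only: of_real_mult[symmetric] of_real_add[symmetric] of_real_0)
 qed
 also have "hs (%t. 0) E = (%t i j. 0)" by (simp add: hs_def fun_eq_iff)
 hence "opp (%t. 0) E v = 0" unfolding opp_def using R_zero by simp
 finally have z: "2 * M * inner v (opp (cx s) E v) + inner v (opp ?s2 E v)
   + inner (opp h a v) (opp h a v) = 0" using hh by simp
 have "0 <= inner y y" by simp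
 also have "inner y y = M\<^sup>2 * inner v v + 2 * M * inner v (opp (cx s) E v)
  + inner v (opp ?s2 E v)" by (simp add: y_def inner_add_left inner_add_right ss inner_commute power2_eq_square)
 finally have "(norm (opp h a v))\<^sup>2 <= (M * norm v)\<^sup>2" using z by (simp add: power_mult_distrib power2_norm_eq_inner)
 thus ?thesis by (rule power2_le_imp_le) (simp add: M(1))
qed

text \<open>\<open>M\<close> is expanded in matrix units. Since it vanishes at both endpoints, each
  entry times its matrix unit lies in the algebra by itself and has norm at most c; there are (card
  I)^2 of them.\<close>

lemma small_norm:
 assumes M: "M \<in> Mfun p q" "M 0 = (%i j. 0)" "M 1 = (%i j. 0)"
  and c: "0 <= c" "!!t i j. t \<in> {0..1} ==> i \<in> I ==> j \<in> I ==> cmod (M t i j) <= c"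
 shows "norm (R M v) <= (real (card I))\<^sup>2 * c * norm v"
proof -
 define E where "E kl = (%i j. if i = fst kl & j = snd kl then 1 else 0 :: complex)" for kl :: "(nat \<times> nat) \<times> (nat \<times> nat)"
 let ?K = "I \<times> I"
 define N where "N kl = hs (%t. M t (fst kl) (snd kl)) (E kl)" for kl
 have Es: "supp I (E kl)" if "kl \<in> ?K" for kl using that by (auto simp: supp_def E_def)
 have a: "adm p q (%t. M t (fst kl) (snd kl)) (E kl)" if "kl \<in> ?K" for kl
  unfolding adm_def using MfunD(1)[OF M(1)] Es[OF that] M(2,3) by (auto intro: Fib_interior)
 have MN: "M = (%t i j. \<Sum>kl\<in>?K. N kl t i j)"
 proof (intro ext)
  fix t i j
  have "(\<Sum>kl\<in>?K. N kl t i j) = (\<Sum>kl\<in>?K. if kl = (i, j) then (if t \<in> {0..1} then M t i j else 0) else 0)"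
   by (rule sum.cong) (auto simp: N_def hs_def E_def)
  also have "\<dots> = M t i j" using MfunD(3)[OF M(1), of t] MfunD(4)[OF M(1), of t] by (auto simp: supp_def)
  finally show "M t i j = (\<Sum>kl\<in>?K. N kl t i j)" by simp
 qed
 have n: "norm (R (N kl) v) <= c * norm v" if kl: "kl \<in> ?K" for kl
 proof -
  have e: "mm I (madj (E kl)) (E kl) = E (snd kl, snd kl)"
  proof (intro ext)
   fix i j
   have "mm I (madj (E kl)) (E kl) i j = (\<Sum>l\<in>I. if l = fst kl then E (snd kl, snd kl) i j else 0)"
    unfolding mm_def by (rule sum.cong) (auto simp: madj_def E_def)
   thus "mm I (madj (E kl)) (E kl) i j = E (snd kl, snd kl) i j" using kl by auto
  qed
  have e2: "mm I (E (l, l)) (E (l, l)) = E (l, l)" if "l \<in> I" for l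
  proof (intro ext)
   fix i j
   have "mm I (E (l, l)) (E (l, l)) i j = (\<Sum>k\<in>I. if k = l then E (l, l) i j else 0)"
    unfolding mm_def by (rule sum.cong) (auto simp: E_def)
   thus "mm I (E (l, l)) (E (l, l)) i j = E (l, l) i j" using that by auto
  qed
  have "norm (opp (%t. M t (fst kl) (snd kl)) (E kl) v) <= c * norm v"
   by (rule norm_opp_le[OF a[OF kl] c(1)]) (use c(2) kl in \<open>auto simp: e e2\<close>)
  thus ?thesis by (simp add: N_def opp_def)
 qed
 have "R M v = (\<Sum>kl\<in>?K. R (N kl) v)" using R_sum[of ?K N v] a by (subst MN) (auto simp: N_def Mfun_hs)
 also have "norm \<dots> <= (\<Sum>kl\<in>?K. c * norm v)" by (rule sum_norm_le) (rule n)
 also have "\<dots> = (real (card I))\<^sup>2 * c * norm v" by (simp add: card_cartesian_product power2_eq_square)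
 finally show ?thesis .
qed

definition nearh :: "real => real => (real => complex) => bool" where
 "nearh t r h \<longleftrightarrow> continuous_on {0..1} h & (\<forall>\<tau>\<in>{0..1}. cmod (h \<tau>) <= 1 & (h \<tau> ~= 0 --> \<bar>\<tau> - t\<bar> <= r))"

lemma nearh_mono: "nearh t r h ==> r <= r' ==> nearh t r' h"
 unfolding nearh_def by force

lemma adm_nearh:
 assumes t: "t \<in> {0..1}"
 shows "\<exists>r>0. \<forall>h a. nearh t r h & a \<in> Fib t p q --> adm p q h a"
proof -
 \<comment> \<open>Small enough that an endpoint within distance r of t must be t itself. A function
   supported there vanishes at every endpoint other than t, so only the fibre at t restricts the
   matrix.\<close>
 define r where "r = (if t = 0 | t = 1 then 1 / 2 else min t (1 - t) / 2)"
 have r: "r > 0" using t by (auto simp: r_def)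
 have ex: "\<tau> = t" if "\<tau> = 0 | \<tau> = 1" "\<bar>\<tau> - t\<bar> <= r" for \<tau> using that t by (auto simp: r_def min_def split: if_splits)
 have "adm p q h a" if "nearh t r h" "a \<in> Fib t p q" for h a unfolding adm_def
 proof (intro conjI ballI)
  show "continuous_on {0..1} h" "supp I a" using that Fib_supp by (auto simp: nearh_def)
  fix \<tau> :: real assume \<tau>: "\<tau> \<in> {0..1}"
  show "h \<tau> = 0 | a \<in> Fib \<tau> p q"
  proof (cases "\<tau> = 0 | \<tau> = 1")
   case True
   thus ?thesis using ex[OF True] that \<tau> by (auto simp: nearh_def)
  next
   case False
   thus ?thesis using Fib_interior Fib_supp[OF that(2)] by blast
  qed
 qed
 thus ?thesis using r by blast
qed

text \<open>On the support of a narrow bump h, the continuous function F is nearly the constant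
  F(t). The error F h a - h F(t) a vanishes at both endpoints, because either h vanishes there or
  the endpoint is t and the difference is zero; so its norm is controlled by its entries through
  \<open>small_norm\<close>.\<close>

lemma near_mult:
 assumes F: "F \<in> Mfun p q" and t: "t \<in> {0..1}" and a: "a \<in> Fib t p q" and \<epsilon>: "\<epsilon> > 0"
 shows "\<exists>r>0. \<forall>h. nearh t r h --> adm p q h a &
  (\<forall>v. norm (R F (opp h a v) - opp h (mm I (F t) a) v) <= \<epsilon> * norm v)"
proof -
 from adm_nearh[OF t] obtain r1 where r1: "r1 > 0"
  and r1': "\<forall>h a. nearh t r1 h & a \<in> Fib t p q --> adm p q h a" by (elim exE conjE)
 define A where "A = (\<Sum>l\<in>I. \<Sum>m\<in>I. cmod (a l m))"
 define N where "N = real (card I)"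
 have A0: "A \<ge> 0" by (simp add: A_def sum_nonneg)
 define c where "c = \<epsilon> / (N\<^sup>2 * A + 1)"
 have c0: "c > 0" using \<epsilon> A0 by (simp add: c_def add_nonneg_pos)
 define g where "g \<tau> = (\<Sum>k\<in>I. \<Sum>l\<in>I. cmod (F \<tau> k l - F t k l))" for \<tau>
 have cg: "continuous_on {0..1} g" unfolding g_def using MfunD(1)[OF F] by (intro continuous_intros)
 have gt: "g t = 0" by (simp add: g_def)
 from cg[unfolded continuous_on_iff, rule_format, OF t c0] obtain r2 where r2: "r2 > 0"
  and r2': "\<forall>\<tau>\<in>{0..1}. dist \<tau> t < r2 --> dist (g \<tau>) (g t) < c" by (elim exE conjE)
 have gc: "g \<tau> < c" if "\<tau> \<in> {0..1}" "\<bar>\<tau> - t\<bar> < r2" for \<tau>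
  using bspec[OF r2' that(1)] that(2) gt by (simp add: dist_real_def)
 define r0 where "r0 = (if t = 0 | t = 1 then 1 / 2 else min t (1 - t) / 2)"
 have r0: "r0 > 0" using t by (auto simp: r0_def)
 have r3: "\<tau> = t" if "\<tau> = 0 | \<tau> = 1" "\<bar>\<tau> - t\<bar> <= r0" for \<tau> using that t by (auto simp: r0_def min_def split: if_splits)
 define r where "r = min r0 (min r1 (r2 / 2))"
 have r: "r > 0" "r <= r1" "r < r2" "r <= r0" using r1 r2 r0 by (auto simp: r_def)
 have "adm p q h a & norm (R F (opp h a v) - opp h (mm I (F t) a) v) <= \<epsilon> * norm v"
  if h: "nearh t r h" for h v
 proof
  have h1: "nearh t r1 h" using h r(2) nearh_mono by blast
  show ad: "adm p q h a" using r1' h1 a by simp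
  have ad2: "adm p q h (mm I (F t) a)" using r1' h1 Fib_mm[OF MfunD(2)[OF F t] a] by simp
  define D where "D = fadd (fm p q F (hs h a)) (fsc (- 1) (hs h (mm I (F t) a)))"
  have DM: "D \<in> Mfun p q" unfolding D_def by (intro Mfun_fadd Mfun_fm Mfun_fsc F Mfun_hs ad ad2)
  have RD: "R D v = R F (opp h a v) - opp h (mm I (F t) a) v" unfolding D_def opp_def
   by (simp add: R_add R_mult R_sc Mfun_fm Mfun_fsc F Mfun_hs ad ad2 scaleC_minus_one)
  have Dt: "D \<tau> i j = (\<Sum>k\<in>I. h \<tau> * ((F \<tau> i k - F t i k) * a k j))" if "\<tau> \<in> {0..1}" for \<tau> i j
   using that by (simp add: D_def fadd_def fm_def fsc_def hs_def mm_def sum_distrib_left sum_subtractf[symmetric] algebra_simps)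
  have Db: "D \<tau> = (%i j. 0)" if "\<tau> = 0 | \<tau> = 1" for \<tau>
  proof (cases "h \<tau> = 0")
   case True
   thus ?thesis using that by (auto simp: Dt fun_eq_iff)
  next
   case False
   moreover have "\<tau> \<in> {0..1}" using that by auto
   ultimately have "\<bar>\<tau> - t\<bar> <= r" using h by (auto simp: nearh_def)
   hence "\<tau> = t" using r3[OF that] r(4) by linarith
   thus ?thesis using that by (auto simp: Dt fun_eq_iff)
  qed
  have "norm (R D v) <= N\<^sup>2 * (c * A) * norm v" unfolding N_def
  proof (rule small_norm[OF DM Db Db])
   fix \<tau> :: real and i j assume \<tau>: "\<tau> \<in> {0..1}" and ij: "i \<in> I" "j \<in> I"
   show "cmod (D \<tau> i j) <= c * A"
   proof (cases "h \<tau> = 0")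
    case True
    thus ?thesis using c0 A0 by (simp add: Dt[OF \<tau>])
   next
    case False
    hence "\<bar>\<tau> - t\<bar> <= r" using h \<tau> by (auto simp: nearh_def)
    hence g: "g \<tau> < c" using gc[OF \<tau>] r(3) by simp
    have h1: "cmod (h \<tau>) <= 1" using h \<tau> by (auto simp: nearh_def)
    have "cmod (D \<tau> i j) <= (\<Sum>k\<in>I. cmod (h \<tau> * ((F \<tau> i k - F t i k) * a k j)))" unfolding Dt[OF \<tau>] by (rule norm_sum)
    also have "\<dots> <= (\<Sum>k\<in>I. c * cmod (a k j))"
    proof (rule sum_mono)
     fix k assume k: "k \<in> I"
     have "cmod (F \<tau> i k - F t i k) <= (\<Sum>l\<in>I. cmod (F \<tau> i l - F t i l))" using k by (intro member_le_sum) auto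
     also have "\<dots> <= g \<tau>"
      unfolding g_def using ij(1) by (intro member_le_sum[of i _ "%i. \<Sum>l\<in>I. cmod (F \<tau> i l - F t i l)"]) (auto intro: sum_nonneg)
     finally have "cmod (F \<tau> i k - F t i k) <= c" using g by simp
     hence "cmod (h \<tau>) * (cmod (F \<tau> i k - F t i k) * cmod (a k j)) <= 1 * (c * cmod (a k j))"
      using h1 by (intro mult_mono mult_right_mono) auto
     thus "cmod (h \<tau> * ((F \<tau> i k - F t i k) * a k j)) <= c * cmod (a k j)" by (simp add: norm_mult)
    qed
    also have "\<dots> = c * (\<Sum>k\<in>I. cmod (a k j))" by (simp add: sum_distrib_left)
    also have "\<dots> <= c * A" unfolding A_def using c0 ij(2) by (intro mult_left_mono sum_mono member_le_sum) auto
    finally show ?thesis .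
   qed
  qed (use c0 A0 in auto)
  also have "\<dots> <= \<epsilon> * norm v"
  proof (rule mult_right_mono)
   have p: "N\<^sup>2 * A + 1 > 0" using A0 by (simp add: add_nonneg_pos)
   have "N\<^sup>2 * (c * A) = \<epsilon> * (N\<^sup>2 * A) / (N\<^sup>2 * A + 1)" by (simp add: c_def)
   also have "\<dots> <= \<epsilon>" using p \<epsilon> by (simp add: pos_divide_le_eq)
   finally show "N\<^sup>2 * (c * A) <= \<epsilon>" .
  qed simp
  finally show "norm (R F (opp h a v) - opp h (mm I (F t) a) v) <= \<epsilon> * norm v" by (simp add: RD)
 qed
 thus ?thesis using r(1) by blast
qed

end

section \<open>Concentration of a vector on the centre\<close>

context dd_rep
begin

definition cen :: "(real => real) => 'x ell2 => 'x ell2" where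
 "cen h = opp (cx h) (mone I)"

lemma adm_cen: "continuous_on {0..1} h ==> adm p q (cx h) (mone I)"
 by (intro adm_one continuous_intros)

lemma cen_lin: "continuous_on {0..1} h ==> cblinear (cen h)"
 unfolding cen_def by (intro opp_lin adm_cen)

lemma cen_mult: "continuous_on {0..1} h ==> continuous_on {0..1} k ==> cen h (cen k v) = cen (%t. h t * k t) v"
 unfolding cen_def by (simp add: opp_mult adm_cen mm_one)

lemma cen_add: "continuous_on {0..1} h ==> continuous_on {0..1} k ==> cen (%t. h t + k t) v = cen h v + cen k v"
 unfolding cen_def by (simp add: opp_add_left adm_cen)

lemma cen_cong: "(!!t. t \<in> {0..1} ==> h t = k t) ==> cen h v = cen k v"
 unfolding cen_def by (rule opp_cong) simp

lemma cen_1: "cen (%t. 1) v = v"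
 unfolding cen_def using opp_one by simp

lemma cen_0: "cen (%t. 0) v = 0"
proof -
 have "hs (%t. complex_of_real 0) (mone I) = (%t i j. 0)" by (simp add: hs_def fun_eq_iff)
 thus ?thesis unfolding cen_def opp_def using R_zero by simp
qed

lemma cen_norm_le: "continuous_on {0..1} h ==> (!!t. t \<in> {0..1} ==> \<bar>h t\<bar> <= 1) ==> norm (cen h v) <= norm v"
 unfolding cen_def using norm_opp_le[OF adm_cen, of h 1 v] by (simp add: mm_one)

lemma cen_commute: "continuous_on {0..1} h ==> M \<in> Mfun p q ==> cen h (R M v) = R M (cen h v)"
proof -
 assume h: "continuous_on {0..1} h" and M: "M \<in> Mfun p q"
 let ?H = "hs (cx h) (mone I)"
 have H: "?H \<in> Mfun p q" by (rule Mfun_hs[OF adm_cen[OF h]])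
 have 1: "mm I (%i j. c * mone I i j) a = (%i j. c * a i j)"
  "mm I a (%i j. c * mone I i j) = (%i j. c * a i j)" if "supp I a" for a c
 proof -
  have "mm I (%i j. c * mone I i j) a = (%i j. c * mm I (mone I) a i j)"
   by (simp add: mm_def sum_distrib_left mult.assoc)
  thus "mm I (%i j. c * mone I i j) a = (%i j. c * a i j)" using that by (simp add: mm_one)
  have "mm I a (%i j. c * mone I i j) = (%i j. c * mm I a (mone I) i j)"
   by (simp add: mm_def sum_distrib_left mult.left_commute)
  thus "mm I a (%i j. c * mone I i j) = (%i j. c * a i j)" using that by (simp add: mm_one)
 qed
 have "fm p q ?H M t = fm p q M ?H t" for t
 proof (cases "t \<in> {0..1}")
  case True
  thus ?thesis using 1[OF MfunD(4)[OF M]] by (simp add: fm_def hs_def)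
 next
  case False
  hence "M t = (%i j. 0)" by (rule MfunD(3)[OF M])
  thus ?thesis by (simp add: fm_def mm_def)
 qed
 hence "fm p q ?H M = fm p q M ?H" by blast
 thus ?thesis unfolding cen_def opp_def using R_mult[OF H M] R_mult[OF M H] by (metis (no_types))
qed

text \<open>The spectral measure of \<xi> on the centre is concentrated at t: cutting off outside an
  arbitrarily small neighbourhood of t moves \<xi> by at most e, where e does not depend on the
  radius r.\<close>

definition peaked :: "'x ell2 => real => real => bool" where
 "peaked \<xi> t e \<longleftrightarrow> (\<forall>h r. continuous_on {0..1} h --> (\<forall>t\<in>{0..1}. 0 <= h t & h t <= 1) --> r > 0 -->
   (\<forall>\<tau>\<in>{0..1}. \<bar>\<tau> - t\<bar> <= r --> h \<tau> = 1) --> norm (cen h \<xi> - \<xi>) <= e)"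

lemma peakedD:
 "peaked \<xi> t e ==> continuous_on {0..1} h ==> (!!t. t \<in> {0..1} ==> 0 <= h t & h t <= 1) ==> r > 0 ==>
  (!!\<tau>. \<tau> \<in> {0..1} ==> \<bar>\<tau> - t\<bar> <= r ==> h \<tau> = 1) ==> norm (cen h \<xi> - \<xi>) <= e" unfolding peaked_def by blast

text \<open>If every central element almost has \<open>\<xi>\<close> as an eigenvector, then the spectral measure of \<open>\<xi>\<close> on the
 centre \<open>C[0,1]\<close> is almost a point mass; the point is found as a median.\<close>

lemma concentration:
 assumes \<xi>: "norm \<xi> = 1" and \<delta>: "0 <= \<delta>" "\<delta> <= 1 / 100"
  and ev: "!!h. continuous_on {0..1} h ==> (!!t. t \<in> {0..1} ==> 0 <= h t & h t <= 1) ==>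
   \<exists>c. norm (cen h \<xi> - scaleC c \<xi>) <= \<delta>"
 obtains t where "t \<in> {0..1}" "peaked \<xi> t (15 * \<delta>)"
proof -
 let ?c = "%(h :: real => real) t. 1 - h t"
 define H where "H = {h :: real => real. continuous_on {0..1} h & (\<forall>t\<in>{0..1}. 0 <= h t & h t <= 1)}"
 have Hc: "continuous_on {0..1} h" if "h \<in> H" for h using that by (simp add: H_def)
 have Hn: "norm (cen h v) <= norm v" if "h \<in> H" for h v
  by (rule cen_norm_le[OF Hc[OF that]]) (use that in \<open>auto simp: H_def\<close>)
 have H1: "(?c h) \<in> H" if "h \<in> H" for h using that by (auto simp: H_def intro!: continuous_intros)
 have "\<exists>lam. \<forall>h\<in>H. norm (cen h \<xi> - scaleC (lam h) \<xi>) <= \<delta>" by (rule bchoice) (use ev in \<open>auto simp: H_def\<close>)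
 then obtain lam where lam: "!!h. h \<in> H ==> norm (cen h \<xi> - scaleC (lam h) \<xi>) <= \<delta>" by blast
 have lam_le: "norm (cen h \<xi>) <= cmod (lam h) + \<delta>" if "h \<in> H" for h
  using lam[OF that] norm_triangle_ineq2[of "cen h \<xi>" "scaleC (lam h) \<xi>"] \<xi> by simp
 have lam1: "cmod (lam h) <= 1 + \<delta>" if "h \<in> H" for h
  using lam[OF that] Hn[OF that, of \<xi>] norm_triangle_ineq2[of "scaleC (lam h) \<xi>" "cen h \<xi>"] \<xi>
  by (simp add: norm_minus_commute)
 \<comment> \<open>The eigenvalue is almost multiplicative, so two functions with product zero
   cannot both have a large eigenvalue.\<close>
 have a: "cmod (lam h) * cmod (lam k) <= 3 * \<delta>" if h: "h \<in> H" and k: "k \<in> H" and hk: "!!t. t \<in> {0..1} ==> h t * k t = 0" for h k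
 proof -
  have "cen h (cen k \<xi>) = cen (%t. 0) \<xi>" unfolding cen_mult[OF Hc[OF h] Hc[OF k]] by (rule cen_cong) (rule hk)
  hence 0: "cen h (cen k \<xi>) = 0" by (simp add: cen_0)
  let ?x = "cen k \<xi> - scaleC (lam k) \<xi>" and ?y = "cen h \<xi> - scaleC (lam h) \<xi>"
  have "scaleC (lam k * lam h) \<xi> = - (cen h ?x) - scaleC (lam k) ?y"
   by (simp add: cblinear_diff[OF cen_lin[OF Hc[OF h]]] cblinear_scaleC[OF cen_lin[OF Hc[OF h]]] 0 scaleC_minus)
  hence "norm (scaleC (lam k * lam h) \<xi>) <= norm (cen h ?x) + norm (scaleC (lam k) ?y)"
   using norm_triangle_ineq4[of "- (cen h ?x)" "scaleC (lam k) ?y"] by simp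
  hence "cmod (lam h) * cmod (lam k) <= norm (cen h ?x) + cmod (lam k) * norm ?y"
   using \<xi> by (simp add: norm_mult mult.commute)
  also have "norm (cen h ?x) <= \<delta>" using Hn[OF h, of ?x] lam[OF k] by linarith
  also have "cmod (lam k) * norm ?y <= (1 + \<delta>) * \<delta>" using lam1[OF k] lam[OF h] \<delta> by (intro mult_mono) auto
  also have "\<delta> + (1 + \<delta>) * \<delta> <= 3 * \<delta>" using \<delta> mult_right_mono[of \<delta> 1 \<delta>] by (simp add: algebra_simps)
  finally show ?thesis by simp
 qed
 have b: "1 - cmod (lam h) - 2 * \<delta> <= cmod (lam (?c h))" if h: "h \<in> H" for h
 proof -
  have "cen h \<xi> + cen (?c h) \<xi> = cen (%t. h t + (1 - h t)) \<xi>" using cen_add[OF Hc[OF h] Hc[OF H1[OF h]]] by simp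
  also have "\<dots> = \<xi>" using cen_1 by simp
  finally have s: "cen h \<xi> + cen (?c h) \<xi> = \<xi>" .
  have "1 <= norm (cen h \<xi>) + norm (cen (?c h) \<xi>)" using norm_triangle_ineq[of "cen h \<xi>" "cen (?c h) \<xi>"] s \<xi> by simp
  thus ?thesis using lam_le[OF h] lam_le[OF H1[OF h]] by linarith
 qed
 \<comment> \<open>The points t to the right of which there is a function with eigenvalue at least
   1/2. The supremum \<open>ts\<close> is the median: \<open>A\<close> shows that there is little
   mass strictly to its left, \<open>B\<close> that there is little strictly to its right.\<close>
 define U where "U = {t \<in> {0..1}. \<exists>h\<in>H. (\<forall>\<tau>\<in>{0..1}. \<tau> <= t --> h \<tau> = 0) & 1 / 2 <= cmod (lam h)}"
 define ts where "ts = Sup (insert 0 U)"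
 have bdd: "bdd_above (insert 0 U)" by (auto simp: U_def bdd_above_def intro!: exI[of _ 1])
 have ts: "0 <= ts" "ts <= 1" using cSup_upper[OF insertI1 bdd] by (auto simp: ts_def U_def intro!: cSup_least)
 have A: "norm (cen (?c k) \<xi>) <= 7 * \<delta>" if k: "k \<in> H" and al: "al < ts" and k1: "!!\<tau>. \<tau> \<in> {0..1} ==> al <= \<tau> ==> k \<tau> = 1" for k al
 proof -
  obtain u where u: "u \<in> insert 0 U" "al < u" using al less_cSup_iff[OF _ bdd] unfolding ts_def by blast
  show ?thesis
  proof (cases "u \<in> U")
   case True
   then obtain h where h: "h \<in> H" "!!\<tau>. \<tau> \<in> {0..1} ==> \<tau> <= u ==> h \<tau> = 0" "1 / 2 <= cmod (lam h)" unfolding U_def by blast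
   have "cmod (lam h) * cmod (lam (?c k)) <= 3 * \<delta>"
   proof (rule a[OF h(1) H1[OF k]])
    fix \<tau> :: real assume "\<tau> \<in> {0..1}"
    thus "h \<tau> * (1 - k \<tau>) = 0" using h(2)[of \<tau>] k1[of \<tau>] u(2) by (cases "\<tau> <= u") auto
   qed
   moreover have "1 / 2 * cmod (lam (?c k)) <= cmod (lam h) * cmod (lam (?c k))"
    using h(3) by (rule mult_right_mono) simp
   ultimately have "cmod (lam (?c k)) <= 6 * \<delta>" by linarith
   thus ?thesis using lam_le[OF H1[OF k]] by linarith
  next
   case False
   hence "cen (?c k) \<xi> = cen (%\<tau>. 0) \<xi>" using u k1 by (intro cen_cong) auto
   thus ?thesis using \<delta> by (simp add: cen_0)
  qed
 qed
 have B: "norm (cen (?c k) \<xi>) <= 8 * \<delta>" if k: "k \<in> H" and al: "ts < al" and k1: "!!\<tau>. \<tau> \<in> {0..1} ==> \<tau> <= al ==> k \<tau> = 1" for k al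
 proof (cases "ts = 1")
  case True
  hence "cen (?c k) \<xi> = cen (%\<tau>. 0) \<xi>" using al k1 by (intro cen_cong) auto
  thus ?thesis using \<delta> by (simp add: cen_0)
 next
  case False
  hence "ts < 1" using ts by simp
  define be where "be = min al 1"
  define u where "u = (ts + be) / 2"
  have u: "ts < u" "u < be" "be <= 1" "be <= al" using al \<open>ts < 1\<close> by (auto simp: u_def be_def min_def)
  have uU: "u \<notin> U" using cSup_upper[OF insertI2 bdd, of u] u(1) unfolding ts_def by linarith
  \<comment> \<open>A ramp from 0 at u to 1 at be. Since u lies beyond the supremum, the eigenvalue
    of h is below 1/2, hence that of 1 - h is at least 1/2 - 2 \<delta>, which is at least 12/25
    because \<delta> <= 1/100.\<close>
  define h where "h \<tau> = max 0 (min 1 ((\<tau> - u) / (be - u)))" for \<tau>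
  have hH: "h \<in> H" unfolding H_def h_def using u by (auto intro!: continuous_intros)
  have h0: "h \<tau> = 0" if "\<tau> <= u" for \<tau> using that u by (simp add: h_def divide_nonpos_pos)
  have h1: "h \<tau> = 1" if "be <= \<tau>" for \<tau> using that u by (simp add: h_def)
  have "\<not> 1 / 2 <= cmod (lam h)"
  proof
   assume "1 / 2 <= cmod (lam h)"
   hence "u \<in> U" using hH h0 u ts unfolding U_def by auto
   thus False using uU by simp
  qed
  hence l: "1 / 2 - 2 * \<delta> <= cmod (lam (?c h))" using b[OF hH] by linarith
  have "cmod (lam (?c h)) * cmod (lam (?c k)) <= 3 * \<delta>"
  proof (rule a[OF H1[OF hH] H1[OF k]])
   fix \<tau> :: real assume "\<tau> \<in> {0..1}"
   thus "(1 - h \<tau>) * (1 - k \<tau>) = 0" using h1[of \<tau>] k1[of \<tau>] u(4) by (cases "be <= \<tau>") auto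
  qed
  moreover have "12 / 25 * cmod (lam (?c k)) <= cmod (lam (?c h)) * cmod (lam (?c k))"
   using l \<delta> by (intro mult_right_mono) auto
  ultimately have "cmod (lam (?c k)) <= 7 * \<delta>" using \<delta> by linarith
  thus ?thesis using lam_le[OF H1[OF k]] by linarith
 qed
 show thesis
 proof (rule that[of ts])
  show "ts \<in> {0..1}" using ts by simp
  show "peaked \<xi> ts (15 * \<delta>)" unfolding peaked_def
  proof (intro allI impI)
   fix k :: "real => real" and r :: real
   assume kc: "continuous_on {0..1} k" and k01: "\<forall>t\<in>{0..1}. 0 <= k t & k t <= 1" and r: "r > 0"
    and "\<forall>\<tau>\<in>{0..1}. \<bar>\<tau> - ts\<bar> <= r --> k \<tau> = 1"
   hence k1: "\<tau> \<in> {0..1} ==> \<bar>\<tau> - ts\<bar> <= r ==> k \<tau> = 1" for \<tau> by blast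
  have kH: "k \<in> H" using kc k01 by (auto simp: H_def)
  \<comment> \<open>k is split at ts: kl equals k on the left and 1 on the right, kr the other way
    round. Since k is 1 at ts, 1 - k is the sum of 1 - kl and 1 - kr, and the bounds 7 \<delta> and
    8 \<delta> add up to 15 \<delta>.\<close>
  define kl where "kl \<tau> = k (min \<tau> ts)" for \<tau>
  define kr where "kr \<tau> = k (max \<tau> ts)" for \<tau>
  have kts: "k ts = 1" using k1[of ts] ts r by simp
  have "continuous_on {0..1} kl" unfolding kl_def
   by (rule continuous_on_compose2[OF kc]) (use ts in \<open>auto intro!: continuous_intros\<close>)
  hence klH: "kl \<in> H" using k01 ts by (auto simp: H_def kl_def min_def)
  have "continuous_on {0..1} kr" unfolding kr_def
   by (rule continuous_on_compose2[OF kc]) (use ts in \<open>auto intro!: continuous_intros\<close>)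
  hence krH: "kr \<in> H" using k01 ts by (auto simp: H_def kr_def max_def)
  have "norm (cen (?c kl) \<xi>) <= 7 * \<delta>" by (rule A[OF klH, of "ts - r"]) (use r k1 kts ts in \<open>auto simp: kl_def min_def\<close>)
  moreover have "norm (cen (?c kr) \<xi>) <= 8 * \<delta>"
   by (rule B[OF krH, of "ts + r"]) (use r k1 kts ts in \<open>auto simp: kr_def max_def\<close>)
  moreover have "\<xi> - cen k \<xi> = cen (?c kl) \<xi> + cen (?c kr) \<xi>"
  proof -
   have "cen (?c kl) \<xi> + cen (?c kr) \<xi> = cen (%\<tau>. (1 - kl \<tau>) + (1 - kr \<tau>)) \<xi>"
    using cen_add[OF Hc[OF H1[OF klH]] Hc[OF H1[OF krH]]] by simp
   also have "\<dots> = cen (?c k) \<xi>" by (rule cen_cong) (simp add: kl_def kr_def min_def max_def kts)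
   finally have 1: "cen (?c kl) \<xi> + cen (?c kr) \<xi> = cen (?c k) \<xi>" .
   have "cen k \<xi> + cen (?c k) \<xi> = cen (%t. k t + (1 - k t)) \<xi>" using cen_add[OF Hc[OF kH] Hc[OF H1[OF kH]]] by simp
   also have "\<dots> = \<xi>" using cen_1 by simp
   finally show ?thesis unfolding 1 by (simp add: algebra_simps)
  qed
  ultimately show "norm (cen k \<xi> - \<xi>) <= 15 * \<delta>" using norm_triangle_ineq[of "cen (?c kl) \<xi>" "cen (?c kr) \<xi>"]
   by (simp add: norm_minus_commute[of "cen k \<xi>"])
  qed
 qed
qed

end

section \<open>A corner of a matrix fibre has no approximate character\<close>

definition tent :: "real => real => real => real" where
 "tent t r \<tau> = max 0 (min 1 (2 - \<bar>\<tau> - t\<bar> / r))"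

lemma norm_sum3: "norm (a + b + c) <= norm a + norm b + norm (c :: 'a :: real_normed_vector)"
 using norm_triangle_ineq[of "a + b" c] norm_triangle_ineq[of a b] by linarith

lemma norm_diff3: "norm (a - b - c) <= norm a + norm b + norm (c :: 'a :: real_normed_vector)"
 using norm_triangle_ineq4[of "a - b" c] norm_triangle_ineq4[of a b] by linarith

lemma norm_sum5: "norm (- a - b - c + d + e) <= norm a + norm b + norm c + norm d + norm (e :: 'a :: real_normed_vector)"
 using norm_sum3[of "- a - b - c" d e] norm_diff3[of "- a" b c] by simp

lemma tent_cont: "r > 0 ==> continuous_on S (tent t r)"
 unfolding tent_def[abs_def] by (intro continuous_intros) auto

lemma tent_range: "0 <= tent t r \<tau>" "tent t r \<tau> <= 1"
 by (auto simp: tent_def)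

lemma tent_eq_1: "r > 0 ==> \<bar>\<tau> - t\<bar> <= r ==> tent t r \<tau> = 1"
 by (simp add: tent_def)

lemma tent_eq_0: "r > 0 ==> 2 * r <= \<bar>\<tau> - t\<bar> ==> tent t r \<tau> = 0"
 by (simp add: tent_def pos_le_divide_eq)

text \<open>\<open>E\<close> are matrix units of a fibre of a small subalgebra, cut down by a bump function; conjugating
 with them maps operators \<open>y\<close> to operators \<open>K y\<close> almost commuting with that subalgebra.\<close>

locale corner = dd_rep p q R for p q and R :: "(real => cmat) => 'x ell2 => 'x ell2" +
 fixes J :: "'k set" and E Es :: "'k => 'x ell2 => 'x ell2" and B :: "real => cmat"
 assumes J: "finite J"
  and B: "B \<in> Mfun p q"
  and El: "i \<in> J ==> cblinear (E i)" and Esl: "i \<in> J ==> cblinear (Es i)"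
  and Ead: "i \<in> J ==> inner (E i v) w = inner v (Es i w)"
  and En: "i \<in> J ==> norm (E i v) <= norm v"
  and EE: "i \<in> J ==> j \<in> J ==> Es i (E j v) = (if i = j then R B v else 0)"
  and Ess: "(\<Sum>i\<in>J. (norm (Es i v))\<^sup>2) <= (norm v)\<^sup>2"
begin

definition K :: "('x ell2 => 'x ell2) => 'x ell2 => 'x ell2" where
 "K y v = (\<Sum>i\<in>J. E i (y (Es i v)))"

text \<open>By \<open>EE\<close> the vectors \<open>E i (y (Es i v))\<close> are mutually
  orthogonal, so the squares of their norms add up, and \<open>Ess\<close> bounds the sum. The
  constant is thus not multiplied by the number of summands.\<close>

lemma K_norm:
 assumes C: "0 <= C" "!!v. norm (y v) <= C * norm v"
 shows "norm (K y v) <= C * norm v"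
proof -
 define w where "w i = y (Es i v)" for i
 have "(norm (K y v))\<^sup>2 = (\<Sum>i\<in>J. \<Sum>j\<in>J. inner (E j (w j)) (E i (w i)))"
  by (simp add: K_def power2_norm_eq_inner inner_sum_left inner_sum_right w_def)
 also have "\<dots> = (\<Sum>i\<in>J. \<Sum>j\<in>J. if j = i then (norm (E i (w i)))\<^sup>2 else 0)"
  by (intro sum.cong refl) (auto simp: Ead EE power2_norm_eq_inner)
 also have "\<dots> = (\<Sum>i\<in>J. (norm (E i (w i)))\<^sup>2)" using J by simp
 also have "\<dots> <= (\<Sum>i\<in>J. C\<^sup>2 * (norm (Es i v))\<^sup>2)"
 proof (rule sum_mono)
  fix i assume "i \<in> J"
  hence "norm (E i (w i)) <= C * norm (Es i v)" using En[of i "w i"] C(2)[of "Es i v"] by (simp add: w_def)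
  hence "(norm (E i (w i)))\<^sup>2 <= (C * norm (Es i v))\<^sup>2" by (rule power_mono) simp
  thus "(norm (E i (w i)))\<^sup>2 <= C\<^sup>2 * (norm (Es i v))\<^sup>2" by (simp add: power_mult_distrib)
 qed
 also have "\<dots> <= C\<^sup>2 * (norm v)\<^sup>2" using mult_left_mono[OF Ess[of v], of "C\<^sup>2"] by (simp add: sum_distrib_left)
 also have "\<dots> = (C * norm v)\<^sup>2" by (simp add: power_mult_distrib)
 finally show ?thesis by (rule power2_le_imp_le) (simp add: C)
qed

lemma K_diff: "K (%u. y u - z u) v = K y v - K z v"
 unfolding K_def sum_subtractf[symmetric] by (rule sum.cong) (auto simp: cblinear_diff[OF El])

lemma K_add: "K (%u. y u + z u) v = K y v + K z v"
 unfolding K_def sum.distrib[symmetric] by (rule sum.cong) (auto simp: cblinear_add[OF El])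

lemma K_lin_diff: "cblinear y ==> K y (v - w) = K y v - K y w"
 unfolding K_def sum_subtractf[symmetric]
 by (rule sum.cong) (auto simp: cblinear_diff[OF El] cblinear_diff[OF Esl] cblinear_diff)

lemma K_scale: "cblinear y ==> K y (scaleC c v) = scaleC c (K y v)"
proof -
 assume y: "cblinear y"
 have s: "scaleC c (sum f J) = (\<Sum>i\<in>J. scaleC c (f i))" for f :: "'k => 'x ell2"
  by (rule cblinear_sum[OF cblinear_smult[OF cblinear_id]])
 show ?thesis unfolding K_def s
  by (rule sum.cong) (auto simp: cblinear_scaleC[OF El] cblinear_scaleC[OF Esl] cblinear_scaleC[OF y])
qed

text \<open>\<open>K\<close> is multiplicative up to the insertion of \<open>R B\<close>. It is
  applied to operators on which \<open>R B\<close> acts almost as a unit.\<close>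

lemma K_comp: "cblinear y ==> K y (K z v) = K (%u. y (R B (z u))) v"
 unfolding K_def
proof (rule sum.cong)
 fix i assume y: "cblinear y" and i: "i \<in> J"
 have "Es i (\<Sum>j\<in>J. E j (z (Es j v))) = (\<Sum>j\<in>J. if j = i then R B (z (Es i v)) else 0)"
  unfolding cblinear_sum[OF Esl[OF i]] by (rule sum.cong) (auto simp: EE i)
 thus "E i (y (Es i (\<Sum>j\<in>J. E j (z (Es j v))))) = E i (y (R B (z (Es i v))))" using J i by simp
qed simp

text \<open>If the square of a is almost zero and \<xi> is almost an eigenvector of a, then a \<xi>
  is almost zero. In the fibre at \<open>s\<close>, where \<xi> concentrates, \<open>P1\<close> and
  \<open>P2\<close> are nonzero with orthogonal ranges below \<open>B1\<close>. So that corner has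
  rank at least two, and a projection Q acting as a unit on it is a sum of products of nilpotents;
  cut down near \<open>s\<close> and transported by \<open>K\<close>, Q almost annihilates \<xi>.
  But Q acts as a unit on \<open>B2 s\<close>, and \<open>b2\<close> almost fixes \<xi>.\<close>

lemma no_approx_character:
 fixes \<xi> :: "'x ell2" and b2 :: "'x ell2 => 'x ell2"
 defines "\<delta> \<equiv> 1 / 10000 :: real"
 assumes \<xi>: "norm \<xi> = 1" and s: "s \<in> {0..1}" and cs: "peaked \<xi> s (15 * \<delta>)"
  and B12: "B1 \<in> Mfun p q" "B2 \<in> Mfun p q" "P1 \<in> Mfun p q" "P2 \<in> Mfun p q"
  and m: "mm I (B s) (B1 s) = B1 s" "mm I (B1 s) (B2 s) = B2 s"
   "mm I (B1 s) (P1 s) = P1 s" "mm I (B1 s) (P2 s) = P2 s"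
   "mm I (madj (P1 s)) (P2 s) = (%i j. 0)" "P1 s ~= (%i j. 0)" "P2 s ~= (%i j. 0)"
  and B2a: "fadj B2 = B2"
  and Esb: "!!i v. i \<in> J ==> Es i (b2 v) = R B2 (Es i v)"
  and b2: "!!v. b2 v = (\<Sum>i\<in>J. E i (R B2 (Es i v)))" "norm (b2 \<xi> - \<xi>) <= 15 * \<delta>"
  and cenE: "!!h i v. continuous_on {0..1} h ==> i \<in> J ==> cen h (E i v) = E i (cen h v)"
  and NC: "!!M. M \<in> Mfun p q ==> (!!v. norm (R M v) <= norm v) ==> \<exists>c. norm (K (R M) \<xi> - scaleC c \<xi>) <= \<delta>"
 shows False
proof -
 let ?J = "fJ s p q"
 have \<delta>0: "\<delta> > 0" by (simp add: \<delta>_def)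
 have fib: "B1 s \<in> Fib s p q" "B2 s \<in> Fib s p q" "P1 s \<in> Fib s p q" "P2 s \<in> Fib s p q" using B12 MfunD(2) s by blast+
 obtain \<beta>1 where \<beta>1: "supp ?J \<beta>1" "B1 s = iota s p q \<beta>1" using fib(1) unfolding Fib_def by blast
 obtain \<beta>2 where \<beta>2: "supp ?J \<beta>2" "B2 s = iota s p q \<beta>2" using fib(2) unfolding Fib_def by blast
 obtain \<pi>1 where \<pi>1: "supp ?J \<pi>1" "P1 s = iota s p q \<pi>1" using fib(3) unfolding Fib_def by blast
 obtain \<pi>2 where \<pi>2: "supp ?J \<pi>2" "P2 s = iota s p q \<pi>2" using fib(4) unfolding Fib_def by blast
 have inj: "a = b" if "supp ?J a" "supp ?J b" "iota s p q a = iota s p q b" for a b using iota_inj[OF pq that] .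
 have mj: "mm ?J \<beta>1 \<beta>2 = \<beta>2" "mm ?J \<beta>1 \<pi>1 = \<pi>1" "mm ?J \<beta>1 \<pi>2 = \<pi>2" "mm ?J (madj \<pi>1) \<pi>2 = (%i j. 0)"
  by (rule inj; use m(2-5) \<beta>1 \<beta>2 \<pi>1 \<pi>2 in \<open>simp add: supp_mm supp_madj iota_mm[symmetric] iota_madj[symmetric] iota_zero\<close>;
   simp add: supp_def)+
 have pn: "\<pi>1 ~= (%i j. 0)" "\<pi>2 ~= (%i j. 0)" using m(6,7) \<pi>1 \<pi>2 iota_zero by auto
 obtain u1 u2 where u: "supp ?J u1" "supp ?J u2" "mm ?J u1 u1 = (%i j. 0)" "mm ?J u2 u2 = (%i j. 0)"
  and ux: "!!x. x \<in> {u1, madj u1, u2, madj u2} ==> mm ?J \<beta>1 x = x & mm ?J (mm ?J (madj x) x) (mm ?J (madj x) x) = mm ?J (madj x) x"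
  and uq: "!!q'. q' = (%i j. mm ?J (madj u1) u1 i j + mm ?J u1 (madj u1) i j + mm ?J u2 (madj u2) i j) ==>
    madj q' = q' & mm ?J q' q' = q' & (\<forall>C. supp ?J C & mm ?J \<beta>1 C = C --> mm ?J q' C = C)"
  using nilpotent_decomposition[OF finite_fJ \<beta>1(1) \<pi>1(1) \<pi>2(1) pn mj(4,2,3)] by blast
 define X where "X = {iota s p q u1, iota s p q (madj u1), iota s p q u2, iota s p q (madj u2)}"
 define q' where "q' = (%i j. mm ?J (madj u1) u1 i j + mm ?J u1 (madj u1) i j + mm ?J u2 (madj u2) i j)"
 define Q where "Q = iota s p q q'"
 have q's: "supp ?J q'" using u by (auto simp: q'_def supp_def madj_def mm_def)
 have Xex: "\<exists>u\<in>{u1, madj u1, u2, madj u2}. x = iota s p q u" if "x \<in> X" for x using that by (auto simp: X_def)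
 have XF: "x \<in> Fib s p q" if "x \<in> X" for x using that u by (auto simp: X_def intro!: FibI supp_madj)
 have Xm: "madj x \<in> X" if "x \<in> X" for x using that by (auto simp: X_def iota_madj)
 have X0: "mm I x x = (%i j. 0)" if "x \<in> X" for x
 proof -
  have "mm ?J (madj u1) (madj u1) = (%i j. 0)" "mm ?J (madj u2) (madj u2) = (%i j. 0)"
   using u(3,4) by (simp_all add: madj_mm[symmetric]) (simp_all add: madj_def)
  thus ?thesis using that u by (auto simp: X_def iota_mm iota_zero)
 qed
 have XB1: "mm I (B1 s) x = x" if xX: "x \<in> X" for x
 proof -
  obtain u where "u \<in> {u1, madj u1, u2, madj u2}" "x = iota s p q u" using Xex[OF xX] by blast
  thus ?thesis using ux[of u] by (simp add: \<beta>1(2) iota_mm)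
 qed
 have XB: "mm I (B s) x = x" if "x \<in> X" for x
 proof -
  have "mm I (B s) x = mm I (B s) (mm I (B1 s) x)" by (simp only: XB1[OF that])
  also have "\<dots> = mm I (B1 s) x" unfolding mm_assoc[symmetric] m(1) ..
  finally show ?thesis by (simp only: XB1[OF that])
 qed
 have Xe: "mm I (mm I (madj x) x) (mm I (madj x) x) = mm I (madj x) x" if xX: "x \<in> X" for x
 proof -
  obtain u where "u \<in> {u1, madj u1, u2, madj u2}" "x = iota s p q u" using Xex[OF xX] by blast
  thus ?thesis using ux[of u] by (simp add: iota_mm iota_madj)
 qed
 have q'p: "madj q' = q'" "mm ?J q' q' = q'" "mm ?J q' \<beta>2 = \<beta>2" using uq[OF q'_def] \<beta>2(1) mj(1) by blast+
 have Qp: "madj Q = Q" "mm I Q Q = Q" "mm I Q (B2 s) = B2 s" by (simp_all add: Q_def iota_madj iota_mm q'p \<beta>2(2))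
 have B2s: "madj (B2 s) = B2 s" using B2a by (metis fadj_def)
 have QB2: "mm I (B2 s) Q = B2 s" using arg_cong[OF Qp(3), of madj] by (simp add: madj_mm Qp(1) B2s)
 have QF: "Q \<in> Fib s p q" unfolding Q_def by (rule FibI[OF q's])
 have Qsum: "Q = (%i j. mm I (madj (iota s p q u1)) (iota s p q u1) i j + mm I (iota s p q u1) (madj (iota s p q u1)) i j
   + mm I (iota s p q u2) (madj (iota s p q u2)) i j)" by (simp add: Q_def q'_def iota_add iota_mm iota_madj)
 have X4: "finite X" by (simp add: X_def)
 have "\<exists>r>0. \<forall>h. nearh s r h --> adm p q h x & (\<forall>v. norm (R B (opp h x v) - opp h x v) <= \<delta> * norm v)"
  if x: "x \<in> X" for x using near_mult[OF B s XF[OF x] \<delta>0] unfolding XB[OF x] .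
 then obtain rx where rx: "!!x. x \<in> X ==> rx x > 0"
  "!!x h. x \<in> X ==> nearh s (rx x) h ==> adm p q h x & (\<forall>v. norm (R B (opp h x v) - opp h x v) <= \<delta> * norm v)" by metis
 obtain r1 where r1: "r1 > 0"
  "!!h. nearh s r1 h ==> adm p q h Q & (\<forall>v. norm (R B2 (opp h Q v) - opp h (B2 s) v) <= \<delta> * norm v)"
  using near_mult[OF B12(2) s QF \<delta>0] unfolding QB2 by (elim exE conjE) simp
 have B2one: "mm I (B2 s) (mone I) = B2 s" using Fib_supp[OF fib(2)] by (simp add: mm_one)
 obtain r2 where r2: "r2 > 0"
  "!!h. nearh s r2 h ==> adm p q h (mone I) & (\<forall>v. norm (R B2 (opp h (mone I) v) - opp h (B2 s) v) <= \<delta> * norm v)"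
  using near_mult[OF B12(2) s Fib_one \<delta>0] unfolding B2one by (elim exE conjE) simp
 define r where "r = Min (insert r1 (insert r2 (rx ` X)))"
 have r: "r > 0" "r <= r1" "r <= r2" "!!x. x \<in> X ==> r <= rx x"
  proof -
  have fin: "finite (insert r1 (insert r2 (rx ` X)))" using X4 by simp
  show "r > 0" unfolding r_def using fin r1(1) r2(1) rx(1) by (subst Min_gr_iff) auto
  show "r <= r1" "r <= r2" "!!x. x \<in> X ==> r <= rx x" unfolding r_def by (rule Min_le[OF fin], simp)+
 qed
 \<comment> \<open>A bump at s that vanishes beyond distance r, where all the estimates of
   \<open>near_mult\<close> are available. Products of two cut-down nilpotents carry its square
   \<open>bb\<close>.\<close>
 define bt where "bt = tent s (r / 2)"
 define b where "b t = complex_of_real (bt t)" for t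
 define bb where "bb t = complex_of_real (bt t * bt t)" for t
 have btc: "continuous_on {0..1} bt" unfolding bt_def using r(1) by (intro tent_cont) simp
 have bt01: "0 <= bt t" "bt t <= 1" for t by (simp_all add: bt_def tent_range)
 have bt2: "0 <= bt t * bt t" "bt t * bt t <= 1" for t using bt01[of t] by (auto intro: mult_le_one)
 have bts: "\<bar>\<tau> - s\<bar> <= r" if "bt \<tau> ~= 0" for \<tau> using tent_eq_0[of "r/2" \<tau> s] that r(1) by (force simp: bt_def)
 have nb: "nearh s r b" unfolding nearh_def b_def using btc bt01 bts by (auto intro!: continuous_intros)
 have nbb: "nearh s r bb" unfolding nearh_def bb_def
  using btc bt2 bts by (auto intro!: continuous_intros simp del: of_real_mult)
 have bbb: "(%t. b t * b t) = bb" by (simp add: b_def bb_def fun_eq_iff)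
 have xadm: "adm p q b x" if "x \<in> X" for x using rx(2)[OF that nearh_mono[OF nb r(4)[OF that]]] by blast
 have xR: "norm (R B (opp b x v) - opp b x v) <= \<delta> * norm v" if "x \<in> X" for x v
  using rx(2)[OF that nearh_mono[OF nb r(4)[OF that]]] by blast
 have Qadm: "adm p q bb Q" and QR: "norm (R B2 (opp bb Q v) - opp bb (B2 s) v) <= \<delta> * norm v" for v
  using r1(2)[OF nearh_mono[OF nbb r(2)]] by blast+
 have oadm: "adm p q bb (mone I)" and oR: "norm (R B2 (opp bb (mone I) v) - opp bb (B2 s) v) <= \<delta> * norm v" for v
  using r2(2)[OF nearh_mono[OF nbb r(3)]] by blast+
 have xn: "norm (opp b x v) <= norm v" if "x \<in> X" for x v
  using norm_opp_le[OF xadm[OF that] _ _ Xe[OF that], of 1 v] bt01 by (simp add: b_def)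
 have Qn: "norm (opp bb Q v) <= norm v" for v
  using norm_opp_le[OF Qadm, of 1 v] bt2 by (simp add: bb_def Qp del: of_real_mult)
 define a where "a x = K (opp b x)" for x
 have an: "norm (a x v) <= norm v" if "x \<in> X" for x v using K_norm[of 1 "opp b x" v] xn[OF that] by (simp add: a_def)
 have al: "cblinear (opp b x)" if "x \<in> X" for x using xadm[OF that] by (rule opp_lin)
 \<comment> \<open>Composing inserts \<open>R B\<close> by \<open>K_comp\<close>. At s the matrix
   \<open>B s\<close> acts as a unit on the elements of \<open>X\<close>, so on the support of the
   bump the insertion costs at most \<delta>.\<close>
 have aa: "norm (a x (a y v) - K (opp bb (mm I x y)) v) <= \<delta> * norm v" if x: "x \<in> X" and y: "y \<in> X" for x y v
 proof -
  have "a x (a y v) - K (opp bb (mm I x y)) v = K (%u. opp b x (R B (opp b y u) - opp b y u)) v"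
   using opp_mult[OF xadm[OF x] xadm[OF y]]
   by (simp add: a_def K_comp[OF al[OF x]] K_diff cblinear_diff[OF al[OF x]] bbb)
  also have "norm \<dots> <= \<delta> * norm v" by (rule K_norm) (use \<delta>0 xn[OF x] xR[OF y] in \<open>auto intro: order_trans\<close>)
  finally show ?thesis .
 qed
 have K0: "K (opp bb (%i j. 0)) v = 0" for v by (simp add: K_def opp_zero cblinear_0[OF El])
 \<comment> \<open>With c the approximate eigenvalue, c^2 \<xi> differs from zero by three errors,
   \<delta>, \<delta> and (1 + \<delta>) \<delta>, together at most 4 \<delta>. The value \<delta> =
   1/10000 makes 4 \<delta> the square of 2/100.\<close>
 have small: "norm (a x \<xi>) <= 21 / 1000" if x: "x \<in> X" for x
 proof -
  obtain c where c: "norm (a x \<xi> - scaleC c \<xi>) <= \<delta>"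
   using NC[OF Mfun_hs[OF xadm[OF x]]] xn[OF x] unfolding a_def opp_def by blast
  have c1: "cmod c <= 1 + \<delta>"
   using norm_triangle_ineq2[of "scaleC c \<xi>" "a x \<xi>"] c an[OF x, of \<xi>] \<xi> by (simp add: norm_minus_commute)
  have 1: "norm (a x (a x \<xi>)) <= \<delta>" using aa[OF x x, of \<xi>] X0[OF x] K0 \<xi> by simp
  have 2: "norm (a x (a x \<xi> - scaleC c \<xi>)) <= \<delta>" using an[OF x, of "a x \<xi> - scaleC c \<xi>"] c by linarith
  have 3: "norm (scaleC c (a x \<xi> - scaleC c \<xi>)) <= (1 + \<delta>) * \<delta>" using c c1 \<delta>0 by (simp add: mult_mono)
  have "scaleC (c * c) \<xi> = a x (a x \<xi>) - a x (a x \<xi> - scaleC c \<xi>) - scaleC c (a x \<xi> - scaleC c \<xi>)"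
   unfolding a_def by (simp add: K_lin_diff[OF al[OF x]] K_scale[OF al[OF x]] scaleC_minus)
  hence "norm (scaleC (c * c) \<xi>) <= norm (a x (a x \<xi>)) + norm (a x (a x \<xi> - scaleC c \<xi>)) + norm (scaleC c (a x \<xi> - scaleC c \<xi>))"
   by (simp only: norm_diff3)
  hence "(cmod c)\<^sup>2 <= 4 * \<delta>" using 1 2 3 \<xi> by (simp add: norm_mult power2_eq_square \<delta>_def)
  also have "\<dots> = (2 / 100)\<^sup>2" by (simp add: \<delta>_def power2_eq_square)
  finally have "cmod c <= 2 / 100" by (rule power2_le_imp_le) simp
  thus ?thesis using c norm_triangle_ineq2[of "a x \<xi>" "scaleC c \<xi>"] \<xi> by (simp add: \<delta>_def)
 qed
 have sm2: "norm (K (opp bb (mm I (madj x) x)) \<xi>) <= 22 / 1000" if x: "x \<in> X" for x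
 proof -
  have "norm (a (madj x) (a x \<xi>)) <= 21 / 1000" using an[OF Xm[OF x], of "a x \<xi>"] small[OF x] by linarith
  moreover have "norm (a (madj x) (a x \<xi>) - K (opp bb (mm I (madj x) x)) \<xi>) <= \<delta>" using aa[OF Xm[OF x] x, of \<xi>] \<xi> by simp
  ultimately show ?thesis using norm_triangle_ineq2[of "K (opp bb (mm I (madj x) x)) \<xi>" "a (madj x) (a x \<xi>)"]
   by (simp add: \<delta>_def norm_minus_commute)
 qed
 have KQ: "norm (K (opp bb Q) \<xi>) <= 66 / 1000"
 proof -
  let ?x1 = "iota s p q u1" and ?x2 = "iota s p q u2"
  have xX: "?x1 \<in> X" "madj ?x1 \<in> X" "madj ?x2 \<in> X" by (auto simp: X_def iota_madj)
  have ad: "adm p q bb (mm I (madj x) x)" if "x \<in> X" for x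
   using adm_mm[OF xadm[OF Xm[OF that]] xadm[OF that]] bbb by simp
  have ad2: "adm p q bb (%i j. mm I (madj ?x1) ?x1 i j + mm I ?x1 (madj ?x1) i j)"
   using ad[OF xX(1)] ad[OF xX(2)] by (intro adm_add) auto
  have "opp bb Q = (%v. opp bb (mm I (madj ?x1) ?x1) v + opp bb (mm I ?x1 (madj ?x1)) v + opp bb (mm I ?x2 (madj ?x2)) v)"
   unfolding Qsum using ad[OF xX(1)] ad[OF xX(2)] ad[OF xX(3)] ad2 by (intro ext) (simp add: opp_add_right)
  hence KS: "K (opp bb Q) \<xi> = K (opp bb (mm I (madj ?x1) ?x1)) \<xi> + K (opp bb (mm I ?x1 (madj ?x1))) \<xi> + K (opp bb (mm I ?x2 (madj ?x2))) \<xi>"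
   by (simp add: K_add)
  have "norm (K (opp bb Q) \<xi>) <= norm (K (opp bb (mm I (madj ?x1) ?x1)) \<xi>) + norm (K (opp bb (mm I ?x1 (madj ?x1))) \<xi>) + norm (K (opp bb (mm I ?x2 (madj ?x2))) \<xi>)"
   unfolding KS by (rule norm_sum3)
  thus ?thesis using sm2[OF xX(1)] sm2[OF xX(2), unfolded madj_madj] sm2[OF xX(3), unfolded madj_madj] by linarith
 qed
 \<comment> \<open>Wanted is that Q - 1, cut down by the bump, almost annihilates the range of
   \<open>R B2\<close>, that is a bound for \<open>Z'\<close>. \<open>near_mult\<close> estimates
   products with the bump on the right, so it bounds the adjoint \<open>Z\<close> instead, and the
   bound is carried over.\<close>
 define Z where "Z u = R B2 (opp bb Q u - opp bb (mone I) u)" for u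
 define Z' where "Z' w = opp bb Q (R B2 w) - opp bb (mone I) (R B2 w)" for w
 have RB2: "cblinear (R B2)" by (rule lin[OF B12(2)])
 have Zn: "norm (Z u) <= 2 * \<delta> * norm u" for u unfolding Z_def cblinear_diff[OF RB2]
  using norm_triangle_ineq4[of "R B2 (opp bb Q u) - opp bb (B2 s) u" "R B2 (opp bb (mone I) u) - opp bb (B2 s) u"] QR[of u] oR[of u]
  by simp
 have bbr: "(%t. cnj (bb t)) = bb" by (simp add: bb_def fun_eq_iff)
 have Zad: "inner (Z u) w = inner u (Z' w)" for u w unfolding Z_def Z'_def
  by (simp add: R_adj[OF B12(2)] B2a inner_diff_left inner_diff_right opp_adj[OF Qadm] opp_adj[OF oadm] bbr Qp)
 have Z'n: "norm (Z' w) <= 2 * \<delta> * norm w" for w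
 proof (cases "norm (Z' w) = 0")
  case True
  thus ?thesis using \<delta>0 by simp
 next
  case False
  have "norm (Z' w) * norm (Z' w) = inner (Z (Z' w)) w" by (simp add: Zad power2_norm_eq_inner[symmetric] power2_eq_square)
  also have "\<dots> <= norm (Z (Z' w)) * norm w" by (rule norm_cauchy_schwarz)
  also have "\<dots> <= 2 * \<delta> * norm (Z' w) * norm w" by (rule mult_right_mono[OF Zn]) simp
  finally have "norm (Z' w) * norm (Z' w) <= norm (Z' w) * (2 * \<delta> * norm w)" by (simp add: mult_ac)
  thus ?thesis using False mult_le_cancel_left_pos[of "norm (Z' w)"] by simp
 qed
 define k where "k t = bt t * bt t" for t
 have kc: "continuous_on {0..1} k" unfolding k_def using btc by (intro continuous_intros)
 have cenk: "cen k v = opp bb (mone I) v" for v by (simp only: cen_def k_def bb_def[abs_def])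
 have ck: "norm (cen k \<xi> - \<xi>) <= 15 * \<delta>"
  by (rule peakedD[OF cs kc, of "r/2"]) (use bt2 r(1) tent_eq_1[of "r/2" _ s] in \<open>auto simp: k_def bt_def\<close>)
 have cn: "norm (cen k v) <= norm v" for v by (rule cen_norm_le[OF kc]) (use bt2 in \<open>auto simp: k_def\<close>)
 have dif: "K (opp bb Q) (b2 \<xi>) - cen k (b2 \<xi>) = K Z' \<xi>"
 proof -
  have "K (opp bb Q) (b2 \<xi>) = (\<Sum>i\<in>J. E i (opp bb Q (R B2 (Es i \<xi>))))"
   unfolding K_def by (rule sum.cong) (simp_all add: Esb)
  moreover have "cen k (b2 \<xi>) = (\<Sum>i\<in>J. E i (opp bb (mone I) (R B2 (Es i \<xi>))))"
   unfolding b2(1) cblinear_sum[OF cen_lin[OF kc]] by (rule sum.cong) (simp_all add: cenE[OF kc] flip: cenk)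
  ultimately show ?thesis
   unfolding K_def Z'_def by (simp add: sum_subtractf[symmetric]) (rule sum.cong, simp_all add: cblinear_diff[OF El])
 qed
 have d1: "norm (K (opp bb Q) (b2 \<xi>) - cen k (b2 \<xi>)) <= 2 * \<delta>"
  unfolding dif using K_norm[of "2 * \<delta>" Z' \<xi>] Z'n \<delta>0 \<xi> by simp
 have d2: "norm (K (opp bb Q) (b2 \<xi> - \<xi>)) <= 15 * \<delta>" using K_norm[of 1 "opp bb Q" "b2 \<xi> - \<xi>"] Qn b2(2) by simp
 have d3: "norm (cen k (b2 \<xi> - \<xi>)) <= 15 * \<delta>" using cn[of "b2 \<xi> - \<xi>"] b2(2) by linarith
 \<comment> \<open>A telescoping sum from \<xi> through \<open>cen k \<xi>\<close> and the two
   images of \<open>b2 \<xi>\<close> to the image under Q. The errors are 15 + 15 + 2 + 15 times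
   \<delta>, and 66/1000 remains for the last term, far less than the norm 1 of \<xi>.\<close>
 have xi: "\<xi> = - (cen k \<xi> - \<xi>) - cen k (b2 \<xi> - \<xi>) - (K (opp bb Q) (b2 \<xi>) - cen k (b2 \<xi>)) + K (opp bb Q) (b2 \<xi> - \<xi>) + K (opp bb Q) \<xi>"
  by (simp add: K_lin_diff[OF opp_lin[OF Qadm]] cblinear_diff[OF cen_lin[OF kc]])
 have "norm \<xi> <= norm (cen k \<xi> - \<xi>) + norm (cen k (b2 \<xi> - \<xi>)) + norm (K (opp bb Q) (b2 \<xi>) - cen k (b2 \<xi>))
   + norm (K (opp bb Q) (b2 \<xi> - \<xi>)) + norm (K (opp bb Q) \<xi>)"
  by (rule ord_eq_le_trans[OF arg_cong[OF xi, of norm] norm_sum5])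
 hence "norm \<xi> <= 15 * \<delta> + 15 * \<delta> + 2 * \<delta> + 15 * \<delta> + 66 / 1000" using ck d1 d2 d3 KQ by linarith
 thus False unfolding \<xi> by (simp add: \<delta>_def)
qed

end

section \<open>Matrix units of a fibre and almost commuting averages\<close>

lemma adjoint_bound:
 assumes Y: "!!w. norm (Y w) <= c * norm w" and ad: "!!w v. inner (Y w) v = inner w (Y' v)" and c: "0 <= c"
 shows "norm (Y' v :: 'a :: real_inner) <= c * norm (v :: 'b :: real_inner)"
proof (cases "norm (Y' v) = 0")
 case True
 thus ?thesis using c by simp
next
 case False
 have "norm (Y' v) * norm (Y' v) = inner (Y (Y' v)) v" by (simp add: ad power2_norm_eq_inner[symmetric] power2_eq_square)
 also have "\<dots> <= norm (Y (Y' v)) * norm v" by (rule norm_cauchy_schwarz)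
 also have "\<dots> <= c * norm (Y' v) * norm v" by (rule mult_right_mono[OF Y]) simp
 finally have "norm (Y' v) * norm (Y' v) <= norm (Y' v) * (c * norm v)" by (simp add: mult_ac)
 thus ?thesis using False mult_le_cancel_left_pos[of "norm (Y' v)"] by simp
qed

definition munit :: "real => nat => nat => nat \<times> nat => nat \<times> nat => cmat" where
 "munit t p q i j = iota t p q (%x y. if x = i & y = j then 1 else 0)"

lemma munit_Fib: "i \<in> fJ t p q ==> j \<in> fJ t p q ==> munit t p q i j \<in> Fib t p q"
 unfolding munit_def by (rule FibI) (auto simp: supp_def)

lemma munit_madj: "madj (munit t p q i j) = munit t p q j i"
 unfolding munit_def iota_madj by (rule arg_cong[where f="iota t p q"]) (auto simp: madj_def fun_eq_iff)

lemma mm_munit: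
 assumes "i \<in> fJ t p q"
 shows "mm (idx p q) (iota t p q g) (munit t p q i l) = (%x y. iota t p q (%x y. if y = l then g x i else 0) x y)"
 unfolding munit_def iota_mm
proof (rule arg_cong[where f="iota t p q"], intro ext)
 fix x y
 have "mm (fJ t p q) g (%x y. if x = i & y = l then 1 else 0) x y = (\<Sum>k\<in>fJ t p q. if k = i then (if y = l then g x i else 0) else 0)"
  unfolding mm_def by (rule sum.cong) auto
 thus "mm (fJ t p q) g (%x y. if x = i & y = l then 1 else 0) x y = (if y = l then g x i else 0)" using assms by simp
qed

lemma munit_mm:
 assumes "j \<in> fJ t p q" "k \<in> fJ t p q"
 shows "mm (idx p q) (munit t p q i j) (munit t p q k l) = (if j = k then munit t p q i l else (%x y. 0))"
 using mm_munit[OF assms(2), of "%x y. if x = i & y = j then 1 else 0" l]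
 by (auto simp: munit_def iota_zero intro!: arg_cong[where f="iota t p q"] simp del: iota_zero) (simp_all add: iota_def fun_eq_iff)

lemma mm_munit_sum:
 assumes "i \<in> fJ t p q" "supp (fJ t p q) g"
 shows "mm (idx p q) (iota t p q g) (munit t p q i l) = (%x y. \<Sum>j\<in>fJ t p q. g j i * munit t p q j l x y)"
proof (intro ext)
 fix x y
 show "mm (idx p q) (iota t p q g) (munit t p q i l) x y = (\<Sum>j\<in>fJ t p q. g j i * munit t p q j l x y)"
 proof (cases "x \<in> idx p q & y \<in> idx p q & fka t x = fka t y")
  case True
  have "(\<Sum>j\<in>fJ t p q. g j i * munit t p q j l x y) = (\<Sum>j\<in>fJ t p q. if j = fpi t x then (if fpi t y = l then g (fpi t x) i else 0) else 0)"
   by (rule sum.cong) (use True in \<open>auto simp: munit_def iota_def\<close>)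
  also have "\<dots> = (if fpi t y = l then g (fpi t x) i else 0)" using fpi_fJ[of x p q t] True by simp
  finally show ?thesis unfolding mm_munit[OF assms(1)] using True by (simp add: iota_def)
 next
  case False
  hence "munit t p q j l x y = 0" for j by (simp only: munit_def iota_def if_False)
  moreover have "iota t p q h x y = 0" for h using False by (simp only: iota_def if_False)
  ultimately show ?thesis unfolding mm_munit[OF assms(1)] by simp
 qed
qed

lemma munit_sum: "(%x y. \<Sum>i\<in>fJ t p q. munit t p q i i x y) = mone (idx p q)"
proof (intro ext)
 fix x y
 show "(\<Sum>i\<in>fJ t p q. munit t p q i i x y) = mone (idx p q) x y"
 proof (cases "x \<in> idx p q & y \<in> idx p q & fka t x = fka t y")
  case True
  have "(\<Sum>i\<in>fJ t p q. munit t p q i i x y) = (\<Sum>i\<in>fJ t p q. if i = fpi t x then (if fpi t y = fpi t x then 1 else 0) else 0)"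
   by (rule sum.cong) (use True in \<open>auto simp: munit_def iota_def\<close>)
  also have "\<dots> = (if fpi t y = fpi t x then 1 else 0)" using fpi_fJ[of x p q t] True by simp
  finally show ?thesis using True fpi_fka_eqD[of t x y] by (auto simp: mone_def)
 next
  case False
  hence "munit t p q i i x y = 0" for i by (simp only: munit_def iota_def if_False)
  thus ?thesis using False by (auto simp: mone_def)
 qed
qed

lemma munit_nonzero:
 assumes "p \<ge> 1" "q \<ge> 1" "i \<in> fJ t p q" "j \<in> fJ t p q"
 shows "munit t p q i j ~= (%x y. 0)"
proof
 assume "munit t p q i j = (%x y. 0)"
 hence "munit t p q i j i j = 0" by simp
 thus False using iota_fJ[OF assms] by (simp add: munit_def)
qed

context dd_rep
begin

lemma opp_sum:
 assumes "finite S" "!!i. i \<in> S ==> adm p q h (a i)" "continuous_on {0..1} h"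
 shows "adm p q h (%x y. \<Sum>i\<in>S. a i x y) & opp h (%x y. \<Sum>i\<in>S. a i x y) v = (\<Sum>i\<in>S. opp h (a i) v)" using assms
proof (induction S rule: finite_induct)
 case empty
 thus ?case by (simp add: opp_zero adm_zero)
next
 case (insert i S)
 hence "adm p q h (%x y. a i x y + (\<Sum>i\<in>S. a i x y))" by (intro adm_add) auto
 thus ?case using insert opp_add_right[of h "a i" "%x y. \<Sum>i\<in>S. a i x y" v] by simp
qed

lemma adm_scale_right: "adm p q h a ==> adm p q h (%x y. c * a x y)"
 by (auto simp: adm_def supp_def Fib_scale)

text \<open>Write e_ij for the matrix units at t and \<gamma> for the small matrix of g at t. On the
  support of the bump, g e_io is nearly the sum over j of \<gamma>_ji e_jo, and e_oi g is nearly the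
  sum of \<gamma>_ij e_oj. Hence moving g through the sum of the e_io y e_oi from either side gives
  the same double sum with the indices exchanged. Each side leaves an error \<epsilon> for every
  index, which accounts for the factor 2 \<open>card J\<close>.\<close>

lemma commutator_bound:
 fixes b :: "real => real" and y :: "'x ell2 => 'x ell2" and t :: real and o' :: "nat \<times> nat"
 defines "J \<equiv> fJ t p q"
 defines "E \<equiv> %i. opp (cx b) (munit t p q i o')"
 defines "Es \<equiv> %i. opp (cx b) (munit t p q o' i)"
 assumes t: "t \<in> {0..1}" and o: "o' \<in> J" and bc: "continuous_on {0..1} b"
  and ad: "!!a. a \<in> Fib t p q ==> adm p q (cx b) a"
  and b1: "!!\<tau>. \<tau> \<in> {0..1} ==> \<bar>b \<tau>\<bar> <= 1"
  and g: "g \<in> Mfun p q" and \<epsilon>: "0 <= \<epsilon>"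
  and near: "!!i v. i \<in> J ==> norm (R g (E i v) - opp (cx b) (mm (idx p q) (g t) (munit t p q i o')) v) <= \<epsilon> * norm v"
   "!!i v. i \<in> J ==> norm (R (fadj g) (E i v) - opp (cx b) (mm (idx p q) (fadj g t) (munit t p q i o')) v) <= \<epsilon> * norm v"
  and y: "cblinear y" "!!v. norm (y v) <= norm v"
 shows "norm ((\<Sum>i\<in>J. E i (y (Es i (R g v)))) - R g (\<Sum>i\<in>J. E i (y (Es i v)))) <= 2 * real (card J) * \<epsilon> * norm v"
proof -
 let ?b = "%\<tau>. complex_of_real (b \<tau>)"
 have fJ: "finite J" by (simp add: J_def)
 have cb: "continuous_on {0..1} ?b" using bc by (intro continuous_intros)
 have um: "adm p q ?b (munit t p q i j)" if "i \<in> J" "j \<in> J" for i j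
  using that by (intro ad munit_Fib) (auto simp: J_def)
 have El: "cblinear (E i)" "cblinear (Es i)" if "i \<in> J" for i
  unfolding E_def Es_def by (rule opp_lin[OF um[OF that o]], rule opp_lin[OF um[OF o that]])
 have nn: "norm (opp ?b (munit t p q i j) v) <= norm v" if ij: "i \<in> J" "j \<in> J" for i j v
  using norm_opp_le[OF um[OF ij], of 1 v] b1 ij by (simp add: munit_madj munit_mm J_def)
 have Ead: "inner (E i v) w = inner v (Es i w)" if "i \<in> J" for i v w
  unfolding E_def Es_def opp_adj[OF um[OF that o]] by (simp add: munit_madj)
 have gF: "g t \<in> Fib t p q" by (rule MfunD(2)[OF g t])
 then obtain \<gamma> where \<gamma>: "supp J \<gamma>" "g t = iota t p q \<gamma>" unfolding Fib_def J_def by blast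
 have S1: "opp ?b (mm (idx p q) (iota t p q h) (munit t p q i o')) v = (\<Sum>j\<in>J. scaleC (h j i) (E j v))"
  if i: "i \<in> J" and h: "supp J h" for i v h
 proof -
  have "mm (idx p q) (iota t p q h) (munit t p q i o') = (%x y. \<Sum>j\<in>J. h j i * munit t p q j o' x y)"
   unfolding J_def by (rule mm_munit_sum) (use i h in \<open>auto simp: J_def\<close>)
  hence "opp ?b (mm (idx p q) (iota t p q h) (munit t p q i o')) v = (\<Sum>j\<in>J. opp ?b (%x y. h j i * munit t p q j o' x y) v)"
   using opp_sum[OF fJ _ cb, of "%j x y. h j i * munit t p q j o' x y" v] um o by (simp add: adm_scale_right)
  also have "\<dots> = (\<Sum>j\<in>J. scaleC (h j i) (E j v))" by (rule sum.cong) (auto simp: E_def opp_scale_right um o)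
  finally show ?thesis .
 qed
 define X where "X i v = R g (E i v) - (\<Sum>j\<in>J. scaleC (\<gamma> j i) (E j v))" for i v
 define Y where "Y i v = R (fadj g) (E i v) - (\<Sum>j\<in>J. scaleC (cnj (\<gamma> i j)) (E j v))" for i v
 \<comment> \<open>The error of multiplying by g from the right. Only left multiplication is
   estimated by \<open>near\<close>, so it is treated as the adjoint of the error \<open>Y\<close>
   for \<open>fadj g\<close>; this is why both g and \<open>fadj g\<close> are assumed to be
   near.\<close>
 define Y' where "Y' i v = Es i (R g v) - (\<Sum>j\<in>J. scaleC (\<gamma> i j) (Es j v))" for i v
 have Xn: "norm (X i v) <= \<epsilon> * norm v" if "i \<in> J" for i v using near(1)[OF that] \<gamma> S1[OF that \<gamma>(1)] by (simp add: X_def)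
 have gat: "fadj g t = iota t p q (madj \<gamma>)" by (simp add: fadj_def \<gamma>(2) iota_madj)
 have Yn: "norm (Y i v) <= \<epsilon> * norm v" if "i \<in> J" for i v
  using near(2)[OF that] S1[OF that supp_madj[OF \<gamma>(1)]] unfolding gat by (simp add: Y_def madj_def)
 have Yad: "inner (Y i w) v = inner w (Y' i v)" if i: "i \<in> J" for i v w
 proof -
  have "fadj (fadj g) = g" by (simp add: fadj_def)
  hence "inner (R (fadj g) (E i w)) v = inner w (Es i (R g v))" by (simp add: R_adj[OF Mfun_fadj[OF g]] Ead[OF i])
  moreover have "inner (\<Sum>j\<in>J. scaleC (cnj (\<gamma> i j)) (E j w)) v = inner w (\<Sum>j\<in>J. scaleC (\<gamma> i j) (Es j v))"
   unfolding inner_sum_left inner_sum_right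
  proof (rule sum.cong)
   fix j assume j: "j \<in> J"
   show "inner (scaleC (cnj (\<gamma> i j)) (E j w)) v = inner w (scaleC (\<gamma> i j) (Es j v))"
    by (simp add: inner_scaleC_left Ead[OF j] cblinear_scaleC[OF El(2)[OF j]])
  qed simp
  ultimately show ?thesis by (simp add: Y_def Y'_def inner_diff_left inner_diff_right)
 qed
 have Y'n: "norm (Y' i v) <= \<epsilon> * norm v" if "i \<in> J" for i v by (rule adjoint_bound[OF Yn[OF that] Yad[OF that] \<epsilon>])
 have gl: "cblinear (R g)" by (rule lin[OF g])
 have "(\<Sum>i\<in>J. E i (y (Es i (R g v)))) = (\<Sum>i\<in>J. E i (y (Y' i v)) + (\<Sum>j\<in>J. scaleC (\<gamma> i j) (E i (y (Es j v)))))"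
 proof (rule sum.cong)
  fix i assume i: "i \<in> J"
  have "Es i (R g v) = Y' i v + (\<Sum>j\<in>J. scaleC (\<gamma> i j) (Es j v))" by (simp add: Y'_def)
  thus "E i (y (Es i (R g v))) = E i (y (Y' i v)) + (\<Sum>j\<in>J. scaleC (\<gamma> i j) (E i (y (Es j v))))"
   by (simp add: cblinear_add[OF y(1)] cblinear_sum[OF y(1)] cblinear_scaleC[OF y(1)]
     cblinear_add[OF El(1)[OF i]] cblinear_sum[OF El(1)[OF i]] cblinear_scaleC[OF El(1)[OF i]])
 qed simp
 moreover have "R g (\<Sum>i\<in>J. E i (y (Es i v))) = (\<Sum>i\<in>J. X i (y (Es i v)) + (\<Sum>j\<in>J. scaleC (\<gamma> j i) (E j (y (Es i v)))))"
  unfolding cblinear_sum[OF gl] by (rule sum.cong) (simp_all add: X_def)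
 moreover have "(\<Sum>i\<in>J. \<Sum>j\<in>J. scaleC (\<gamma> j i) (E j (y (Es i v)))) = (\<Sum>i\<in>J. \<Sum>j\<in>J. scaleC (\<gamma> i j) (E i (y (Es j v))))"
  by (rule sum.swap)
 ultimately have "(\<Sum>i\<in>J. E i (y (Es i (R g v)))) - R g (\<Sum>i\<in>J. E i (y (Es i v)))
   = (\<Sum>i\<in>J. E i (y (Y' i v))) - (\<Sum>i\<in>J. X i (y (Es i v)))" by (simp add: sum.distrib)
 moreover have "norm (\<Sum>i\<in>J. E i (y (Y' i v))) <= (\<Sum>i\<in>J. \<epsilon> * norm v)"
 proof (rule sum_norm_le)
  fix i assume i: "i \<in> J"
  have "norm (E i (y (Y' i v))) <= norm (y (Y' i v))" unfolding E_def by (rule nn[OF i o])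
  also have "\<dots> <= norm (Y' i v)" by (rule y(2))
  also have "\<dots> <= \<epsilon> * norm v" by (rule Y'n[OF i])
  finally show "norm (E i (y (Y' i v))) <= \<epsilon> * norm v" .
 qed
 moreover have "norm (\<Sum>i\<in>J. X i (y (Es i v))) <= (\<Sum>i\<in>J. \<epsilon> * norm v)"
 proof (rule sum_norm_le)
  fix i assume i: "i \<in> J"
  have "norm (X i (y (Es i v))) <= \<epsilon> * norm (y (Es i v))" by (rule Xn[OF i])
  also have "\<dots> <= \<epsilon> * norm v"
  proof (rule mult_left_mono[OF _ \<epsilon>])
   have "norm (Es i v) <= norm v" unfolding Es_def by (rule nn[OF o i])
   thus "norm (y (Es i v)) <= norm v" using y(2)[of "Es i v"] by linarith
  qed
  finally show "norm (X i (y (Es i v))) <= \<epsilon> * norm v" .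
 qed
 ultimately show ?thesis using norm_triangle_ineq4[of "\<Sum>i\<in>J. E i (y (Y' i v))" "\<Sum>i\<in>J. X i (y (Es i v))"] by simp
qed

end

section \<open>Almost central elements that do not fix the line of a vector\<close>

text \<open>An increasing union of dimension drop algebras, each of which becomes full in the later ones, has
 almost central elements that do not almost have a given vector as an eigenvector.\<close>

theorem approx_central_nonscalar:
 fixes p q :: "nat => nat" and R :: "nat => (real => cmat) => 'x ell2 => 'x ell2" and \<xi> :: "'x ell2"
 assumes rep: "!!n. dd_rep (p n) (q n) (R n)"
  and inj: "!!n M N. M \<in> Mfun (p n) (q n) ==> N \<in> Mfun (p n) (q n) ==> R n M = R n N ==> M = N"
  and incl: "!!n m M. n <= m ==> M \<in> Mfun (p n) (q n) ==> \<exists>N\<in>Mfun (p m) (q m). R m N = R n M"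
  and full: "!!n M. M \<in> Mfun (p n) (q n) ==> M ~= (%t i j. 0) ==>
   \<exists>m0. \<forall>m\<ge>m0. \<forall>N\<in>Mfun (p m) (q m). R m N = R n M --> (\<forall>s\<in>{0..1}. N s ~= (%i j. 0))"
  and \<xi>: "norm \<xi> = 1"
 shows "\<exists>\<delta>>0. \<forall>n G \<epsilon>. finite G --> G \<subseteq> Mfun (p n) (q n) --> \<epsilon> > 0 -->
  (\<exists>m\<ge>n. \<exists>M\<in>Mfun (p m) (q m). (\<forall>v. norm (R m M v) <= norm v) &
   (\<forall>g\<in>G. \<forall>v. norm (R m M (R n g v) - R n g (R m M v)) <= \<epsilon> * norm v) &
   (\<forall>c. \<delta> < norm (R m M \<xi> - scaleC c \<xi>)))"
proof (rule ccontr)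
 define \<delta> :: real where "\<delta> = 1 / 10000"
 assume "\<not> ?thesis"
 hence "\<not> (\<forall>n G \<epsilon>. finite G --> G \<subseteq> Mfun (p n) (q n) --> \<epsilon> > 0 -->
  (\<exists>m\<ge>n. \<exists>M\<in>Mfun (p m) (q m). (\<forall>v. norm (R m M v) <= norm v) &
   (\<forall>g\<in>G. \<forall>v. norm (R m M (R n g v) - R n g (R m M v)) <= \<epsilon> * norm v) &
   (\<forall>c. \<delta> < norm (R m M \<xi> - scaleC c \<xi>))))" unfolding \<delta>_def by (metis zero_less_divide_1_iff zero_less_numeral)
 then obtain n G \<epsilon> where G: "finite G" "G \<subseteq> Mfun (p n) (q n)" "\<epsilon> > 0"
  and NC0: "\<not> (\<exists>m\<ge>n. \<exists>M\<in>Mfun (p m) (q m). (\<forall>v. norm (R m M v) <= norm v) &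
   (\<forall>g\<in>G. \<forall>v. norm (R m M (R n g v) - R n g (R m M v)) <= \<epsilon> * norm v) &
   (\<forall>c. \<delta> < norm (R m M \<xi> - scaleC c \<xi>)))" by blast
 \<comment> \<open>The negated claim: from level n on, every contraction that almost commutes with
   \<open>G\<close> almost has \<xi> as an eigenvector. The contradiction comes from applying it to
   central functions and to averages over matrix units.\<close>
 have NC: "\<exists>c. norm (R m M \<xi> - scaleC c \<xi>) <= \<delta>"
  if "n <= m" "M \<in> Mfun (p m) (q m)" "!!v. norm (R m M v) <= norm v"
   "!!g v. g \<in> G ==> norm (R m M (R n g v) - R n g (R m M v)) <= \<epsilon> * norm v" for m M
  using NC0 that by (meson linorder_not_less)
 \<comment> \<open>Functions in the centre of level m commute exactly with level m, hence with
   \<open>G\<close>, so the negated claim applies to all of them and \<xi> concentrates at some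
   point of level m.\<close>
 have conc: "\<exists>t\<in>{0..1}. dd_rep.peaked (p m) (q m) (R m) \<xi> t (15 * \<delta>)"
  if nm: "n <= m" for m
 proof -
  interpret L: dd_rep "p m" "q m" "R m" by (rule rep)
  have ev: "\<exists>c. norm (L.cen h \<xi> - scaleC c \<xi>) <= \<delta>"
   if h: "continuous_on {0..1} h" "!!t. t \<in> {0..1} ==> 0 <= h t & h t <= 1" for h
  proof -
   let ?M = "hs (cx h) (mone (idx (p m) (q m)))"
   have c: "L.cen h = R m ?M" by (simp add: L.cen_def L.opp_def)
   have MM: "?M \<in> Mfun (p m) (q m)" by (rule Mfun_hs[OF L.adm_cen[OF h(1)]])
   show ?thesis unfolding c
   proof (rule NC[OF nm MM])
    show "norm (R m ?M v) <= norm v" for v unfolding c[symmetric]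
    proof (rule L.cen_norm_le[OF h(1)])
     fix t :: real assume "t \<in> {0..1}"
     thus "\<bar>h t\<bar> <= 1" using h(2)[of t] by simp
    qed
    fix g v assume "g \<in> G"
    then obtain N where N: "N \<in> Mfun (p m) (q m)" "R m N = R n g" using incl[OF nm, of g] G(2) by blast
    show "norm (R m ?M (R n g v) - R n g (R m ?M v)) <= \<epsilon> * norm v"
     unfolding c[symmetric] N(2)[symmetric] L.cen_commute[OF h(1) N(1)] using G(3) by simp
   qed
  qed
  show ?thesis by (rule L.concentration[OF \<xi> _ _ ev]) (auto simp: \<delta>_def)
 qed
 interpret L: dd_rep "p n" "q n" "R n" by (rule rep)
 obtain t where t: "t \<in> {0..1}" and ct: "L.peaked \<xi> t (15 * \<delta>)" using conc[OF order_refl] ..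
 let ?I = "idx (p n) (q n)"
 define J where "J = fJ t (p n) (q n)"
 define e where "e = munit t (p n) (q n)"
 have "(0, 0) \<in> ?I" using L.pq by (simp add: idx_def)
 hence "fpi t (0, 0) \<in> J" unfolding J_def by (rule fpi_fJ)
 then obtain o' where o: "o' \<in> J" by blast
 have fJ: "finite J" by (simp add: J_def)
 have eF: "e i j \<in> Fib t (p n) (q n)" if "i \<in> J" "j \<in> J" for i j using that by (simp add: e_def J_def munit_Fib)
 have emm: "mm ?I (e i j) (e k l) = (if j = k then e i l else (%x y. 0))" if "j \<in> J" "k \<in> J" for i j k l
  using that by (simp add: e_def J_def munit_mm)
 have eadj: "madj (e i j) = e j i" for i j by (simp add: e_def munit_madj)
 define N where "N = real (card J)"
 have N: "N \<ge> 0" by (simp add: N_def)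
 \<comment> \<open>Divided by twice the number of matrix units, the factor in
   \<open>commutator_bound\<close>; the 1 avoids a zero denominator.\<close>
 define \<epsilon>1 where "\<epsilon>1 = \<epsilon> / (2 * N + 1)"
 have \<epsilon>1: "\<epsilon>1 > 0" "2 * N * \<epsilon>1 <= \<epsilon>" using G(3) N by (auto simp: \<epsilon>1_def field_simps add_nonneg_pos)
 have GM: "g \<in> Mfun (p n) (q n)" if "g \<in> G" for g using G(2) that by blast
 from L.adm_nearh[OF t] obtain r0 where r0: "r0 > 0"
  and r0': "\<forall>h a. L.nearh t r0 h & a \<in> Fib t (p n) (q n) --> adm (p n) (q n) h a" by (elim exE conjE)
 let ?G = "(G \<union> fadj ` G) \<times> J"
 have "\<forall>x\<in>?G. \<exists>r>0. \<forall>h. L.nearh t r h -->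
  (\<forall>v. norm (R n (fst x) (L.opp h (e (snd x) o') v) - L.opp h (mm ?I (fst x t) (e (snd x) o')) v) <= \<epsilon>1 * norm v)"
 proof
  fix x assume x: "x \<in> ?G"
  have "fst x \<in> Mfun (p n) (q n)" using x GM Mfun_fadj by auto
  from L.near_mult[OF this t eF[OF _ o] \<epsilon>1(1), of "snd x"] x
  show "\<exists>r>0. \<forall>h. L.nearh t r h -->
   (\<forall>v. norm (R n (fst x) (L.opp h (e (snd x) o') v) - L.opp h (mm ?I (fst x t) (e (snd x) o')) v) <= \<epsilon>1 * norm v)"
   by (auto simp: mem_Times_iff)
 qed
 from bchoice[OF this] obtain rr where rr: "\<forall>x\<in>?G. rr x > 0 & (\<forall>h. L.nearh t (rr x) h -->
  (\<forall>v. norm (R n (fst x) (L.opp h (e (snd x) o') v) - L.opp h (mm ?I (fst x t) (e (snd x) o')) v) <= \<epsilon>1 * norm v))"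
  by (elim exE)
 define r where "r = Min (insert r0 (insert (1 / 2) (rr ` ?G)))"
 have fin: "finite (insert r0 (insert (1 / 2) (rr ` ?G)))" using G(1) fJ by simp
 have r: "r > 0" unfolding r_def using fin r0 rr by (subst Min_gr_iff) auto
 have r_le: "r <= r0" "r <= 1 / 2" "!!x. x \<in> ?G ==> r <= rr x" unfolding r_def by (rule Min_le[OF fin], simp)+
 have adm_e: "adm (p n) (q n) h a" if "L.nearh t r h" "a \<in> Fib t (p n) (q n)" for h a
  using r0' L.nearh_mono[OF that(1) r_le(1)] that(2) by blast
 have near: "norm (R n g (L.opp h (e i o') v) - L.opp h (mm ?I (g t) (e i o')) v) <= \<epsilon>1 * norm v"
  if "g \<in> G \<union> fadj ` G" "i \<in> J" "L.nearh t r h" for g i h v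
 proof -
  have gi: "(g, i) \<in> ?G" using that by simp
  thus ?thesis using bspec[OF rr gi] L.nearh_mono[OF that(3) r_le(3)[OF gi]] by simp
 qed
 \<comment> \<open>Each of b, b1, b2 is 1 on the support of the next one. The bump c2 sits at
   distance 3r/32 from t with support of radius r/64: outside the support of b2, which has radius
   r/16, and inside the region of radius r/8 where b1 is 1. So b2 and c2 are orthogonal and both lie
   below b1. The centre u is taken on the side of t where there is room in the unit
   interval.\<close>
 define b where "b = tent t (r / 2)"
 let ?bb = "%\<tau>. b \<tau> * b \<tau>"
 define b1 where "b1 = tent t (r / 8)"
 define b2 where "b2 = tent t (r / 32)"
 define u where "u = (if t <= 1 / 2 then t + 3 * r / 32 else t - 3 * r / 32)"
 define c2 where "c2 = tent u (r / 128)"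
 have u: "u \<in> {0..1}" "\<bar>u - t\<bar> = 3 * r / 32" using t r r_le(2) by (auto simp: u_def)
 have s: "b \<tau> ~= 0 ==> \<bar>\<tau> - t\<bar> <= r" "b1 \<tau> ~= 0 ==> \<bar>\<tau> - t\<bar> <= r / 4" "b2 \<tau> ~= 0 ==> \<bar>\<tau> - t\<bar> < r / 16"
  "c2 \<tau> ~= 0 ==> \<bar>\<tau> - u\<bar> <= r / 64" for \<tau>
 proof -
  have tn: "\<bar>\<tau> - t\<bar> < 2 * r" if "r > 0" "tent t r \<tau> ~= 0" for t r
   using tent_eq_0[OF that(1), of \<tau> t] that(2) by linarith
  show "b \<tau> ~= 0 ==> \<bar>\<tau> - t\<bar> <= r" "b1 \<tau> ~= 0 ==> \<bar>\<tau> - t\<bar> <= r / 4" "b2 \<tau> ~= 0 ==> \<bar>\<tau> - t\<bar> < r / 16"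
   "c2 \<tau> ~= 0 ==> \<bar>\<tau> - u\<bar> <= r / 64" using tn[of "r/2" t] tn[of "r/8" t] tn[of "r/32" t] tn[of "r/128" u] r
   by (simp_all add: b_def b1_def b2_def c2_def)
 qed
 have one: "\<bar>\<tau> - t\<bar> <= r / 2 ==> b \<tau> = 1" "\<bar>\<tau> - t\<bar> <= r / 8 ==> b1 \<tau> = 1" for \<tau>
  using tent_eq_1[of "r/2" \<tau> t] tent_eq_1[of "r/8" \<tau> t] r by (auto simp: b_def b1_def)
 have sc: "\<bar>\<tau> - t\<bar> <= r / 8" "r / 16 <= \<bar>\<tau> - t\<bar>" if "c2 \<tau> ~= 0" for \<tau> using s(4)[OF that] u(2) r by linarith+
 have bb1: "b \<tau> * b1 \<tau> = b1 \<tau>" for \<tau> using s(2)[of \<tau>] one(1)[of \<tau>] r by (cases "b1 \<tau> = 0") auto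
 have b1b2: "b1 \<tau> * b2 \<tau> = b2 \<tau>" for \<tau> using s(3)[of \<tau>] one(2)[of \<tau>] r by (cases "b2 \<tau> = 0") auto
 have bb2: "b \<tau> * b2 \<tau> = b2 \<tau>" for \<tau> using bb1[of \<tau>] b1b2[of \<tau>] by (metis mult.assoc)
 have bb2': "(%\<tau>. b \<tau> * b2 \<tau>) = b2" "(%\<tau>. b2 \<tau> * b \<tau>) = b2"
  by (rule ext, rule bb2) (rule ext, subst mult.commute, rule bb2)
 have b1c2: "b1 \<tau> * c2 \<tau> = c2 \<tau>" for \<tau> using sc[of \<tau>] one(2)[of \<tau>] by (cases "c2 \<tau> = 0") auto
 have b2c2: "b2 \<tau> * c2 \<tau> = 0" for \<tau> using sc[of \<tau>] s(3)[of \<tau>] by (cases "c2 \<tau> = 0"; cases "b2 \<tau> = 0") auto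
 have cont: "continuous_on {0..1} b" "continuous_on {0..1} b1" "continuous_on {0..1} b2" "continuous_on {0..1} c2"
  using r by (auto simp: b_def b1_def b2_def c2_def intro!: tent_cont)
 have rng: "0 <= b \<tau> & b \<tau> <= 1" "0 <= b1 \<tau> & b1 \<tau> <= 1" "0 <= b2 \<tau> & b2 \<tau> <= 1" "0 <= c2 \<tau> & c2 \<tau> <= 1" for \<tau>
  by (simp_all add: b_def b1_def b2_def c2_def tent_range)
 define op where "op f a = L.opp (cx f) a" for f :: "real => real" and a
 define good where "good f \<longleftrightarrow> continuous_on {0..1} f & (\<forall>\<tau>. 0 <= f \<tau> & f \<tau> <= 1) & (\<forall>\<tau>. f \<tau> ~= 0 --> \<bar>\<tau> - t\<bar> <= r)" for f :: "real => real"
 have gd: "good b" "good b1" "good b2" "good c2"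
  using cont rng s sc r unfolding good_def by (force, force, force, force)
 have gm: "good (%\<tau>. f \<tau> * k \<tau>)" if "good f" "good k" for f k
  using that unfolding good_def by (auto intro!: continuous_intros mult_le_one)
 have gn: "L.nearh t r (cx f)" if "good f" for f
  using that unfolding good_def L.nearh_def by (auto intro!: continuous_intros)
 have ga: "adm (p n) (q n) (cx f) a" if "good f" "a \<in> Fib t (p n) (q n)" for f a using adm_e[OF gn] that by blast
 have op_mult: "op f a (op k a' v) = op (%\<tau>. f \<tau> * k \<tau>) (mm ?I a a') v"
  if "good f" "good k" "a \<in> Fib t (p n) (q n)" "a' \<in> Fib t (p n) (q n)" for f k a a' v
  using L.opp_mult[OF ga[OF that(1,3)] ga[OF that(2,4)]] by (simp add: op_def)
 have op_adj: "inner (op f (e i j) v) w = inner v (op f (e j i) w)" if "good f" "i \<in> J" "j \<in> J" for f i j v w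
  using L.opp_adj[OF ga[OF that(1) eF[OF that(2,3)]]] by (simp add: op_def eadj)
 have op_norm: "norm (op f (e i j) v) <= norm v" if "good f" "i \<in> J" "j \<in> J" for f i j v
  using L.norm_opp_le[OF ga[OF that(1) eF[OF that(2,3)]], of 1 v] that by (simp add: op_def eadj emm good_def)
 have op_cong: "op f a v = op k a v" if "!!\<tau>. f \<tau> = k \<tau>" for f k a v using that by (simp add: op_def)
 have op_0: "op f (%i j. 0) v = 0" "op (%\<tau>. 0) a v = 0" for f a v
 proof -
  show "op f (%i j. 0) v = 0" by (simp add: op_def L.opp_zero)
  have "hs (%\<tau>. complex_of_real 0) a = (%t i j. 0)" by (simp add: hs_def fun_eq_iff)
  thus "op (%\<tau>. 0) a v = 0" by (simp add: op_def L.opp_def L.R_zero)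
 qed
 have hsM: "hs (cx f) (e i j) \<in> Mfun (p n) (q n)" if "good f" "i \<in> J" "j \<in> J" for f i j
  by (rule Mfun_hs[OF ga[OF that(1) eF[OF that(2,3)]]])
 have opR: "R n (hs (cx f) a) = op f a" for f a by (simp add: op_def L.opp_def fun_eq_iff)
 have op_sum: "(\<Sum>i\<in>J. op f (e i i) v) = L.cen f v" if "good f" for f v
 proof -
  have "(%x y. \<Sum>i\<in>J. e i i x y) = mone ?I" unfolding e_def J_def by (rule munit_sum)
  moreover have "continuous_on {0..1} (cx f)" using that unfolding good_def by (intro continuous_intros) auto
  ultimately show ?thesis
   using L.opp_sum[OF fJ, of "%\<tau>. complex_of_real (f \<tau>)" "%i. e i i" v] ga[OF that eF] by (simp add: op_def L.cen_def)
 qed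
 define E where "E i = op b (e i o')" for i
 define Es where "Es i = op b (e o' i)" for i
 have e0: "e o' o' ~= (%i j. 0)" using munit_nonzero[OF L.pq, of o' t o'] o by (simp add: e_def J_def)
 have nz: "hs (cx f) (e o' o') ~= (%t i j. 0)" if "f w = 1" "w \<in> {0..1}" for f w
 proof
  assume "hs (cx f) (e o' o') = (%t i j. 0)"
  from fun_cong[OF this, of w] have "e o' o' = (%i j. 0)" using that by (simp add: hs_def)
  thus False using e0 by simp
 qed
 have w1: "b2 t = 1" "c2 u = 1" using tent_eq_1[of "r/32" t t] tent_eq_1[of "r/128" u u] r by (auto simp: b2_def c2_def)
 \<comment> \<open>The point of concentration at level m is not known in advance and need not be
   related to t. Therefore the lifts of b2 and c2 times a diagonal matrix unit must be nonzero in
   every fibre of level m, which fullness provides for large m.\<close>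
 obtain m1 where m1: "\<forall>m\<ge>m1. \<forall>N\<in>Mfun (p m) (q m). R m N = op b2 (e o' o') --> (\<forall>s\<in>{0..1}. N s ~= (%i j. 0))"
  using full[OF hsM[OF gd(3) o o] nz[of b2 t, OF w1(1) t]] unfolding opR by (elim exE) blast
 obtain m2 where m2: "\<forall>m\<ge>m2. \<forall>N\<in>Mfun (p m) (q m). R m N = op c2 (e o' o') --> (\<forall>s\<in>{0..1}. N s ~= (%i j. 0))"
  using full[OF hsM[OF gd(4) o o] nz[of c2 u, OF w1(2) u(1)]] unfolding opR by (elim exE) blast
 define m where "m = max n (max m1 m2)"
 have m: "n <= m" "m1 <= m" "m2 <= m" by (auto simp: m_def)
 interpret M: dd_rep "p m" "q m" "R m" by (rule rep)
 let ?S = "Mfun (p m) (q m)"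
 have lift: "\<exists>X\<in>?S. R m X = op f (e i j)" if "good f" "i \<in> J" "j \<in> J" for f i j
  using incl[OF m(1) hsM[OF that]] unfolding opR .
 obtain Bm where Bm: "Bm \<in> ?S" "R m Bm = op ?bb (e o' o')" using lift[OF gm[OF gd(1) gd(1)] o o] by blast
 obtain B1m where B1m: "B1m \<in> ?S" "R m B1m = op b1 (e o' o')" using lift[OF gd(2) o o] by blast
 obtain B2m where B2m: "B2m \<in> ?S" "R m B2m = op b2 (e o' o')" using lift[OF gd(3) o o] by blast
 obtain C2m where C2m: "C2m \<in> ?S" "R m C2m = op c2 (e o' o')" using lift[OF gd(4) o o] by blast
 have lmult: "fm (p m) (q m) X Y = W"
  if "X \<in> ?S" "Y \<in> ?S" "W \<in> ?S" "R m X = op f (e o' o')" "R m Y = op k (e o' o')" "R m W = op l (e o' o')"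
   "good f" "good k" "!!\<tau>. f \<tau> * k \<tau> = l \<tau>" for X Y W f k l
 proof (rule inj[OF Mfun_fm[OF that(1,2)] that(3)])
  show "R m (fm (p m) (q m) X Y) = R m W"
   unfolding M.R_mult[OF that(1,2)] that(4-6) using op_mult[OF that(7,8) eF[OF o o] eF[OF o o]] that(9)
   by (simp add: emm[OF o o] fun_eq_iff)
 qed
 have z: "(%t i j. 0) \<in> ?S" "R m (%t i j. 0) = op (%\<tau>. 0) (e o' o')"
  using M.R_sum[of "{}"] by (auto simp: M.R_zero op_0 fun_eq_iff)
 have B2a: "fadj B2m = B2m"
 proof (rule inj[OF Mfun_fadj[OF B2m(1)] B2m(1)])
  show "R m (fadj B2m) = R m B2m"
  proof
   fix w
   have "inner v (R m (fadj B2m) w) = inner v (R m B2m w)" for v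
    by (simp add: M.R_adj[OF B2m(1), symmetric] B2m(2) op_adj[OF gd(3) o o])
   hence "inner (R m (fadj B2m) w - R m B2m w) (R m (fadj B2m) w - R m B2m w) = 0" by (simp add: inner_diff_right)
   thus "R m (fadj B2m) w = R m B2m w" by simp
  qed
 qed
 \<comment> \<open>The concentration point of level m. The matrix units and bumps come from the
   point t of level n, the nilpotents from the fibre of level m at s.\<close>
 obtain s where s: "s \<in> {0..1}" and cs: "M.peaked \<xi> s (15 * \<delta>)" using conc[OF m(1)] ..
 have El: "cblinear (op b (e i j))" if "i \<in> J" "j \<in> J" for i j
  unfolding op_def by (rule L.opp_lin[OF ga[OF gd(1) eF[OF that]]])
 have gbb: "good ?bb" by (rule gm[OF gd(1) gd(1)])
 have EEs: "E i (Es i v) = op ?bb (e i i) v" if "i \<in> J" for i v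
  unfolding E_def Es_def op_mult[OF gd(1) gd(1) eF[OF that o] eF[OF o that]] by (simp add: emm[OF o o])
 interpret C: corner "p m" "q m" "R m" J E Es Bm
 proof
  fix i v w assume i: "i \<in> J"
  show "cblinear (E i)" "cblinear (Es i)" unfolding E_def Es_def using El i o by auto
  show "inner (E i v) w = inner v (Es i w)" unfolding E_def Es_def by (rule op_adj[OF gd(1) i o])
  show "norm (E i v) <= norm v" unfolding E_def by (rule op_norm[OF gd(1) i o])
  fix j assume j: "j \<in> J"
  show "Es i (E j v) = (if i = j then R m Bm v else 0)"
   unfolding E_def Es_def op_mult[OF gd(1) gd(1) eF[OF o i] eF[OF j o]] emm[OF i j] Bm(2) by (simp add: op_0)
 next
  fix v
  have "(\<Sum>i\<in>J. (norm (Es i v))\<^sup>2) = (\<Sum>i\<in>J. inner v (E i (Es i v)))"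
  proof (rule sum.cong)
   fix i assume i: "i \<in> J"
   have "inner (Es i v) (Es i v) = inner v (E i (Es i v))" unfolding Es_def E_def by (rule op_adj[OF gd(1) o i])
   thus "(norm (Es i v))\<^sup>2 = inner v (E i (Es i v))" by (simp add: power2_norm_eq_inner)
  qed simp
  also have "\<dots> = inner v (L.cen ?bb v)" by (simp add: EEs inner_sum_right[symmetric] op_sum[OF gbb])
  also have "\<dots> <= norm v * norm (L.cen ?bb v)" by (rule norm_cauchy_schwarz)
  also have "\<dots> <= norm v * norm v" by (rule mult_left_mono[OF L.cen_norm_le]) (use gbb in \<open>auto simp: good_def\<close>)
  finally show "(\<Sum>i\<in>J. (norm (Es i v))\<^sup>2) <= (norm v)\<^sup>2" by (simp add: power2_eq_square)
 qed (use fJ Bm in auto)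
 show False
 proof (rule C.no_approx_character[OF \<xi> s _ B1m(1) B2m(1) B2m(1) C2m(1), where ?b2.0="L.cen b2"])
  show "M.peaked \<xi> s (15 * (1 / 10000))" using cs by (simp add: \<delta>_def)
  show "mm (idx (p m) (q m)) (Bm s) (B1m s) = B1m s"
   using lmult[OF Bm(1) B1m(1) B1m(1) Bm(2) B1m(2) B1m(2) gbb gd(2)] bb1 by (simp add: mult.assoc fm_def fun_eq_iff)
  show "mm (idx (p m) (q m)) (B1m s) (B2m s) = B2m s"
   using lmult[OF B1m(1) B2m(1) B2m(1) B1m(2) B2m(2) B2m(2) gd(2,3) b1b2] by (simp add: fm_def fun_eq_iff)
  thus "mm (idx (p m) (q m)) (B1m s) (B2m s) = B2m s" .
  show "mm (idx (p m) (q m)) (B1m s) (C2m s) = C2m s"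
   using lmult[OF B1m(1) C2m(1) C2m(1) B1m(2) C2m(2) C2m(2) gd(2,4) b1c2] by (simp add: fm_def fun_eq_iff)
  show "mm (idx (p m) (q m)) (madj (B2m s)) (C2m s) = (%i j. 0)"
  proof -
   have "madj (B2m s) = B2m s" using fun_cong[OF B2a, of s] by (simp add: fadj_def)
   thus ?thesis
    using fun_cong[OF lmult[OF B2m(1) C2m(1) z(1) B2m(2) C2m(2) z(2) gd(3,4) b2c2], of s] by (simp add: fm_def)
  qed
  show "B2m s ~= (%i j. 0)" using m1 m(2) B2m s by blast
  show "C2m s ~= (%i j. 0)" using m2 m(3) C2m s by blast
  show "fadj B2m = B2m" by (rule B2a)
  have e1: "e o' i \<in> Fib t (p n) (q n)" if "i \<in> J" for i by (rule eF[OF o that])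
  have supe: "mm ?I (e o' i) (mone ?I) = e o' i" if "i \<in> J" for i using Fib_supp[OF e1[OF that]] by (simp add: mm_one)
  have EsB: "R m B2m (Es i v) = op b2 (e o' i) v" if "i \<in> J" for i v
   unfolding B2m(2) Es_def op_mult[OF gd(3) gd(1) eF[OF o o] e1[OF that]] by (simp add: emm[OF o o] bb2')
  show "Es i (L.cen b2 v) = R m B2m (Es i v)" if "i \<in> J" for i v
  proof -
   have "Es i (L.cen b2 v) = op b (e o' i) (op b2 (mone ?I) v)" by (simp add: Es_def L.cen_def op_def)
   also have "\<dots> = op b2 (e o' i) v"
    unfolding op_mult[OF gd(1) gd(3) e1[OF that] Fib_one] by (simp add: supe[OF that] bb2')
   finally show ?thesis by (simp add: EsB[OF that])
  qed
  show "L.cen b2 v = (\<Sum>i\<in>J. E i (R m B2m (Es i v)))" for v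
  proof -
   have "E i (R m B2m (Es i v)) = op b2 (e i i) v" if "i \<in> J" for i
    unfolding EsB[OF that] E_def op_mult[OF gd(1) gd(3) eF[OF that o] e1[OF that]] by (simp add: emm[OF o o] bb2')
   thus ?thesis by (simp add: op_sum[OF gd(3)])
  qed
  have "norm (L.cen b2 \<xi> - \<xi>) <= 15 * \<delta>"
   by (rule L.peakedD[OF ct, of b2 "r / 32"]) (use cont rng r tent_eq_1[of "r/32" _ t] in \<open>auto simp: b2_def\<close>)
  thus "norm (L.cen b2 \<xi> - \<xi>) <= 15 * (1 / 10000)" by (simp add: \<delta>_def)
  show "M.cen h (E i v) = E i (M.cen h v)" if hi: "continuous_on {0..1} h" "i \<in> J" for h i v
  proof -
   obtain X where X: "X \<in> ?S" "R m X = E i" using lift[OF gd(1) hi(2) o] unfolding E_def by blast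
   show ?thesis using M.cen_commute[OF hi(1) X(1)] unfolding X(2) .
  qed
  fix X assume X: "X \<in> ?S" "!!v. norm (R m X v) <= norm v"
  have "\<forall>i\<in>J. \<exists>Y. Y \<in> ?S & R m Y = E i" using lift[OF gd(1) _ o] unfolding E_def by blast
  from bchoice[OF this] obtain Eh where Eh: "!!i. i \<in> J ==> Eh i \<in> ?S" "!!i. i \<in> J ==> R m (Eh i) = E i" by blast
  have "\<forall>i\<in>J. \<exists>Y. Y \<in> ?S & R m Y = Es i" using lift[OF gd(1) o] unfolding Es_def by blast
  from bchoice[OF this] obtain Eg where Eg: "!!i. i \<in> J ==> Eg i \<in> ?S" "!!i. i \<in> J ==> R m (Eg i) = Es i" by blast
  \<comment> \<open>The average \<open>K\<close> of X over the matrix units is itself an element of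
    level m, since \<open>E\<close> and \<open>Es\<close> lift to that level. It almost commutes
    with \<open>G\<close> by \<open>commutator_bound\<close>, so the negated claim applies to
    it.\<close>
  define W where "W = (%t x y. \<Sum>i\<in>J. fm (p m) (q m) (fm (p m) (q m) (Eh i) X) (Eg i) t x y)"
  have W: "W \<in> ?S" "R m W v = C.K (R m X) v" for v
  proof -
   have fi: "fm (p m) (q m) (fm (p m) (q m) (Eh i) X) (Eg i) \<in> ?S" if "i \<in> J" for i
    using Eh(1)[OF that] Eg(1)[OF that] X(1) by (intro Mfun_fm)
   have "W \<in> ?S & R m W v = (\<Sum>i\<in>J. R m (fm (p m) (q m) (fm (p m) (q m) (Eh i) X) (Eg i)) v)"
    unfolding W_def by (rule M.R_sum[OF fJ fi])
   moreover have "(\<Sum>i\<in>J. R m (fm (p m) (q m) (fm (p m) (q m) (Eh i) X) (Eg i)) v) = C.K (R m X) v" unfolding C.K_def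
    by (rule sum.cong) (auto simp: M.R_mult[OF Mfun_fm[OF Eh(1) X(1)] Eg(1)] M.R_mult[OF Eh(1) X(1)] Eh(2) Eg(2))
   ultimately show "W \<in> ?S" "R m W v = C.K (R m X) v" by auto
  qed
  have Wf: "R m W = C.K (R m X)" using W(2) by blast
  have "\<exists>c. norm (R m W \<xi> - scaleC c \<xi>) <= \<delta>"
  proof (rule NC[OF m(1) W(1)])
   show "norm (R m W v) <= norm v" for v using C.K_norm[of 1 "R m X" v] X(2) by (simp add: Wf)
   fix g v assume g: "g \<in> G"
   have "norm ((\<Sum>i\<in>J. E i (R m X (Es i (R n g v)))) - R n g (\<Sum>i\<in>J. E i (R m X (Es i v)))) <= 2 * real (card J) * \<epsilon>1 * norm v"
    unfolding E_def Es_def op_def e_def J_def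
   proof (rule L.commutator_bound[OF t _ cont(1) _ _ GM[OF g] _ _ _ M.lin[OF X(1)] X(2)])
    show "o' \<in> fJ t (p n) (q n)" using o by (simp add: J_def)
    show "adm (p n) (q n) (cx b) a" if "a \<in> Fib t (p n) (q n)" for a by (rule ga[OF gd(1) that])
    show "\<bar>b \<tau>\<bar> <= 1" for \<tau> using rng(1)[of \<tau>] by simp
    show "0 <= \<epsilon>1" using \<epsilon>1 by simp
    fix i w assume i: "i \<in> fJ t (p n) (q n)"
    show "norm (R n g (L.opp (cx b) (munit t (p n) (q n) i o') w)
      - L.opp (cx b) (mm ?I (g t) (munit t (p n) (q n) i o')) w) <= \<epsilon>1 * norm w"
     using near[OF _ _ gn[OF gd(1)], of g i w] g i by (simp add: e_def J_def)
    show "norm (R n (fadj g) (L.opp (cx b) (munit t (p n) (q n) i o') w)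
      - L.opp (cx b) (mm ?I (fadj g t) (munit t (p n) (q n) i o')) w) <= \<epsilon>1 * norm w"
     using near[OF _ _ gn[OF gd(1)], of "fadj g" i w] g i by (simp add: e_def J_def)
   qed
   also have "\<dots> <= \<epsilon> * norm v" using \<epsilon>1(2) by (intro mult_right_mono) (auto simp: N_def)
   finally show "norm (R m W (R n g v) - R n g (R m W v)) <= \<epsilon> * norm v" by (simp add: Wf C.K_def)
  qed
  thus "\<exists>c. norm (C.K (R m X) \<xi> - scaleC c \<xi>) <= 1 / 10000" by (simp add: Wf \<delta>_def)
 qed
qed

section \<open>Tensor products of operators\<close>

lemma col_l2: "(%i. Rep_ell2 x (i, j)) \<in> l2 UNIV"
proof (rule l2_if_finite_sums)
 fix F :: "'a set" assume F: "finite F"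
 have "(\<Sum>i\<in>F. (cmod (Rep_ell2 x (i, j)))\<^sup>2) = (\<Sum>z\<in>(%i. (i, j)) ` F. (cmod (Rep_ell2 x z))\<^sup>2)"
  by (subst sum.reindex) (auto simp: inj_on_def)
 also have "\<dots> <= (norm x)\<^sup>2" using F by (intro finite_sum_le_norm) auto
 finally show "(\<Sum>i\<in>F. (cmod (Rep_ell2 x (i, j)))\<^sup>2) <= (norm x)\<^sup>2" .
qed

definition col :: "('i \<times> 'j) ell2 => 'j => 'i ell2" where
 "col x j = Abs_ell2 (%i. Rep_ell2 x (i, j))"

lemma Rep_col [simp]: "Rep_ell2 (col x j) i = Rep_ell2 x (i, j)"
 by (simp add: col_def Abs_ell2_inverse col_l2)

lemma col_add: "col (x + y) j = col x j + col y j"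
 and col_scaleC: "col (scaleC c x) j = scaleC c (col x j)" by (auto intro!: ell2_eqI)

text \<open>Fubini after exchanging the two coordinates: the squared norms of the columns sum to the
  squared norm of the whole vector.\<close>

lemma sum_col_le:
 fixes x :: "('i \<times> 'j) ell2"
 assumes "finite F"
 shows "(\<Sum>j\<in>F. (norm (col x j))\<^sup>2) <= (norm x)\<^sup>2"
proof -
 have s: "(%z. (cmod (Rep_ell2 x z))\<^sup>2) summable_on UNIV" using Rep_l2[of x] by (simp add: l2_def)
 have b: "bij_betw prod.swap (UNIV :: ('j \<times> 'i) set) (UNIV :: ('i \<times> 'j) set)"
  by (rule bij_betwI[where g=prod.swap]) auto
 have s2: "(%z. (cmod (Rep_ell2 x (prod.swap z)))\<^sup>2) summable_on (UNIV :: ('j \<times> 'i) set)"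
  using s summable_on_reindex_bij_betw[OF b, of "%z. (cmod (Rep_ell2 x z))\<^sup>2"] by simp
 hence s3: "(%(j, i). (cmod (Rep_ell2 x (i, j)))\<^sup>2) summable_on (SIGMA j:UNIV. UNIV)"
  by (simp add: case_prod_unfold prod.swap_def)
 have "(norm x)\<^sup>2 = (\<Sum>\<^sub>\<infinity>z. (cmod (Rep_ell2 x (prod.swap z)))\<^sup>2)"
  unfolding norm_sq_eq using infsum_reindex_bij_betw[OF b, of "%z. (cmod (Rep_ell2 x z))\<^sup>2"] by simp
 also have "\<dots> = (\<Sum>\<^sub>\<infinity>(j, i)\<in>(SIGMA j:UNIV. UNIV). (cmod (Rep_ell2 x (i, j)))\<^sup>2)"
  by (simp add: case_prod_unfold prod.swap_def)
 also have "\<dots> = (\<Sum>\<^sub>\<infinity>j. \<Sum>\<^sub>\<infinity>i. (cmod (Rep_ell2 x (i, j)))\<^sup>2)" by (rule infsum_Sigma'_banach[OF s3, symmetric])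
 also have "\<dots> = (\<Sum>\<^sub>\<infinity>j. (norm (col x j))\<^sup>2)" by (simp add: norm_sq_eq)
 finally have e: "(norm x)\<^sup>2 = (\<Sum>\<^sub>\<infinity>j. (norm (col x j))\<^sup>2)" .
 have "(%j. \<Sum>\<^sub>\<infinity>i. (cmod (Rep_ell2 x (i, j)))\<^sup>2) summable_on UNIV" by (rule summable_on_Sigma_banach[OF s3])
 hence "(%j. (norm (col x j))\<^sup>2) summable_on UNIV" by (simp add: norm_sq_eq)
 thus ?thesis unfolding e using assms by (intro finite_sum_le_infsum) auto
qed

text \<open>The operator B tensor 1, acting column by column.\<close>

definition amp :: "('i ell2 => 'k ell2) => ('i \<times> 'j) ell2 => ('k \<times> 'j) ell2" where
 "amp B x = Abs_ell2 (%z. Rep_ell2 (B (col x (snd z))) (fst z))"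

lemma amp_bound:
 assumes C: "0 <= C" "!!x. norm (B x) <= C * norm x" and F: "finite F"
 shows "(\<Sum>z\<in>F. (cmod (Rep_ell2 (B (col x (snd z))) (fst z)))\<^sup>2) <= (C * norm x)\<^sup>2"
proof -
 have "(\<Sum>z\<in>F. (cmod (Rep_ell2 (B (col x (snd z))) (fst z)))\<^sup>2)
   <= (\<Sum>z\<in>fst ` F \<times> snd ` F. (cmod (Rep_ell2 (B (col x (snd z))) (fst z)))\<^sup>2)"
  using F by (intro sum_mono2[OF _ subset_fst_snd]) auto
 also have "\<dots> = (\<Sum>i\<in>fst ` F. \<Sum>j\<in>snd ` F. (cmod (Rep_ell2 (B (col x j)) i))\<^sup>2)"
  by (simp add: sum.cartesian_product case_prod_unfold)
 also have "\<dots> = (\<Sum>j\<in>snd ` F. \<Sum>i\<in>fst ` F. (cmod (Rep_ell2 (B (col x j)) i))\<^sup>2)" by (rule sum.swap)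
 also have "\<dots> <= (\<Sum>j\<in>snd ` F. C\<^sup>2 * (norm (col x j))\<^sup>2)"
 proof (rule sum_mono)
  fix j
  have "(\<Sum>i\<in>fst ` F. (cmod (Rep_ell2 (B (col x j)) i))\<^sup>2) <= (norm (B (col x j)))\<^sup>2"
   using F by (intro finite_sum_le_norm) simp
  also have "\<dots> <= (C * norm (col x j))\<^sup>2" by (intro power_mono C) simp
  finally show "(\<Sum>i\<in>fst ` F. (cmod (Rep_ell2 (B (col x j)) i))\<^sup>2) <= C\<^sup>2 * (norm (col x j))\<^sup>2"
   by (simp add: power_mult_distrib)
 qed
 also have "\<dots> <= C\<^sup>2 * (norm x)\<^sup>2"
  using sum_col_le[of "snd ` F" x] F by (simp add: sum_distrib_left[symmetric] mult_left_mono)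
 finally show ?thesis by (simp add: power_mult_distrib)
qed

lemma Rep_amp: "cblinear B ==> Rep_ell2 (amp B x) z = Rep_ell2 (B (col x (snd z))) (fst z)"
proof -
 assume B: "cblinear B"
 obtain C where C: "0 <= C" "!!x. norm (B x) <= C * norm x" using cblinear_obtain_bound[OF B] by blast
 show ?thesis unfolding amp_def by (subst Abs_ell2_inverse) (auto intro: l2_if_finite_sums amp_bound[OF C])
qed

lemma cblinear_amp: "cblinear B ==> cblinear (amp B)"
proof -
 assume B: "cblinear B"
 obtain C where C: "0 <= C" "!!x. norm (B x) <= C * norm x" using cblinear_obtain_bound[OF B] by blast
 show ?thesis
 proof (rule cblinearI[where C=C])
  show "amp B (x + y) = amp B x + amp B y" for x y
   by (rule ell2_eqI) (simp add: Rep_amp[OF B] col_add cblinear_add[OF B])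
  show "amp B (scaleC c x) = scaleC c (amp B x)" for c x
   by (rule ell2_eqI) (simp add: Rep_amp[OF B] col_scaleC cblinear_scaleC[OF B])
  show "norm (amp B x) <= C * norm x" for x
   by (rule norm_le_if_finite_sums) (use C in \<open>auto simp: Rep_amp[OF B] intro!: amp_bound[OF C]\<close>)
 qed
qed

definition flip :: "('i \<times> 'j) ell2 => ('j \<times> 'i) ell2" where
 "flip x = Abs_ell2 (%z. Rep_ell2 x (prod.swap z))"

lemma flip_bound: "finite F ==> (\<Sum>z\<in>F. (cmod (Rep_ell2 x (prod.swap z)))\<^sup>2) <= (norm x)\<^sup>2"
proof -
 assume F: "finite F"
 have "(\<Sum>z\<in>F. (cmod (Rep_ell2 x (prod.swap z)))\<^sup>2) = (\<Sum>z\<in>prod.swap ` F. (cmod (Rep_ell2 x z))\<^sup>2)"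
  by (subst sum.reindex) auto
 also have "\<dots> <= (norm x)\<^sup>2" using F by (intro finite_sum_le_norm) auto
 finally show ?thesis .
qed

lemma Rep_flip [simp]: "Rep_ell2 (flip x) z = Rep_ell2 x (prod.swap z)"
 unfolding flip_def by (subst Abs_ell2_inverse) (auto intro: l2_if_finite_sums flip_bound)

lemma cblinear_flip: "cblinear flip"
 by (rule cblinearI[where C=1])
  (auto intro!: ell2_eqI norm_le_if_finite_sums flip_bound)

definition vtens :: "'i ell2 => 'j ell2 => ('i \<times> 'j) ell2" where
 "vtens x y = Abs_ell2 (%z. Rep_ell2 x (fst z) * Rep_ell2 y (snd z))"

lemma vtens_l2: "(%z. Rep_ell2 x (fst z) * Rep_ell2 y (snd z)) \<in> l2 UNIV"
proof (rule l2_if_finite_sums)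
 fix F :: "('a \<times> 'b) set" assume F: "finite F"
 have "(\<Sum>z\<in>F. (cmod (Rep_ell2 x (fst z) * Rep_ell2 y (snd z)))\<^sup>2)
  <= (\<Sum>z\<in>fst ` F \<times> snd ` F. (cmod (Rep_ell2 x (fst z)))\<^sup>2 * (cmod (Rep_ell2 y (snd z)))\<^sup>2)"
  unfolding norm_mult power_mult_distrib using F by (intro sum_mono2[OF _ subset_fst_snd]) auto
 also have "\<dots> = (\<Sum>i\<in>fst ` F. (cmod (Rep_ell2 x i))\<^sup>2) * (\<Sum>j\<in>snd ` F. (cmod (Rep_ell2 y j))\<^sup>2)"
  by (simp add: sum_product sum.cartesian_product case_prod_unfold)
 also have "\<dots> <= (norm x)\<^sup>2 * (norm y)\<^sup>2" using F by (intro mult_mono finite_sum_le_norm) (auto intro: sum_nonneg)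
 finally show "(\<Sum>z\<in>F. (cmod (Rep_ell2 x (fst z) * Rep_ell2 y (snd z)))\<^sup>2) <= (norm x)\<^sup>2 * (norm y)\<^sup>2" .
qed

lemma Rep_vtens [simp]: "Rep_ell2 (vtens x y) z = Rep_ell2 x (fst z) * Rep_ell2 y (snd z)"
 unfolding vtens_def by (simp add: Abs_ell2_inverse vtens_l2)

lemma vtens_ket: "vtens (ket i) (ket j) = ket (i, j)"
 by (rule ell2_eqI) (auto simp: prod_eq_iff)

lemma vtens_0 [simp]: "vtens 0 y = 0" "vtens x 0 = 0"
 by (auto intro!: ell2_eqI)

text \<open>The product of B tensor 1 and 1 tensor C, where the latter is C tensor 1 conjugated by
  the flip.\<close>

definition tens :: "('i ell2 => 'i ell2) => ('j ell2 => 'j ell2) => ('i \<times> 'j) ell2 => ('i \<times> 'j) ell2" where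
 "tens B C x = amp B (flip (amp C (flip x)))"

lemma cblinear_tens: "cblinear B ==> cblinear C ==> cblinear (tens B C)"
 unfolding tens_def[abs_def]
 by (rule cblinear_comp[OF cblinear_amp cblinear_comp[OF cblinear_flip cblinear_comp[OF cblinear_amp cblinear_flip]]])

lemma tens_vtens:
 assumes "cblinear B" "cblinear C"
 shows "tens B C (vtens x y) = vtens (B x) (C y)"
proof -
 have a: "amp B (vtens x y) = vtens (B x) y" if "cblinear B"
  for B :: "'c ell2 => 'c ell2" and x and y :: "'d ell2"
 proof -
  have "col (vtens x y) j = scaleC (Rep_ell2 y j) x" for j by (rule ell2_eqI) simp
  thus ?thesis by (intro ell2_eqI) (simp add: Rep_amp[OF that] cblinear_scaleC[OF that])
 qed
 have f: "flip (vtens x y) = vtens y x" for x :: "'c ell2" and y :: "'d ell2" by (rule ell2_eqI) simp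
 show ?thesis by (simp add: tens_def f a assms)
qed

lemma tens_ket: "cblinear B ==> cblinear C ==> tens B C (ket z) = vtens (B (ket (fst z))) (C (ket (snd z)))"
 using tens_vtens[of B C "ket (fst z)" "ket (snd z)"] by (simp add: vtens_ket)

lemma tens_eqI:
 assumes "cblinear D" "cblinear B" "cblinear C" "!!i j. D (ket (i, j)) = vtens (B (ket i)) (C (ket j))"
 shows "D = tens B C"
 by (rule cblinear_eqI[OF assms(1) cblinear_tens[OF assms(2,3)]]) (use assms in \<open>auto simp: tens_ket\<close>)

lemma tens_comp:
 assumes "cblinear B" "cblinear C" "cblinear B'" "cblinear C'"
 shows "tens B C (tens B' C' x) = tens (%v. B (B' v)) (%v. C (C' v)) x"
 using tens_eqI[OF cblinear_comp[OF cblinear_tens[OF assms(1,2)] cblinear_tens[OF assms(3,4)]]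
   cblinear_comp[OF assms(1,3)] cblinear_comp[OF assms(2,4)]] assms by (simp add: tens_ket tens_vtens) (metis)

lemma tens_add_right:
 assumes "cblinear B" "cblinear C" "cblinear C'"
 shows "tens B (%v. C v + C' v) = (%x. tens B C x + tens B C' x)" by (rule tens_eqI[symmetric])
  (use assms in \<open>auto simp: cblinear_plus cblinear_tens tens_ket distrib_left intro!: ell2_eqI\<close>)

lemma tens_scale_right:
 assumes "cblinear B" "cblinear C"
 shows "tens B (%v. scaleC c (C v)) = (%x. scaleC c (tens B C x))" by (rule tens_eqI[symmetric])
  (use assms in \<open>auto simp: cblinear_smult cblinear_tens tens_ket intro!: ell2_eqI\<close>)

lemma cinner_ket_right: "l2_inner (Rep_ell2 x) (Rep_ell2 (ket i)) = cnj (Rep_ell2 x i)"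
proof -
 have "l2_inner (Rep_ell2 x) (Rep_ell2 (ket i)) = cnj (l2_inner (Rep_ell2 (ket i)) (Rep_ell2 x))"
  unfolding l2_inner_def by (simp add: mult.commute flip: infsum_cnj)
 thus ?thesis by (simp add: l2_inner_ket)
qed

lemma cadj_tens:
 assumes "cblinear B" "cblinear C"
 shows "cadj (tens B C) = tens (cadj B) (cadj C)"
proof (rule tens_eqI)
 fix k l
 show "cadj (tens B C) (ket (k, l)) = vtens (cadj B (ket k)) (cadj C (ket l))"
 proof (rule ell2_eqI)
  fix z
  show "Rep_ell2 (cadj (tens B C) (ket (k, l))) z = Rep_ell2 (vtens (cadj B (ket k)) (cadj C (ket l))) z"
   by (simp only: Rep_cadj[OF cblinear_tens[OF assms]] Rep_vtens Rep_cadj[OF assms(1)] Rep_cadj[OF assms(2)]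
    tens_ket[OF assms] cinner_ket_right) simp
 qed
qed (use assms in \<open>auto simp: cblinear_cadj cblinear_tens\<close>)

lemma tens_proj: "tens (proj I) (proj J) = proj (I \<times> J)"
 by (rule tens_eqI[symmetric]) (auto simp: cblinear_proj proj_ket vtens_ket)

text \<open>A coordinate of an elementary tensor is a product of coordinates. The lemma serves to
  show that z \<mapsto> 1 tensor z is injective.\<close>

lemma tens_nonzero:
 assumes B: "cblinear B" and C: "cblinear C" and "B x ~= 0" "C y ~= 0"
 shows "tens B C ~= (%x. 0)"
proof
 assume "tens B C = (%x. 0)"
 hence "vtens (B x) (C y) = 0" using tens_vtens[OF B C, of x y] by simp
 moreover obtain i where "Rep_ell2 (B x) i ~= 0" using assms(3) by (metis ell2_eqI Rep_ell2_0)
 moreover obtain j where "Rep_ell2 (C y) j ~= 0" using assms(4) by (metis ell2_eqI Rep_ell2_0)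
 ultimately show False using Rep_vtens[of "B x" "C y" "(i, j)"] by simp
qed

text \<open>Discharges the definite description in \<open>op_tensor\<close>: an operator with the
  prescribed values on elementary tensors agrees with \<open>tens\<close> on basis vectors, hence
  everywhere. Basis vectors outside \<open>I \<times> J\<close> go to zero on both sides.\<close>

lemma opr_op_tensor:
 fixes S :: "'i operator" and T :: "'j operator"
 assumes S: "S \<in> bounded_operators I" and T: "T \<in> bounded_operators J"
 shows "op_tensor I J S T \<in> bounded_operators (I \<times> J)"
  and "opr (I \<times> J) (op_tensor I J S T) = tens (opr I S) (opr J T)"
proof -
 let ?B = "tens (opr I S) (opr J T)"
 let ?t = "%(x :: 'i => complex) (y :: 'j => complex) (i, j). x i * y j"
 have cS: "cblinear (opr I S)" and cT: "cblinear (opr J T)" using S T by auto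
 have cB: "cblinear ?B" by (rule cblinear_tens[OF cS cT])
 have p1: "?B (proj (I \<times> J) x) = ?B x" for x
  unfolding tens_proj[symmetric] using tens_comp[OF cS cT cblinear_proj cblinear_proj, of I J x] by simp
 have p2: "proj (I \<times> J) (?B x) = ?B x" for x
  unfolding tens_proj[symmetric] using tens_comp[OF cblinear_proj cblinear_proj cS cT, of I J x] S T by simp
 define R where "R = rpo (I \<times> J) ?B"
 have R: "R \<in> bounded_operators (I \<times> J)" "opr (I \<times> J) R = ?B"
  unfolding R_def using rpo_bo[OF cB, of "I \<times> J"] by (auto simp: p1 p2)
 have el: "(?t x y) \<in> l2 (I \<times> J) & Abs_ell2 (?t x y) = vtens (Abs_ell2 x) (Abs_ell2 y)"
  if "x \<in> l2 I" "y \<in> l2 J" for x y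
 proof -
  have xy: "Rep_ell2 (Abs_ell2 x) = x" "Rep_ell2 (Abs_ell2 y) = y"
   using that by (auto simp: Abs_ell2_inverse l2_sub_UNIV)
  have e: "(?t x y) = Rep_ell2 (vtens (Abs_ell2 x) (Abs_ell2 y))" by (auto simp: xy fun_eq_iff)
  have "(?t x y) \<in> l2 (I \<times> J)" unfolding l2_iff_UNIV[of _ "I \<times> J"]
  proof (intro conjI allI impI)
   show "(?t x y) \<in> l2 UNIV" unfolding e by simp
   fix z assume "z \<notin> I \<times> J"
   thus "(case z of (i, j) => x i * y j) = 0" using that by (cases z) (auto simp: l2_def)
  qed
  thus ?thesis by (simp add: e Rep_ell2_inverse)
 qed
 have iff: "(\<forall>x\<in>l2 I. \<forall>y\<in>l2 J. R' (?t x y) = (?t (S x) (T y))) \<longleftrightarrow> opr (I \<times> J) R' = ?B"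
  if R': "R' \<in> bounded_operators (I \<times> J)" for R'
 proof
  assume a: "\<forall>x\<in>l2 I. \<forall>y\<in>l2 J. R' (?t x y) = (?t (S x) (T y))"
  show "opr (I \<times> J) R' = ?B"
  proof (rule tens_eqI)
   fix i j
   show "opr (I \<times> J) R' (ket (i, j)) = vtens (opr I S (ket i)) (opr J T (ket j))"
   proof (cases "(i, j) \<in> I \<times> J")
    case True
    have k: "Rep_ell2 (ket i) \<in> l2 I" "Rep_ell2 (ket j) \<in> l2 J" using True by (auto simp: Rep_l2_iff proj_ket)
    have "proj (I \<times> J) (ket (i, j)) = ket (i, j)" using True by (simp add: proj_ket)
    hence "Rep_ell2 (opr (I \<times> J) R' (ket (i, j))) = R' (Rep_ell2 (ket (i, j)))" by (simp only: Rep_opr[OF R'])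
    also have "Rep_ell2 (ket (i, j)) = (%(i', j'). Rep_ell2 (ket i) i' * Rep_ell2 (ket j) j')"
     by (auto simp: fun_eq_iff split: if_splits)
    also have "R' \<dots> = (%(i', j'). S (Rep_ell2 (ket i)) i' * T (Rep_ell2 (ket j)) j')" using a k by blast
    also have "\<dots> = Rep_ell2 (vtens (opr I S (ket i)) (opr J T (ket j)))"
     using True by (auto simp: Rep_opr[OF S] Rep_opr[OF T] proj_ket fun_eq_iff simp del: Rep_proj)
    finally show ?thesis by (simp only: Rep_ell2_inject)
   next
    case False
    have "opr (I \<times> J) R' (ket (i, j)) = opr (I \<times> J) R' (proj (I \<times> J) (ket (i, j)))" by simp
    also have "\<dots> = 0" using False by (simp only: proj_ket if_False cblinear_0[OF cblinear_opr[OF R']])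
    finally have l: "opr (I \<times> J) R' (ket (i, j)) = 0" .
    have "opr I S (ket i) = 0" if "i \<notin> I"
     using opr_proj[of I S "ket i"] that by (simp only: proj_ket if_False cblinear_0[OF cS])
    moreover have "opr J T (ket j) = 0" if "j \<notin> J"
     using opr_proj[of J T "ket j"] that by (simp only: proj_ket if_False cblinear_0[OF cT])
    ultimately have "opr I S (ket i) = 0 | opr J T (ket j) = 0" using False by auto
    thus ?thesis using l by auto
   qed
  qed (use R' S T in auto)
 next
  assume a: "opr (I \<times> J) R' = ?B"
  show "\<forall>x\<in>l2 I. \<forall>y\<in>l2 J. R' (?t x y) = (?t (S x) (T y))"
  proof (intro ballI)
   fix x y assume x: "x \<in> l2 I" and y: "y \<in> l2 J"
   have "R' (?t x y) = Rep_ell2 (vtens (opr I S (Abs_ell2 x)) (opr J T (Abs_ell2 y)))"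
    using el[OF x y] bo_apply[OF R', of "%(i, j). x i * y j"] by (simp add: a tens_vtens[OF cS cT] del: Rep_ell2_inject)
   also have "\<dots> = (?t (S x) (T y))" by (auto simp: bo_apply[OF S x] bo_apply[OF T y] fun_eq_iff)
   finally show "R' (?t x y) = (?t (S x) (T y))" .
  qed
 qed
 have "op_tensor I J S T = R" unfolding op_tensor_def
 proof (rule the_equality)
  show "R \<in> bounded_operators (I \<times> J) & (\<forall>x\<in>l2 I. \<forall>y\<in>l2 J. R (?t x y) = (?t (S x) (T y)))"
   using R iff[OF R(1)] by blast
  fix R' assume "R' \<in> bounded_operators (I \<times> J) & (\<forall>x\<in>l2 I. \<forall>y\<in>l2 J. R' (?t x y) = (?t (S x) (T y)))"
  thus "R' = R" using R iff[of R'] bo_eqI[of R' "I \<times> J" R] by simp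
 qed
 thus "op_tensor I J S T \<in> bounded_operators (I \<times> J)" "opr (I \<times> J) (op_tensor I J S T) = ?B" using R by auto
qed

section \<open>Operators on finite-dimensional spaces as matrices; the carrier of
  \<open>dimension_drop\<close>\<close>

definition mtx :: "'i set => 'i operator => 'i => 'i => complex" where
 "mtx I S = (%i j. if i \<in> I & j \<in> I then Rep_ell2 (opr I S (ket j)) i else 0)"

definition mop :: "'i set => ('i => 'i => complex) => 'i operator" where
 "mop I a = rpo I (%x. \<Sum>j\<in>I. scaleC (Rep_ell2 x j) (\<Sum>i\<in>I. scaleC (a i j) (ket i)))"

lemma supp_mtx [simp]: "supp I (mtx I S)"
 by (simp add: supp_def mtx_def)

lemma proj_finite: "finite I ==> proj I x = (\<Sum>j\<in>I. scaleC (Rep_ell2 x j) (ket j))"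
 by (rule ell2_eqI) (auto simp: Rep_ell2_sum if_distrib cong: if_cong)

lemma opr_finite:
 assumes I: "finite I" and S: "S \<in> bounded_operators I"
 shows "opr I S x = (\<Sum>j\<in>I. scaleC (Rep_ell2 x j) (opr I S (ket j)))"
proof -
 have "opr I S x = opr I S (proj I x)" by simp
 also have "\<dots> = (\<Sum>j\<in>I. scaleC (Rep_ell2 x j) (opr I S (ket j)))"
  unfolding proj_finite[OF I] using S by (simp add: cblinear_sum cblinear_scaleC del: opr_proj)
 finally show ?thesis .
qed

lemma Rep_opr_outside: "S \<in> bounded_operators I ==> i \<notin> I ==> Rep_ell2 (opr I S x) i = 0"
 using proj_opr[of S I x] Rep_proj[of I "opr I S x" i] by simp

lemma mop_bo:
 assumes I: "finite I"
 shows "mop I a \<in> bounded_operators I"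
  and "opr I (mop I a) = (%x. \<Sum>j\<in>I. scaleC (Rep_ell2 x j) (\<Sum>i\<in>I. scaleC (a i j) (ket i)))"
proof -
 define B where "B x = (\<Sum>j\<in>I. scaleC (Rep_ell2 x j) (\<Sum>i\<in>I. scaleC (a i j) (ket i)))" for x
 have "cblinear B"
 proof (rule cblinearI[where C="\<Sum>j\<in>I. norm (\<Sum>i\<in>I. scaleC (a i j) (ket i))"])
  show "B (x + y) = B x + B y" for x y by (simp add: B_def scaleC_add_left sum.distrib)
  show "B (scaleC c x) = scaleC c (B x)" for c x
   by (rule ell2_eqI) (simp add: B_def Rep_ell2_sum sum_distrib_left mult.assoc)
  show "norm (B x) <= (\<Sum>j\<in>I. norm (\<Sum>i\<in>I. scaleC (a i j) (ket i))) * norm x" for x unfolding B_def sum_distrib_right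
   by (rule sum_norm_le) (simp add: mult.commute[of _ "norm x"] mult_right_mono norm_coord_le)
 qed
 moreover have pB: "proj I (B x) = B x" for x
  by (rule ell2_eqI) (auto simp: B_def Rep_ell2_sum if_distrib[of "(*) _"] I cong: if_cong)
 moreover have Bp: "B (proj I x) = B x" for x by (simp add: B_def)
 ultimately show "mop I a \<in> bounded_operators I" "opr I (mop I a) = (%x. \<Sum>j\<in>I. scaleC (Rep_ell2 x j) (\<Sum>i\<in>I. scaleC (a i j) (ket i)))"
  using rpo_bo[of B I] by (simp_all add: mop_def B_def[symmetric])
qed

lemma mtx_mop: "finite I ==> supp I a ==> mtx I (mop I a) = a"
 by (auto simp: mtx_def mop_bo Rep_ell2_sum fun_eq_iff supp_def if_distrib[of "%x. x * _"] if_distrib[of "(*) _"] cong: if_cong)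

lemma mtx_inj:
 assumes "finite I" "S \<in> bounded_operators I" "T \<in> bounded_operators I" "mtx I S = mtx I T"
 shows "S = T"
proof (rule bo_eqI)
 have "opr I S (ket j) = opr I T (ket j)" if "j \<in> I" for j
 proof (rule ell2_eqI)
  fix i show "Rep_ell2 (opr I S (ket j)) i = Rep_ell2 (opr I T (ket j)) i"
   using fun_cong[OF fun_cong[OF assms(4)], of i j] that assms
   by (cases "i \<in> I") (simp_all add: mtx_def Rep_opr_outside)
 qed
 hence "opr I S x = opr I T x" for x
  unfolding opr_finite[OF assms(1,2), of x] opr_finite[OF assms(1,3), of x] by simp
 thus "opr I S = opr I T" by blast
qed (use assms in auto)

lemma mop_mtx: "finite I ==> S \<in> bounded_operators I ==> mop I (mtx I S) = S"
 by (rule mtx_inj[of I]) (simp_all add: mop_bo mtx_mop)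

lemma mtx_mult:
 assumes "finite I" "S \<in> bounded_operators I" "T \<in> bounded_operators I"
 shows "mtx I (S \<otimes>\<^bsub>BL2 I\<^esub> T) = mm I (mtx I S) (mtx I T)"
proof (intro ext)
 fix i k
 show "mtx I (S \<otimes>\<^bsub>BL2 I\<^esub> T) i k = mm I (mtx I S) (mtx I T) i k"
 proof (cases "i \<in> I & k \<in> I")
  case True
  have "Rep_ell2 (opr I S (opr I T (ket k))) i = (\<Sum>j\<in>I. Rep_ell2 (opr I T (ket k)) j * Rep_ell2 (opr I S (ket j)) i)"
   by (subst opr_finite[OF assms(1,2)]) (simp add: Rep_ell2_sum)
  thus ?thesis using True by (simp add: mtx_def mm_def opr_simps assms mult.commute)
 qed (auto simp: mtx_def mm_def)
qed

lemma mtx_add: "S \<in> bounded_operators I ==> T \<in> bounded_operators I ==> mtx I (S \<oplus>\<^bsub>BL2 I\<^esub> T) = (%i j. mtx I S i j + mtx I T i j)"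
 by (auto simp: mtx_def opr_simps fun_eq_iff)

lemma mtx_smult: "S \<in> bounded_operators I ==> mtx I (c \<odot>\<^bsub>BL2 I\<^esub> S) = (%i j. c * mtx I S i j)"
 by (auto simp: mtx_def opr_simps fun_eq_iff)

lemma mtx_one: "mtx I \<one>\<^bsub>BL2 I\<^esub> = mone I"
 by (auto simp: mtx_def opr_simps fun_eq_iff mone_def proj_ket)

lemma mtx_adj: "S \<in> bounded_operators I ==> mtx I (adj (BL2 I) S) = madj (mtx I S)"
 by (auto simp: mtx_def opr_simps fun_eq_iff madj_def Rep_cadj cinner_ket_right)

lemma cmod_mtx_le: "S \<in> bounded_operators I ==> cmod (mtx I S i j) <= nrm (BL2 I) S"
 using norm_coord_le[of "opr I S (ket j)" i] norm_opr_le[of S I "ket j"] nrm_BL2_nonneg[of S I] by (auto simp: mtx_def)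

lemma nrm_le_mtx:
 assumes I: "finite I" and S: "S \<in> bounded_operators I"
 shows "nrm (BL2 I) S <= (\<Sum>j\<in>I. \<Sum>i\<in>I. cmod (mtx I S i j))"
proof (subst nrm_BL2_le[OF S], simp add: sum_nonneg, intro allI)
 fix x
 have "norm (opr I S (ket j)) <= (\<Sum>i\<in>I. cmod (mtx I S i j))" if "j \<in> I" for j
 proof -
  have "opr I S (ket j) = (\<Sum>i\<in>I. scaleC (mtx I S i j) (ket i))"
   using proj_finite[OF I, of "opr I S (ket j)"] S that by (simp add: mtx_def)
  thus ?thesis by (auto intro!: sum_norm_le)
 qed
 thus "norm (opr I S x) <= (\<Sum>j\<in>I. \<Sum>i\<in>I. cmod (mtx I S i j)) * norm x"
  unfolding opr_finite[OF I S, of x] sum_distrib_right[of _ I "norm x"]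
  by (intro sum_norm_le) (simp add: mult.commute[of _ "norm x"] mult_mono norm_coord_le flip: sum_distrib_left)
qed

lemma mtx_op_tensor:
 assumes "S \<in> bounded_operators I" "T \<in> bounded_operators J"
 shows "mtx (I \<times> J) (op_tensor I J S T) x y = mtx I S (fst x) (fst y) * mtx J T (snd x) (snd y)"
 using assms by (auto simp: mtx_def opr_op_tensor tens_ket mem_Times_iff)

lemma mtx_minus:
 assumes "S \<in> bounded_operators I" "T \<in> bounded_operators I"
 shows "mtx I (S \<ominus>\<^bsub>BL2 I\<^esub> T) = (%i j. mtx I S i j - mtx I T i j)"
proof -
 interpret normed_star_algebra "BL2 I" by (rule normed_star_algebra_BL2)
 show ?thesis using assms smult_closed[of T "-1"] by (simp add: minus_smult mtx_add mtx_smult)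
qed

lemma (in normed_star_algebra) continuous_into_iff:
 fixes f :: "'b :: metric_space => 'a"
 shows "continuous_map (top_of_set S) (cstar_topology A) f \<longleftrightarrow> f ` S \<subseteq> carrier A &
  (\<forall>x\<in>S. \<forall>e>0. \<exists>d>0. \<forall>y\<in>S. dist y x < d --> nrm A (f x \<ominus> f y) < e)" (is "?l \<longleftrightarrow> _ & ?r")
proof (cases "f ` S \<subseteq> carrier A")
 case True
 have "(\<exists>U. openin (top_of_set S) U & x \<in> U & (\<forall>y\<in>U. f y \<in> metric.mball (f x) e))
  \<longleftrightarrow> (\<exists>d>0. \<forall>y\<in>S. dist y x < d --> nrm A (f x \<ominus> f y) < e)" if x: "x \<in> S" for x e
 proof
  assume "\<exists>U. openin (top_of_set S) U & x \<in> U & (\<forall>y\<in>U. f y \<in> metric.mball (f x) e)"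
  then obtain U where U: "openin (top_of_set S) U" "x \<in> U" "\<forall>y\<in>U. f y \<in> metric.mball (f x) e" by blast
  obtain d where "d > 0" "\<forall>y\<in>S. dist y x < d --> y \<in> U" using U(1,2) unfolding openin_euclidean_subtopology_iff by blast
  thus "\<exists>d>0. \<forall>y\<in>S. dist y x < d --> nrm A (f x \<ominus> f y) < e"
   using U(3) True x by (intro exI[of _ d]) (auto simp: metric.in_mball cdist_def image_subset_iff split: if_splits)
 next
  assume "\<exists>d>0. \<forall>y\<in>S. dist y x < d --> nrm A (f x \<ominus> f y) < e"
  then obtain d where d: "d > 0" "\<forall>y\<in>S. dist y x < d --> nrm A (f x \<ominus> f y) < e" by blast
  have "openin (top_of_set S) (S \<inter> ball x d)" by (intro openin_open_Int open_ball)
  thus "\<exists>U. openin (top_of_set S) U & x \<in> U & (\<forall>y\<in>U. f y \<in> metric.mball (f x) e)"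
   using d True x by (intro exI[of _ "S \<inter> ball x d"])
    (auto simp: metric.in_mball cdist_def image_subset_iff dist_commute)
 qed
 thus ?thesis using True by (simp add: metric.continuous_map_to_metric)
next
 case False
 thus ?thesis using continuous_map_image_subset_topspace[of "top_of_set S" "cstar_topology A" f] by auto
qed

text \<open>Over a finite index set the operator norm dominates every entry and is dominated by the
  sum of the moduli of all entries, so continuity in norm is continuity of the entries.\<close>

lemma continuous_BL2_iff:
 fixes f :: "real => 'i operator"
 assumes I: "finite I"
 shows "continuous_map (top_of_set S) (cstar_topology (BL2 I)) f \<longleftrightarrow> f ` S \<subseteq> bounded_operators I &
  (\<forall>i j. continuous_on S (%t. mtx I (f t) i j))"
proof (cases "f ` S \<subseteq> bounded_operators I")
 case True
 interpret normed_star_algebra "BL2 I" by (rule normed_star_algebra_BL2)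
 have fb: "f t \<in> bounded_operators I" if "t \<in> S" for t using True that by blast
 let ?d = "%x y. f x \<ominus>\<^bsub>BL2 I\<^esub> f y"
 have "(\<forall>x\<in>S. \<forall>e>0. \<exists>d>0. \<forall>y\<in>S. dist y x < d --> nrm (BL2 I) (?d x y) < e)
  \<longleftrightarrow> (\<forall>i j. continuous_on S (%t. mtx I (f t) i j))"
 proof
  assume a: "\<forall>x\<in>S. \<forall>e>0. \<exists>d>0. \<forall>y\<in>S. dist y x < d --> nrm (BL2 I) (?d x y) < e"
  have b: "dist (mtx I (f y) i j) (mtx I (f x) i j) <= nrm (BL2 I) (?d x y)" if "x \<in> S" "y \<in> S" for x y i j
   using cmod_mtx_le[of "?d x y" I i j] fb[OF that(1)] fb[OF that(2)] minus_closed[of "f x" "f y"]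
   by (simp add: mtx_minus dist_norm norm_minus_commute)
  show "\<forall>i j. continuous_on S (%t. mtx I (f t) i j)"
   unfolding continuous_on_iff using a b by (meson order_le_less_trans)
 next
  assume a: "\<forall>i j. continuous_on S (%t. mtx I (f t) i j)"
  show "\<forall>x\<in>S. \<forall>e>0. \<exists>d>0. \<forall>y\<in>S. dist y x < d --> nrm (BL2 I) (?d x y) < e"
  proof (intro ballI allI impI)
   fix x and e :: real assume x: "x \<in> S" and e: "e > 0"
   define g where "g y = (\<Sum>j\<in>I. \<Sum>i\<in>I. cmod (mtx I (f x) i j - mtx I (f y) i j))" for y
   have "continuous_on S g" unfolding g_def using a by (intro continuous_intros) auto
   then obtain d where d: "d > 0" "\<forall>y\<in>S. dist y x < d --> dist (g y) (g x) < e"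
    using x e unfolding continuous_on_iff by meson
   have "nrm (BL2 I) (?d x y) <= g y" if "y \<in> S" for y
    using nrm_le_mtx[OF I, of "?d x y"] fb[OF that] fb[OF x] minus_closed[of "f x" "f y"]
    by (simp add: mtx_minus g_def)
   moreover have "g x = 0" "g y \<ge> 0" for y by (simp_all add: g_def sum_nonneg)
   ultimately have "dist y x < d --> nrm (BL2 I) (?d x y) < e" if "y \<in> S" for y
    using d(2)[rule_format, OF that] that by (auto simp: dist_real_def intro: order_le_less_trans)
   thus "\<exists>d>0. \<forall>y\<in>S. dist y x < d --> nrm (BL2 I) (?d x y) < e" using d(1) by blast
  qed
 qed
 thus ?thesis unfolding continuous_into_iff using True by simp
next
 case False
 interpret normed_star_algebra "BL2 I" by (rule normed_star_algebra_BL2)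
 show ?thesis unfolding continuous_into_iff using False by simp
qed

lemma mop_mult:
 assumes "finite I" "supp I a" "supp I b"
 shows "mop I (mm I a b) = mop I a \<otimes>\<^bsub>BL2 I\<^esub> mop I b"
 by (rule mtx_inj[of I]) (use assms in \<open>simp_all add: mop_bo opr_mult mtx_mop mtx_mult supp_mm\<close>)

lemma mop_add:
 assumes "finite I" "supp I a" "supp I b"
 shows "mop I (%i j. a i j + b i j) = mop I a \<oplus>\<^bsub>BL2 I\<^esub> mop I b"
proof -
 have "supp I (%i j. a i j + b i j)" using assms(2,3) by (auto simp: supp_def)
 thus ?thesis by (intro mtx_inj[of I]) (use assms in \<open>simp_all add: mop_bo opr_add mtx_mop mtx_add\<close>)
qed

lemma mop_smult:
 assumes "finite I" "supp I a"
 shows "mop I (%i j. c * a i j) = c \<odot>\<^bsub>BL2 I\<^esub> mop I a"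
proof -
 have "supp I (%i j. c * a i j)" using assms(2) by (auto simp: supp_def)
 thus ?thesis by (intro mtx_inj[of I]) (use assms in \<open>simp_all add: mop_bo opr_smult mtx_mop mtx_smult\<close>)
qed

lemma mop_adj:
 assumes "finite I" "supp I a"
 shows "mop I (madj a) = adj (BL2 I) (mop I a)"
 by (rule mtx_inj[of I]) (use assms in \<open>simp_all add: mop_bo opr_adj mtx_mop mtx_adj supp_madj\<close>)

text \<open>The matrix of a tensor 1 repeats the entries of a along the diagonal of the second
  coordinate, which is what \<open>iota 0\<close> does. So the boundary condition at 0 is membership
  in the fibre at 0.\<close>

lemma boundary_0:
 assumes q: "q \<ge> 1" and T: "T \<in> bounded_operators (idx p q)"
 shows "(\<exists>a\<in>carrier (Mn p). T = op_tensor {..<p} {..<q} a \<one>\<^bsub>Mn q\<^esub>) \<longleftrightarrow> mtx (idx p q) T \<in> Fib 0 p q"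
proof
 assume "\<exists>a\<in>carrier (Mn p). T = op_tensor {..<p} {..<q} a \<one>\<^bsub>Mn q\<^esub>"
 then obtain a where a: "a \<in> bounded_operators {..<p}" "T = op_tensor {..<p} {..<q} a \<one>\<^bsub>Mn q\<^esub>" by auto
 define a' where "a' x y = (if x \<in> fJ 0 p q & y \<in> fJ 0 p q then mtx {..<p} a (fst x) (fst y) else 0)" for x y :: "nat \<times> nat"
 have "mtx (idx p q) T x y = iota 0 p q a' x y" for x y unfolding a(2) idx_def mtx_op_tensor[OF a(1) opr_one(1)]
  using q by (auto simp: mtx_one mone_def iota_def idx_def a'_def fJ_def fpi_def fka_def mtx_def image_iff opr_one(2) proj_ket mem_Times_iff)
 hence "mtx (idx p q) T = iota 0 p q a'" by blast
 moreover have "supp (fJ 0 p q) a'" by (auto simp: supp_def a'_def)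
 ultimately show "mtx (idx p q) T \<in> Fib 0 p q" using FibI by simp
next
 assume "mtx (idx p q) T \<in> Fib 0 p q"
 then obtain a where a: "mtx (idx p q) T = iota 0 p q a" unfolding Fib_def by blast
 define b where "b i j = (if i < p & j < p then a (i, 0) (j, 0) else 0)" for i j
 have b: "supp {..<p} b" by (auto simp: supp_def b_def)
 have "mtx (idx p q) T x y = mtx (idx p q) (op_tensor {..<p} {..<q} (mop {..<p} b) \<one>\<^bsub>Mn q\<^esub>) x y" for x y
  unfolding a unfolding idx_def mtx_op_tensor[OF mop_bo(1)[OF finite_lessThan] opr_one(1)] mtx_mop[OF finite_lessThan b]
  by (auto simp: iota_def idx_def fka_def fpi_def b_def mtx_one mone_def mem_Times_iff)
 hence "T = op_tensor {..<p} {..<q} (mop {..<p} b) \<one>\<^bsub>Mn q\<^esub>"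
  using T by (intro mtx_inj[of "idx p q"]) (auto simp: idx_def mop_bo opr_op_tensor opr_one intro!: ext)
 thus "\<exists>a\<in>carrier (Mn p). T = op_tensor {..<p} {..<q} a \<one>\<^bsub>Mn q\<^esub>" using mop_bo(1)[of "{..<p}" b] by auto
qed

lemma boundary_1:
 assumes q: "p \<ge> 1" and T: "T \<in> bounded_operators (idx p q)"
 shows "(\<exists>a\<in>carrier (Mn q). T = op_tensor {..<p} {..<q} \<one>\<^bsub>Mn p\<^esub> a) \<longleftrightarrow> mtx (idx p q) T \<in> Fib 1 p q"
proof
 assume "\<exists>a\<in>carrier (Mn q). T = op_tensor {..<p} {..<q} \<one>\<^bsub>Mn p\<^esub> a"
 then obtain a where a: "a \<in> bounded_operators {..<q}" "T = op_tensor {..<p} {..<q} \<one>\<^bsub>Mn p\<^esub> a" by auto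
 define a' where "a' x y = (if x \<in> fJ 1 p q & y \<in> fJ 1 p q then mtx {..<q} a (snd x) (snd y) else 0)" for x y :: "nat \<times> nat"
 have "mtx (idx p q) T x y = iota 1 p q a' x y" for x y unfolding a(2) idx_def mtx_op_tensor[OF opr_one(1) a(1)]
  using q by (auto simp: mtx_one mone_def iota_def idx_def a'_def fJ_def fpi_def fka_def mtx_def image_iff opr_one(2) proj_ket mem_Times_iff)
 hence "mtx (idx p q) T = iota 1 p q a'" by blast
 moreover have "supp (fJ 1 p q) a'" by (auto simp: supp_def a'_def)
 ultimately show "mtx (idx p q) T \<in> Fib 1 p q" using FibI by simp
next
 assume "mtx (idx p q) T \<in> Fib 1 p q"
 then obtain a where a: "mtx (idx p q) T = iota 1 p q a" unfolding Fib_def by blast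
 define b where "b i j = (if i < q & j < q then a (0, i) (0, j) else 0)" for i j
 have b: "supp {..<q} b" by (auto simp: supp_def b_def)
 have "mtx (idx p q) T x y = mtx (idx p q) (op_tensor {..<p} {..<q} \<one>\<^bsub>Mn p\<^esub> (mop {..<q} b)) x y" for x y
  unfolding a unfolding idx_def mtx_op_tensor[OF opr_one(1) mop_bo(1)[OF finite_lessThan]] mtx_mop[OF finite_lessThan b]
  by (auto simp: iota_def idx_def fka_def fpi_def b_def mtx_one mone_def mem_Times_iff)
 hence "T = op_tensor {..<p} {..<q} \<one>\<^bsub>Mn p\<^esub> (mop {..<q} b)"
  using T by (intro mtx_inj[of "idx p q"]) (auto simp: idx_def mop_bo opr_op_tensor opr_one intro!: ext)
 thus "\<exists>a\<in>carrier (Mn q). T = op_tensor {..<p} {..<q} \<one>\<^bsub>Mn p\<^esub> a" using mop_bo(1)[of "{..<q}" b] by auto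
qed

definition mk :: "nat => nat => (real => cmat) => real => (nat \<times> nat) operator" where
 "mk p q M = (\<lambda>t\<in>{0..1}. mop (idx p q) (M t))"

lemma mk_inj:
 assumes "M \<in> Mfun p q" "N \<in> Mfun p q" "mk p q M = mk p q N"
 shows "M = N"
proof
 fix t show "M t = N t"
 proof (cases "t \<in> {0..1}")
  case True
  hence "mop (idx p q) (M t) = mop (idx p q) (N t)" using fun_cong[OF assms(3), of t] by (simp add: mk_def)
  hence "mtx (idx p q) (mop (idx p q) (M t)) = mtx (idx p q) (mop (idx p q) (N t))" by (rule arg_cong)
  thus ?thesis unfolding mtx_mop[OF finite_idx MfunD(4)[OF assms(1)]] mtx_mop[OF finite_idx MfunD(4)[OF assms(2)]] .
 next
  case False
  thus ?thesis using MfunD(3)[OF assms(1) False] MfunD(3)[OF assms(2) False] by (simp only:)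
 qed
qed

lemma carrier_dimension_drop:
 assumes "p \<ge> 1" "q \<ge> 1"
 shows "carrier (dimension_drop p q) = mk p q ` Mfun p q"
proof -
 have c: "f \<in> carrier (dimension_drop p q) \<longleftrightarrow> f \<in> extensional {0..1} & f ` {0..1} \<subseteq> bounded_operators (idx p q) &
   (\<forall>i j. continuous_on {0..1} (%t. mtx (idx p q) (f t) i j)) & mtx (idx p q) (f 0) \<in> Fib 0 p q & mtx (idx p q) (f 1) \<in> Fib 1 p q"
  (is "_ \<longleftrightarrow> ?c f") for f
 proof -
  have "f \<in> carrier (dimension_drop p q) \<longleftrightarrow> f \<in> extensional {0..1} &
    continuous_map (top_of_set {0..1}) (cstar_topology (BL2 (idx p q))) f &
    (\<exists>a\<in>carrier (Mn p). f 0 = op_tensor {..<p} {..<q} a \<one>\<^bsub>Mn q\<^esub>) &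
    (\<exists>b\<in>carrier (Mn q). f 1 = op_tensor {..<p} {..<q} \<one>\<^bsub>Mn p\<^esub> b)"
   by (auto simp: dimension_drop_def C01_def idx_def Let_def)
  also have "\<dots> \<longleftrightarrow> ?c f"
  proof (cases "f ` {0..1} \<subseteq> bounded_operators (idx p q)")
   case True
   hence "f 0 \<in> bounded_operators (idx p q)" "f 1 \<in> bounded_operators (idx p q)" by auto
   from boundary_0[OF assms(2) this(1)] boundary_1[OF assms(1) this(2)] show ?thesis
    unfolding continuous_BL2_iff[OF finite_idx] by (simp only: True simp_thms conj_assoc)
  next
   case False
   thus ?thesis unfolding continuous_BL2_iff[OF finite_idx] by blast
  qed
  finally show ?thesis .
 qed
 show ?thesis
 proof (intro equalityI subsetI)
  fix f assume "f \<in> carrier (dimension_drop p q)"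
  hence f: "?c f" using c by blast
  define M where "M t = (if t \<in> {0..1} then mtx (idx p q) (f t) else (%i j. 0))" for t
  have "M \<in> Mfun p q" unfolding Mfun_def
  proof (intro CollectI conjI allI ballI impI)
   fix i j
   have "continuous_on {0..1} (%t. mtx (idx p q) (f t) i j)" using f by blast
   thus "continuous_on {0..1} (%t. M t i j)"
    by (subst continuous_on_cong[OF refl, where g="%t. mtx (idx p q) (f t) i j"]) (auto simp: M_def)
  next
   fix t :: real assume t: "t \<in> {0..1}"
   thus "M t \<in> Fib t p q" using f Fib_interior[of t p q "M t"] by (cases "t = 0 | t = 1") (auto simp: M_def)
  qed (auto simp: M_def)
  moreover have "f = mk p q M" using f by (auto simp: mk_def M_def fun_eq_iff extensional_def mop_mtx image_subset_iff)
  ultimately show "f \<in> mk p q ` Mfun p q" by blast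
 next
  fix f assume "f \<in> mk p q ` Mfun p q"
  then obtain M where M: "M \<in> Mfun p q" "f = mk p q M" by blast
  have m: "mtx (idx p q) (f t) = M t" if "t \<in> {0..1}" for t
   using that MfunD(4)[OF M(1)] by (simp add: M(2) mk_def mtx_mop)
  have "continuous_on {0..1} (%t. mtx (idx p q) (f t) i j)" for i j
   using MfunD(1)[OF M(1), of i j] by (subst continuous_on_cong[OF refl, where g="%t. M t i j"]) (auto simp: m)
  moreover have "f \<in> extensional {0..1}" "f ` {0..1} \<subseteq> bounded_operators (idx p q)" by (auto simp: M(2) mk_def mop_bo)
  ultimately have "?c f" using m[of 0] m[of 1] MfunD(2)[OF M(1), of 0] MfunD(2)[OF M(1), of 1] by simp
  thus "f \<in> carrier (dimension_drop p q)" using c by blast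
 qed
qed

lemma mk_ops:
 assumes M: "M \<in> Mfun p q" and N: "N \<in> Mfun p q"
 shows "mk p q (fadd M N) = mk p q M \<oplus>\<^bsub>dimension_drop p q\<^esub> mk p q N"
  and "mk p q (fm p q M N) = mk p q M \<otimes>\<^bsub>dimension_drop p q\<^esub> mk p q N"
  and "mk p q (fadj M) = adj (dimension_drop p q) (mk p q M)"
  and "mk p q (fsc c M) = c \<odot>\<^bsub>dimension_drop p q\<^esub> mk p q M" using MfunD(4)[OF M] MfunD(4)[OF N]
 by (auto simp: mk_def dimension_drop_def C01_def Let_def fadd_def fm_def fadj_def fsc_def
   mop_add mop_mult mop_adj mop_smult fun_eq_iff simp flip: idx_def)

lemma fm_fone: "M \<in> Mfun p q ==> fm p q M (fone p q) = M" "M \<in> Mfun p q ==> fm p q (fone p q) M = M"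
proof -
 assume M: "M \<in> Mfun p q"
 have "fm p q M (fone p q) t = M t & fm p q (fone p q) M t = M t" for t
 proof (cases "t \<in> {0..1}")
  case True
  hence "fone p q t = mone (idx p q)" by (simp add: fone_def hs_def)
  thus ?thesis using MfunD(4)[OF M, of t] by (simp add: fm_def mm_one)
 qed (use MfunD(3)[OF M] in \<open>simp add: fm_def mm_def\<close>)
 thus "fm p q M (fone p q) = M" "fm p q (fone p q) M = M" by blast+
qed

lemma Mfun_fone: "fone p q \<in> Mfun p q"
 unfolding fone_def by (intro Mfun_hs adm_one) simp

section \<open>The building blocks of the Jiang-Su algebra\<close>

locale dd_level = cstar_algebra Z + monoid Z for Z :: "'a cstar" (structure) +
 fixes D :: "'a set" and p q :: nat and \<psi> :: "(real => cmat) => 'a"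
 assumes D: "cstar_subalgebra Z D" and pq: "p \<ge> 1" "q \<ge> 1" and bij: "bij_betw \<psi> (Mfun p q) D"
  and add: "M \<in> Mfun p q ==> N \<in> Mfun p q ==> \<psi> (fadd M N) = \<psi> M \<oplus> \<psi> N"
  and mult: "M \<in> Mfun p q ==> N \<in> Mfun p q ==> \<psi> (fm p q M N) = \<psi> M \<otimes> \<psi> N"
  and adj: "M \<in> Mfun p q ==> \<psi> (fadj M) = adj Z (\<psi> M)"
  and sc: "M \<in> Mfun p q ==> \<psi> (fsc c M) = c \<odot> \<psi> M"
  and one: "\<psi> (fone p q) = \<one>"

lemma dd_level_exists:
 fixes Z (structure)
 assumes Z: "cstar_algebra Z" "monoid Z" and D: "cstar_subalgebra Z D" "\<one> \<in> D" and pq: "p \<ge> 1" "q \<ge> 1"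
  and iso: "isomorphic (Z\<lparr>carrier := D\<rparr>) (dimension_drop p q)"
 shows "\<exists>\<psi>. dd_level Z D p q \<psi>"
proof -
 interpret cstar_algebra Z by (rule Z)
 interpret monoid Z by (rule Z)
 obtain f where f: "star_hom (Z\<lparr>carrier := D\<rparr>) (dimension_drop p q) f" "bij_betw f D (carrier (dimension_drop p q))"
  using iso unfolding isomorphic_def by auto
 note fD = star_homD[OF f(1), simplified]
 have inj: "inj_on f D" and im: "f ` D = mk p q ` Mfun p q"
  using f(2) unfolding bij_betw_def carrier_dimension_drop[OF pq] by (rule conjunct1, rule conjunct2)
 define \<psi> where "\<psi> M = the_inv_into D f (mk p q M)" for M
 have \<psi>: "\<psi> M \<in> D" "f (\<psi> M) = mk p q M" if "M \<in> Mfun p q" for M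
 proof -
  have "mk p q M \<in> f ` D" unfolding im using that by blast
  thus "\<psi> M \<in> D" "f (\<psi> M) = mk p q M"
   unfolding \<psi>_def using the_inv_into_into[OF inj] f_the_inv_into_f[OF inj] by blast+
 qed
 have \<psi>I: "\<psi> M = x" if "x \<in> D" "f x = mk p q M" for M x
  unfolding \<psi>_def that(2)[symmetric] by (rule the_inv_into_f_f[OF inj that(1)])
 note DD = cstar_subalgebraD[OF D(1)]
 have "\<psi> ` Mfun p q = D"
 proof (intro equalityI subsetI)
  fix x assume x: "x \<in> D"
  then obtain M where "M \<in> Mfun p q" "f x = mk p q M" using im by blast
  thus "x \<in> \<psi> ` Mfun p q" using \<psi>I[OF x] by blast
 qed (use \<psi> in auto)
 moreover have "inj_on \<psi> (Mfun p q)" by (rule inj_onI) (metis \<psi>(2) mk_inj)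
 ultimately have bij: "bij_betw \<psi> (Mfun p q) D" by (simp add: bij_betw_def)
 have add: "\<psi> (fadd M N) = \<psi> M \<oplus> \<psi> N" and mult: "\<psi> (fm p q M N) = \<psi> M \<otimes> \<psi> N"
  if "M \<in> Mfun p q" "N \<in> Mfun p q" for M N by (rule \<psi>I, simp_all add: DD \<psi> that fD mk_ops)+
 have adj: "\<psi> (fadj M) = adj Z (\<psi> M)" and sc: "\<psi> (fsc c M) = c \<odot> \<psi> M" if "M \<in> Mfun p q" for M c
  by (rule \<psi>I, simp_all add: DD \<psi> that fD mk_ops[OF that that])+
 have "\<one> \<in> \<psi> ` Mfun p q" using D(2) \<open>\<psi> ` Mfun p q = D\<close> by simp
 then obtain P where P: "P \<in> Mfun p q" "\<psi> P = \<one>" by force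
 \<comment> \<open>The image of \<open>fone\<close> is a unit of \<open>D\<close>. Since
   \<open>D\<close> contains the unit of Z, written as the image of P, the product of the two is
   equal to both of them.\<close>
 have c: "\<psi> (fone p q) \<in> carrier Z" using \<psi>(1)[OF Mfun_fone] subalgebra_subset[OF D(1)] by blast
 have "\<psi> (fone p q) = \<psi> P \<otimes> \<psi> (fone p q)" using c P(2) by simp
 also have "\<dots> = \<one>" unfolding mult[OF P(1) Mfun_fone, symmetric] fm_fone(1)[OF P(1)] by (rule P(2))
 finally have one: "\<psi> (fone p q) = \<one>" .
 have "dd_level Z D p q \<psi>" by (intro dd_level.intro dd_level_axioms.intro Z D(1) pq bij add mult adj sc one)
 thus ?thesis by blast
qed

context dd_level
begin

lemma psi_D: "M \<in> Mfun p q ==> \<psi> M \<in> D"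
 using bij by (rule bij_betwE[THEN bspec])

lemma psi_carrier: "M \<in> Mfun p q ==> \<psi> M \<in> carrier Z"
 using psi_D subalgebra_subset[OF D] by blast

lemma psi_surj: "x \<in> D ==> \<exists>M\<in>Mfun p q. x = \<psi> M"
 using bij unfolding bij_betw_def by blast

lemma psi_inj: "M \<in> Mfun p q ==> N \<in> Mfun p q ==> \<psi> M = \<psi> N ==> M = N"
 using bij unfolding bij_betw_def inj_on_def by blast

text \<open>Evaluation at s is a star homomorphism from \<open>D\<close> to a matrix algebra, hence
  contractive, and an entry is bounded by the norm of the matrix.\<close>

lemma entry_le:
 assumes M: "M \<in> Mfun p q"
 shows "cmod (M s i j) <= nrm Z (\<psi> M)"
proof (cases "s \<in> {0..1}")
 case True
 define e where "e x = mop (idx p q) (the_inv_into (Mfun p q) \<psi> x s)" for x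
 have inj: "inj_on \<psi> (Mfun p q)" using bij unfolding bij_betw_def by blast
 have e: "e (\<psi> N) = mop (idx p q) (N s)" if "N \<in> Mfun p q" for N
  unfolding e_def by (simp add: the_inv_into_f_f[OF inj that])
 have "star_hom (Z\<lparr>carrier := D\<rparr>) (BL2 (idx p q)) e"
 proof (rule star_homI)
  fix x y c assume "x \<in> carrier (Z\<lparr>carrier := D\<rparr>)" "y \<in> carrier (Z\<lparr>carrier := D\<rparr>)"
  then obtain X Y where X: "X \<in> Mfun p q" "x = \<psi> X" and Y: "Y \<in> Mfun p q" "y = \<psi> Y"
   using psi_surj[of x] psi_surj[of y] by auto
  note sX = MfunD(4)[OF X(1), of s] and sY = MfunD(4)[OF Y(1), of s]
  have "e (x \<oplus> y) = e x \<oplus>\<^bsub>BL2 (idx p q)\<^esub> e y"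
   unfolding X(2) Y(2) add[OF X(1) Y(1), symmetric] e[OF X(1)] e[OF Y(1)] e[OF Mfun_fadd[OF X(1) Y(1)]]
   by (simp add: fadd_def mop_add sX sY)
  thus "e (x \<oplus>\<^bsub>Z\<lparr>carrier := D\<rparr>\<^esub> y) = e x \<oplus>\<^bsub>BL2 (idx p q)\<^esub> e y" by simp
  have "e (x \<otimes> y) = e x \<otimes>\<^bsub>BL2 (idx p q)\<^esub> e y"
   unfolding X(2) Y(2) mult[OF X(1) Y(1), symmetric] e[OF X(1)] e[OF Y(1)] e[OF Mfun_fm[OF X(1) Y(1)]]
   by (simp add: fm_def mop_mult sX sY)
  thus "e (x \<otimes>\<^bsub>Z\<lparr>carrier := D\<rparr>\<^esub> y) = e x \<otimes>\<^bsub>BL2 (idx p q)\<^esub> e y" by simp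
 next
  fix x c assume "x \<in> carrier (Z\<lparr>carrier := D\<rparr>)"
  then obtain X where X: "X \<in> Mfun p q" "x = \<psi> X" using psi_surj[of x] by auto
  note sX = MfunD(4)[OF X(1), of s]
  show "e x \<in> carrier (BL2 (idx p q))" unfolding X(2) e[OF X(1)] by (simp add: mop_bo)
  have "e (c \<odot> x) = c \<odot>\<^bsub>BL2 (idx p q)\<^esub> e x"
   unfolding X(2) sc[OF X(1), symmetric] e[OF X(1)] e[OF Mfun_fsc[OF X(1)]] by (simp add: fsc_def mop_smult sX)
  thus "e (c \<odot>\<^bsub>Z\<lparr>carrier := D\<rparr>\<^esub> x) = c \<odot>\<^bsub>BL2 (idx p q)\<^esub> e x" by simp
  have "e (cstar.adj Z x) = cstar.adj (BL2 (idx p q)) (e x)"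
   unfolding X(2) adj[OF X(1), symmetric] e[OF X(1)] e[OF Mfun_fadj[OF X(1)]] by (simp add: fadj_def mop_adj sX)
  thus "e (cstar.adj (Z\<lparr>carrier := D\<rparr>) x) = cstar.adj (BL2 (idx p q)) (e x)" by simp
 qed
 from star_hom_contractive[OF cstar_subalgebra_algebra[OF D] this, of "\<psi> M"]
 have "nrm (BL2 (idx p q)) (mop (idx p q) (M s)) <= nrm Z (\<psi> M)" using psi_D[OF M] e[OF M] by simp
 moreover have "cmod (M s i j) <= nrm (BL2 (idx p q)) (mop (idx p q) (M s))"
  using cmod_mtx_le[OF mop_bo(1)[OF finite_idx, of p q "M s"], of i j] unfolding mtx_mop[OF finite_idx MfunD(4)[OF M]] .
 ultimately show ?thesis by simp
next
 case False
 thus ?thesis using MfunD(3)[OF M False] nrm_nonneg[OF psi_carrier[OF M]] by simp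
qed

lemma dd_rep_of_star_hom:
 assumes \<eta>: "star_hom Z (BL2 UNIV) \<eta>" and \<eta>1: "\<eta> \<one> = \<one>\<^bsub>BL2 UNIV\<^esub>"
 shows "dd_rep p q (%M. opr UNIV (\<eta> (\<psi> M)))"
proof -
 note h = star_homD[OF \<eta>, unfolded carrier_BL2]
 note b = h(1)[OF psi_carrier]
 show ?thesis
 proof
  show "p \<ge> 1" "q \<ge> 1" by (rule pq)+
  fix M N v w c assume M: "M \<in> Mfun p q"
  note cM = psi_carrier[OF M]
  show "cblinear (opr UNIV (\<eta> (\<psi> M)))" using b[OF M] by simp
  show "inner (opr UNIV (\<eta> (\<psi> M)) v) w = inner v (opr UNIV (\<eta> (\<psi> (fadj M))) w)"
   unfolding adj[OF M] h(5)[OF cM] opr_adj(2)[OF b[OF M]]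
   using inner_cadj[OF cblinear_opr[OF b[OF M]], of w v] by (simp add: inner_commute)
  show "opr UNIV (\<eta> (\<psi> (fsc c M))) = (%v. scaleC c (opr UNIV (\<eta> (\<psi> M)) v))"
   unfolding sc[OF M] h(3)[OF cM] opr_smult(2)[OF b[OF M]] ..
  assume N: "N \<in> Mfun p q"
  note cN = psi_carrier[OF N]
  show "opr UNIV (\<eta> (\<psi> (fadd M N))) = (%v. opr UNIV (\<eta> (\<psi> M)) v + opr UNIV (\<eta> (\<psi> N)) v)"
   unfolding add[OF M N] h(2)[OF cM cN] opr_add(2)[OF b[OF M] b[OF N]] ..
  show "opr UNIV (\<eta> (\<psi> (fm p q M N))) = (%v. opr UNIV (\<eta> (\<psi> M)) (opr UNIV (\<eta> (\<psi> N)) v))"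
   unfolding mult[OF M N] h(4)[OF cM cN] opr_mult(2)[OF b[OF M] b[OF N]] ..
 next
  show "opr UNIV (\<eta> (\<psi> (fone p q))) = (%v. v)" unfolding one \<eta>1 opr_one(2) by (simp add: fun_eq_iff)
 qed
qed

end

section \<open>Simplicity makes nonzero elements full at a finite level\<close>

lemma (in normed_star_algebra) closure_of_seqI:
 "S \<subseteq> carrier A ==> (%n. nrm A (X n \<ominus> x)) \<longlonglongrightarrow> 0 ==> (!!n. X n \<in> S) ==> x \<in> carrier A ==>
  x \<in> cstar_topology A closure_of S" by (simp add: closure_of_seq) (rule exI[of _ X], simp)

text \<open>The ideal generated by c, without closure: each of its elements then belongs to one
  level, where it is a finite sum.\<close>

inductive_set ideal_in :: "'a cstar => 'a set => 'a => 'a set" for A D c where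
 mult: "y \<in> D ==> z \<in> D ==> y \<otimes>\<^bsub>A\<^esub> c \<otimes>\<^bsub>A\<^esub> z \<in> ideal_in A D c"
| add: "x \<in> ideal_in A D c ==> y \<in> ideal_in A D c ==> x \<oplus>\<^bsub>A\<^esub> y \<in> ideal_in A D c"

lemma ideal_in_mono: "x \<in> ideal_in A D c ==> D \<subseteq> D' ==> x \<in> ideal_in A D' c"
 by (induction rule: ideal_in.induct) (auto intro: ideal_in.intros)

lemma ideal_in_props:
 fixes A (structure)
 assumes A: "normed_star_algebra A" and D: "cstar_subalgebra A D" and c: "c \<in> D" and x: "x \<in> ideal_in A D c" and y: "y \<in> D"
 shows "x \<in> D" "y \<otimes> x \<in> ideal_in A D c" "x \<otimes> y \<in> ideal_in A D c"
proof -
 interpret normed_star_algebra A by (rule A)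
 note DD = cstar_subalgebraD[OF D] and sub = subsetD[OF subalgebra_subset[OF D]]
 have "x \<in> D & y \<otimes> x \<in> ideal_in A D c & x \<otimes> y \<in> ideal_in A D c" using x
 proof (induction rule: ideal_in.induct)
  case (mult u z)
  have "y \<otimes> (u \<otimes> c \<otimes> z) = (y \<otimes> u) \<otimes> c \<otimes> z" using mult y c by (simp add: sub m_assoc m_closed)
  moreover have "(u \<otimes> c \<otimes> z) \<otimes> y = u \<otimes> c \<otimes> (z \<otimes> y)" using mult y c by (simp add: sub m_assoc m_closed)
  ultimately show ?case using mult y c by (simp add: DD ideal_in.mult)
 next
  case (add u v)
  hence "u \<in> D" "v \<in> D" by auto
  thus ?case using add y by (simp add: DD l_distr r_distr sub ideal_in.add)
 qed
 thus "x \<in> D" "y \<otimes> x \<in> ideal_in A D c" "x \<otimes> y \<in> ideal_in A D c" by auto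
qed

text \<open>The closure of the union of the algebraic ideals generated by c at the various levels is
  a closed ideal of Z, because the union of the levels is dense. By simplicity it contains the unit,
  which is therefore approximated by an element of the ideal at one level.\<close>

lemma dense_ideal:
 fixes Z (structure) and D :: "nat => 'a set"
 assumes Z: "cstar_algebra Z" "monoid Z" "simple Z" and D: "!!n. cstar_subalgebra Z (D n)" "!!n. \<one> \<in> D n"
  and mono: "!!n m. n <= m ==> D n \<subseteq> D m"
  and dense: "cstar_topology Z closure_of (\<Union>n. D n) = carrier Z"
  and c: "c \<in> D n" "c ~= \<zero>"
 shows "\<exists>m\<ge>n. \<exists>w\<in>ideal_in Z (D m) c. nrm Z (\<one> \<ominus> w) < 1"
proof -
 interpret cstar_algebra Z by (rule Z)
 interpret monoid Z by (rule Z)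
 note sub = subsetD[OF subalgebra_subset[OF D(1)]]
 have cm: "c \<in> D m" if "n <= m" for m using mono[OF that] c by blast
 have wD: "w \<in> D m" if "w \<in> ideal_in Z (D m) c" "n <= m" for w m
  using ideal_in_props(1)[OF normed_star_algebra_axioms D(1) cm[OF that(2)] that(1) D(2)] .
 define I where "I = (\<Union>m\<in>{n..}. ideal_in Z (D m) c)"
 have I: "I \<subseteq> carrier Z" and U: "(\<Union>n. D n) \<subseteq> carrier Z" unfolding I_def using wD sub by auto
 have cZ: "c \<in> carrier Z" using c sub by blast
 moreover have "\<one> \<otimes> c \<otimes> \<one> \<in> ideal_in Z (D n) c" by (rule ideal_in.mult[OF D(2) D(2)])
 ultimately have cI: "c \<in> I" unfolding I_def by auto
 have I_add: "x \<oplus> y \<in> I" if xy: "x \<in> I" "y \<in> I" for x y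
 proof -
  obtain m k where "m \<ge> n" "x \<in> ideal_in Z (D m) c" "y \<in> ideal_in Z (D k) c" using xy by (auto simp: I_def)
  note this(1) ideal_in_mono[OF this(2) mono[of m "max m k"]] ideal_in_mono[OF this(3) mono[of k "max m k"]]
  hence "n <= max m k" "x \<oplus> y \<in> ideal_in Z (D (max m k)) c" by (simp_all add: ideal_in.add)
  thus ?thesis unfolding I_def by blast
 qed
 have I_mult: "x \<otimes> y \<in> I & y \<otimes> x \<in> I" if xy: "x \<in> I" "y \<in> (\<Union>n. D n)" for x y
 proof -
  obtain m k where m: "m \<ge> n" "x \<in> ideal_in Z (D m) c" "y \<in> D k" using xy by (auto simp: I_def)
  have nm: "n <= max m k" using m(1) by simp
  have "x \<in> ideal_in Z (D (max m k)) c" "y \<in> D (max m k)"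
   using ideal_in_mono[OF m(2) mono[of m "max m k"]] m(3) mono[of k "max m k"] by auto
  note ideal_in_props(2,3)[OF normed_star_algebra_axioms D(1) cm[OF nm] this]
  thus ?thesis using nm unfolding I_def by (intro conjI UN_I[of "max m k"]) simp_all
 qed
 let ?J = "cstar_topology Z closure_of I"
 note iff = closure_of_seq[OF I]
 have mult: "x \<otimes> y \<in> ?J & y \<otimes> x \<in> ?J" if x: "x \<in> ?J" and y: "y \<in> carrier Z" for x y
 proof -
  obtain X where X: "!!n. X n \<in> I" "x \<in> carrier Z" "(%n. nrm Z (X n \<ominus> x)) \<longlonglongrightarrow> 0" using x unfolding iff by blast
  obtain Y where Y: "!!n. Y n \<in> (\<Union>n. D n)" "(%n. nrm Z (Y n \<ominus> y)) \<longlonglongrightarrow> 0"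
   using y closure_of_seq[OF U, of y] unfolding dense by blast
  note Xc = subsetD[OF I X(1)] and Yc = subsetD[OF U Y(1)]
  show ?thesis
   using closure_of_seqI[OF I lim_mult[OF Xc X(2,3) Yc y Y(2)]] closure_of_seqI[OF I lim_mult[OF Yc y Y(2) Xc X(2,3)]]
    I_mult[OF X(1) Y(1)] X(2) y m_closed by simp
 qed
 have cJ: "c \<in> ?J" using cI closure_of_subset[of I "cstar_topology Z"] I by auto
 have Jc: "?J \<subseteq> carrier Z" unfolding closure_of_iff[OF I] subset_iff by blast
 have sc: "k \<odot> x \<in> ?J" if "x \<in> ?J" for x k
 proof -
  have "k \<odot> x = (k \<odot> \<one>) \<otimes> x" using subsetD[OF Jc that] by (simp add: smult_mult_left)
  thus ?thesis using mult[OF that] by (simp add: smult_closed)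
 qed
 have "x \<oplus> y \<in> ?J" if xy: "x \<in> ?J" "y \<in> ?J" for x y
 proof -
  obtain X where X: "!!n. X n \<in> I" "x \<in> carrier Z" "(%n. nrm Z (X n \<ominus> x)) \<longlonglongrightarrow> 0" using xy(1) unfolding iff by blast
  obtain Y where Y: "!!n. Y n \<in> I" "y \<in> carrier Z" "(%n. nrm Z (Y n \<ominus> y)) \<longlonglongrightarrow> 0" using xy(2) unfolding iff by blast
  show ?thesis
   by (rule closure_of_seqI[OF I lim_add[OF subsetD[OF I X(1)] X(2,3) subsetD[OF I Y(1)] Y(2,3)] I_add[OF X(1) Y(1)]])
    (simp add: X Y)
 qed
 moreover have "\<zero> \<in> ?J" using sc[OF cJ, of 0] cZ by (simp add: smult_zero_left)
 ultimately have "closed_ideal Z ?J" unfolding closed_ideal_def by (intro conjI ballI allI closedin_closure_of sc) (simp_all add: mult)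
 hence "?J = carrier Z" using Z(3) cJ c(2) unfolding simple_def by blast
 hence "\<one> \<in> ?J" by simp
 then obtain w where "w \<in> I" "nrm Z (\<one> \<ominus> w) < 1" unfolding closure_of_iff[OF I] by (auto dest: spec[of _ 1])
 thus ?thesis unfolding I_def by blast
qed

lemma (in dd_level) ideal_in_vanish:
 assumes x: "x \<in> ideal_in Z D (\<psi> N)" and N: "N \<in> Mfun p q" "N s = (%i j. 0)"
 shows "\<exists>K\<in>Mfun p q. x = \<psi> K & K s = (%i j. 0)"
proof -
 note psi_mult = mult and psi_add = add
 show ?thesis using x
proof (induction rule: ideal_in.induct)
 case (mult y z)
 obtain Y where Y: "Y \<in> Mfun p q" "y = \<psi> Y" using psi_surj[OF mult(1)] by blast
 obtain W where W: "W \<in> Mfun p q" "z = \<psi> W" using psi_surj[OF mult(2)] by blast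
 let ?K = "fm p q (fm p q Y N) W"
 note YN = Mfun_fm[OF Y(1) N(1)]
 have "y \<otimes> \<psi> N \<otimes> z = \<psi> ?K" using Y W N(1) YN by (simp add: psi_mult)
 moreover have "?K s = (%i j. 0)" using N(2) by (simp add: fm_def mm_def)
 ultimately show ?case using Mfun_fm[OF YN W(1)] by blast
next
 case (add x y)
 obtain X where X: "X \<in> Mfun p q" "x = \<psi> X" "X s = (%i j. 0)" using add.IH(1) by blast
 obtain Y where Y: "Y \<in> Mfun p q" "y = \<psi> Y" "Y s = (%i j. 0)" using add.IH(2) by blast
 have "x \<oplus> y = \<psi> (fadd X Y)" using X Y by (simp add: psi_add)
 moreover have "fadd X Y s = (%i j. 0)" using X(3) Y(3) by (simp add: fadd_def)
 ultimately show ?case using Mfun_fadd[OF X(1) Y(1)] by blast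
qed
qed

text \<open>If N vanished at s, so would every element of the ideal it generates. Then 1 - w would
  be the unit matrix at s and have norm at least 1.\<close>

lemma (in dd_level) nonvanish:
 assumes w: "w \<in> ideal_in Z D (\<psi> N)" "nrm Z (\<one> \<ominus> w) < 1" and N: "N \<in> Mfun p q" and s: "s \<in> {0..1}"
 shows "N s ~= (%i j. 0)"
proof
 assume "N s = (%i j. 0)"
 then obtain K where K: "K \<in> Mfun p q" "w = \<psi> K" "K s = (%i j. 0)" using ideal_in_vanish[OF w(1) N] by blast
 define E where "E = fadd (fone p q) (fsc (- 1) K)"
 note k = Mfun_fsc[OF K(1), of "- 1"]
 have E: "E \<in> Mfun p q" unfolding E_def by (rule Mfun_fadd[OF Mfun_fone k])
 have "\<psi> E = \<one> \<ominus> w"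
  unfolding E_def add[OF Mfun_fone k] sc[OF K(1)] one K(2) by (simp add: minus_smult psi_carrier[OF K(1)])
 moreover have "E s (0, 0) (0, 0) = 1"
  using s pq K(3) by (simp add: E_def fadd_def fsc_def fone_def hs_def mone_def idx_def)
 ultimately have "1 <= nrm Z (\<one> \<ominus> w)" using entry_le[OF E, of s "(0, 0)" "(0, 0)"] by simp
 thus False using w(2) by simp
qed

section \<open>Almost central elements of the Jiang-Su algebra\<close>

text \<open>Reduction to \<open>approx_central_nonscalar\<close> for the levels of an inductive
  limit. Its fullness assumption holds because the ideal generated by a nonzero element comes within
  distance less than 1 of the unit at some level and stays so at all later ones; from there on the
  element vanishes in no fibre. Finitely many elements of Z are approximated within a single
  level.\<close>

theorem jiang_su_approx_central:
 fixes Z :: "'z cstar" (structure) and \<eta> :: "'z => 'i operator"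
 assumes Z: "jiang_su Z" and \<eta>: "star_hom Z (BL2 UNIV) \<eta>" "inj_on \<eta> (carrier Z)" "\<eta> \<one> = \<one>\<^bsub>BL2 UNIV\<^esub>"
  and \<xi>: "norm \<xi> = 1"
 shows "\<exists>\<delta>>0. \<forall>G \<epsilon>. finite G --> G \<subseteq> carrier Z --> \<epsilon> > 0 -->
  (\<exists>z\<in>carrier Z. (\<forall>v. norm (opr UNIV (\<eta> z) v) <= norm v) &
   (\<forall>g\<in>G. \<forall>v. norm (opr UNIV (\<eta> z) (opr UNIV (\<eta> g) v) - opr UNIV (\<eta> g) (opr UNIV (\<eta> z) v)) <= \<epsilon> * norm v) &
   (\<forall>c. \<delta> < norm (opr UNIV (\<eta> z) \<xi> - scaleC c \<xi>)))"
proof -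
 have Z': "cstar_algebra Z" "monoid Z" "simple Z" "dimension_drop_limit Z" using Z unfolding jiang_su_def by blast+
 interpret cstar_algebra Z by (rule Z'(1))
 interpret monoid Z by (rule Z'(2))
 obtain D where D: "\<forall>n. cstar_subalgebra Z (D n) & \<one> \<in> D n & D n \<subseteq> D (Suc n) &
    (\<exists>p\<ge>1. \<exists>q\<ge>1. coprime p q & isomorphic (Z\<lparr>carrier := D n\<rparr>) (dimension_drop p q))"
  and dense: "cstar_topology Z closure_of (\<Union>n::nat. D n) = carrier Z"
  using Z'(4) unfolding dimension_drop_limit_def by blast
 have Ds: "!!n. cstar_subalgebra Z (D n)" and D1: "!!n. \<one> \<in> D n" and DS: "!!n. D n \<subseteq> D (Suc n)" using D by blast+
 have mono: "D n \<subseteq> D m" if "n <= m" for n m by (rule lift_Suc_mono_le[of D, OF DS that])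
 note sub = subsetD[OF subalgebra_subset[OF Ds]]
 have "\<exists>p q \<psi>. dd_level Z (D n) p q \<psi>" for n using D dd_level_exists[OF Z'(1,2) Ds D1] by blast
 then obtain p q \<psi> where lev: "!!n. dd_level Z (D n) (p n) (q n) (\<psi> n)" by metis
 define R where "R n M = opr UNIV (\<eta> (\<psi> n M))" for n M
 note psi_D = dd_level.psi_D[OF lev] and psi_c = dd_level.psi_carrier[OF lev]
 note h = star_homD[OF \<eta>(1), unfolded carrier_BL2]
 have inj': "x = y" if "x \<in> carrier Z" "y \<in> carrier Z" "opr UNIV (\<eta> x) = opr UNIV (\<eta> y)" for x y
  using bo_eqI[OF h(1)[OF that(1)] h(1)[OF that(2)] that(3)] \<eta>(2) that(1,2) by (auto dest: inj_onD)
 obtain \<delta> where \<delta>: "\<delta> > 0" and ac: "!!n G \<epsilon>. finite G ==> G \<subseteq> Mfun (p n) (q n) ==> \<epsilon> > 0 ==>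
   \<exists>m\<ge>n. \<exists>M\<in>Mfun (p m) (q m). (\<forall>v. norm (R m M v) <= norm v) &
    (\<forall>g\<in>G. \<forall>v. norm (R m M (R n g v) - R n g (R m M v)) <= \<epsilon> * norm v) & (\<forall>c. \<delta> < norm (R m M \<xi> - scaleC c \<xi>))"
 proof -
  have "\<exists>\<delta>>0. \<forall>n G \<epsilon>. finite G --> G \<subseteq> Mfun (p n) (q n) --> \<epsilon> > 0 --> (\<exists>m\<ge>n. \<exists>M\<in>Mfun (p m) (q m).
    (\<forall>v. norm (R m M v) <= norm v) &
    (\<forall>g\<in>G. \<forall>v. norm (R m M (R n g v) - R n g (R m M v)) <= \<epsilon> * norm v) & (\<forall>c. \<delta> < norm (R m M \<xi> - scaleC c \<xi>)))"
  proof (rule approx_central_nonscalar)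
   show "dd_rep (p n) (q n) (R n)" for n unfolding R_def by (rule dd_level.dd_rep_of_star_hom[OF lev \<eta>(1,3)])
   show "M = N" if "M \<in> Mfun (p n) (q n)" "N \<in> Mfun (p n) (q n)" "R n M = R n N" for n M N
    using that inj'[OF psi_c[OF that(1)] psi_c[OF that(2)]] dd_level.psi_inj[OF lev that(1,2)] by (simp add: R_def)
   show "\<exists>N\<in>Mfun (p m) (q m). R m N = R n M" if "n <= m" "M \<in> Mfun (p n) (q n)" for n m M
   proof -
    have "\<psi> n M \<in> D m" using psi_D[OF that(2)] mono[OF that(1)] by blast
    then obtain N where "N \<in> Mfun (p m) (q m)" "\<psi> n M = \<psi> m N" using dd_level.psi_surj[OF lev] by blast
    thus ?thesis unfolding R_def by (intro bexI[of _ N]) simp_all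
   qed
   show "\<exists>m0. \<forall>m\<ge>m0. \<forall>N\<in>Mfun (p m) (q m). R m N = R n M --> (\<forall>s\<in>{0..1}. N s ~= (%i j. 0))"
    if M: "M \<in> Mfun (p n) (q n)" and nz: "M ~= (%t i j. 0)" for n M
   proof -
    interpret dd_level Z "D n" "p n" "q n" "\<psi> n" by (rule lev)
    have z: "(%t i j. 0) \<in> Mfun (p n) (q n)" "\<psi> n (%t i j. 0) = \<zero>"
     using Mfun_fsc[OF M, of 0] sc[OF M, of 0] psi_carrier[OF M] by (simp_all add: fsc_def smult_zero_left)
    have "\<psi> n M ~= \<zero>" using psi_inj[OF M z(1)] nz z(2) by auto
    then obtain m0 w where w: "n <= m0" "w \<in> ideal_in Z (D m0) (\<psi> n M)" "nrm Z (\<one> \<ominus> w) < 1"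
     using dense_ideal[OF Z'(1-3) Ds D1 mono dense psi_D[OF M]] by blast
    show ?thesis
    proof (intro exI[of _ m0] allI impI ballI)
     fix m N s assume a: "m0 <= m" "N \<in> Mfun (p m) (q m)" "R m N = R n M" "s \<in> {0..1 :: real}"
     have e: "\<psi> m N = \<psi> n M" using inj'[OF psi_c[OF a(2)] psi_c[OF M]] a(3) by (simp add: R_def)
     have "w \<in> ideal_in Z (D m) (\<psi> m N)" unfolding e by (rule ideal_in_mono[OF w(2) mono[OF a(1)]])
     thus "N s ~= (%i j. 0)" by (rule dd_level.nonvanish[OF lev _ w(3) a(2,4)])
    qed
   qed
  qed (rule \<xi>)
  thus ?thesis using that by meson
 qed
 have "\<exists>z\<in>carrier Z. (\<forall>v. norm (opr UNIV (\<eta> z) v) <= norm v) &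
   (\<forall>g\<in>G. \<forall>v. norm (opr UNIV (\<eta> z) (opr UNIV (\<eta> g) v) - opr UNIV (\<eta> g) (opr UNIV (\<eta> z) v)) <= \<epsilon> * norm v) &
   (\<forall>c. \<delta> < norm (opr UNIV (\<eta> z) \<xi> - scaleC c \<xi>))"
  if G: "finite G" "G \<subseteq> carrier Z" and \<epsilon>: "\<epsilon> > 0" for G \<epsilon>
 proof -
  have s: "(\<Union>n. D n) \<subseteq> carrier Z" using sub by blast
  have "\<exists>n M. M \<in> Mfun (p n) (q n) & nrm Z (g \<ominus> \<psi> n M) < \<epsilon> / 4" if g: "g \<in> G" for g
  proof -
   have "g \<in> cstar_topology Z closure_of (\<Union>n. D n)" using g G(2) by (simp only: dense) blast
   then obtain n y where "y \<in> D n" "nrm Z (g \<ominus> y) < \<epsilon> / 4"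
    using \<epsilon> unfolding closure_of_iff[OF s] by (metis UN_E divide_pos_pos zero_less_numeral)
   thus ?thesis using dd_level.psi_surj[OF lev] by blast
  qed
  then obtain k K where k: "!!g. g \<in> G ==> K g \<in> Mfun (p (k g)) (q (k g)) & nrm Z (g \<ominus> \<psi> (k g) (K g)) < \<epsilon> / 4" by metis
  define n where "n = Max (insert 0 (k ` G))"
  have "\<exists>N\<in>Mfun (p n) (q n). \<psi> n N = \<psi> (k g) (K g)" if g: "g \<in> G" for g
  proof -
   have "k g <= n" unfolding n_def using G(1) g by (intro Max_ge) auto
   hence "\<psi> (k g) (K g) \<in> D n" using psi_D k[OF g] mono by blast
   thus ?thesis using dd_level.psi_surj[OF lev] by metis
  qed
  then obtain N where N: "!!g. g \<in> G ==> N g \<in> Mfun (p n) (q n)" "!!g. g \<in> G ==> \<psi> n (N g) = \<psi> (k g) (K g)" by metis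
  have "finite (N ` G)" "N ` G \<subseteq> Mfun (p n) (q n)" using G(1) N(1) by auto
  from ac[OF this, of "\<epsilon> / 2"] \<epsilon> obtain m M where M: "M \<in> Mfun (p m) (q m)" and
   M1: "!!v. norm (R m M v) <= norm v" and
   M2: "!!g v. g \<in> G ==> norm (R m M (R n (N g) v) - R n (N g) (R m M v)) <= \<epsilon> / 2 * norm v" and
   M3: "!!c. \<delta> < norm (R m M \<xi> - scaleC c \<xi>)" by auto
  have lin: "cblinear (R m M)" unfolding R_def using h(1)[OF psi_c[OF M]] by simp
  have "norm (R m M (opr UNIV (\<eta> g) v) - opr UNIV (\<eta> g) (R m M v)) <= \<epsilon> * norm v" if g: "g \<in> G" for g v
  proof -
   \<comment> \<open>The error of replacing g by its approximant, of norm at most \<epsilon>/4. It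
     enters the commutator twice, which together with \<epsilon>/2 for the approximant gives
     \<epsilon>.\<close>
   define d where "d v = opr UNIV (\<eta> g) v - R n (N g) v" for v
   have cg: "g \<in> carrier Z" using g G(2) by blast
   note cn = psi_c[OF N(1)[OF g]]
   have d: "norm (d v) <= \<epsilon> / 4 * norm v" for v
   proof -
    have "d v = opr UNIV (\<eta> (g \<ominus> \<psi> n (N g))) v"
     unfolding star_hom_minus[OF \<eta>(1) normed_star_algebra_axioms normed_star_algebra_BL2 cg cn] d_def R_def
     using opr_minus[OF h(1)[OF cg] h(1)[OF cn]] by simp
    also have "norm \<dots> <= nrm Z (g \<ominus> \<psi> n (N g)) * norm v"
     by (rule star_hom_contractive_opr[OF Z'(1) \<eta>(1) minus_closed[OF cg cn]])
    also have "\<dots> <= \<epsilon> / 4 * norm v" using k[OF g] by (intro mult_right_mono) (simp_all add: N(2)[OF g])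
    finally show ?thesis .
   qed
   have "R m M (opr UNIV (\<eta> g) v) = R m M (R n (N g) v) + R m M (d v)" by (simp add: d_def flip: cblinear_add[OF lin])
   hence "R m M (opr UNIV (\<eta> g) v) - opr UNIV (\<eta> g) (R m M v) = (R m M (R n (N g) v) - R n (N g) (R m M v)) + (R m M (d v) - d (R m M v))"
    by (simp add: d_def)
   hence "norm (R m M (opr UNIV (\<eta> g) v) - opr UNIV (\<eta> g) (R m M v))
     <= norm (R m M (R n (N g) v) - R n (N g) (R m M v)) + norm (R m M (d v) - d (R m M v))"
    by (simp only: norm_triangle_ineq)
   moreover have "norm (R m M (d v) - d (R m M v)) <= norm (R m M (d v)) + norm (d (R m M v))" by (rule norm_triangle_ineq4)
   moreover have "norm (R m M (d v)) <= \<epsilon> / 4 * norm v" using M1[of "d v"] d[of v] by simp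
   moreover have "norm (d (R m M v)) <= \<epsilon> / 4 * norm v"
    using M1[of v] \<epsilon> by (intro order_trans[OF d[of "R m M v"]] mult_left_mono) simp_all
   ultimately show ?thesis using M2[OF g, of v] by simp
  qed
  thus ?thesis using psi_c[OF M] M1 M3 unfolding R_def by (intro bexI[of _ "\<psi> m M"]) auto
 qed
 thus ?thesis using \<delta> by blast
qed

section \<open>The free product of copies of the group with two elements\<close>

definition lmul :: "nat => nat list => nat list" where
 "lmul x w = (if w ~= [] & hd w = x then tl w else x # w)"

lemma distinct_adj_lmul: "distinct_adj w ==> distinct_adj (lmul x w)"
 by (cases w) (auto simp: lmul_def distinct_adj_Cons)

lemma lmul_lmul: "distinct_adj w ==> lmul x (lmul x w) = w"
 by (cases w) (auto simp: lmul_def distinct_adj_Cons)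

text \<open>Left and right multiplication act on opposite ends of a word; they can touch the same
  letter only if its length is at most one, and there the cases are checked.\<close>

lemma lmul_rev_lmul:
 assumes "distinct_adj w"
 shows "lmul x (rev (lmul y (rev w))) = rev (lmul y (rev (lmul x w)))"
proof (cases w)
 case (Cons a v)
 show ?thesis
 proof (cases v rule: rev_cases)
  case Nil
  thus ?thesis using Cons by (auto simp: lmul_def)
 next
  case (snoc m b)
  thus ?thesis using Cons by (auto simp: lmul_def hd_append)
 qed
qed (auto simp: lmul_def)

text \<open>Reduced words: the free product of the groups \<open>\<int>/2\<close> with generators \<open>0, 1, 2, \<dots>\<close>.\<close>

typedef rword = "{w :: nat list. distinct_adj w}" by (rule exI[of _ "[]"]) simp

definition em :: rword where "em = Abs_rword []"
definition lm :: "nat => rword => rword" where "lm x w = Abs_rword (lmul x (Rep_rword w))"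
definition rm :: "nat => rword => rword" where "rm x w = Abs_rword (rev (lmul x (rev (Rep_rword w))))"

lemma Rep_rword_adj [simp]: "distinct_adj (Rep_rword w)"
 using Rep_rword[of w] by simp

lemma Rep_em [simp]: "Rep_rword em = []"
 by (simp add: em_def Abs_rword_inverse)

lemma Rep_lm: "Rep_rword (lm x w) = lmul x (Rep_rword w)"
 by (simp add: lm_def Abs_rword_inverse distinct_adj_lmul)

lemma Rep_rm: "Rep_rword (rm x w) = rev (lmul x (rev (Rep_rword w)))"
 by (simp add: rm_def Abs_rword_inverse distinct_adj_lmul)

lemma lm_lm [simp]: "lm x (lm x w) = w"
 by (simp add: lmul_lmul Rep_lm flip: Rep_rword_inject)

lemma rm_rm [simp]: "rm x (rm x w) = w"
 by (simp add: lmul_lmul Rep_rm flip: Rep_rword_inject)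

lemma lm_eqD: "lm x v = w ==> lm x w = v"
 by auto

lemma lm_rm: "lm x (rm y w) = rm y (lm x w)"
 by (simp add: lmul_rev_lmul Rep_rm Rep_lm flip: Rep_rword_inject)

text \<open>Right multiplication by k, composed of right multiplications by the letters of k. It
  carries statements about left multiplication at the unit over to k.\<close>

lemma right_translation: "\<exists>\<rho>. inj \<rho> & \<rho> em = k & (\<forall>x w. lm x (\<rho> w) = \<rho> (lm x w))"
proof (induction "Rep_rword k" arbitrary: k rule: rev_induct)
 case Nil
 hence "em = k" by (simp flip: Rep_rword_inject)
 thus ?case by (intro exI[of _ id]) auto
next
 case (snoc y w)
 hence d: "distinct_adj (w @ [y])" by (metis Rep_rword_adj)
 define k' where "k' = Abs_rword w"
 have k': "Rep_rword k' = w" using d by (simp add: k'_def Abs_rword_inverse distinct_adj_append_iff)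
 obtain \<rho> where \<rho>: "inj \<rho>" "\<rho> em = k'" "\<forall>x w. lm x (\<rho> w) = \<rho> (lm x w)" using snoc.hyps(1)[of k'] k' by blast
 have "w = [] | last w ~= y" using d by (auto simp: distinct_adj_append_iff)
 hence "Rep_rword (rm y k') = w @ [y]" unfolding Rep_rm k' by (auto simp: lmul_def hd_rev)
 hence "rm y k' = k" unfolding snoc.hyps(2) Rep_rword_inject .
 moreover have "inj (%w. rm y (\<rho> w))" by (rule injI) (metis \<rho>(1) injD rm_rm)
 ultimately show ?case using \<rho> by (intro exI[of _ "%w. rm y (\<rho> w)"]) (simp add: lm_rm)
qed

text \<open>\<open>foldr lm g\<close> is left multiplication by the product of the generators listed
  in g; such a map fixes one element of the group iff it fixes all of them.\<close>

lemma free_action: "foldr lm g k = k \<longleftrightarrow> foldr lm g em = em"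
proof -
 obtain \<rho> where \<rho>: "inj \<rho>" "\<rho> em = k" "\<forall>x w. lm x (\<rho> w) = \<rho> (lm x w)" using right_translation by blast
 have "foldr lm g (\<rho> w) = \<rho> (foldr lm g w)" for w by (induction g) (auto simp: \<rho>(3))
 thus ?thesis using \<rho>(1,2) by (metis injD)
qed

section \<open>Operators on lists given by words in the generators\<close>

text \<open>The pair \<open>(h, r)\<close> stands for the nonempty list \<open>h # r\<close>.\<close>

type_synonym wl = "rword \<times> rword list"

text \<open>The generators act on basis vectors as partial injections, with \<open>None\<close>
  standing for the zero vector. Removing the head is possible only if it is the unit and the list
  has a further entry, so lists stay nonempty.\<close>

definition ush :: "wl => wl option" where
 "ush l = Some (em, fst l # snd l)"
definition pop :: "wl => wl option" where
 "pop l = (case snd l of [] => None | h # r => if fst l = em then Some (h, r) else None)"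
definition lact :: "nat => wl => wl option" where
 "lact x l = Some (lm x (fst l), snd l)"

text \<open>The letters \<open>0\<close>, \<open>1\<close> and \<open>x + 2\<close> stand for the isometry \<open>s\<close>, its adjoint and the unitary \<open>u_x\<close>.\<close>

definition act1 :: "nat => wl => wl option" where
 "act1 g = (if g = 0 then ush else if g = 1 then pop else lact (g - 2))"
definition inv1 :: "nat => nat" where
 "inv1 g = (if g = 0 then 1 else if g = 1 then 0 else g)"

lemma act1_inv1: "act1 g i = Some j \<longleftrightarrow> act1 (inv1 g) j = Some i"
 by (cases i; cases j)
  (auto simp: act1_def inv1_def ush_def pop_def lact_def dest: lm_eqD split: list.splits if_splits)

text \<open>Coordinates are pulled back along f, so the basis vector at f(j) is sent to the one at
  j. This is why \<open>op1\<close> uses the inverse letter.\<close>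

definition pull :: "('i => 'i option) => 'i ell2 => 'i ell2" where
 "pull f x = Abs_ell2 (%j. case f j of None => 0 | Some i => Rep_ell2 x i)"

lemma pull_bound:
 assumes f: "!!i j k. f i = Some k ==> f j = Some k ==> i = j" and F: "finite F"
 shows "(\<Sum>j\<in>F. (cmod (case f j of None => 0 | Some i => Rep_ell2 x i))\<^sup>2) <= (norm x)\<^sup>2"
proof -
 let ?F = "{j \<in> F. f j ~= None}"
 have "(\<Sum>j\<in>F. (cmod (case f j of None => 0 | Some i => Rep_ell2 x i))\<^sup>2) = (\<Sum>j\<in>?F. (cmod (Rep_ell2 x (the (f j))))\<^sup>2)"
  using F by (intro sum.mono_neutral_cong_right) auto
 also have "\<dots> = (\<Sum>i\<in>(%j. the (f j)) ` ?F. (cmod (Rep_ell2 x i))\<^sup>2)"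
  using f by (subst sum.reindex) (auto simp: inj_on_def)
 also have "\<dots> <= (norm x)\<^sup>2" using F by (intro finite_sum_le_norm) auto
 finally show ?thesis .
qed

lemma
 assumes f: "!!i j k. f i = Some k ==> f j = Some k ==> i = j"
 shows Rep_pull: "Rep_ell2 (pull f x) j = (case f j of None => 0 | Some i => Rep_ell2 x i)"
  and norm_pull_le: "norm (pull f x) <= norm x"
proof -
 show R: "Rep_ell2 (pull f x) j = (case f j of None => 0 | Some i => Rep_ell2 x i)" for j
  unfolding pull_def by (subst Abs_ell2_inverse) (auto intro: l2_if_finite_sums pull_bound f)
 show "norm (pull f x) <= norm x" by (rule norm_le_if_finite_sums) (auto simp: R intro!: pull_bound f)
qed

definition op1 :: "nat => wl ell2 => wl ell2" where
 "op1 g = pull (act1 (inv1 g))"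

lemma act1_inj: "act1 g i = Some k ==> act1 g j = Some k ==> i = j"
 using act1_inv1[of g i k] act1_inv1[of g j k] by simp

lemma Rep_op1: "Rep_ell2 (op1 g x) j = (case act1 (inv1 g) j of None => 0 | Some i => Rep_ell2 x i)"
 unfolding op1_def by (rule Rep_pull) (erule (1) act1_inj)

lemma norm_op1_le: "norm (op1 g x) <= norm x"
 unfolding op1_def by (rule norm_pull_le) (erule (1) act1_inj)

lemma cblinear_op1: "cblinear (op1 g)"
 by (rule cblinearI[where C=1])
  (auto intro!: ell2_eqI simp: Rep_op1 norm_op1_le split: option.splits)

lemma op1_ket: "op1 g (ket i) = (case act1 g i of None => 0 | Some j => ket j)"
proof (rule ell2_eqI)
 fix k
 show "Rep_ell2 (op1 g (ket i)) k = Rep_ell2 (case act1 g i of None => 0 | Some j => ket j) k"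
  using act1_inv1[of g i k] by (auto simp: Rep_op1 split: option.splits)
qed

lemma cadj_op1: "cadj (op1 g) = op1 (inv1 g)"
proof (rule cblinear_eqI[OF cblinear_cadj[OF cblinear_op1] cblinear_op1])
 fix i
 show "cadj (op1 g) (ket i) = op1 (inv1 g) (ket i)"
 proof (rule ell2_eqI)
  fix k
  show "Rep_ell2 (cadj (op1 g) (ket i)) k = Rep_ell2 (op1 (inv1 g) (ket i)) k" using act1_inv1[of g k i]
   by (auto simp: Rep_cadj[OF cblinear_op1] cinner_ket_right op1_ket split: option.splits)
 qed
qed

primrec opw :: "nat list => wl ell2 => wl ell2" where
 "opw [] x = x"
| "opw (g # w) x = op1 g (opw w x)"

primrec actw :: "nat list => wl => wl option" where
 "actw [] i = Some i"
| "actw (g # w) i = (case actw w i of None => None | Some j => act1 g j)"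

lemma cblinear_opw: "cblinear (opw w)"
proof (induction w)
 case (Cons g w)
 have "opw (g # w) = (%x. op1 g (opw w x))" by (simp add: fun_eq_iff)
 thus ?case using cblinear_comp[OF cblinear_op1 Cons] by simp
qed (simp add: opw.simps(1)[abs_def])

lemma norm_opw_le: "norm (opw w x) <= norm x"
 by (induction w) (auto intro: order_trans norm_op1_le)

lemma opw_append: "opw (v @ w) x = opw v (opw w x)"
 by (induction v) auto

lemma opw_ket: "opw w (ket i) = (case actw w i of None => 0 | Some j => ket j)"
 by (induction w) (auto simp: op1_ket cblinear_0[OF cblinear_op1] split: option.splits)

lemma cadj_opw: "cadj (opw w) = opw (rev (map inv1 w))"
proof (induction w)
 case Nil
 have e: "opw [] = (%x. x)" by (simp add: fun_eq_iff)
 have "(%x. x) = cadj (%x :: wl ell2. x)" by (rule cadj_unique) simp_all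
 thus ?case by (simp add: e)
next
 case (Cons g w)
 have "opw (g # w) = (%x. op1 g (opw w x))" by (simp add: fun_eq_iff)
 thus ?case using cadj_comp[OF cblinear_op1[of g] cblinear_opw[of w]]
  by (simp add: Cons cadj_op1 opw_append fun_eq_iff)
qed

text \<open>For all but finitely many \<open>k\<close>, a word acts on the lists starting with \<open>k\<close> as it acts on \<open>([], [])\<close>:
 it never gets to see \<open>k\<close>.\<close>

lemma actw_generic:
 "\<exists>F. finite F & ((\<forall>k h r. k \<notin> F --> actw w (k, h # r) = None) & actw w (em, []) = None
  | (\<exists>g. (\<forall>k h r. k \<notin> F --> actw w (k, h # r) = Some (foldr lm g k, h # r)) & actw w (em, []) = Some (foldr lm g em, []))
  | (\<exists>m \<mu> g. (\<forall>k h r. k \<notin> F --> actw w (k, h # r) = Some (m, \<mu> @ foldr lm g k # h # r)) &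
    actw w (em, []) = Some (m, \<mu> @ [foldr lm g em])))"
proof (induction w)
 case Nil
 show ?case by (intro exI[of _ "{}"]) (auto intro!: exI[of _ "[]"])
next
 case (Cons a w)
 then obtain F where F: "finite F" and d: "(\<forall>k h r. k \<notin> F --> actw w (k, h # r) = None) & actw w (em, []) = None
  | (\<exists>g. (\<forall>k h r. k \<notin> F --> actw w (k, h # r) = Some (foldr lm g k, h # r)) & actw w (em, []) = Some (foldr lm g em, []))
  | (\<exists>m \<mu> g. (\<forall>k h r. k \<notin> F --> actw w (k, h # r) = Some (m, \<mu> @ foldr lm g k # h # r)) &
    actw w (em, []) = Some (m, \<mu> @ [foldr lm g em]))" by blast
 have inj: "foldr lm (rev g) (foldr lm g k) = k" for g k by (induction g arbitrary: k rule: rev_induct) auto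
 from d show ?case
 proof (elim disjE exE)
  assume "(\<forall>k h r. k \<notin> F --> actw w (k, h # r) = None) & actw w (em, []) = None"
  thus ?thesis using F by (intro exI[of _ F]) simp
 next
  fix g assume a: "(\<forall>k h r. k \<notin> F --> actw w (k, h # r) = Some (foldr lm g k, h # r)) & actw w (em, []) = Some (foldr lm g em, [])"
  consider "a = 0" | "a = 1" | x where "a = x + 2" by (metis add_2_eq_Suc' not0_implies_Suc One_nat_def)
  thus ?thesis
  proof cases
   case 1
   show ?thesis by (rule exI[of _ F], rule conjI[OF F], rule disjI2, rule disjI2, rule exI[of _ em], rule exI[of _ "[]"], rule exI[of _ g])
     (use a 1 in \<open>auto simp: act1_def ush_def\<close>)
  next
   case 2
   \<comment> \<open>The adjoint of s survives on (g k, h # r) only if g k is the unit; this single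
     value of k is added to the excluded set. On the list of length one it gives zero in any
     case.\<close>
   have "k \<notin> insert (foldr lm (rev g) em) F ==> foldr lm g k ~= em" for k using inj[of g k] by auto
   thus ?thesis using F a 2
    by (intro exI[of _ "insert (foldr lm (rev g) em) F"] conjI disjI1) (auto simp: act1_def pop_def)
  next
   case 3
   show ?thesis by (rule exI[of _ F], rule conjI[OF F], rule disjI2, rule disjI1, rule exI[of _ "x # g"])
     (use a 3 in \<open>auto simp: act1_def lact_def\<close>)
  qed
 next
  fix m \<mu> g assume a: "(\<forall>k h r. k \<notin> F --> actw w (k, h # r) = Some (m, \<mu> @ foldr lm g k # h # r)) &
    actw w (em, []) = Some (m, \<mu> @ [foldr lm g em])"
  consider "a = 0" | "a = 1" "m ~= em" | "a = 1" "m = em" "\<mu> = []" | m' \<mu>' where "a = 1" "m = em" "\<mu> = m' # \<mu>'"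
   | x where "a = x + 2" by (metis add_2_eq_Suc' not0_implies_Suc One_nat_def list.exhaust)
  thus ?thesis
  proof cases
   case 1
   show ?thesis by (rule exI[of _ F], rule conjI[OF F], rule disjI2, rule disjI2, rule exI[of _ em], rule exI[of _ "m # \<mu>"], rule exI[of _ g])
     (use a 1 in \<open>auto simp: act1_def ush_def\<close>)
  next
   case 2
   show ?thesis by (rule exI[of _ F], rule conjI[OF F], rule disjI1) (use a 2 in \<open>auto simp: act1_def pop_def split: list.splits\<close>)
  next
   case 3
   show ?thesis by (rule exI[of _ F], rule conjI[OF F], rule disjI2, rule disjI1, rule exI[of _ g])
     (use a 3 in \<open>auto simp: act1_def pop_def\<close>)
  next
   case 4
   show ?thesis by (rule exI[of _ F], rule conjI[OF F], rule disjI2, rule disjI2, rule exI[of _ m'], rule exI[of _ \<mu>'], rule exI[of _ g])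
     (use a 4 in \<open>auto simp: act1_def pop_def\<close>)
  next
   case 5
   show ?thesis by (rule exI[of _ F], rule conjI[OF F], rule disjI2, rule disjI2, rule exI[of _ "lm x m"], rule exI[of _ \<mu>], rule exI[of _ g])
     (use a 5 in \<open>auto simp: act1_def lact_def\<close>)
  qed
 qed
qed

primrec opL :: "(complex \<times> nat list) list => wl ell2 => wl ell2" where
 "opL [] x = 0"
| "opL (a # cs) x = scaleC (fst a) (opw (snd a) x) + opL cs x"

lemma cblinear_opL: "cblinear (opL cs)"
proof (induction cs)
 case (Cons a cs)
 have "opL (a # cs) = (%x. scaleC (fst a) (opw (snd a) x) + opL cs x)" by (simp add: fun_eq_iff)
 thus ?case using cblinear_plus[OF cblinear_smult[OF cblinear_opw] Cons] by simp
qed (simp add: opL.simps(1)[abs_def])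

lemma opL_append: "opL (cs @ ds) x = opL cs x + opL ds x"
 by (induction cs) (auto simp: add.assoc)

lemma opL_scale: "scaleC c (opL cs x) = opL (map (%a. (c * fst a, snd a)) cs) x"
 by (induction cs) (auto simp: scaleC_add intro: ell2_eqI)

lemma opw_opL: "opw w (opL cs x) = opL (map (%a. (fst a, w @ snd a)) cs) x"
 by (induction cs) (auto simp: cblinear_0[OF cblinear_opw] cblinear_add[OF cblinear_opw]
   cblinear_scaleC[OF cblinear_opw] opw_append)

lemma opL_comp: "\<exists>es. \<forall>x. opL es x = opL cs (opL ds x)"
proof (induction cs)
 case Nil
 show ?case by (intro exI[of _ "[]"]) simp
next
 case (Cons a cs)
 then obtain es where "\<forall>x. opL es x = opL cs (opL ds x)" by blast
 thus ?case
  by (intro exI[of _ "map (%b. (fst a * fst b, snd (b :: complex \<times> nat list))) (map (%b. (fst b, snd a @ snd b)) ds) @ es"])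
   (simp only: opL_append opL_scale[symmetric] opw_opL[symmetric] opL.simps simp_thms)
qed

lemma opL_adj: "\<exists>ds. opL ds = cadj (opL cs)"
proof (induction cs)
 case Nil
 have e: "opL [] = (%x. 0)" by (simp add: fun_eq_iff)
 have "(%x. 0) = cadj (%x :: wl ell2. 0 :: wl ell2)" by (rule cadj_unique) simp_all
 thus ?case unfolding e[symmetric] by blast
next
 case (Cons a cs)
 then obtain ds where ds: "opL ds = cadj (opL cs)" by blast
 have e: "opL (a # cs) = (%x. scaleC (fst a) (opw (snd a) x) + opL cs x)" by (simp add: fun_eq_iff)
 have f: "opL ((cnj (fst a), rev (map inv1 (snd a))) # ds) = (%x. scaleC (cnj (fst a)) (opw (rev (map inv1 (snd a))) x) + opL ds x)"
  by (simp add: fun_eq_iff)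
 have "cadj (opL (a # cs)) = (%x. scaleC (cnj (fst a)) (opw (rev (map inv1 (snd a))) x) + opL ds x)"
  unfolding e cadj_plus[OF cblinear_smult[OF cblinear_opw] cblinear_opL] cadj_smult[OF cblinear_opw] cadj_opw ds ..
 thus ?case unfolding f[symmetric] by metis
qed

section \<open>The algebra generated by the isometry and the symmetries\<close>

lemma (in cstar_algebra) closure_subalgebra:
 assumes S: "S \<subseteq> carrier A" "\<zero> \<in> S" and ad: "!!x y. x \<in> S ==> y \<in> S ==> x \<oplus> y \<in> S"
  and mu: "!!x y. x \<in> S ==> y \<in> S ==> x \<otimes> y \<in> S" and aj: "!!x. x \<in> S ==> adj A x \<in> S"
  and sm: "!!c x. x \<in> S ==> c \<odot> x \<in> S"
 shows "cstar_subalgebra A (cstar_topology A closure_of S)" unfolding cstar_subalgebra_def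
proof (intro conjI ballI allI)
 let ?C = "cstar_topology A closure_of S"
 note iff = closure_of_seq[OF S(1)]
 show "closedin (cstar_topology A) ?C" by (rule closedin_closure_of)
 show "\<zero> \<in> ?C" using S closure_of_subset[of S "cstar_topology A"] by auto
 fix x assume "x \<in> ?C"
 then obtain X where X: "!!n. X n \<in> S" "x \<in> carrier A" "(%n. nrm A (X n \<ominus> x)) \<longlonglongrightarrow> 0" unfolding iff by blast
 note Xc = subsetD[OF S(1) X(1)]
 have "nrm A (adj A (X n) \<ominus> adj A x) = nrm A (X n \<ominus> x)" for n
  using nrm_adj[of "X n \<ominus> x"] Xc[of n] X(2) by (simp add: adj_minus)
 thus "adj A x \<in> ?C" using X by (intro closure_of_seqI[OF S(1), of "%n. adj A (X n)"] aj adj_closed) simp_all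
 have "(%n. nrm A (c \<odot> X n \<ominus> c \<odot> x)) \<longlonglongrightarrow> 0" for c
  using tendsto_mult_left[OF X(3), of "cmod c"] Xc X(2) by (simp add: nrm_smult flip: smult_minus)
 thus "c \<odot> x \<in> ?C" for c using X by (intro closure_of_seqI[OF S(1), of "%n. c \<odot> X n"] sm smult_closed) simp_all
 fix y assume "y \<in> ?C"
 then obtain Y where Y: "!!n. Y n \<in> S" "y \<in> carrier A" "(%n. nrm A (Y n \<ominus> y)) \<longlonglongrightarrow> 0" unfolding iff by blast
 note Yc = subsetD[OF S(1) Y(1)]
 show "x \<oplus> y \<in> ?C" by (rule closure_of_seqI[OF S(1) lim_add[OF Xc X(2,3) Yc Y(2,3)] ad[OF X(1) Y(1)]]) (simp add: X Y)
 show "x \<otimes> y \<in> ?C" by (rule closure_of_seqI[OF S(1) lim_mult[OF Xc X(2,3) Yc Y(2,3)] mu[OF X(1) Y(1)]]) (simp add: X Y m_closed)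
qed

definition S0 :: "wl operator set" where
 "S0 = {T \<in> bounded_operators UNIV. \<exists>cs. opr UNIV T = opL cs}"

definition AC :: "wl operator set" where
 "AC = cstar_topology (BL2 UNIV) closure_of S0"

definition AA :: "wl operator cstar" where
 "AA = (BL2 UNIV)\<lparr>carrier := AC\<rparr>"

definition elL :: "(complex \<times> nat list) list => wl operator" where
 "elL cs = rpo UNIV (opL cs)"

lemma elL: "elL cs \<in> S0" "opr UNIV (elL cs) = opL cs" "elL cs \<in> bounded_operators UNIV"
 using rpo_bo[OF cblinear_opL, of UNIV cs] by (auto simp: S0_def elL_def)

lemma subalgebra_AC: "cstar_subalgebra (BL2 UNIV) AC"
proof -
 interpret cstar_algebra "BL2 (UNIV :: wl set)" by (rule cstar_algebra_BL2)
 have S: "x \<in> bounded_operators UNIV" "\<exists>cs. opr UNIV x = opL cs" if "x \<in> S0" for x using that by (auto simp: S0_def)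
 show ?thesis unfolding AC_def
 proof (rule closure_subalgebra)
  show "S0 \<subseteq> carrier (BL2 UNIV)" by (auto simp: S0_def)
  show "\<zero>\<^bsub>BL2 UNIV\<^esub> \<in> S0" by (auto simp: S0_def opr_zero fun_eq_iff intro!: exI[of _ "[]"])
  fix x c assume x: "x \<in> S0"
  obtain cs where cs: "opr UNIV x = opL cs" using S(2)[OF x] by blast
  obtain cs' where "opL cs' = cadj (opL cs)" using opL_adj by blast
  thus "adj (BL2 UNIV) x \<in> S0" using S(1)[OF x] by (auto simp: S0_def opr_adj cs intro!: exI[of _ cs'])
  have "opr UNIV (c \<odot>\<^bsub>BL2 UNIV\<^esub> x) = opL (map (%a. (c * fst a, snd a)) cs)"
   using S(1)[OF x] by (simp add: opr_smult cs opL_scale fun_eq_iff)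
  thus "c \<odot>\<^bsub>BL2 UNIV\<^esub> x \<in> S0" using S(1)[OF x] unfolding S0_def by (auto simp: opr_smult(1))
  fix y assume y: "y \<in> S0"
  obtain ds where ds: "opr UNIV y = opL ds" using S(2)[OF y] by blast
  have "opr UNIV (x \<oplus>\<^bsub>BL2 UNIV\<^esub> y) = opL (cs @ ds)"
   using S(1)[OF x] S(1)[OF y] by (simp add: opr_add cs ds opL_append fun_eq_iff)
  thus "x \<oplus>\<^bsub>BL2 UNIV\<^esub> y \<in> S0" using S(1)[OF x] S(1)[OF y] unfolding S0_def by (auto simp: opr_add(1))
  obtain es where "\<forall>x. opL es x = opL cs (opL ds x)" using opL_comp by blast
  hence "opr UNIV (x \<otimes>\<^bsub>BL2 UNIV\<^esub> y) = opL es" using S(1)[OF x] S(1)[OF y] by (simp add: opr_mult cs ds fun_eq_iff)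
  thus "x \<otimes>\<^bsub>BL2 UNIV\<^esub> y \<in> S0" using S(1)[OF x] S(1)[OF y] unfolding S0_def by (auto simp: opr_mult(1))
 qed
qed

lemma AC_bo: "a \<in> AC ==> a \<in> bounded_operators UNIV"
 using normed_star_algebra.subalgebra_subset[OF normed_star_algebra_BL2 subalgebra_AC] by auto

lemma cstar_algebra_AA: "cstar_algebra AA"
 unfolding AA_def by (rule cstar_algebra.cstar_subalgebra_algebra[OF cstar_algebra_BL2 subalgebra_AC])

lemma carrier_AA [simp]: "carrier AA = AC"
 by (simp add: AA_def)

lemma S0_AC: "S0 \<subseteq> AC"
proof -
 interpret cstar_algebra "BL2 (UNIV :: wl set)" by (rule cstar_algebra_BL2)
 have "S0 \<subseteq> topspace (cstar_topology (BL2 UNIV))" unfolding metric.topspace_mtopology by (auto simp: S0_def)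
 thus ?thesis unfolding AC_def by (rule closure_of_subset)
qed

definition \<xi> :: "wl ell2" where "\<xi> = ket (em, [])"

lemma AC_approx:
 assumes a: "a \<in> AC" and e: "e > 0"
 shows "\<exists>cs. \<forall>x. norm (opr UNIV a x - opL cs x) <= e * norm x"
proof -
 interpret cstar_algebra "BL2 (UNIV :: wl set)" by (rule cstar_algebra_BL2)
 have S: "S0 \<subseteq> carrier (BL2 UNIV)" by (auto simp: S0_def)
 obtain y where y: "y \<in> S0" "nrm (BL2 UNIV) (a \<ominus>\<^bsub>BL2 UNIV\<^esub> y) < e"
  using a e unfolding AC_def closure_of_iff[OF S] by blast
 then obtain cs where cs: "opr UNIV y = opL cs" and yb: "y \<in> bounded_operators UNIV" by (auto simp: S0_def)
 note ab = AC_bo[OF a]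
 have "norm (opr UNIV a x - opL cs x) <= e * norm x" for x
 proof -
  have "opr UNIV a x - opL cs x = opr UNIV (a \<ominus>\<^bsub>BL2 UNIV\<^esub> y) x" using opr_minus[OF ab yb] cs by simp
  also have "norm \<dots> <= nrm (BL2 UNIV) (a \<ominus>\<^bsub>BL2 UNIV\<^esub> y) * norm x"
   using minus_closed[of a y] ab yb by (intro norm_opr_le) simp
  also have "\<dots> <= e * norm x" using y(2) by (intro mult_right_mono) auto
  finally show ?thesis .
 qed
 thus ?thesis by blast
qed

section \<open>Compression to scalars and pure infiniteness\<close>

text \<open>The word of the isometry that prepends k: the last letter acts first and prepends the
  unit, then the letters of k turn this head into k.\<close>

definition tk :: "rword => nat list" where
 "tk k = map (%x. x + 2) (Rep_rword k) @ [0]"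

lemma actw_lact: "actw (map (%x. x + 2) g) (h, r) = Some (foldr lm g h, r)"
 by (induction g) (auto simp: act1_def lact_def)

lemma actw_append: "actw (v @ w) i = (case actw w i of None => None | Some j => actw v j)"
 by (induction v) (auto split: option.splits)

lemma foldr_lm_Rep: "foldr lm (Rep_rword k) em = k"
proof -
 have "Rep_rword (foldr lm w em) = w" if "distinct_adj w" for w
  using that by (induction w) (auto simp: Rep_lm lmul_def distinct_adj_Cons)
 thus ?thesis by (simp flip: Rep_rword_inject)
qed

lemma actw_tk: "actw (tk k) i = Some (k, fst i # snd i)"
 using actw_lact[of "Rep_rword k" em] by (simp add: tk_def actw_append act1_def ush_def foldr_lm_Rep)

text \<open>Any list can be written entry by entry from its end, so \<xi> reaches every basis
  vector. Thus a nonzero operator does not vanish on w \<xi> for some word w.\<close>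

lemma reach: "\<exists>w. actw w (em, []) = Some i"
proof (induction "snd i" arbitrary: i)
 case Nil
 show ?case using actw_lact[of "Rep_rword (fst i)" em "[]"] Nil by (metis foldr_lm_Rep prod.collapse)
next
 case (Cons h r)
 obtain w where "actw w (em, []) = Some (h, r)" using Cons(1)[of "(h, r)"] by auto
 hence "actw (tk (fst i) @ w) (em, []) = Some i" using Cons(2) by (simp add: actw_append actw_tk prod_eq_iff)
 thus ?case by blast
qed

text \<open>In the three cases of \<open>actw_generic\<close>: the word annihilates both vectors; or
  it multiplies the head by a group element, and both coefficients are 1 or 0 according to whether
  that element is the unit, since the action is free; or it ends with a longer list whose head m
  does not depend on k, and both coefficients are 0 once k = m is excluded too.\<close>

lemma compress_word:
 "\<exists>F. finite F & (\<forall>k h r j. k \<notin> F --> Rep_ell2 (opw w (ket (k, h # r))) (k, fst j # snd j)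
   = (if j = (h, r) then Rep_ell2 (opw w \<xi>) (em, []) else 0))"
proof -
 obtain F where F: "finite F" and d: "(\<forall>k h r. k \<notin> F --> actw w (k, h # r) = None) & actw w (em, []) = None
  | (\<exists>g. (\<forall>k h r. k \<notin> F --> actw w (k, h # r) = Some (foldr lm g k, h # r)) & actw w (em, []) = Some (foldr lm g em, []))
  | (\<exists>m \<mu> g. (\<forall>k h r. k \<notin> F --> actw w (k, h # r) = Some (m, \<mu> @ foldr lm g k # h # r)) &
    actw w (em, []) = Some (m, \<mu> @ [foldr lm g em]))" using actw_generic[of w] by blast
 from d show ?thesis
 proof (elim disjE exE)
  assume "(\<forall>k h r. k \<notin> F --> actw w (k, h # r) = None) & actw w (em, []) = None"
  thus ?thesis using F by (intro exI[of _ F]) (auto simp: opw_ket \<xi>_def)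
 next
  fix g assume "(\<forall>k h r. k \<notin> F --> actw w (k, h # r) = Some (foldr lm g k, h # r)) & actw w (em, []) = Some (foldr lm g em, [])"
  moreover have "foldr lm g k = k \<longleftrightarrow> foldr lm g em = em" "k = foldr lm g k \<longleftrightarrow> foldr lm g em = em" "em = foldr lm g em \<longleftrightarrow> foldr lm g em = em" for k
   using free_action[of g k] by auto
  ultimately show ?thesis using F by (intro exI[of _ F]) (auto simp: opw_ket \<xi>_def prod_eq_iff)
 next
  fix m \<mu> g assume "(\<forall>k h r. k \<notin> F --> actw w (k, h # r) = Some (m, \<mu> @ foldr lm g k # h # r)) &
    actw w (em, []) = Some (m, \<mu> @ [foldr lm g em])"
  thus ?thesis using F by (intro exI[of _ "insert m F"]) (auto simp: opw_ket \<xi>_def)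
 qed
qed

lemma compress_opL:
 "\<exists>F. finite F & (\<forall>k h r j. k \<notin> F --> Rep_ell2 (opL cs (ket (k, h # r))) (k, fst j # snd j)
   = (if j = (h, r) then Rep_ell2 (opL cs \<xi>) (em, []) else 0))"
proof (induction cs)
 case (Cons a cs)
 obtain F where F: "finite F" "\<forall>k h r j. k \<notin> F --> Rep_ell2 (opw (snd a) (ket (k, h # r))) (k, fst j # snd j)
   = (if j = (h, r) then Rep_ell2 (opw (snd a) \<xi>) (em, []) else 0)" using compress_word[of "snd a"] by (elim exE conjE) (rule that)
 obtain F' where F': "finite F'" "\<forall>k h r j. k \<notin> F' --> Rep_ell2 (opL cs (ket (k, h # r))) (k, fst j # snd j)
   = (if j = (h, r) then Rep_ell2 (opL cs \<xi>) (em, []) else 0)" using Cons.IH by (elim exE conjE) (rule that)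
 show ?case by (rule exI[of _ "F \<union> F'"]) (use F F' in simp)
qed (intro exI[of _ "{}"], simp)

lemma infinite_rword: "infinite (UNIV :: rword set)"
proof
 assume "finite (UNIV :: rword set)"
 moreover have "inj (%x. Abs_rword [x])" by (rule injI) (simp add: Abs_rword_inject)
 ultimately have "finite (UNIV :: nat set)" using finite_imageD[of "%x. Abs_rword [x]" UNIV] rev_finite_subset by blast
 thus False by simp
qed

text \<open>For a finite combination of words only finitely many heads k are excluded, and the group
  is infinite. The compression is then exactly the scalar given by the vector state at
  \<xi>.\<close>

lemma compress:
 "\<exists>k. \<forall>x. cadj (opw (tk k)) (opL cs (opw (tk k) x)) = scaleC (Rep_ell2 (opL cs \<xi>) (em, [])) x"
proof -
 from compress_opL[of cs] obtain F where F: "finite F & (\<forall>k h r j. k \<notin> F --> Rep_ell2 (opL cs (ket (k, h # r))) (k, fst j # snd j)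
   = (if j = (h, r) then Rep_ell2 (opL cs \<xi>) (em, []) else 0))" ..
 obtain k where k: "k \<notin> F" using ex_new_if_finite[OF infinite_rword conjunct1[OF F]] ..
 note Fk = conjunct2[OF F, rule_format, OF k]
 have "(%x. cadj (opw (tk k)) (opL cs (opw (tk k) x))) = (%x. scaleC (Rep_ell2 (opL cs \<xi>) (em, [])) x)"
 proof (rule cblinear_eqI)
  show "cblinear (%x. cadj (opw (tk k)) (opL cs (opw (tk k) x)))"
   by (rule cblinear_comp[OF cblinear_cadj[OF cblinear_opw] cblinear_comp[OF cblinear_opL cblinear_opw]])
  show "cblinear (%x. scaleC (Rep_ell2 (opL cs \<xi>) (em, [])) x)" by (rule cblinear_smult) simp
  fix i
  show "cadj (opw (tk k)) (opL cs (opw (tk k) (ket i))) = scaleC (Rep_ell2 (opL cs \<xi>) (em, [])) (ket i)"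
  proof (rule ell2_eqI)
   fix j
   have "Rep_ell2 (cadj (opw (tk k)) (opL cs (opw (tk k) (ket i)))) j = Rep_ell2 (opL cs (ket (k, fst i # snd i))) (k, fst j # snd j)"
    by (simp add: Rep_cadj[OF cblinear_opw] opw_ket actw_tk l2_inner_ket)
   thus "Rep_ell2 (cadj (opw (tk k)) (opL cs (opw (tk k) (ket i)))) j = Rep_ell2 (scaleC (Rep_ell2 (opL cs \<xi>) (em, [])) (ket i)) j"
    using Fk[of "fst i" "snd i" j] by (auto simp: prod_eq_iff)
  qed
 qed
 thus ?thesis by (intro exI[of _ k]) (simp add: fun_eq_iff)
qed

lemma opL_single: "opL [(1, w)] = opw w"
 by (auto simp: fun_eq_iff intro!: ell2_eqI)

lemma monoid_AA: "monoid AA"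
proof -
 have "\<one>\<^bsub>BL2 UNIV\<^esub> \<in> S0" unfolding S0_def by (auto simp: opr_one fun_eq_iff intro!: exI[of _ "[(1, [])]"] ell2_eqI)
 hence 1: "\<one>\<^bsub>BL2 UNIV\<^esub> \<in> AC" using S0_AC by blast
 interpret monoid "BL2 (UNIV :: wl set)" by (rule monoid_BL2)
 show ?thesis by (rule monoidI) (use 1 cstar_subalgebraD(4)[OF subalgebra_AC] in \<open>auto simp: AA_def AC_bo m_assoc\<close>)
qed

text \<open>The form in which pure infiniteness is verified: the unit is Cuntz below every nonzero
  positive element.\<close>

definition PI :: "'a cstar => bool" where
 "PI A \<longleftrightarrow> (\<forall>b\<in>carrier A. b ~= \<zero>\<^bsub>A\<^esub> --> (\<forall>e>0. \<exists>v\<in>carrier A.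
   nrm A (\<one>\<^bsub>A\<^esub> \<ominus>\<^bsub>A\<^esub> v \<otimes>\<^bsub>A\<^esub> (adj A b \<otimes>\<^bsub>A\<^esub> b) \<otimes>\<^bsub>A\<^esub> adj A v) < e))"

text \<open>A word w is chosen such that y = b w does not annihilate \<xi>, and \<beta> is the
  squared norm of y \<xi>, the value of the vector state at y^* y. Compressing y^* y by the isometry
  t that prepends a suitable k gives nearly \<beta>, so v = \<beta>^(-1/2) times the adjoint of w t
  works.\<close>

lemma PI_AA: "PI AA"
 unfolding PI_def
proof (intro ballI impI allI)
 fix b and e :: real assume "b \<in> carrier AA" and nz: "b ~= \<zero>\<^bsub>AA\<^esub>" and e: "e > 0"
 hence b: "b \<in> AC" by simp
 note bb = AC_bo[OF b]
 have "opr UNIV b ~= opr UNIV \<zero>\<^bsub>BL2 UNIV\<^esub>" using nz bo_eqI[OF bb opr_zero(1)] by (auto simp: AA_def)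
 then obtain i where i: "opr UNIV b (ket i) ~= 0"
  using cblinear_eqI[of "opr UNIV b" "%x. 0"] bb by (auto simp: opr_zero)
 from reach[of i] obtain w where "actw w (em, []) = Some i" ..
 hence w: "opw w \<xi> = ket i" by (simp add: opw_ket \<xi>_def)
 define W where "W = elL [(1, w)]"
 have W: "W \<in> AC" "opr UNIV W = opw w" using elL[of "[(1, w)]"] S0_AC by (auto simp: W_def opL_single)
 note D = cstar_subalgebraD[OF subalgebra_AC]
 define y where "y = b \<otimes>\<^bsub>BL2 UNIV\<^esub> W"
 have y: "y \<in> AC" unfolding y_def by (rule D(4)[OF b W(1)])
 have y\<xi>: "opr UNIV y \<xi> = opr UNIV b (ket i)" using bb AC_bo[OF W(1)] by (simp add: y_def opr_mult W(2) w)
 define C where "C = adj (BL2 UNIV) y \<otimes>\<^bsub>BL2 UNIV\<^esub> y"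
 have C: "C \<in> AC" unfolding C_def by (intro D(4,5) y)
 have oC: "opr UNIV C x = cadj (opr UNIV y) (opr UNIV y x)" for x
  using AC_bo[OF y] by (simp add: C_def opr_mult opr_adj)
 define \<beta> where "\<beta> = (norm (opr UNIV y \<xi>))\<^sup>2"
 have \<beta>: "\<beta> > 0" using i by (simp add: \<beta>_def y\<xi>)
 have C\<beta>: "Rep_ell2 (opr UNIV C \<xi>) (em, []) = complex_of_real \<beta>"
 proof -
  have "Rep_ell2 (opr UNIV C \<xi>) (em, []) = l2_inner (Rep_ell2 (opr UNIV y \<xi>)) (Rep_ell2 (opr UNIV y \<xi>))"
   unfolding oC using Rep_cadj[of "opr UNIV y" "opr UNIV y \<xi>" "(em, [])"] AC_bo[OF y] by (simp add: \<xi>_def)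
  also have "\<dots> = complex_of_real \<beta>"
  proof -
   have c: "cnj z * z = complex_of_real ((cmod z)\<^sup>2)" for z by (simp only: complex_norm_square mult.commute)
   have "(%i. (cmod (Rep_ell2 (opr UNIV y \<xi>) i))\<^sup>2) summable_on UNIV"
    using Rep_l2[of "opr UNIV y \<xi>"] by (simp add: l2_def)
   thus ?thesis unfolding l2_inner_def \<beta>_def norm_sq_eq c by (intro infsumI has_sum_of_real has_sum_infsum)
  qed
  finally show ?thesis .
 qed
 \<comment> \<open>Approximating C by words costs e', and so does replacing the resulting scalar by
   \<beta>. After division by \<beta> this is e/2, which leaves room for the strict
   inequality.\<close>
 define e' where "e' = \<beta> * e / 4"
 have e': "e' > 0" using \<beta> e by (simp add: e'_def)
 obtain cs where cs: "!!x. norm (opr UNIV C x - opL cs x) <= e' * norm x" using AC_approx[OF C e'] by blast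
 define \<gamma> where "\<gamma> = Rep_ell2 (opL cs \<xi>) (em, [])"
 obtain k where k: "!!x. cadj (opw (tk k)) (opL cs (opw (tk k) x)) = scaleC \<gamma> x" using compress unfolding \<gamma>_def by blast
 have \<gamma>: "cmod (\<gamma> - complex_of_real \<beta>) <= e'"
 proof -
  have "\<gamma> - complex_of_real \<beta> = - Rep_ell2 (opr UNIV C \<xi> - opL cs \<xi>) (em, [])" by (simp add: \<gamma>_def C\<beta>)
  hence "cmod (\<gamma> - complex_of_real \<beta>) <= norm (opr UNIV C \<xi> - opL cs \<xi>)"
   by (simp only: norm_minus_cancel norm_coord_le)
  thus ?thesis using cs[of \<xi>] by (simp add: \<xi>_def)
 qed
 define T where "T = elL [(1, tk k)]"
 have T: "T \<in> AC" "opr UNIV T = opw (tk k)" using elL[of "[(1, tk k)]"] S0_AC by (auto simp: T_def opL_single)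
 have WT: "W \<otimes>\<^bsub>BL2 UNIV\<^esub> T \<in> AC" by (intro D(4) W T)
 let ?s = "complex_of_real (1 / sqrt \<beta>)"
 define v where "v = ?s \<odot>\<^bsub>BL2 UNIV\<^esub> adj (BL2 UNIV) (W \<otimes>\<^bsub>BL2 UNIV\<^esub> T)"
 have v: "v \<in> AC" unfolding v_def by (intro D(5,6) WT)
 have ov: "opr UNIV v x = scaleC ?s (cadj (opw (tk k)) (cadj (opw w) x))" for x using AC_bo[OF W(1)] AC_bo[OF T(1)]
  by (simp add: v_def opr_smult opr_adj opr_mult W(2) T(2) cadj_comp[OF cblinear_opw cblinear_opw])
 have oav: "opr UNIV (adj (BL2 UNIV) v) x = scaleC ?s (opw w (opw (tk k) x))" for x
 proof -
  have cl: "cblinear (%x. opw w (opw (tk k) x))" by (rule cblinear_comp[OF cblinear_opw cblinear_opw])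
  have v': "opr UNIV v = (%x. scaleC ?s (cadj (%x. opw w (opw (tk k) x)) x))"
   by (rule ext) (simp only: ov cadj_comp[OF cblinear_opw cblinear_opw])
  show ?thesis unfolding opr_adj(2)[OF AC_bo[OF v]] v' cadj_smult[OF cblinear_cadj[OF cl]] cadj_cadj[OF cl] by simp
 qed
 define Q where "Q = v \<otimes>\<^bsub>BL2 UNIV\<^esub> (adj (BL2 UNIV) b \<otimes>\<^bsub>BL2 UNIV\<^esub> b) \<otimes>\<^bsub>BL2 UNIV\<^esub> adj (BL2 UNIV) v"
 have Q: "Q \<in> AC" unfolding Q_def by (intro D(4,5) v b)
 have oQ: "opr UNIV Q x = scaleC (complex_of_real (1 / \<beta>)) (cadj (opw (tk k)) (opr UNIV C (opw (tk k) x)))" for x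
 proof -
  have oy: "opr UNIV y = (%x. opr UNIV b (opw w x))" using bb AC_bo[OF W(1)] by (simp add: y_def opr_mult W(2))
  have cy: "cadj (opr UNIV y) = (%x. cadj (opw w) (cadj (opr UNIV b) x))"
   unfolding oy by (rule cadj_comp[OF cblinear_opr[OF bb] cblinear_opw])
  have "?s * ?s = complex_of_real (1 / \<beta>)" using \<beta> by (simp flip: of_real_mult)
  hence "scaleC ?s (scaleC ?s z) = scaleC (complex_of_real (1 / \<beta>)) z" for z :: "wl ell2" by (simp only: scaleC_scaleC)
  thus ?thesis
   using bb AC_bo[OF v] AC_bo[OF D(5)[OF v]] AC_bo[OF D(5)[OF b]] AC_bo[OF D(4)[OF D(5)[OF b] b]] AC_bo[OF D(4)[OF v D(4)[OF D(5)[OF b] b]]]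
   by (simp add: Q_def opr_mult opr_adj(2)[OF bb] ov oav oC cy[unfolded oy] oy cblinear_scaleC[OF cblinear_cadj[OF cblinear_opw]]
     cblinear_scaleC[OF cblinear_cadj[OF cblinear_opr[OF bb]]] cblinear_scaleC[OF cblinear_opr[OF bb]] del: scaleC_scaleC)
 qed
 have bnd: "norm (x - opr UNIV Q x) <= e / 2 * norm x" for x
 proof -
  let ?T = "opw (tk k)"
  have "x - opr UNIV Q x = scaleC (complex_of_real (1 / \<beta>)) (scaleC (complex_of_real \<beta>) x - cadj ?T (opr UNIV C (?T x)))"
   using \<beta> by (simp add: oQ scaleC_minus del: scaleC_of_real)
  also have "scaleC (complex_of_real \<beta>) x - cadj ?T (opr UNIV C (?T x))
    = - (scaleC (\<gamma> - complex_of_real \<beta>) x + cadj ?T (opr UNIV C (?T x) - opL cs (?T x)))"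
   by (simp add: cblinear_diff[OF cblinear_cadj[OF cblinear_opw]] k scaleC_diff_left)
  finally have 1: "norm (x - opr UNIV Q x) = 1 / \<beta> * norm (scaleC (\<gamma> - complex_of_real \<beta>) x + cadj ?T (opr UNIV C (?T x) - opL cs (?T x)))"
   using \<beta> by (simp only: norm_scaleC norm_minus_cancel norm_of_real) simp
  have "norm (cadj ?T z) <= norm z" for z by (simp add: cadj_opw norm_opw_le)
  hence "norm (cadj ?T (opr UNIV C (?T x) - opL cs (?T x))) <= norm (opr UNIV C (?T x) - opL cs (?T x))" .
  also have "\<dots> <= e' * norm (?T x)" by (rule cs)
  also have "\<dots> <= e' * norm x" using e' norm_opw_le by (intro mult_left_mono) auto
  finally have 2: "norm (cadj ?T (opr UNIV C (?T x) - opL cs (?T x))) <= e' * norm x" .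
  have 3: "norm (scaleC (\<gamma> - complex_of_real \<beta>) x) <= e' * norm x" using \<gamma> by (simp add: mult_right_mono)
  have "norm (x - opr UNIV Q x) <= 1 / \<beta> * (e' * norm x + e' * norm x)"
   unfolding 1 using \<beta> norm_triangle_mono[OF 3 2] by (intro mult_left_mono) auto
  also have "\<dots> = e / 2 * norm x" using \<beta> by (simp add: e'_def field_simps)
  finally show ?thesis .
 qed
 interpret cstar_algebra "BL2 (UNIV :: wl set)" by (rule cstar_algebra_BL2)
 note QB = AC_bo[OF Q]
 have 1: "\<one>\<^bsub>BL2 UNIV\<^esub> \<in> AC" using monoid.one_closed[OF monoid_AA] by (simp add: AA_def)
 have "nrm (BL2 UNIV) (\<one>\<^bsub>BL2 UNIV\<^esub> \<ominus>\<^bsub>BL2 UNIV\<^esub> Q) <= e / 2" using e bnd QB minus_closed[of "\<one>\<^bsub>BL2 UNIV\<^esub>" Q] AC_bo[OF 1]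
  by (subst nrm_BL2_le) (auto simp: opr_minus opr_one)
 hence "nrm AA (\<one>\<^bsub>AA\<^esub> \<ominus>\<^bsub>AA\<^esub> Q) < e" using e subalgebra_minus[OF subalgebra_AC 1 Q] by (simp add: AA_def)
 thus "\<exists>v\<in>carrier AA. nrm AA (\<one>\<^bsub>AA\<^esub> \<ominus>\<^bsub>AA\<^esub> v \<otimes>\<^bsub>AA\<^esub> (adj AA b \<otimes>\<^bsub>AA\<^esub> b) \<otimes>\<^bsub>AA\<^esub> adj AA v) < e"
  using v by (intro bexI[of _ v]) (simp_all add: Q_def AA_def)
qed

text \<open>The adjoint of s annihilates \<xi>, whereas s is an isometry. This is what excludes an
  isomorphism with the complex numbers.\<close>

lemma noncommutative_AA: "\<exists>x\<in>carrier AA. \<exists>y\<in>carrier AA. x \<otimes>\<^bsub>AA\<^esub> y ~= y \<otimes>\<^bsub>AA\<^esub> x"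
proof (intro bexI)
 let ?s = "elL [(1, [0])]" and ?t = "elL [(1, [1])]"
 show "?t \<in> carrier AA" "?s \<in> carrier AA" using elL(1) S0_AC by auto
 have "opr UNIV (?s \<otimes>\<^bsub>BL2 UNIV\<^esub> ?t) \<xi> = 0" "opr UNIV (?t \<otimes>\<^bsub>BL2 UNIV\<^esub> ?s) \<xi> = \<xi>"
  by (simp_all add: opr_mult elL opL_single \<xi>_def op1_ket act1_def pop_def ush_def cblinear_0[OF cblinear_op1])
 moreover have "\<xi> ~= 0" using norm_ket[of "(em, [] :: rword list)"] unfolding \<xi>_def by (metis norm_zero zero_neq_one)
 ultimately show "?s \<otimes>\<^bsub>AA\<^esub> ?t ~= ?t \<otimes>\<^bsub>AA\<^esub> ?s" by (auto simp: AA_def)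
qed

section \<open>Separability\<close>

lemma opL_rational:
 assumes "e > 0"
 shows "\<exists>ds. set ds \<subseteq> (%(a, b). Complex (of_rat a) (of_rat b)) ` UNIV \<times> UNIV & (\<forall>x. norm (opL cs x - opL ds x) <= e * norm x)"
 using assms
proof (induction cs arbitrary: e)
 case Nil
 thus ?case by (intro exI[of _ "[]"]) simp
next
 case (Cons c cs)
 let ?Q = "(%(a, b). Complex (of_rat a) (of_rat b)) ` (UNIV :: (rat \<times> rat) set)"
 obtain ds where ds: "set ds \<subseteq> ?Q \<times> UNIV" "\<forall>x. norm (opL cs x - opL ds x) <= e / 2 * norm x"
  using Cons.IH[of "e / 2"] Cons.prems by auto
 have "\<exists>r. \<bar>t - of_rat r\<bar> < e / 4" for t :: real
 proof -
  have "t - e / 4 < t + e / 4" using Cons.prems by simp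
  then obtain r where "t - e / 4 < of_rat r" "of_rat r < t + e / 4" using of_rat_dense by blast
  hence "\<bar>t - of_rat r\<bar> < e / 4" by arith
  thus ?thesis ..
 qed
 then obtain a b where ab: "\<bar>Re (fst c) - of_rat a\<bar> < e / 4" "\<bar>Im (fst c) - of_rat b\<bar> < e / 4" by metis
 let ?d = "Complex (of_rat a) (of_rat b)"
 have d: "cmod (fst c - ?d) <= e / 2" using cmod_le[of "fst c - ?d"] ab by simp
 have "norm (opL (c # cs) x - opL ((?d, snd c) # ds) x) <= e * norm x" for x
 proof -
  have "opL (c # cs) x - opL ((?d, snd c) # ds) x = scaleC (fst c - ?d) (opw (snd c) x) + (opL cs x - opL ds x)"
   by (simp add: scaleC_diff_left)
  also have "norm \<dots> <= cmod (fst c - ?d) * norm (opw (snd c) x) + e / 2 * norm x"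
   using ds(2) by (intro norm_triangle_mono) simp_all
  also have "\<dots> <= e / 2 * norm x + e / 2 * norm x"
   using d norm_opw_le[of "snd c" x] Cons.prems by (intro add_mono mult_mono) auto
  finally show ?thesis by simp
 qed
 thus ?case using ds(1) by (intro exI[of _ "(?d, snd c) # ds"]) auto
qed

lemma separable_AA: "separable AA"
proof -
 let ?Q = "(%(a, b). Complex (of_rat a) (of_rat b)) ` (UNIV :: (rat \<times> rat) set)"
 define L where "L = {cs :: (complex \<times> nat list) list. set cs \<subseteq> ?Q \<times> UNIV}"
 have "L = lists (?Q \<times> UNIV)" by (auto simp: L_def)
 hence cL: "countable L" by (simp add: countable_SIGMA)
 interpret cstar_algebra AA by (rule cstar_algebra_AA)
 have sub: "elL ` L \<subseteq> carrier AA" using elL(1) S0_AC by auto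
 have "x \<in> cstar_topology AA closure_of (elL ` L)" if x: "x \<in> AC" for x unfolding closure_of_iff[OF sub]
 proof (intro conjI allI impI)
  fix e :: real assume e: "e > 0"
  obtain cs where cs: "\<forall>v. norm (opr UNIV x v - opL cs v) <= e / 4 * norm v" using AC_approx[OF x, of "e / 4"] e by auto
  obtain ds where ds: "set ds \<subseteq> ?Q \<times> UNIV" "\<forall>v. norm (opL cs v - opL ds v) <= e / 4 * norm v"
   using opL_rational[of "e / 4" cs] e by auto
  have y: "elL ds \<in> AC" using elL(1) S0_AC by auto
  note B = normed_star_algebra_BL2[of "UNIV :: wl set"]
  have "norm (opr UNIV (x \<ominus>\<^bsub>BL2 UNIV\<^esub> elL ds) v) <= e / 2 * norm v" for v
   using norm_triangle_mono[OF cs[rule_format, of v] ds(2)[rule_format, of v]] by (simp add: opr_minus AC_bo[OF x] elL)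
  hence "nrm (BL2 UNIV) (x \<ominus>\<^bsub>BL2 UNIV\<^esub> elL ds) <= e / 2"
   using e AC_bo[OF x] elL(3)[of ds] abelian_group.minus_closed[OF abelian_group_BL2, of x UNIV "elL ds"]
   by (subst nrm_BL2_le) auto
  hence "nrm AA (x \<ominus>\<^bsub>AA\<^esub> elL ds) < e"
   using e normed_star_algebra.subalgebra_minus[OF B subalgebra_AC x y] by (simp add: AA_def)
  thus "\<exists>y\<in>elL ` L. nrm AA (x \<ominus>\<^bsub>AA\<^esub> y) < e" using ds(1) by (auto simp: L_def)
 qed (use x in simp)
 hence "cstar_topology AA closure_of (elL ` L) = topspace (cstar_topology AA)"
  using closure_of_subset_topspace[of "cstar_topology AA" "elL ` L"] unfolding metric.topspace_mtopology by auto
 thus ?thesis unfolding separable_def separable_space_def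
  using cL sub unfolding metric.topspace_mtopology by (intro exI[of _ "elL ` L"]) auto
qed

section \<open>Elements almost commuting with three symmetries\<close>

text \<open>Right multiplication of the last entry of a list: the symmetries commuting with the algebra.\<close>

definition ract :: "nat => wl => wl" where
 "ract x i = (if snd i = [] then (rm x (fst i), []) else (fst i, butlast (snd i) @ [rm x (last (snd i))]))"

lemma ract_ract [simp]: "ract x (ract x i) = i"
 by (cases i) (auto simp: ract_def butlast_append)

text \<open>Generators change the front of a list, \<open>ract\<close> its last entry. For lists of
  length one these are the same entry, and left and right multiplication commute.\<close>

lemma act1_ract: "act1 g (ract x i) = map_option (ract x) (act1 g i)"
proof (cases i)
 case (Pair h r)
 show ?thesis by (cases r) (auto simp: Pair act1_def ush_def pop_def lact_def ract_def lm_rm)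
qed

definition rop :: "nat => wl ell2 => wl ell2" where
 "rop x = pull (%i. Some (ract x i))"

lemma ract_inj: "Some (ract x i) = Some k ==> Some (ract x j) = Some k ==> i = j"
 by (metis option.inject ract_ract)

lemma Rep_rop: "Rep_ell2 (rop x v) i = Rep_ell2 v (ract x i)"
 unfolding rop_def by (subst Rep_pull, erule (1) ract_inj, simp)

lemma norm_rop_le: "norm (rop x v) <= norm v"
 unfolding rop_def by (rule norm_pull_le, erule (1) ract_inj)

lemma cblinear_rop: "cblinear (rop x)"
 by (rule cblinearI[where C=1]) (auto intro!: ell2_eqI simp: Rep_rop norm_rop_le)

lemma rop_ket: "rop x (ket i) = ket (ract x i)"
 by (rule ell2_eqI) (auto simp: Rep_rop)

lemma rop_op1: "rop x (op1 g v) = op1 g (rop x v)"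
proof -
 have "(%v. rop x (op1 g v)) = (%v. op1 g (rop x v))"
 proof (rule cblinear_eqI)
  show "cblinear (%v. rop x (op1 g v))" by (rule cblinear_comp[OF cblinear_rop cblinear_op1])
  show "cblinear (%v. op1 g (rop x v))" by (rule cblinear_comp[OF cblinear_op1 cblinear_rop])
  show "rop x (op1 g (ket i)) = op1 g (rop x (ket i))" for i
   by (simp add: rop_ket op1_ket act1_ract cblinear_0[OF cblinear_rop] split: option.splits)
 qed
 thus ?thesis by metis
qed

lemma rop_opL: "rop x (opL cs v) = opL cs (rop x v)"
proof -
 have "rop x (opw w v) = opw w (rop x v)" for w by (induction w) (auto simp: rop_op1)
 thus ?thesis
  by (induction cs) (auto simp: cblinear_0[OF cblinear_rop] cblinear_add[OF cblinear_rop] cblinear_scaleC[OF cblinear_rop])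
qed

lemma rop_commutes:
 assumes a: "a \<in> AC"
 shows "rop x (opr UNIV a v) = opr UNIV a (rop x v)"
proof -
 have "norm (rop x (opr UNIV a v) - opr UNIV a (rop x v)) <= e" if e: "e > 0" for e
 proof -
  define d where "d = e / (2 * (norm v + 1))"
  have d: "d > 0" "2 * d * norm v <= e" using e by (auto simp: d_def field_simps add_pos_nonneg)
  obtain cs where cs: "\<forall>x. norm (opr UNIV a x - opL cs x) <= d * norm x" using AC_approx[OF a d(1)] ..
  have "rop x (opr UNIV a v) - opr UNIV a (rop x v) = rop x (opr UNIV a v - opL cs v) - (opr UNIV a (rop x v) - opL cs (rop x v))"
   by (simp add: cblinear_diff[OF cblinear_rop] rop_opL)
  also have "norm \<dots> <= norm (rop x (opr UNIV a v - opL cs v)) + norm (opr UNIV a (rop x v) - opL cs (rop x v))"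
   by (rule norm_triangle_ineq4)
  also have "\<dots> <= d * norm v + d * norm v"
  proof (rule add_mono)
   show "norm (rop x (opr UNIV a v - opL cs v)) <= d * norm v" using norm_rop_le cs order_trans by blast
   have "norm (opr UNIV a (rop x v) - opL cs (rop x v)) <= d * norm (rop x v)" using cs by blast
   also have "\<dots> <= d * norm v" using d by (intro mult_left_mono norm_rop_le) auto
   finally show "norm (opr UNIV a (rop x v) - opL cs (rop x v)) <= d * norm v" .
  qed
  finally show ?thesis using d(2) by simp
 qed
 hence "norm (rop x (opr UNIV a v) - opr UNIV a (rop x v)) <= 0" by (rule field_le_epsilon[of _ 0, simplified])
 thus ?thesis by simp
qed

definition pset :: "nat => wl set" where
 "pset x = {i. \<exists>w. Rep_rword (fst i) = x # w}"

text \<open>If the head does not begin with x, left multiplication makes it begin with x. Right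
  multiplication by x then changes another entry, or the other end of the same word; only the list
  consisting of the unit escapes, being fixed.\<close>

lemma paradoxical:
 assumes "i ~= (em, [])" "i \<notin> pset x"
 shows "\<exists>j\<in>pset x. act1 (x + 2) (ract x i) = Some j"
proof -
 have L: "Rep_rword (lm x h) = x # Rep_rword h" if "\<nexists>w. Rep_rword h = x # w" for h
  using that by (cases "Rep_rword h") (auto simp: Rep_lm lmul_def)
 have h: "\<nexists>w. Rep_rword (fst i) = x # w" using assms(2) by (auto simp: pset_def)
 show ?thesis
 proof (cases "snd i")
  case Nil
  hence "fst i ~= em" using assms(1) by (auto simp: prod_eq_iff)
  hence "Rep_rword (fst i) ~= []" using Rep_em Rep_rword_inject by metis
  then obtain w y where wy: "Rep_rword (fst i) = w @ [y]" by (metis rev_exhaust)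
  \<comment> \<open>The word is nonempty, so the right multiplication acts on its last letter y, by
    cancelling or appending, and the new leading x stays.\<close>
  have "Rep_rword (rm x (lm x (fst i))) = rev (lmul x (rev (x # w @ [y])))" by (simp add: Rep_rm L[OF h] wy)
  also have "\<dots> = x # (if y = x then w else w @ [y, x])" by (simp add: lmul_def)
  finally have "\<exists>u. Rep_rword (rm x (lm x (fst i))) = x # u" ..
  thus ?thesis using Nil by (auto simp: act1_def lact_def ract_def pset_def lm_rm)
 next
  case Cons
  thus ?thesis using L[OF h] by (auto simp: act1_def lact_def ract_def pset_def)
 qed
qed

lemma proj_compl: "x = proj P x + proj (- P) x"
 by (rule ell2_eqI) auto

lemma norm_proj_compl: "(norm x)\<^sup>2 = (norm (proj P x))\<^sup>2 + (norm (proj (- P) x))\<^sup>2"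
proof -
 have "proj P (proj (- P) x) = 0" by (rule ell2_eqI) auto
 hence "inner (proj P x) (proj (- P) x) = 0" by (simp add: inner_proj)
 hence "(norm (proj P x + proj (- P) x))\<^sup>2 = (norm (proj P x))\<^sup>2 + (norm (proj (- P) x))\<^sup>2"
  by (simp add: power2_norm_eq_inner inner_add_left inner_add_right inner_commute)
 thus ?thesis by (simp flip: proj_compl)
qed

text \<open>Let c be the composition of \<open>op1 (x + 2)\<close> and \<open>rop x\<close>, which
  permutes the basis vectors. Outside \<open>pset x\<close> the coordinates of c y are coordinates
  of y at different points of \<open>pset x\<close>, or the coordinate at the base point, which is
  zero. Hence c y has at most the mass there that y has on \<open>pset x\<close>, and y is close to
  c y.\<close>

lemma almost_invariant:
 assumes y: "Rep_ell2 y (em, []) = 0" and e: "norm (op1 (x + 2) (rop x y) - y) <= \<epsilon>"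
 shows "norm (proj (- pset x) y) <= norm (proj (pset x) y) + \<epsilon>"
proof -
 let ?c = "%y. op1 (x + 2) (rop x y)"
 have R: "Rep_ell2 (?c z) i = Rep_ell2 z (the (act1 (x + 2) (ract x i)))" for z i
  by (cases i) (simp add: Rep_op1 Rep_rop inv1_def act1_def lact_def ract_def lm_rm)
 have "proj (- pset x) (?c y) = proj (- pset x) (?c (proj (pset x) y))"
 proof (rule ell2_eqI)
  fix i
  have "Rep_ell2 (?c y) i = Rep_ell2 (?c (proj (pset x) y)) i" if "i \<notin> pset x"
  proof (cases "i = (em, [])")
   case True
   have "act1 (x + 2) (ract x i) = Some i" unfolding True using lm_lm[of x em]
    by (simp add: act1_def lact_def ract_def lm_rm flip: Rep_rword_inject) (simp add: Rep_rm Rep_lm lmul_def)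
   thus ?thesis unfolding R using y True by simp
  next
   case False
   thus ?thesis unfolding R using paradoxical[OF False that] by auto
  qed
  thus "Rep_ell2 (proj (- pset x) (?c y)) i = Rep_ell2 (proj (- pset x) (?c (proj (pset x) y))) i" by simp
 qed
 hence "norm (proj (- pset x) (?c y)) <= norm (proj (pset x) y)"
  using order_trans[OF norm_proj_le order_trans[OF norm_op1_le norm_rop_le]] by (simp only:)
 moreover have "norm (proj (- pset x) (?c y - y)) <= \<epsilon>" by (rule order_trans[OF norm_proj_le e])
 moreover have "proj (- pset x) y = proj (- pset x) (?c y) - proj (- pset x) (?c y - y)" by (rule ell2_eqI) simp
 ultimately show ?thesis using norm_triangle_ineq4[of "proj (- pset x) (?c y)" "proj (- pset x) (?c y - y)"] by simp
qed

text \<open>\<xi> is fixed by \<open>op1 (x + 2)\<close> after \<open>rop x\<close>, and a commutes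
  with \<open>rop x\<close>. So the component y of a \<xi> orthogonal to \<xi> is almost invariant
  under this composition if a almost commutes with \<open>op1 (x + 2)\<close>. Then about half of
  the mass of y, at least, lies in \<open>pset x\<close>; for x = 0, 1, 2 these sets are disjoint,
  so y is small.\<close>

theorem fullness:
 assumes a: "a \<in> AC" and \<epsilon>: "\<epsilon> \<ge> 0"
  and c: "!!x v. x < 3 ==> norm (opr UNIV a (op1 (x + 2) v) - op1 (x + 2) (opr UNIV a v)) <= \<epsilon> * norm v"
 shows "\<exists>c. norm (opr UNIV a \<xi> - scaleC c \<xi>) <= 7 * \<epsilon>"
proof -
 define \<eta> where "\<eta> = opr UNIV a \<xi>"
 define y where "y = \<eta> - scaleC (Rep_ell2 \<eta> (em, [])) \<xi>"
 have y0: "Rep_ell2 y (em, []) = 0" by (simp add: y_def \<xi>_def)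
 have inv: "op1 (x + 2) (rop x \<xi>) = \<xi>" for x
 proof -
  have "lm x (rm x em) = em" by (simp add: Rep_rm Rep_lm lmul_def flip: Rep_rword_inject)
  thus ?thesis by (simp add: \<xi>_def rop_ket op1_ket act1_def lact_def ract_def)
 qed
 have b: "norm (proj (- pset x) y) <= norm (proj (pset x) y) + \<epsilon>" if x: "x < 3" for x
 proof (rule almost_invariant[OF y0])
  have "op1 (x + 2) (rop x y) - y = op1 (x + 2) (rop x \<eta>) - \<eta>"
   by (simp add: y_def cblinear_diff[OF cblinear_rop] cblinear_diff[OF cblinear_op1] cblinear_scaleC[OF cblinear_rop]
     cblinear_scaleC[OF cblinear_op1] inv del: add_2_eq_Suc')
  also have "\<dots> = - (opr UNIV a (op1 (x + 2) (rop x \<xi>)) - op1 (x + 2) (opr UNIV a (rop x \<xi>)))"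
   by (simp add: \<eta>_def rop_commutes[OF a] inv del: add_2_eq_Suc')
  also have "norm \<dots> <= \<epsilon> * norm (rop x \<xi>)" unfolding norm_minus_cancel by (rule c[OF x])
  also have "\<dots> <= \<epsilon>" by (simp add: \<xi>_def rop_ket)
  finally show "norm (op1 (x + 2) (rop x y) - y) <= \<epsilon>" .
 qed
 define N where "N = norm y"
 define \<alpha> where "\<alpha> x = norm (proj (pset x) y)" for x
 have 1: "N\<^sup>2 <= (\<alpha> x)\<^sup>2 + (\<alpha> x + \<epsilon>)\<^sup>2" if "x < 3" for x
  unfolding N_def \<alpha>_def norm_proj_compl[of y "pset x"] using b[OF that] by (intro add_left_mono power_mono) auto
 have aN: "\<alpha> x <= N" "0 <= \<alpha> x" for x by (simp_all add: \<alpha>_def N_def norm_proj_le)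
 have 2: "(\<alpha> 0)\<^sup>2 + (\<alpha> 1)\<^sup>2 + (\<alpha> 2)\<^sup>2 <= N\<^sup>2"
 proof -
  have d: "pset 0 \<inter> pset 1 = {}" "pset 0 \<inter> pset 2 = {}" "pset 1 \<inter> pset 2 = {}" by (auto simp: pset_def)
  let ?z = "proj (- pset 0) y"
  have "proj (pset 1) ?z = proj (pset 1) y" "proj (pset 2) (proj (- pset 1) ?z) = proj (pset 2) y"
   using d by (auto intro!: ell2_eqI)
  hence "(\<alpha> 2)\<^sup>2 <= (norm (proj (- pset 1) ?z))\<^sup>2" "(norm ?z)\<^sup>2 = (\<alpha> 1)\<^sup>2 + (norm (proj (- pset 1) ?z))\<^sup>2"
   using norm_proj_le[of "pset 2" "proj (- pset 1) ?z"] norm_proj_compl[of ?z "pset 1"]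
   by (auto simp: \<alpha>_def intro!: power_mono)
  moreover have "N\<^sup>2 = (\<alpha> 0)\<^sup>2 + (norm ?z)\<^sup>2" unfolding N_def \<alpha>_def by (rule norm_proj_compl)
  ultimately show ?thesis by simp
 qed
 have "N\<^sup>2 <= 2 * (\<alpha> x)\<^sup>2 + 2 * \<epsilon> * N + \<epsilon>\<^sup>2" if "x < 3" for x
 proof -
  have "\<epsilon> * \<alpha> x <= \<epsilon> * N" using aN \<epsilon> by (intro mult_left_mono) auto
  thus ?thesis using 1[OF that] by (simp add: power2_sum algebra_simps)
 qed
 \<comment> \<open>The sum of the three inequalities has 3 N^2 on the left and, by disjointness, at
   most 2 N^2 plus small terms on the right. Two generators would leave nothing. The resulting
   inequality forces N <= 7 \<epsilon>.\<close>
 from this[of 0] this[of 1] this[of 2] 2 have N2: "N\<^sup>2 <= 6 * \<epsilon> * N + 3 * \<epsilon>\<^sup>2" by simp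
 have "N <= 7 * \<epsilon>"
 proof (rule ccontr)
  assume "\<not> N <= 7 * \<epsilon>"
  hence n: "N > 7 * \<epsilon>" by simp
  hence "N * N > 7 * \<epsilon> * N" using \<epsilon> by (intro mult_strict_right_mono) auto
  moreover have "\<epsilon> * N \<ge> \<epsilon> * (7 * \<epsilon>)" using n \<epsilon> by (intro mult_left_mono) auto
  moreover have "\<epsilon> * \<epsilon> \<ge> 0" by simp
  ultimately show False using N2 unfolding power2_eq_square by linarith
 qed
 thus ?thesis unfolding N_def y_def \<eta>_def by blast
qed

section \<open>Polynomials of a bounded symmetric operator\<close>

definition papp :: "real poly => ('a => 'a) => 'a => 'a :: real_vector" where
 "papp p T x = fold_coeffs (%a y. a *\<^sub>R x + T y) p 0"

locale bounded_symmetric =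
 fixes T :: "'a => 'a :: real_inner" and R :: real
 assumes lin: "linear T" and sym: "inner (T x) y = inner x (T y)" and bound: "norm (T x) <= R * norm x" and R: "R \<ge> 0"
begin

lemma papp_0 [simp]: "papp 0 T x = 0"
 by (simp add: papp_def)

lemma papp_pCons [simp]: "papp (pCons a p) T x = a *\<^sub>R x + T (papp p T x)"
 by (cases "p = 0 & a = 0") (auto simp: papp_def linear_0[OF lin])

lemma papp_add: "papp (p + q) T x = papp p T x + papp q T x"
 by (induction p q rule: poly_induct2) (auto simp: linear_add[OF lin] scaleR_add_left)

lemma papp_smult: "papp (Polynomial.smult a p) T x = a *\<^sub>R papp p T x"
 by (induction p) (auto simp: linear_scale[OF lin] scaleR_add_right)

lemma papp_diff: "papp (p - q) T x = papp p T x - papp q T x"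
 using papp_add[of p "Polynomial.smult (-1) q" x] papp_smult[of "-1" q x] by simp

lemma papp_mult: "papp (p * q) T x = papp p T (papp q T x)"
 by (induction p) (auto simp: papp_add papp_smult)

lemma papp_commute: "papp p T (papp q T x) = papp q T (papp p T x)"
 by (metis papp_mult mult.commute)

lemma papp_sym: "inner (papp p T x) y = inner x (papp p T y)"
proof (induction p arbitrary: x y)
 case (pCons a p)
 have "papp p T (T y) = T (papp p T y)" for y using papp_commute[of p "[:0, 1:]" y] by (simp add: linear_0[OF lin])
 thus ?case using pCons.IH[of x "T y"] by (simp add: inner_add_left inner_add_right sym)
qed auto

text \<open>Positivity of r(T) and of its products with R + T, R - T and R^2 - T^2. The products are
  included so that the property is stable under multiplying r by R + t or R - t, the factors that
  occur at a minimum at an end of the interval.\<close>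

definition posq :: "real poly => bool" where
 "posq r \<longleftrightarrow> (\<forall>e\<in>{1, [:R, 1:], [:R, -1:], [:R, 1:] * [:R, -1:]}. \<forall>x. 0 <= inner (papp (e * r) T x) x)"

lemma posq_const:
 assumes "m \<ge> 0"
 shows "posq [:m:]"
proof -
 have Tx: "\<bar>inner (T x) x\<bar> <= R * inner x x" for x
  using Cauchy_Schwarz_ineq2[of "T x" x] mult_right_mono[OF bound[of x] norm_ge_zero[of x]]
  by (simp add: power2_norm_eq_inner[symmetric] power2_eq_square)
 have TT: "inner (T (T x)) x <= R * R * inner x x" for x using power_mono[OF bound[of x] norm_ge_zero, of 2] R
  by (simp add: sym power_mult_distrib power2_norm_eq_inner) (simp add: power2_eq_square)
 have "0 <= inner (papp e T x) x" if ee: "e \<in> {1, [:R, 1:], [:R, -1:], [:R, 1:] * [:R, -1:]}" for e x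
 proof -
  consider "e = 1" | "e = [:R, 1:]" | "e = [:R, -1:]" | "e = [:R, 1:] * [:R, -1:]" using ee by blast
  thus ?thesis
  proof cases
   case 4
   show ?thesis using TT[of x]
    by (simp only: 4 papp_mult) (simp add: one_pCons linear_0[OF lin] linear_add[OF lin] linear_scale[OF lin] inner_add_left linear_neg[OF lin] linear_diff[OF lin] algebra_simps)
  qed (use Tx[of x] in \<open>auto simp: one_pCons linear_0[OF lin] linear_neg[OF lin] inner_add_left inner_diff_left abs_le_iff\<close>)
 qed
 moreover have "e * [:m:] = Polynomial.smult m e" for e by (simp add: mult.commute)
 ultimately show ?thesis unfolding posq_def using assms by (auto simp only: papp_smult inner_scaleR_left intro!: mult_nonneg_nonneg)
qed

lemma posq_add: "posq r ==> posq s ==> posq (r + s)"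
 unfolding posq_def distrib_left papp_add inner_add_left by (blast intro: add_nonneg_nonneg)

lemma papp_square: "inner (papp (e * (u * u * r)) T x) x = inner (papp (e * r) T (papp u T x)) (papp u T x)"
proof -
 have "e * (u * u * r) = u * ((e * r) * u)" by (simp add: mult_ac)
 thus ?thesis by (simp only: papp_mult papp_sym[of u])
qed

lemma posq_square: "posq r ==> posq (u * u * r)"
 unfolding posq_def papp_square by blast

text \<open>Multiplication by u permutes the multipliers 1, u, v, u v up to a factor u^2, and a
  square is absorbed by moving u(T) to both sides of the inner product.\<close>

lemma posq_linear:
 assumes r: "posq r" and u: "(u, v) \<in> {([:R, 1:], [:R, -1:]), ([:R, -1:], [:R, 1:])}"
 shows "posq (u * r)"
proof -
 have E: "{1, [:R, 1:], [:R, -1:], [:R, 1:] * [:R, -1:]} = {1, u, v, u * v}" using u by (auto simp: mult.commute simp del: mult_pCons_left mult_pCons_right)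
 have p: "0 <= inner (papp (e * r) T x) x" if "e \<in> {1, u, v, u * v}" for e x using r that unfolding posq_def E by blast
 have "u * (u * r) = 1 * (u * u * r)" "u * v * (u * r) = v * (u * u * r)" "v * (u * r) = u * v * r" by (simp_all only: mult_ac mult_1_right mult_1_left)
 thus ?thesis unfolding posq_def E
  using p[of 1 "papp u T _", folded papp_square, unfolded mult_1_left] p[of v "papp u T _"] p[of "u * v"] p[of u] by (simp only: ball_simps papp_square insert_iff simp_thms mult_1_left)
qed

end

lemma poly_nonneg_at:
 fixes p :: "real poly"
 assumes R: "R > 0" and p: "!!t. t \<in> {-R..R} ==> t ~= t0 ==> 0 <= poly p t" and t0: "t0 \<in> {-R..R}"
 shows "0 <= poly p t0"
proof (rule ccontr)
 assume "\<not> 0 <= poly p t0"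
 hence n: "poly p t0 < 0" by simp
 have "isCont (poly p) t0" by simp
 then obtain d where d: "d > 0" "!!t. dist t t0 < d ==> dist (poly p t) (poly p t0) < - poly p t0"
  using n unfolding continuous_at_eps_delta by (metis neg_0_less_iff_less)
 define t where "t = (if t0 <= 0 then t0 + min (d / 2) R else t0 - min (d / 2) R)"
 have "t \<in> {-R..R}" "t ~= t0" "dist t t0 < d" using t0 R d(1) by (auto simp: t_def dist_real_def)
 thus False using p[of t] d(2)[of t] n by (auto simp: dist_real_def)
qed

text \<open>Induction on the degree. After subtracting its minimum m, attained at t0, the polynomial
  has the root t0. If t0 is an endpoint, a factor R + t or R - t splits off; if it is interior, the
  derivative vanishes there, the root is double, and a square splits off. The remaining factor is
  again nonnegative, at t0 itself by continuity.\<close>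

lemma (in bounded_symmetric) posq_if_nonneg:
 assumes R: "R > 0" and r: "!!t. t \<in> {-R..R} ==> 0 <= poly r t"
 shows "posq r" using r
proof (induction "degree r" arbitrary: r rule: less_induct)
 case less
 show ?case
 proof (cases "degree r = 0")
  case True
  then obtain m where m: "r = [:m:]" using degree_eq_zeroE by blast
  thus ?thesis using less.prems[of 0] R posq_const[of m] by simp
 next
  case False
  have "compact {-R..R}" "{-R..R} ~= {}" "continuous_on {-R..R} (poly r)" using R by (auto intro!: continuous_intros)
  then obtain t0 where t0: "t0 \<in> {-R..R}" "!!t. t \<in> {-R..R} ==> poly r t0 <= poly r t"
   using continuous_attains_inf[of "{-R..R}" "poly r"] by blast
  define m where "m = poly r t0"
  have m: "m \<ge> 0" using less.prems[OF t0(1)] by (simp add: m_def)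
  have "poly (r - [:m:]) t0 = 0" by (simp add: m_def)
  then obtain r2 where r2: "r - [:m:] = [:- t0, 1:] * r2" unfolding poly_eq_0_iff_dvd by (elim dvdE)
  have r2e: "poly r t - m = (t - t0) * poly r2 t" for t
   using arg_cong[OF r2, of "%p. poly p t"] by (simp add: algebra_simps)
  have rm: "0 <= (t - t0) * poly r2 t" if "t \<in> {-R..R}" for t using t0(2)[OF that] r2e[of t] by (simp add: m_def)
  have rr: "r - [:m:] = r + [:- m:]" by (simp add: diff_conv_add_uminus del: add_uminus_conv_diff)
  have d1: "degree (r - [:m:]) = degree r" unfolding rr by (rule degree_add_eq_left) (use False in simp)
  hence ne: "r2 ~= 0" using r2 False by auto
  have d: "degree r2 < degree r" using d1 ne unfolding r2 by (subst (asm) degree_mult_eq) auto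
  have dec: "r = [:- t0, 1:] * r2 + [:m:]" using r2 by (simp add: algebra_simps)
  have nn: "0 <= poly r2 t" if "t0 = - R" "t \<in> {-R..R}" for t
  proof (cases "t = t0")
   case True
   have "0 <= poly r2 s" if "s \<in> {-R..R}" "s ~= t0" for s
    using rm[OF that(1)] that \<open>t0 = - R\<close> by (simp add: zero_le_mult_iff)
   thus ?thesis using poly_nonneg_at[OF R _ t0(1), of r2] True by blast
  qed (use rm[OF that(2)] that in \<open>simp add: zero_le_mult_iff\<close>)
  have np: "0 <= poly (- r2) t" if "t0 = R" "t \<in> {-R..R}" for t
  proof (cases "t = t0")
   case True
   have "0 <= poly (- r2) s" if "s \<in> {-R..R}" "s ~= t0" for s
    using rm[OF that(1)] that \<open>t0 = R\<close> by (simp add: zero_le_mult_iff)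
   thus ?thesis using poly_nonneg_at[OF R _ t0(1), of "- r2"] True by blast
  qed (use rm[OF that(2)] that in \<open>simp add: zero_le_mult_iff\<close>)
  consider "t0 = - R" | "t0 = R" | "- R < t0" "t0 < R" using t0(1) by force
  thus ?thesis
  proof cases
   case 1
   have "posq r2" using less.hyps[OF d] nn[OF 1] by blast
   hence "posq ([:R, 1:] * r2 + [:m:])" by (intro posq_add posq_linear[where v="[:R, -1:]"] posq_const m) auto
   thus ?thesis using dec 1 by simp
  next
   case 2
   have "posq (- r2)" using less.hyps[of "- r2"] d np[OF 2] by simp
   hence "posq ([:R, -1:] * (- r2) + [:m:])" by (intro posq_add posq_linear[where v="[:R, 1:]"] posq_const m) auto
   moreover have "[:R, -1:] * (- r2) = [:- t0, 1:] * r2"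
   proof -
    have "[:R, -1:] = - [:- R, 1:]" by simp
    thus ?thesis unfolding 2 by (simp only: minus_mult_minus)
   qed
   ultimately show ?thesis using dec by simp
  next
   case 3
   define \<delta> where "\<delta> = min (t0 + R) (R - t0)"
   have "poly (pderiv r) t0 = 0"
   proof (rule DERIV_local_min[OF poly_DERIV])
    show "\<delta> > 0" using 3 by (simp add: \<delta>_def)
    show "\<forall>y. \<bar>t0 - y\<bar> < \<delta> --> poly r t0 <= poly r y" by (intro allI impI t0(2)) (auto simp: \<delta>_def abs_less_iff)
   qed
   moreover have "pderiv r = r2 + [:- t0, 1:] * pderiv r2"
    by (subst dec) (simp only: pderiv_add pderiv_mult, simp add: pderiv_pCons add_ac)
   ultimately have "poly r2 t0 = 0" by simp
   then obtain r3 where r3: "r2 = [:- t0, 1:] * r3" unfolding poly_eq_0_iff_dvd by (elim dvdE)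
   have n3: "0 <= poly r3 s" if "s \<in> {-R..R}" "s ~= t0" for s
   proof -
    have "poly r2 s = (s - t0) * poly r3 s" unfolding r3 by (simp add: algebra_simps)
    hence "0 <= (s - t0)\<^sup>2 * poly r3 s" using rm[OF that(1)] by (simp add: power2_eq_square mult.assoc)
    moreover have "0 < (s - t0)\<^sup>2" using that(2) by simp
    ultimately show ?thesis by (simp only: zero_le_mult_iff) linarith
   qed
   have "degree r3 < degree r" using ne d unfolding r3 by (subst (asm) degree_mult_eq) auto
   moreover have "0 <= poly r3 t" if "t \<in> {-R..R}" for t
    using n3[OF that] poly_nonneg_at[OF R n3 t0(1)] by (cases "t = t0") auto
   ultimately have "posq r3" using less.hyps by blast
   hence "posq ([:- t0, 1:] * [:- t0, 1:] * r3 + [:m:])" by (intro posq_add posq_square posq_const m)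
   thus ?thesis using dec by (simp only: r3 mult.assoc)
  qed
 qed
qed

text \<open>M^2 - p^2 is nonnegative on the interval, so M^2 - p(T)^2 is a positive operator by
  \<open>posq_if_nonneg\<close>. For R = 0 the interval is a point and T = 0.\<close>

lemma (in bounded_symmetric) norm_papp_le:
 assumes M: "0 <= M" "!!t. t \<in> {-R..R} ==> \<bar>poly p t\<bar> <= M"
 shows "norm (papp p T x) <= M * norm x"
proof (cases "R = 0")
 case True
 hence "T x = 0" for x using bound[of x] by simp
 hence "papp p T x = poly p 0 *\<^sub>R x" by (induction p) auto
 thus ?thesis using M(2)[of 0] True by (simp add: mult_right_mono)
next
 case False
 have "posq ([:M * M:] - p * p)"
 proof (rule posq_if_nonneg)
  show "R > 0" using R False by simp
  fix t assume "t \<in> {-R..R}"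
  hence "\<bar>poly p t\<bar> * \<bar>poly p t\<bar> <= M * M" using M by (intro mult_mono) auto
  thus "0 <= poly ([:M * M:] - p * p) t" by (simp flip: abs_mult)
 qed
 hence "0 <= inner (papp (1 * ([:M * M:] - p * p)) T x) x" unfolding posq_def by blast
 hence "(norm (papp p T x))\<^sup>2 <= (M * norm x)\<^sup>2"
  by (simp add: papp_diff papp_mult linear_0[OF lin] inner_diff_left papp_sym power_mult_distrib power2_norm_eq_inner)
   (simp add: power2_eq_square)
 thus ?thesis by (rule power2_le_imp_le) (use M(1) in simp)
qed

lemma (in bounded_symmetric) papp_sum: "degree p <= n ==> papp p T x = (\<Sum>i\<le>n. coeff p i *\<^sub>R (T ^^ i) x)"
proof (induction p arbitrary: n)
 case (pCons a p)
 show ?case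
 proof (cases n)
  case 0
  hence "p = 0" using pCons.prems by (simp split: if_splits)
  thus ?thesis by (simp add: 0 linear_0[OF lin])
 next
  case (Suc m)
  have "degree p <= m" using pCons.prems Suc by (simp split: if_splits)
  hence "T (papp p T x) = (\<Sum>i\<le>m. coeff p i *\<^sub>R (T ^^ Suc i) x)"
   using pCons.IH by (simp add: linear_sum[OF lin] linear_scale[OF lin])
  thus ?thesis unfolding Suc by (subst sum.atMost_Suc_shift) simp
 qed
qed simp

section \<open>Continuous functional calculus and positivity of cut-downs\<close>

lemma polynomial_approximation:
 fixes f :: "real => real"
 assumes f: "continuous_on {-R..R} f" "f 0 = 0" and R: "R \<ge> 0" and e: "e > 0"
 shows "\<exists>q. poly q 0 = 0 & (\<forall>t\<in>{-R..R}. \<bar>f t - poly q t\<bar> <= e)"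
proof -
 obtain g where g: "real_polynomial_function g" "!!t. t \<in> {-R..R} ==> \<bar>f t - g t\<bar> < e / 2"
  using Stone_Weierstrass_real_polynomial_function[OF compact_Icc f(1), of "e / 2"] e by auto
 obtain a n where an: "g = (%x. \<Sum>i\<le>n. a i * x ^ i)" using g(1) unfolding real_polynomial_function_iff_sum by blast
 \<comment> \<open>Removing the constant term costs another e/2, because f vanishes at 0 and so g 0
   is smaller than e/2 in modulus.\<close>
 define q where "q = (\<Sum>i\<le>n. monom (a i) i) - [:g 0:]"
 have q: "poly q t = g t - g 0" for t by (simp add: q_def an poly_sum poly_monom)
 have "\<bar>f t - poly q t\<bar> <= e" if "t \<in> {-R..R}" for t
  using g(2)[OF that] g(2)[of 0] R f(2) unfolding q atLeastAtMost_iff by arith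
 thus ?thesis using q by (intro exI[of _ q]) simp
qed

text \<open>A self-adjoint element seen through an isometric representation: its image is a bounded
  symmetric operator, and the norm bounds for polynomials of that operator hold in the
  algebra.\<close>

locale sa_element = cstar_algebra A for A :: "'a cstar" (structure) +
 fixes \<sigma> :: "'a => 'i operator" and c :: 'a
 assumes \<sigma>: "star_hom A (BL2 UNIV) \<sigma>" and isometric: "x \<in> carrier A ==> nrm (BL2 UNIV) (\<sigma> x) = nrm A x"
  and c: "c \<in> carrier A" and sa: "adj A c = c"
begin

lemmas \<sigma>D = star_homD[OF \<sigma>, unfolded carrier_BL2]

definition T :: "'i ell2 => 'i ell2" where "T = opr UNIV (\<sigma> c)"

sublocale bounded_symmetric T "nrm A c"
proof (rule bounded_symmetric.intro)
 show "linear T" using \<sigma>D(1)[OF c] unfolding T_def by (intro bounded_linear.linear cblinear_bounded_linear) simp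
 show "inner (T x) y = inner x (T y)" for x y
  using inner_cadj[of T x y] \<sigma>D(5)[OF c] \<sigma>D(1)[OF c] by (simp add: T_def sa opr_adj flip: opr_adj(2))
 show "norm (T x) <= nrm A c * norm x" for x using norm_opr_le[OF \<sigma>D(1)[OF c]] by (simp add: T_def isometric c)
qed (rule nrm_nonneg[OF c])

lemma nrm_leI:
 assumes "x \<in> carrier A" "0 <= M" "!!v. norm (opr UNIV (\<sigma> x) v) <= M * norm v"
 shows "nrm A x <= M" using nrm_BL2_le[OF \<sigma>D(1)[OF assms(1)] assms(2)] assms by (simp add: isometric)

lemma opr_\<sigma>_minus:
 assumes "x \<in> carrier A" "y \<in> carrier A"
 shows "opr UNIV (\<sigma> (x \<ominus> y)) v = opr UNIV (\<sigma> x) v - opr UNIV (\<sigma> y) v"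
 using star_hom_minus[OF \<sigma> normed_star_algebra_axioms normed_star_algebra_BL2 assms]
  opr_minus[OF \<sigma>D(1)[OF assms(1)] \<sigma>D(1)[OF assms(2)]] by simp

lemma faithful:
 assumes "x \<in> carrier A" "y \<in> carrier A" "!!v. opr UNIV (\<sigma> x) v = opr UNIV (\<sigma> y) v"
 shows "x = y"
proof -
 have "nrm A (x \<ominus> y) <= 0" by (rule nrm_leI) (simp_all add: assms opr_\<sigma>_minus)
 thus ?thesis using nrm_nonneg[of "x \<ominus> y"] nrm_eq_0[of "x \<ominus> y"] minus_eq_zero_iff[of x y] assms by simp
qed

lemma pow_Suc_closed: "pow_Suc A c n \<in> carrier A"
 by (induction n) (auto simp: c m_closed)

lemma opr_pow_Suc: "opr UNIV (\<sigma> (pow_Suc A c n)) v = (T ^^ Suc n) v"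
proof (induction n arbitrary: v)
 case (Suc n)
 thus ?case using \<sigma>D(1)[OF pow_Suc_closed[of n]] \<sigma>D(1)[OF c]
  by (simp add: \<sigma>D(4) pow_Suc_closed c opr_mult T_def[symmetric] del: funpow.simps) (simp add: funpow_swap1)
qed (simp add: T_def)

lemma opr_finsum:
 fixes n :: nat
 assumes f: "!!i. f i \<in> carrier A"
 shows "(\<Oplus>i\<in>{..<n}. f i) \<in> carrier A & opr UNIV (\<sigma> (\<Oplus>i\<in>{..<n}. f i)) v = (\<Sum>i<n. opr UNIV (\<sigma> (f i)) v)"
proof (induction n)
 case 0
 have "\<sigma> \<zero> = 0 \<odot>\<^bsub>BL2 UNIV\<^esub> \<sigma> \<zero>" using \<sigma>D(3)[of \<zero> 0] by simp
 hence "opr UNIV (\<sigma> \<zero>) v = 0" using opr_smult(2)[OF \<sigma>D(1)[OF zero_closed], of 0] by simp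
 thus ?case by simp
next
 case (Suc n)
 have "(\<Oplus>i\<in>{..<Suc n}. f i) = f n \<oplus> (\<Oplus>i\<in>{..<n}. f i)" unfolding lessThan_Suc by (rule finsum_insert) (use f in auto)
 thus ?case using Suc f \<sigma>D(1)[OF f[of n]] \<sigma>D(1)[OF conjunct1[OF Suc]] by (simp add: \<sigma>D(2) opr_add)
qed

lemma poly_apply_closed: "poly_apply A p c \<in> carrier A"
 and opr_poly_apply: "poly p 0 = 0 ==> opr UNIV (\<sigma> (poly_apply A p c)) v = papp p T v"
proof -
 let ?f = "%i. complex_of_real (coeff p (Suc i)) \<odot> pow_Suc A c i"
 have f: "?f i \<in> carrier A" for i by (simp add: smult_closed pow_Suc_closed)
 show "poly_apply A p c \<in> carrier A" unfolding poly_apply_def using opr_finsum[of ?f, OF f] by blast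
 assume p: "poly p 0 = 0"
 have "opr UNIV (\<sigma> (poly_apply A p c)) v = (\<Sum>i<degree p. opr UNIV (\<sigma> (?f i)) v)"
  unfolding poly_apply_def using opr_finsum[of ?f, OF f] by blast
 also have "\<dots> = (\<Sum>i<degree p. coeff p (Suc i) *\<^sub>R (T ^^ Suc i) v)"
  using \<sigma>D(1)[OF pow_Suc_closed] by (simp only: \<sigma>D(3)[OF pow_Suc_closed] opr_smult opr_pow_Suc scaleC_of_real)
 also have "\<dots> = papp p T v"
  using p papp_sum[OF order_refl, of p v] unfolding sum.atMost_shift by (simp add: poly_0_coeff_0)
 finally show "opr UNIV (\<sigma> (poly_apply A p c)) v = papp p T v" .
qed

lemma nrm_poly_apply_diff:
 assumes "poly p 0 = 0" "poly q 0 = 0" "0 <= M" "!!t. t \<in> {- nrm A c..nrm A c} ==> \<bar>poly p t - poly q t\<bar> <= M"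
 shows "nrm A (poly_apply A p c \<ominus> poly_apply A q c) <= M"
proof (rule nrm_leI)
 fix v
 have "opr UNIV (\<sigma> (poly_apply A p c \<ominus> poly_apply A q c)) v = papp (p - q) T v"
  by (simp add: opr_\<sigma>_minus poly_apply_closed opr_poly_apply assms papp_diff)
 thus "norm (opr UNIV (\<sigma> (poly_apply A p c \<ominus> poly_apply A q c)) v) <= M * norm v"
  using norm_papp_le[of M "p - q" v] assms by simp
qed (use assms poly_apply_closed in auto)

lemma poly_apply_mult:
 assumes "poly p 0 = 0" "poly q 0 = 0"
 shows "poly_apply A (p * q) c = poly_apply A p c \<otimes> poly_apply A q c" using \<sigma>D(1)[OF poly_apply_closed]
 by (intro faithful) (simp_all add: assms poly_apply_closed m_closed opr_poly_apply papp_mult \<sigma>D(4) opr_mult)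

lemma poly_apply_sa:
 assumes "poly p 0 = 0"
 shows "adj A (poly_apply A p c) = poly_apply A p c"
proof (rule faithful)
 fix v
 let ?P = "opr UNIV (\<sigma> (poly_apply A p c))"
 have P: "?P = papp p T" by (rule ext) (simp add: opr_poly_apply assms)
 have cP: "cblinear ?P" using \<sigma>D(1)[OF poly_apply_closed] by simp
 have "?P = cadj ?P" by (rule cadj_unique[OF cP]) (simp add: P papp_sym)
 thus "opr UNIV (\<sigma> (adj A (poly_apply A p c))) v = ?P v"
  using \<sigma>D(1)[OF poly_apply_closed] by (simp add: \<sigma>D(5) poly_apply_closed opr_adj)
qed (simp_all add: poly_apply_closed adj_closed)

text \<open>Polynomials without constant term converging uniformly to the square root of max (t -
  \<epsilon>) 0 give a Cauchy sequence with self-adjoint limit l. The squares of these polynomials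
  are admissible in the definition of \<open>fun_calc\<close>, and any other admissible sequence has
  the same limit, so the cut-down is l times l.\<close>

theorem cutdown_positive:
 assumes \<epsilon>: "\<epsilon> > 0"
 shows "positive A (cutdown A c \<epsilon>)"
proof -
 define R where "R = nrm A c"
 have R0: "R \<ge> 0" using nrm_nonneg[OF c] by (simp add: R_def)
 define f where "f t = sqrt (max (t - \<epsilon>) 0)" for t
 have f0: "f 0 = 0" using \<epsilon> by (simp add: f_def)
 have "continuous_on {-R..R} f" unfolding f_def by (intro continuous_intros)
 hence "\<exists>q. poly q 0 = 0 & (\<forall>t\<in>{-R..R}. \<bar>f t - poly q t\<bar> <= inverse (real (Suc n)))" for n
  by (intro polynomial_approximation f0 R0) simp_all
 then obtain q where q0: "!!n. poly (q n) 0 = 0" and q: "!!n t. t \<in> {-R..R} ==> \<bar>f t - poly (q n) t\<bar> <= inverse (real (Suc n))"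
  by metis
 define w where "w n = poly_apply A (q n) c" for n
 have wc: "w n \<in> carrier A" for n by (simp add: w_def poly_apply_closed)
 have inv: "inverse (real (Suc m)) <= inverse (real (Suc N))" if "N <= m" for m N
  using that by (intro le_imp_inverse_le) auto
 have "\<exists>l\<in>carrier A. (%n. nrm A (w n \<ominus> l)) \<longlonglongrightarrow> 0"
 proof (rule complete[unfolded mcomplete_iff, rule_format], intro conjI allI impI)
  fix e :: real assume "e > 0"
  then obtain N where N: "inverse (real (Suc N)) < e / 2" using reals_Archimedean[of "e / 2"] by auto
  have "nrm A (w m \<ominus> w n) < e" if "m \<ge> N" "n \<ge> N" for m n
  proof -
   have "\<bar>poly (q m) t - poly (q n) t\<bar> <= 2 * inverse (real (Suc N))" if "t \<in> {-R..R}" for t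
    using q[OF that, of m] q[OF that, of n] inv[OF \<open>m \<ge> N\<close>] inv[OF \<open>n \<ge> N\<close>] by linarith
   hence "nrm A (w m \<ominus> w n) <= 2 * inverse (real (Suc N))"
    unfolding w_def by (intro nrm_poly_apply_diff q0) (auto simp: R_def)
   thus ?thesis using N by simp
  qed
  thus "\<exists>N. \<forall>m\<ge>N. \<forall>n\<ge>N. nrm A (w m \<ominus> w n) < e" by blast
 qed (rule wc)
 then obtain l where l: "l \<in> carrier A" "(%n. nrm A (w n \<ominus> l)) \<longlonglongrightarrow> 0" by blast
 have "nrm A (w n \<ominus> adj A l) = nrm A (w n \<ominus> l)" for n
  using nrm_adj[of "w n \<ominus> l"] l(1) wc[of n] poly_apply_sa[OF q0, of n] by (simp add: adj_minus w_def[symmetric])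
 hence lsa: "adj A l = l" using l by (intro lim_unique[of w]) (simp_all add: wc adj_closed)
 note ww = lim_mult[OF wc l wc l]
 have qq: "poly (q n * q n) 0 = 0" for n by (simp add: q0)
 have w2: "w n \<otimes> w n = poly_apply A (q n * q n) c" for n by (simp add: w_def poly_apply_mult q0)
 have u: "uniform_limit {-R..R} (%n. poly (q n * q n)) (%t. max (t - \<epsilon>) 0) sequentially" unfolding uniform_limit_iff
 proof (intro allI impI)
  fix e :: real assume e: "e > 0"
  \<comment> \<open>Bounds |f + q|, since f is at most sqrt R and q differs from f by at most 1;
    then f^2 - q^2 is at most K times the distance of f and q.\<close>
  define K where "K = 2 * sqrt R + 1"
  have K: "K > 0" using R0 by (simp add: K_def add_nonneg_pos)
  obtain N where N: "inverse (real (Suc N)) < e / K" using reals_Archimedean[of "e / K"] e K by auto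
  show "\<forall>\<^sub>F n in sequentially. \<forall>t\<in>{-R..R}. dist (poly (q n * q n) t) (max (t - \<epsilon>) 0) < e"
   unfolding eventually_sequentially
  proof (intro exI[of _ N] allI impI ballI)
   fix n t assume n: "N <= n" and t: "t \<in> {-R..R}"
   have fR: "0 <= f t" "f t <= sqrt R" using t R0 \<epsilon> by (auto simp: f_def)
   have d: "\<bar>f t - poly (q n) t\<bar> <= inverse (real (Suc N))" "inverse (real (Suc N)) <= 1"
    using order_trans[OF q[OF t, of n] inv[OF n]] by (auto simp: inverse_le_1_iff)
   have "max (t - \<epsilon>) 0 = f t * f t" by (simp add: f_def)
   hence "dist (poly (q n * q n) t) (max (t - \<epsilon>) 0) = \<bar>f t - poly (q n) t\<bar> * \<bar>f t + poly (q n) t\<bar>"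
    by (simp add: dist_real_def abs_mult[symmetric] algebra_simps abs_minus_commute)
   also have "\<dots> <= inverse (real (Suc N)) * K" using d fR by (intro mult_mono) (auto simp: K_def)
   also have "\<dots> < e" using N K by (simp add: pos_less_divide_eq)
   finally show "dist (poly (q n * q n) t) (max (t - \<epsilon>) 0) < e" .
  qed
 qed
 have "cutdown A c \<epsilon> = l \<otimes> l" unfolding cutdown_def fun_calc_def
 proof (rule the_equality)
  show "l \<otimes> l \<in> carrier A & (\<forall>p :: nat => real poly. (\<forall>n. poly (p n) 0 = 0) &
   uniform_limit {- nrm A c..nrm A c} (%n. poly (p n)) (%t. max (t - \<epsilon>) 0) sequentially -->
   (%n. nrm A (poly_apply A (p n) c \<ominus> l \<otimes> l)) \<longlonglongrightarrow> 0)"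
  proof (intro conjI allI impI m_closed l(1))
   fix p :: "nat => real poly"
   assume p: "(\<forall>n. poly (p n) 0 = 0) & uniform_limit {- nrm A c..nrm A c} (%n. poly (p n)) (%t. max (t - \<epsilon>) 0) sequentially"
   show "(%n. nrm A (poly_apply A (p n) c \<ominus> l \<otimes> l)) \<longlonglongrightarrow> 0" unfolding tendsto_iff
   proof (intro allI impI)
    fix e :: real assume e: "e > 0"
    have "\<forall>\<^sub>F n in sequentially. \<forall>t\<in>{-R..R}. dist (poly (p n) t) (max (t - \<epsilon>) 0) < e / 4"
     using conjunct2[OF p, folded R_def] e by (intro uniform_limitD) simp_all
    moreover have "\<forall>\<^sub>F n in sequentially. \<forall>t\<in>{-R..R}. dist (poly (q n * q n) t) (max (t - \<epsilon>) 0) < e / 4"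
     by (rule uniform_limitD[OF u]) (use e in simp)
    moreover have "\<forall>\<^sub>F n in sequentially. nrm A (w n \<otimes> w n \<ominus> l \<otimes> l) < e / 2"
     using ww e by (intro order_tendstoD(2)) auto
    ultimately show "\<forall>\<^sub>F n in sequentially. dist (nrm A (poly_apply A (p n) c \<ominus> l \<otimes> l)) 0 < e"
    proof eventually_elim
     case (elim n)
     have "\<bar>poly (p n) t - poly (q n * q n) t\<bar> <= e / 2" if "t \<in> {-R..R}" for t
      using elim(1)[rule_format, OF that] elim(2)[rule_format, OF that] unfolding dist_real_def by linarith
     hence "nrm A (poly_apply A (p n) c \<ominus> w n \<otimes> w n) <= e / 2"
      unfolding w2 using p e by (intro nrm_poly_apply_diff qq) (auto simp: R_def)
     hence "nrm A (poly_apply A (p n) c \<ominus> l \<otimes> l) < e"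
      using nrm_diff_triangle[OF poly_apply_closed m_closed[OF wc wc] m_closed[OF l(1) l(1)], of "p n" n n] elim(3) by simp
     thus ?case using nrm_nonneg[of "poly_apply A (p n) c \<ominus> l \<otimes> l"] poly_apply_closed[of "p n"] m_closed[OF l(1) l(1)] by simp
    qed
   qed
  qed
  fix y assume as: "y \<in> carrier A & (\<forall>p :: nat => real poly. (\<forall>n. poly (p n) 0 = 0) &
   uniform_limit {- nrm A c..nrm A c} (%n. poly (p n)) (%t. max (t - \<epsilon>) 0) sequentially -->
   (%n. nrm A (poly_apply A (p n) c \<ominus> y)) \<longlonglongrightarrow> 0)"
  hence y: "y \<in> carrier A" ..
  have wy: "(%n. nrm A (w n \<otimes> w n \<ominus> y)) \<longlonglongrightarrow> 0"
   unfolding w2 by (rule conjunct2[OF as, THEN spec, THEN mp, of "%n. q n * q n"]) (use qq u in \<open>simp only: R_def simp_thms\<close>)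
  show "y = l \<otimes> l" by (rule lim_unique[OF _ y _ wy ww]) (simp_all add: wc l m_closed)
 qed
 thus ?thesis unfolding positive_def using l(1) lsa by (intro bexI[of _ l]) simp_all
qed

end

section \<open>Consequences of pure infiniteness\<close>

locale pi_algebra = cstar_algebra A + monoid A for A :: "'a cstar" (structure) +
 fixes \<sigma> :: "'a => 'i operator"
 assumes \<sigma>: "star_hom A (BL2 UNIV) \<sigma>" and isometric: "x \<in> carrier A ==> nrm (BL2 UNIV) (\<sigma> x) = nrm A x"
  and pi: "PI A" and nc: "\<exists>x\<in>carrier A. \<exists>y\<in>carrier A. x \<otimes> y ~= y \<otimes> x"
begin

lemma adj_zero [simp]: "adj A \<zero> = \<zero>"
 using adj_smult[of \<zero> 0] smult_zero_left[of "adj A \<zero>"] adj_closed[of \<zero>] by simp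

lemma pi_sequence:
 assumes "b \<in> carrier A" "b ~= \<zero>"
 obtains w where "!!n. w n \<in> carrier A" "!!n. nrm A (\<one> \<ominus> w n \<otimes> (adj A b \<otimes> b) \<otimes> adj A (w n)) < inverse (real (Suc n))"
proof -
 have "\<exists>v. v \<in> carrier A & nrm A (\<one> \<ominus> v \<otimes> (adj A b \<otimes> b) \<otimes> adj A v) < inverse (real (Suc n))" for n
 proof -
  have "inverse (real (Suc n)) > 0" by simp
  thus ?thesis using pi assms unfolding PI_def by blast
 qed
 hence "\<exists>w. \<forall>n. w n \<in> carrier A & nrm A (\<one> \<ominus> w n \<otimes> (adj A b \<otimes> b) \<otimes> adj A (w n)) < inverse (real (Suc n))"
  by (intro choice allI)
 thus thesis using that by blast
qed

lemma not_complex: "\<not> isomorphic A complex_cstar"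
proof
 assume "isomorphic A complex_cstar"
 then obtain f where f: "star_hom A complex_cstar f" "inj_on f (carrier A)"
  unfolding isomorphic_def bij_betw_def by blast
 obtain x y where xy: "x \<in> carrier A" "y \<in> carrier A" "x \<otimes> y ~= y \<otimes> x" using nc by blast
 have "f (x \<otimes> y) = f (y \<otimes> x)" using star_homD(4)[OF f(1)] xy by (simp add: complex_cstar_def)
 thus False using inj_onD[OF f(2)] xy m_closed by blast
qed

text \<open>A nonzero ideal contains the elements v (b^* b) adj(v) approximating the unit, hence,
  being closed, the unit.\<close>

lemma simple: "simple A"
 unfolding simple_def
proof (intro conjI allI impI)
 show "carrier A ~= {\<zero>}" using nc by auto
 fix J assume J: "closed_ideal A J"
 have Jc: "closedin (cstar_topology A) J" "\<zero> \<in> J"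
  and Jm: "!!x y. x \<in> J ==> y \<in> carrier A ==> x \<otimes> y \<in> J & y \<otimes> x \<in> J" using J unfolding closed_ideal_def by blast+
 have sub: "J \<subseteq> carrier A" using Jc(1) by (simp add: closedin_iff)
 show "J = {\<zero>} | J = carrier A"
 proof (cases "J = {\<zero>}")
  case False
  then obtain b where b: "b \<in> J" "b ~= \<zero>" using Jc(2) by blast
  hence bc: "b \<in> carrier A" using sub by blast
  obtain w where w: "!!n. w n \<in> carrier A"
   "!!n. nrm A (\<one> \<ominus> w n \<otimes> (adj A b \<otimes> b) \<otimes> adj A (w n)) < inverse (real (Suc n))"
   by (rule pi_sequence[OF bc b(2)]) (rule that)
  define X where "X n = w n \<otimes> (adj A b \<otimes> b) \<otimes> adj A (w n)" for n
  have X: "X n \<in> J" for n unfolding X_def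
   by (rule Jm[OF Jm[OF Jm[OF b(1) adj_closed[OF bc], THEN conjunct2] w(1), THEN conjunct2] adj_closed[OF w(1)], THEN conjunct1])
  hence Xc: "X n \<in> carrier A" for n using sub by blast
  have "(%n. nrm A (X n \<ominus> \<one>)) \<longlonglongrightarrow> 0"
  proof (rule tendsto_sandwich[OF _ _ tendsto_const LIMSEQ_inverse_real_of_nat])
   show "\<forall>\<^sub>F n in sequentially. nrm A (X n \<ominus> \<one>) <= inverse (real (Suc n))"
    using w(2) by (simp add: nrm_minus_commute[OF Xc one_closed] X_def[symmetric] less_imp_le)
  qed (simp add: nrm_nonneg Xc)
  hence 1: "\<one> \<in> J" using Jc(1) X unfolding closedin_iff by blast
  have "x \<in> J" if "x \<in> carrier A" for x using Jm[OF 1 that] that by simp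
  thus ?thesis using sub by blast
 qed simp
qed

text \<open>If w_n b adj(w_n) tends to the unit and a = y^* y, then v_n = y^* w_n satisfies v_n b
  adj(v_n) \<rightarrow> a, with the error multiplied by the square of the norm of y.\<close>

lemma cuntz_le_positive:
 assumes a: "positive A a" and b: "positive A b" "b ~= \<zero>"
 shows "cuntz_le A a b"
proof -
 obtain y where y: "y \<in> carrier A" "a = adj A y \<otimes> y" using a unfolding positive_def by blast
 obtain z where z: "z \<in> carrier A" "b = adj A z \<otimes> z" using b(1) unfolding positive_def by blast
 have z0: "z ~= \<zero>" using b(2) z by auto
 obtain w where w: "!!n. w n \<in> carrier A"
  "!!n. nrm A (\<one> \<ominus> w n \<otimes> (adj A z \<otimes> z) \<otimes> adj A (w n)) < inverse (real (Suc n))"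
  by (rule pi_sequence[OF z(1) z0]) (rule that)
 define v where "v n = adj A y \<otimes> w n" for n
 have v: "v n \<in> carrier A" for n using y w by (simp add: v_def m_closed adj_closed)
 have bc: "b \<in> carrier A" using z by (simp add: m_closed adj_closed)
 have le: "nrm A (a \<ominus> v n \<otimes> b \<otimes> adj A (v n)) <= (nrm A y)\<^sup>2 * inverse (real (Suc n))" for n
 proof -
  let ?q = "\<one> \<ominus> w n \<otimes> b \<otimes> adj A (w n)"
  have q: "?q \<in> carrier A" using w(1) bc by (simp add: m_closed adj_closed)
  have "a \<ominus> v n \<otimes> b \<otimes> adj A (v n) = adj A y \<otimes> ?q \<otimes> y" using y(1) w(1)[of n] bc
   by (simp add: y(2) v_def adj_mult adj_adj r_distr_minus l_distr_minus m_closed adj_closed m_assoc)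
  also have "nrm A \<dots> <= nrm A (adj A y \<otimes> ?q) * nrm A y" using y q by (intro nrm_mult m_closed adj_closed)
  also have "\<dots> <= (nrm A (adj A y) * nrm A ?q) * nrm A y"
   using y q by (intro mult_right_mono nrm_mult adj_closed nrm_nonneg)
  also have "\<dots> = (nrm A y)\<^sup>2 * nrm A ?q" using nrm_adj[OF y(1)] by (simp add: power2_eq_square)
  also have "\<dots> <= (nrm A y)\<^sup>2 * inverse (real (Suc n))" using w(2)[of n] z(2) by (intro mult_left_mono) auto
  finally show ?thesis .
 qed
 have "(%n. nrm A (a \<ominus> v n \<otimes> b \<otimes> adj A (v n))) \<longlonglongrightarrow> 0"
 proof (rule tendsto_sandwich[OF _ _ tendsto_const])
  show "\<forall>\<^sub>F n in sequentially. nrm A (a \<ominus> v n \<otimes> b \<otimes> adj A (v n)) <= (nrm A y)\<^sup>2 * inverse (real (Suc n))" using le by simp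
  show "(%n. (nrm A y)\<^sup>2 * inverse (real (Suc n))) \<longlonglongrightarrow> 0"
   using tendsto_mult_left[OF LIMSEQ_inverse_real_of_nat, of "(nrm A y)\<^sup>2"] by simp
  show "\<forall>\<^sub>F n in sequentially. 0 <= nrm A (a \<ominus> v n \<otimes> b \<otimes> adj A (v n))"
   using y bc v by (simp add: nrm_nonneg m_closed adj_closed)
 qed
 thus ?thesis unfolding cuntz_le_def using v by blast
qed

lemma purely_infinite: "purely_infinite A"
 unfolding purely_infinite_def cuntz_equiv_def using simple not_complex cuntz_le_positive by blast

text \<open>For the zero map, condition (i) asks that the cut-down of x^2 be Cuntz below a, and
  every positive element is. What remains is the positivity of the cut-down, supplied by
  \<open>cutdown_positive\<close>.\<close>

lemma tracially_Z_absorbing: "tracially_Z_absorbing A"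
 unfolding tracially_Z_absorbing_def
proof (intro conjI simple not_complex allI impI)
 fix x a F and \<epsilon> :: real and n :: nat
 assume as: "positive A x & positive A a & a ~= \<zero> & finite F & F \<subseteq> carrier A & \<epsilon> > 0 & n \<ge> 1"
 obtain y where y: "y \<in> carrier A" "x = adj A y \<otimes> y" using as unfolding positive_def by blast
 have x: "x \<in> carrier A" "adj A x = x" using y by (auto simp: m_closed adj_closed adj_mult adj_adj)
 have mp: "mat_positive A k (%i j. \<zero>)" for k
 proof -
  have "(%i j. \<zero>) = mat_mult A k (mat_adj A (%i j. \<zero>)) (%i j. \<zero>)" by (simp add: mat_mult_def mat_adj_def)
  thus ?thesis unfolding mat_positive_def by (intro bexI[of _ "%i j. \<zero>"]) (simp_all add: mats_def)
 qed
 have cpc: "cpc (Mn n) A (%z. \<zero>)" unfolding cpc_def linear_map_def using mp nrm_BL2_nonneg by auto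
 have "x \<otimes> x \<ominus> x \<otimes> \<zero> \<otimes> x = x \<otimes> x" using x by (simp add: m_closed minus_eq)
 moreover have "sa_element A \<sigma> (x \<otimes> x)"
  by (intro sa_element.intro sa_element_axioms.intro cstar_algebra_axioms \<sigma> isometric)
   (use x in \<open>simp_all add: m_closed adj_mult\<close>)
 ultimately have "cuntz_le A (cutdown A (x \<otimes> x \<ominus> x \<otimes> \<zero> \<otimes> x) \<epsilon>) a"
  using cuntz_le_positive sa_element.cutdown_positive as by metis
 moreover have "nrm A (\<zero> \<otimes> b \<ominus> b \<otimes> \<zero>) < \<epsilon>" if "b \<in> F" for b
 proof -
  have "b \<in> carrier A" using as that by blast
  thus ?thesis using as minus_eq_zero_iff[of \<zero> \<zero>] by simp
 qed
 moreover have "order_zero (Mn n) A (%z. \<zero>)" unfolding order_zero_def by simp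
 ultimately show "\<exists>\<phi>. cpc (Mn n) A \<phi> & order_zero (Mn n) A \<phi> &
      cuntz_le A (cutdown A (x \<otimes> x \<ominus> x \<otimes> \<phi> \<one>\<^bsub>Mn n\<^esub> \<otimes> x) \<epsilon>) a &
      (\<forall>z\<in>carrier (Mn n). nrm (Mn n) z <= 1 -->
       (\<forall>b\<in>F. nrm A (\<phi> z \<otimes> b \<ominus> b \<otimes> \<phi> z) < \<epsilon>))" using cpc by (intro exI[of _ "%z. \<zero>"]) blast
qed

end

section \<open>Transport of the algebra to a set of real numbers\<close>

definition set_code :: "nat set => real" where
 "set_code = (SOME f. inj f)"

lemma inj_set_code: "inj set_code"
proof -
 obtain f :: "nat set => real" where "bij_betw f UNIV UNIV" using nat_sets_eqpoll_reals unfolding eqpoll_def by blast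
 hence "inj f" by (simp add: bij_betw_def)
 thus ?thesis unfolding set_code_def by (rule someI[of inj])
qed

instance rword :: countable by (rule countable_classI[of "%w. to_nat (Rep_rword w)"]) (simp add: Rep_rword_inject)

text \<open>An operator is determined by the rational cuts of the real and imaginary parts of its
  matrix coefficients (the flag b tells them apart), that is by a set of natural numbers, and such
  sets inject into the reals. This provides the carrier type asked for in the theorem.\<close>

definition code :: "wl operator => real" where
 "code T = set_code {to_nat (i, j, r, b) |i j (r :: rat) b. of_rat r <
   (if b then Re (Rep_ell2 (opr UNIV T (ket i)) j) else Im (Rep_ell2 (opr UNIV T (ket i)) j))}"

lemma rat_cut_eq: "(!!r. of_rat r < x \<longleftrightarrow> of_rat r < y) ==> x = (y :: real)"
 using of_rat_dense[of x y] of_rat_dense[of y x] by (metis linorder_neqE order_less_asym)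

lemma inj_code: "inj_on code (bounded_operators UNIV)"
proof (rule inj_onI)
 fix S T assume S: "S \<in> bounded_operators UNIV" and T: "T \<in> bounded_operators UNIV" and e: "code S = code T"
 define c where "c T i j b = (if b then Re (Rep_ell2 (opr UNIV T (ket i)) j) else Im (Rep_ell2 (opr UNIV T (ket i)) j))"
  for T :: "wl operator" and i j b
 let ?C = "%T. {to_nat (i, j, r, b) |i j (r :: rat) b. of_rat r < c T i j b}"
 have mem: "to_nat (i, j, r, b) \<in> ?C T \<longleftrightarrow> of_rat r < c T i j b" for i j b T and r :: rat by auto
 have "?C S = ?C T" using e inj_set_code unfolding code_def c_def by (rule inj_eq[THEN iffD1, rotated])
 hence "of_rat r < c S i j b \<longleftrightarrow> of_rat r < c T i j b" for i j b and r :: rat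
  unfolding mem[of i j r b S, symmetric] mem[of i j r b T, symmetric] by (rule arg_cong)
 hence c: "c S i j b = c T i j b" for i j b by (rule rat_cut_eq)
 have "opr UNIV S (ket i) = opr UNIV T (ket i)" for i
  using c[of i _ True] c[of i _ False] by (intro ell2_eqI complex_eqI) (simp_all add: c_def)
 hence "opr UNIV S = opr UNIV T" by (intro cblinear_eqI) (use S T in auto)
 thus "S = T" by (rule bo_eqI[OF S T])
qed

definition transport :: "('a => 'b) => ('b => 'a) => 'a cstar => 'b cstar" where
 "transport f g A = \<lparr>carrier = f ` carrier A,
   monoid.mult = (%x y. f (g x \<otimes>\<^bsub>A\<^esub> g y)),
   one = f \<one>\<^bsub>A\<^esub>, zero = f \<zero>\<^bsub>A\<^esub>,
   add = (%x y. f (g x \<oplus>\<^bsub>A\<^esub> g y)),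
   smult = (%c x. f (c \<odot>\<^bsub>A\<^esub> g x)),
   adj = (%x. f (adj A (g x))),
   nrm = (%x. nrm A (g x))\<rparr>"

locale transported = cstar_algebra A + monoid A for A :: "'a cstar" (structure) +
 fixes f :: "'a => 'b" and g :: "'b => 'a"
 assumes gf: "x \<in> carrier A ==> g (f x) = x"
begin

abbreviation B where "B \<equiv> transport f g A"

lemma simps [simp]: "carrier B = f ` carrier A" "\<one>\<^bsub>B\<^esub> = f \<one>" "\<zero>\<^bsub>B\<^esub> = f \<zero>"
  "x \<otimes>\<^bsub>B\<^esub> y = f (g x \<otimes> g y)" "x \<oplus>\<^bsub>B\<^esub> y = f (g x \<oplus> g y)" "c \<odot>\<^bsub>B\<^esub> x = f (c \<odot> g x)"
  "adj B x = f (adj A (g x))" "nrm B x = nrm A (g x)" by (simp_all add: transport_def)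

lemma normed_transport: "normed_star_algebra B"
proof -
 have ab: "abelian_group B"
 proof (rule abelian_groupI)
  fix x assume "x \<in> carrier B"
  then obtain a where "a \<in> carrier A" "x = f a" by auto
  thus "\<exists>y\<in>carrier B. y \<oplus>\<^bsub>B\<^esub> x = \<zero>\<^bsub>B\<^esub>" by (intro bexI[of _ "f (\<ominus> a)"]) (simp_all add: gf l_neg)
 qed (auto simp: gf a_ac)
 show ?thesis by (intro normed_star_algebra.intro normed_star_algebra_axioms.intro ab)
   (auto simp: gf m_closed m_assoc l_distr r_distr smult_closed smult_l_distr smult_r_distr smult_assoc smult_one
    smult_mult_left smult_mult_right adj_closed adj_adj adj_add adj_smult adj_mult nrm_nonneg nrm_eq_0 nrm_triangle nrm_smult nrm_mult
    dest: arg_cong[of _ _ g])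
qed

lemma minus_transport: "x \<in> carrier A ==> y \<in> carrier A ==> f x \<ominus>\<^bsub>B\<^esub> f y = f (x \<ominus> y)"
 using normed_star_algebra.minus_smult[OF normed_transport, of "f x" "f y"] by (simp add: gf minus_smult smult_closed)

lemma cstar_transport: "cstar_algebra B"
proof -
 interpret B: normed_star_algebra B by (rule normed_transport)
 have "B.metric.mcomplete" unfolding B.mcomplete_iff
 proof (intro allI impI)
  fix X :: "nat => 'b" assume X: "(\<forall>n. X n \<in> carrier B) & (\<forall>e>0. \<exists>N. \<forall>m\<ge>N. \<forall>n\<ge>N. nrm B (X m \<ominus>\<^bsub>B\<^esub> X n) < e)"
  define Y where "Y n = g (X n)" for n
  have Y: "Y n \<in> carrier A" "X n = f (Y n)" for n
  proof -
   have "X n \<in> f ` carrier A" using X by simp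
   then obtain a where "a \<in> carrier A" "X n = f a" by blast
   thus "Y n \<in> carrier A" "X n = f (Y n)" by (simp_all add: Y_def gf)
  qed
  have e: "nrm B (X m \<ominus>\<^bsub>B\<^esub> X n) = nrm A (Y m \<ominus> Y n)" for m n by (simp add: Y minus_transport gf)
  hence "(\<forall>n. Y n \<in> carrier A) & (\<forall>e>0. \<exists>N. \<forall>m\<ge>N. \<forall>n\<ge>N. nrm A (Y m \<ominus> Y n) < e)" using X Y(1) unfolding e by blast
  from mcomplete_iff[THEN iffD1, OF complete, THEN spec, THEN mp, OF this]
  obtain l where l: "l \<in> carrier A" "(%n. nrm A (Y n \<ominus> l)) \<longlonglongrightarrow> 0" ..
  thus "\<exists>l\<in>carrier B. (%n. nrm B (X n \<ominus>\<^bsub>B\<^esub> l)) \<longlonglongrightarrow> 0"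
   by (intro bexI[of _ "f l"]) (simp_all add: Y minus_transport gf)
 qed
 thus ?thesis by (intro cstar_algebra.intro cstar_algebra_axioms.intro normed_transport)
   (auto simp: gf adj_closed m_closed cstar_identity)
qed

lemma monoid_transport: "monoid B"
 by (rule monoidI) (auto simp: gf m_closed m_assoc)

lemma separable_transport: "separable A ==> separable B"
proof -
 assume "separable A"
 then obtain C where C: "countable C" "C \<subseteq> carrier A" "cstar_topology A closure_of C = carrier A"
  unfolding separable_def separable_space_def metric.topspace_mtopology by blast
 interpret B: normed_star_algebra B by (rule normed_transport)
 have sub: "f ` C \<subseteq> carrier B" using C(2) by auto
 have "x \<in> cstar_topology B closure_of (f ` C)" if x: "x \<in> carrier B" for x unfolding B.closure_of_iff[OF sub]
 proof (intro conjI x allI impI)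
  fix e :: real assume e: "e > 0"
  obtain a where a: "a \<in> carrier A" "x = f a" using x by auto
  hence "a \<in> cstar_topology A closure_of C" by (simp only: C(3))
  then obtain y where y: "y \<in> C" "nrm A (a \<ominus> y) < e" using e unfolding closure_of_iff[OF C(2)] by blast
  hence "nrm B (x \<ominus>\<^bsub>B\<^esub> f y) < e" using a C(2) by (simp add: a minus_transport gf subset_iff)
  thus "\<exists>y\<in>f ` C. nrm B (x \<ominus>\<^bsub>B\<^esub> y) < e" using y(1) by blast
 qed
 hence "cstar_topology B closure_of (f ` C) = topspace (cstar_topology B)"
  using closure_of_subset_topspace[of "cstar_topology B" "f ` C"] unfolding B.metric.topspace_mtopology by blast
 thus "separable B"
  unfolding separable_def separable_space_def using C(1) sub unfolding B.metric.topspace_mtopology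
  by (intro exI[of _ "f ` C"]) auto
qed

lemma PI_transport: "PI A ==> PI B"
 unfolding PI_def
proof (intro ballI impI allI)
 fix b and e :: real
 assume P: "\<forall>b\<in>carrier A. b ~= \<zero> --> (\<forall>e>0. \<exists>v\<in>carrier A. nrm A (\<one> \<ominus> v \<otimes> (adj A b \<otimes> b) \<otimes> adj A v) < e)"
  and b: "b \<in> carrier B" "b ~= \<zero>\<^bsub>B\<^esub>" and e: "e > 0"
 obtain a where a: "a \<in> carrier A" "b = f a" using b(1) by auto
 then obtain v where v: "v \<in> carrier A" "nrm A (\<one> \<ominus> v \<otimes> (adj A a \<otimes> a) \<otimes> adj A v) < e" using P b(2) e by force
 thus "\<exists>v\<in>carrier B. nrm B (\<one>\<^bsub>B\<^esub> \<ominus>\<^bsub>B\<^esub> v \<otimes>\<^bsub>B\<^esub> (adj B b \<otimes>\<^bsub>B\<^esub> b) \<otimes>\<^bsub>B\<^esub> adj B v) < e"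
  using a(1) by (intro bexI[of _ "f v"]) (simp_all add: a(2) gf m_closed adj_closed minus_transport)
qed

lemma star_hom_transport: "star_hom B A g"
 by (rule star_homI) (auto simp: gf m_closed smult_closed adj_closed)

end

text \<open>The decoding map g serves as the isometric representation, on the Hilbert space of
  lists.\<close>

lemma pi_algebra_transport_AA:
 obtains A :: "real cstar" and g where "cstar_algebra A" "monoid A" "separable A" "pi_algebra A g"
  "inj_on g (carrier A)" "g ` carrier A = AC"
proof -
 define g where "g = the_inv_into AC code"
 have inj: "inj_on code AC" by (rule inj_on_subset[OF inj_code]) (use AC_bo in blast)
 have gf: "g (code x) = x" if "x \<in> AC" for x unfolding g_def by (rule the_inv_into_f_f[OF inj that])
 interpret transported AA code g
  by (intro transported.intro transported_axioms.intro cstar_algebra_AA monoid_AA) (simp add: gf)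
 have s: "star_hom B (BL2 UNIV) g"
 proof (rule star_homI)
  note h = star_homD[OF star_hom_transport]
  fix x y c assume x: "x \<in> carrier B"
  show "g x \<in> carrier (BL2 UNIV)" using h(1)[OF x] AC_bo by simp
  show "g (c \<odot>\<^bsub>B\<^esub> x) = c \<odot>\<^bsub>BL2 UNIV\<^esub> g x" unfolding h(3)[OF x] by (simp add: AA_def)
  show "g (adj B x) = adj (BL2 UNIV) (g x)" unfolding h(5)[OF x] by (simp add: AA_def)
  assume y: "y \<in> carrier B"
  show "g (x \<oplus>\<^bsub>B\<^esub> y) = g x \<oplus>\<^bsub>BL2 UNIV\<^esub> g y" unfolding h(2)[OF x y] by (simp add: AA_def)
  show "g (x \<otimes>\<^bsub>B\<^esub> y) = g x \<otimes>\<^bsub>BL2 UNIV\<^esub> g y" unfolding h(4)[OF x y] by (simp add: AA_def)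
 qed
 have "\<exists>x\<in>carrier B. \<exists>y\<in>carrier B. x \<otimes>\<^bsub>B\<^esub> y ~= y \<otimes>\<^bsub>B\<^esub> x"
 proof -
  obtain x y where xy: "x \<in> carrier AA" "y \<in> carrier AA" "x \<otimes>\<^bsub>AA\<^esub> y ~= y \<otimes>\<^bsub>AA\<^esub> x" using noncommutative_AA by blast
  have "code (x \<otimes>\<^bsub>AA\<^esub> y) ~= code (y \<otimes>\<^bsub>AA\<^esub> x)" using xy m_closed inj by (auto dest: inj_onD)
  thus ?thesis using xy by (intro bexI[of _ "code x"] bexI[of _ "code y"]) (simp_all add: gf)
 qed
 moreover have "nrm (BL2 UNIV) (g x) = nrm B x" for x unfolding simps(8) by (simp add: AA_def)
 ultimately have "pi_algebra B g"
  by (intro pi_algebra.intro pi_algebra_axioms.intro cstar_transport monoid_transport s PI_transport PI_AA) blast+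
 moreover have "inj_on g (carrier B)" "g ` carrier B = AC" by (auto simp: inj_on_def gf image_iff)
 ultimately show ?thesis using that[OF cstar_transport monoid_transport separable_transport[OF separable_AA]] by blast
qed

section \<open>Asymptotic commutation with families of operators\<close>

lemma star_hom_inv:
 assumes f: "star_hom A B f" "bij_betw f (carrier A) (carrier B)" and A: "normed_star_algebra A"
 defines "h \<equiv> the_inv_into (carrier A) f"
 shows "star_hom B A h" "!!x. x \<in> carrier A ==> h (f x) = x" "!!y. y \<in> carrier B ==> h y \<in> carrier A & f (h y) = y"
proof -
 interpret normed_star_algebra A by (rule A)
 note fD = star_homD[OF f(1)]
 have inj: "inj_on f (carrier A)" and im: "f ` carrier A = carrier B" using f(2) unfolding bij_betw_def by blast+
 show hf: "!!x. x \<in> carrier A ==> h (f x) = x" unfolding h_def by (rule the_inv_into_f_f[OF inj])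
 show fh: "h y \<in> carrier A & f (h y) = y" if yB: "y \<in> carrier B" for y
 proof -
  have "y \<in> f ` carrier A" unfolding im by (rule yB)
  then obtain x where "x \<in> carrier A" "y = f x" by blast
  thus ?thesis using hf by simp
 qed
 have eq: "h z = x" if "x \<in> carrier A" "f x = z" for x z using hf[OF that(1)] that(2) by simp
 show "star_hom B A h"
 proof (rule star_homI)
  fix x y c assume "x \<in> carrier B"
  note x = fh[OF this]
  show "h x \<in> carrier A" using x by blast
  show "h (c \<odot>\<^bsub>B\<^esub> x) = c \<odot>\<^bsub>A\<^esub> h x" by (rule eq) (use x in \<open>simp_all add: fD smult_closed\<close>)
  show "h (adj B x) = adj A (h x)" by (rule eq) (use x in \<open>simp_all add: fD adj_closed\<close>)
  assume "y \<in> carrier B"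
  note y = fh[OF this]
  show "h (x \<oplus>\<^bsub>B\<^esub> y) = h x \<oplus>\<^bsub>A\<^esub> h y" by (rule eq) (use x y in \<open>simp_all add: fD\<close>)
  show "h (x \<otimes>\<^bsub>B\<^esub> y) = h x \<otimes>\<^bsub>A\<^esub> h y" by (rule eq) (use x y in \<open>simp_all add: fD m_closed\<close>)
 qed
qed

definition comm :: "('i ell2 => 'i ell2) => ('i ell2 => 'i ell2) => 'i ell2 => 'i ell2" where
 "comm B C v = B (C v) - C (B v)"

lemma comm_adj:
 assumes B: "cblinear B" and C: "cblinear C" and e: "0 <= e" "!!v. norm (comm B C v) <= e * norm v"
 shows "norm (comm (cadj B) (cadj C) v) <= e * norm v"
proof -
 have cl: "cblinear (comm B C)"
 proof -
  have "comm B C = (%v. B (C v) + scaleC (- 1) (C (B v)))" by (simp add: comm_def fun_eq_iff scaleC_minus_one)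
  thus ?thesis by (simp only: cblinear_plus cblinear_smult cblinear_comp B C)
 qed
 have "(%v. - comm (cadj B) (cadj C) v) = cadj (comm B C)" by (rule cadj_unique[OF cl])
   (simp add: comm_def inner_diff_left inner_diff_right inner_cadj[OF B] inner_cadj[OF C])
 hence "norm (comm (cadj B) (cadj C) v) = norm (cadj (comm B C) v)" by (metis norm_minus_cancel)
 thus ?thesis using norm_cadj_le[OF cl e] by simp
qed

text \<open>A directed family \<open>W\<close> of sets of test operators; asymptotic commutation with them
 is what a central sequence would give.\<close>

locale test_family =
 fixes W :: "('i ell2 => 'i ell2) set set"
 assumes nonempty: "W ~= {}" and directed: "S \<in> W ==> S' \<in> W ==> \<exists>S''\<in>W. S'' \<subseteq> S & S'' \<subseteq> S'"
  and test: "S \<in> W ==> B \<in> S ==> cblinear B & (\<forall>v. norm (B v) <= norm v) & cadj B \<in> S"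
begin

text \<open>Commutation with the test operators in the limit along the filter base \<open>W\<close>;
  the bound has to be uniform over a whole test set. Operators with this property are closed under
  the algebraic operations and norm limits.\<close>

definition asym :: "('i ell2 => 'i ell2) => bool" where
 "asym C \<longleftrightarrow> cblinear C & (\<forall>e>0. \<exists>S\<in>W. \<forall>B\<in>S. \<forall>v. norm (comm B C v) <= e * norm v)"

lemma asymD: "asym C ==> e > 0 ==> \<exists>S\<in>W. \<forall>B\<in>S. \<forall>v. norm (comm B C v) <= e * norm v"
 and asym_lin: "asym C ==> cblinear C" by (simp_all add: asym_def)

lemma asym2:
 assumes "asym C" "asym D" "e > 0" "e' > 0"
 obtains S where "S \<in> W" "!!B v. B \<in> S ==> norm (comm B C v) <= e * norm v" "!!B v. B \<in> S ==> norm (comm B D v) <= e' * norm v"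
proof -
 obtain S where S: "S \<in> W" "\<forall>B\<in>S. \<forall>v. norm (comm B C v) <= e * norm v" using asymD[OF assms(1,3)] by blast
 obtain S' where S': "S' \<in> W" "\<forall>B\<in>S'. \<forall>v. norm (comm B D v) <= e' * norm v" using asymD[OF assms(2,4)] by blast
 obtain S'' where "S'' \<in> W" "S'' \<subseteq> S" "S'' \<subseteq> S'" using directed[OF S(1) S'(1)] by blast
 thus ?thesis using that[of S''] S(2) S'(2) by blast
qed

lemma asym_exact: "cblinear C ==> (!!S B v. S \<in> W ==> B \<in> S ==> comm B C v = 0) ==> asym C"
proof -
 assume "cblinear C" and z: "!!S B v. S \<in> W ==> B \<in> S ==> comm B C v = 0"
 obtain S where "S \<in> W" using nonempty by blast
 thus "asym C" unfolding asym_def using \<open>cblinear C\<close> z by (auto intro!: bexI[of _ S])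
qed

lemma asym_add:
 assumes C: "asym C" and D: "asym D"
 shows "asym (%v. C v + D v)" unfolding asym_def
proof (intro conjI allI impI cblinear_plus asym_lin C D)
 fix e :: real assume "e > 0"
 hence e: "e / 2 > 0" by simp
 obtain S where S: "S \<in> W" "!!B v. B \<in> S ==> norm (comm B C v) <= e / 2 * norm v" "!!B v. B \<in> S ==> norm (comm B D v) <= e / 2 * norm v"
  using asym2[OF C D e e] by blast
 have "norm (comm B (%v. C v + D v) v) <= e * norm v" if B: "B \<in> S" for B v
 proof -
  have "comm B (%v. C v + D v) v = comm B C v + comm B D v" using test[OF S(1) B] by (simp add: comm_def cblinear_add)
  thus ?thesis using norm_triangle_mono[OF S(2)[OF B] S(3)[OF B], of v v] by simp
 qed
 thus "\<exists>S\<in>W. \<forall>B\<in>S. \<forall>v. norm (comm B (%v. C v + D v) v) <= e * norm v" using S(1) by blast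
qed

lemma asym_scale:
 assumes C: "asym C"
 shows "asym (%v. scaleC c (C v))" unfolding asym_def
proof (intro conjI allI impI cblinear_smult asym_lin C)
 fix e :: real assume e: "e > 0"
 have d: "e / (cmod c + 1) > 0" using e by (simp add: add_nonneg_pos)
 obtain S where S: "S \<in> W" "\<forall>B\<in>S. \<forall>v. norm (comm B C v) <= e / (cmod c + 1) * norm v" using asymD[OF C d] by blast
 have "norm (comm B (%v. scaleC c (C v)) v) <= e * norm v" if B: "B \<in> S" for B v
 proof -
  have "norm (comm B (%v. scaleC c (C v)) v) = cmod c * norm (comm B C v)"
   using test[OF S(1) B] by (simp add: comm_def cblinear_scaleC flip: scaleC_minus)
  also have "\<dots> <= (cmod c + 1) * (e / (cmod c + 1) * norm v)" using S(2) B d by (intro mult_mono) auto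
  also have "\<dots> = e * norm v"
  proof -
   have "cmod c + 1 ~= 0" using norm_ge_zero[of c] by linarith
   thus ?thesis by simp
  qed
  finally show ?thesis .
 qed
 thus "\<exists>S\<in>W. \<forall>B\<in>S. \<forall>v. norm (comm B (%v. scaleC c (C v)) v) <= e * norm v" using S(1) by blast
qed

lemma asym_comp:
 assumes C: "asym C" and D: "asym D"
 shows "asym (%v. C (D v))" unfolding asym_def
proof (intro conjI allI impI)
 show "cblinear (%v. C (D v))" by (rule cblinear_comp[OF asym_lin[OF C] asym_lin[OF D]])
 fix e :: real assume e: "e > 0"
 obtain K where K: "K \<ge> 0" "!!v. norm (C v) <= K * norm v" using cblinear_obtain_bound[OF asym_lin[OF C]] by blast
 obtain L where L: "L \<ge> 0" "!!v. norm (D v) <= L * norm v" using cblinear_obtain_bound[OF asym_lin[OF D]] by blast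
 define d where "d = e / (K + L + 1)"
 have d: "d > 0" "d * (K + L) <= e" using e K(1) L(1) by (auto simp: d_def field_simps)
 obtain S where S: "S \<in> W" "!!B v. B \<in> S ==> norm (comm B C v) <= d * norm v" "!!B v. B \<in> S ==> norm (comm B D v) <= d * norm v"
  using asym2[OF C D d(1) d(1)] by blast
 have "norm (comm B (%v. C (D v)) v) <= e * norm v" if B: "B \<in> S" for B v
 proof -
  have "comm B (%v. C (D v)) v = comm B C (D v) + C (comm B D v)"
   by (simp add: comm_def cblinear_diff[OF asym_lin[OF C]])
  also have "norm \<dots> <= d * norm (D v) + K * norm (comm B D v)" by (intro norm_triangle_mono S(2)[OF B] K(2))
  also have "\<dots> <= d * (L * norm v) + K * (d * norm v)" using d(1) K(1) by (intro add_mono mult_left_mono L(2) S(3)[OF B]) auto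
  also have "\<dots> = d * (K + L) * norm v" by (simp add: algebra_simps)
  also have "\<dots> <= e * norm v" by (rule mult_right_mono[OF d(2)]) simp
  finally show ?thesis .
 qed
 thus "\<exists>S\<in>W. \<forall>B\<in>S. \<forall>v. norm (comm B (%v. C (D v)) v) <= e * norm v" using S(1) by blast
qed

text \<open>The commutator of B with the adjoint of C is, up to sign, the adjoint of the commutator
  of the adjoint of B with C. Hence the requirement that test sets contain adjoints.\<close>

lemma asym_adj:
 assumes C: "asym C"
 shows "asym (cadj C)" unfolding asym_def
proof (intro conjI allI impI cblinear_cadj asym_lin C)
 fix e :: real assume e: "e > 0"
 obtain S where S: "S \<in> W" "\<forall>B\<in>S. \<forall>v. norm (comm B C v) <= e * norm v" using asymD[OF C e] by blast
 have "norm (comm B (cadj C) v) <= e * norm v" if B: "B \<in> S" for B v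
 proof -
  have "cblinear B" "cadj B \<in> S" using test[OF S(1) B] by blast+
  thus ?thesis using comm_adj[OF cblinear_cadj asym_lin[OF C], of B e v] S(2) e by (simp add: cadj_cadj)
 qed
 thus "\<exists>S\<in>W. \<forall>B\<in>S. \<forall>v. norm (comm B (cadj C) v) <= e * norm v" using S(1) by blast
qed

lemma asym_limit:
 assumes C: "cblinear C" and a: "!!e. e > 0 ==> \<exists>D. asym D & (\<forall>v. norm (C v - D v) <= e * norm v)"
 shows "asym C" unfolding asym_def
proof (intro conjI allI impI C)
 fix e :: real assume "e > 0"
 hence e: "e / 4 > 0" "e / 2 > 0" by simp_all
 obtain D where D: "asym D" "\<forall>v. norm (C v - D v) <= e / 4 * norm v" using a[OF e(1)] by blast
 obtain S where S: "S \<in> W" "\<forall>B\<in>S. \<forall>v. norm (comm B D v) <= e / 2 * norm v" using asymD[OF D(1) e(2)] by blast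
 have "norm (comm B C v) <= e * norm v" if B: "B \<in> S" for B v
 proof -
  have Bl: "cblinear B" "!!v. norm (B v) <= norm v" using test[OF S(1) B] by blast+
  have "comm B C v = comm B D v + (B (C v - D v) - (C (B v) - D (B v)))"
   by (simp add: comm_def cblinear_diff[OF Bl(1)])
  also have "norm \<dots> <= e / 2 * norm v + (norm (B (C v - D v)) + norm (C (B v) - D (B v)))"
   using S(2) B by (intro norm_triangle_mono norm_triangle_ineq4) auto
  also have "norm (B (C v - D v)) <= e / 4 * norm v" by (rule order_trans[OF Bl(2) D(2)[rule_format]])
  also have "norm (C (B v) - D (B v)) <= e / 4 * norm v"
   using e(1) by (intro order_trans[OF D(2)[rule_format]] mult_left_mono Bl(2)) simp
  finally show ?thesis by simp
 qed
 thus "\<exists>S\<in>W. \<forall>B\<in>S. \<forall>v. norm (comm B C v) <= e * norm v" using S(1) by blast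
qed

text \<open>Allows asymptotic commutation to be checked on generators of a C*-algebra only.\<close>

lemma asym_subalgebra:
 fixes H (structure)
 assumes H: "cstar_algebra H" and X: "cstar_subalgebra H X" and \<Phi>: "star_hom (H\<lparr>carrier := X\<rparr>) (BL2 UNIV) \<Phi>"
 shows "cstar_subalgebra H {t \<in> X. asym (opr UNIV (\<Phi> t))}"
proof -
 interpret cstar_algebra H by (rule H)
 note D = cstar_subalgebraD[OF X]
 note h = star_homD[OF \<Phi>, simplified]
 note A = cstar_subalgebra_algebra[OF X]
 let ?S = "{t \<in> X. asym (opr UNIV (\<Phi> t))}"
 have zero: "opr UNIV (\<Phi> \<zero>) = (%v. 0)"
 proof -
  have "\<Phi> \<zero> = 0 \<odot>\<^bsub>BL2 UNIV\<^esub> \<Phi> \<zero>" using h(3)[OF D(2), of 0] by simp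
  thus ?thesis using opr_smult(2)[OF h(1)[OF D(2)], of 0] by simp
 qed
 have lim: "asym (opr UNIV (\<Phi> l))"
  if Y: "!!n. Y n \<in> X & asym (opr UNIV (\<Phi> (Y n)))" and l: "l \<in> X" "(%n. nrm H (Y n \<ominus> l)) \<longlonglongrightarrow> 0" for Y l
 proof (rule asym_limit)
  show "cblinear (opr UNIV (\<Phi> l))" using h(1)[OF l(1)] by simp
  fix e :: real assume "e > 0"
  hence "eventually (%n. nrm H (Y n \<ominus> l) < e) sequentially" using l(2) by (intro order_tendstoD(2)) auto
  then obtain n where n: "nrm H (Y n \<ominus> l) < e" by (auto simp: eventually_sequentially)
  note Yn = conjunct1[OF Y[of n]]
  have "norm (opr UNIV (\<Phi> l) v - opr UNIV (\<Phi> (Y n)) v) <= e * norm v" for v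
  proof -
   have c: "Y n \<ominus>\<^bsub>H\<lparr>carrier := X\<rparr>\<^esub> l = Y n \<ominus> l" by (rule subalgebra_minus[OF X Yn l(1)])
   have m: "\<Phi> (Y n \<ominus> l) = \<Phi> (Y n) \<ominus>\<^bsub>BL2 UNIV\<^esub> \<Phi> l"
    using star_hom_minus[OF \<Phi> normed_star_subalgebra[OF X] normed_star_algebra_BL2, of "Y n" l] Yn l(1) unfolding c by simp
   have "Y n \<ominus> l \<in> X" using abelian_group.minus_closed[of "H\<lparr>carrier := X\<rparr>" "Y n" l]
     normed_star_subalgebra[OF X] Yn l(1) unfolding c normed_star_algebra_def by simp
   hence "norm (opr UNIV (\<Phi> (Y n \<ominus> l)) v) <= nrm H (Y n \<ominus> l) * norm v"
    using star_hom_contractive_opr[OF A \<Phi>, of "Y n \<ominus> l" v] by simp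
   also have "\<dots> <= e * norm v" using n by (intro mult_right_mono) auto
   finally show ?thesis unfolding m opr_minus[OF h(1)[OF Yn] h(1)[OF l(1)]] by (simp add: norm_minus_commute)
  qed
  thus "\<exists>D. asym D & (\<forall>v. norm (opr UNIV (\<Phi> l) v - D v) <= e * norm v)" using Y[of n] by blast
 qed
 show ?thesis unfolding cstar_subalgebra_def
 proof (intro conjI ballI allI)
  show "closedin (cstar_topology H) ?S" unfolding closedin_iff
  proof (intro conjI allI impI)
   show "?S \<subseteq> carrier H" using subalgebra_subset[OF X] by blast
   fix Y l assume a: "(\<forall>n. Y n \<in> ?S) & l \<in> carrier H & (%n. nrm H (Y n \<ominus> l)) \<longlonglongrightarrow> 0"
   hence "l \<in> X" using D(1) unfolding closedin_iff by blast
   thus "l \<in> ?S" using lim[of Y l] a by blast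
  qed
  show "\<zero> \<in> ?S" using D(2) asym_exact[of "%v. 0"] test cblinear_0 by (auto simp: zero comm_def)
  fix x c assume x: "x \<in> ?S"
  show "adj H x \<in> ?S" using x asym_adj h(1) by (simp add: D(5) h(5) opr_adj)
  show "c \<odot> x \<in> ?S" using x asym_scale h(1) by (simp add: D(6) h(3) opr_smult)
  fix y assume y: "y \<in> ?S"
  show "x \<oplus> y \<in> ?S" using x y asym_add h(1) by (simp add: D(3) h(2) opr_add)
  show "x \<otimes> y \<in> ?S" using x y asym_comp h(1) by (simp add: D(4) h(4) opr_mult)
 qed
qed

end

section \<open>Units and embeddings in spatial tensor products\<close>

lemma op_tensor_eqI:
 assumes "S \<in> bounded_operators UNIV" "T \<in> bounded_operators UNIV" "R \<in> bounded_operators UNIV"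
  "opr UNIV R = tens (opr UNIV S) (opr UNIV T)"
 shows "op_tensor UNIV UNIV S T = R"
 using bo_eqI[OF opr_op_tensor(1)[OF assms(1,2), unfolded UNIV_Times_UNIV] assms(3)]
  opr_op_tensor(2)[OF assms(1,2)] assms(4) by simp

text \<open>The faithful representation may be degenerate, so \<open>\<pi> \<one>\<close> is only
  known to be a projection; tensoring with a projection is still multiplicative and preserves
  adjoints.\<close>

lemma op_tensor_star_hom:
 fixes A (structure) and \<pi> :: "'a => 'i operator" and \<rho> :: "'b => 'j operator"
 assumes \<pi>: "star_hom A (BL2 UNIV) \<pi>" and A: "monoid A" "cstar_algebra A" and \<rho>: "star_hom Z (BL2 UNIV) \<rho>"
  and uA: "adj A \<one> = \<one>"
 shows "star_hom Z (BL2 UNIV) (%z. op_tensor UNIV UNIV (\<pi> \<one>) (\<rho> z))"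
proof (rule star_homI)
 let ?o = "%z. op_tensor UNIV UNIV (\<pi> \<one>) (\<rho> z)"
 note p = star_homD[OF \<pi>, unfolded carrier_BL2] and r = star_homD[OF \<rho>, unfolded carrier_BL2]
 have 1: "\<one> \<in> carrier A" by (rule monoid.one_closed[OF A(1)])
 define E where "E = opr UNIV (\<pi> \<one>)"
 note p1 = p(1)[OF 1]
 have pp: "\<pi> \<one> \<otimes>\<^bsub>BL2 UNIV\<^esub> \<pi> \<one> = \<pi> \<one>" using p(4)[OF 1 1] monoid.l_one[OF A(1) 1] by simp
 have pa: "adj (BL2 UNIV) (\<pi> \<one>) = \<pi> \<one>" using p(5)[OF 1] uA by simp
 have E: "cblinear E" "!!v. E (E v) = E v" "cadj E = E"
  using fun_cong[OF opr_mult(2)[OF p1 p1]] opr_adj(2)[OF p1] p1 unfolding E_def pp pa by simp_all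
 have o: "?o z \<in> bounded_operators UNIV" "opr UNIV (?o z) = tens E (opr UNIV (\<rho> z))" if "z \<in> carrier Z" for z
  using opr_op_tensor[OF p(1)[OF 1] r(1)[OF that]] by (simp_all add: E_def)
 fix x y c assume x: "x \<in> carrier Z"
 note rx = r(1)[OF x] cblinear_opr[OF r(1)[OF x]]
 show "?o x \<in> carrier (BL2 UNIV)" using o(1)[OF x] by simp
 note ox = o[OF x]
 show "?o (c \<odot>\<^bsub>Z\<^esub> x) = c \<odot>\<^bsub>BL2 UNIV\<^esub> ?o x"
  unfolding r(3)[OF x] by (rule op_tensor_eqI[OF p1 opr_smult(1)[OF rx(1)] opr_smult(1)[OF ox(1)]])
   (simp only: opr_smult(2)[OF rx(1)] opr_smult(2)[OF ox(1)] ox(2) tens_scale_right[OF E(1) rx(2)] E_def[symmetric])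
 show "?o (adj Z x) = adj (BL2 UNIV) (?o x)"
  unfolding r(5)[OF x] by (rule op_tensor_eqI[OF p1 opr_adj(1)[OF rx(1)] opr_adj(1)[OF ox(1)]])
   (simp only: opr_adj(2)[OF rx(1)] opr_adj(2)[OF ox(1)] ox(2) cadj_tens[OF E(1) rx(2)] E(3) E_def[symmetric])
 assume y: "y \<in> carrier Z"
 note ry = r(1)[OF y] cblinear_opr[OF r(1)[OF y]] and oy = o[OF y]
 show "?o (x \<oplus>\<^bsub>Z\<^esub> y) = ?o x \<oplus>\<^bsub>BL2 UNIV\<^esub> ?o y"
  unfolding r(2)[OF x y] by (rule op_tensor_eqI[OF p1 opr_add(1)[OF rx(1) ry(1)] opr_add(1)[OF ox(1) oy(1)]])
   (simp only: opr_add(2)[OF rx(1) ry(1)] opr_add(2)[OF ox(1) oy(1)] ox(2) oy(2) tens_add_right[OF E(1) rx(2) ry(2)] E_def[symmetric])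
 show "?o (x \<otimes>\<^bsub>Z\<^esub> y) = ?o x \<otimes>\<^bsub>BL2 UNIV\<^esub> ?o y"
  unfolding r(4)[OF x y] by (rule op_tensor_eqI[OF p1 opr_mult(1)[OF rx(1) ry(1)] opr_mult(1)[OF ox(1) oy(1)]])
   (simp only: opr_mult(2)[OF rx(1) ry(1)] opr_mult(2)[OF ox(1) oy(1)] ox(2) oy(2) tens_comp[OF E(1) rx(2) E(1) ry(2)] E(2) E_def[symmetric])
qed

lemma op_tensor_mult:
 assumes "S \<in> bounded_operators I" "S' \<in> bounded_operators I" "T \<in> bounded_operators J" "T' \<in> bounded_operators J"
 shows "op_tensor I J S T \<otimes>\<^bsub>BL2 (I \<times> J)\<^esub> op_tensor I J S' T' = op_tensor I J (S \<otimes>\<^bsub>BL2 I\<^esub> S') (T \<otimes>\<^bsub>BL2 J\<^esub> T')"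
 by (rule bo_eqI[where I="I \<times> J"]) (use assms in \<open>auto simp: opr_mult opr_op_tensor tens_comp\<close>)

lemma (in cstar_algebra) adj_unit: "monoid A ==> adj A \<one> = \<one>"
proof -
 assume "monoid A"
 then interpret monoid A .
 have "adj A (adj A \<one> \<otimes> \<one>) = adj A \<one> \<otimes> adj A (adj A \<one>)" by (rule adj_mult[OF adj_closed[OF one_closed] one_closed])
 thus ?thesis by (simp add: adj_adj adj_closed)
qed

text \<open>The elements on which e acts as a two-sided unit form a C*-subalgebra. For degenerate
  representations the unit of the tensor product is not the identity operator and has to be
  identified this way.\<close>

lemma unit_of_generated:
 fixes H (structure)
 assumes H: "cstar_algebra H" and G: "G \<subseteq> carrier H" and ec: "e \<in> carrier H"
  and u: "!!t. t \<in> G ==> e \<otimes> t = t" and t: "t \<in> cstar_generated H G"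
  and Ga: "!!t. t \<in> G ==> t \<otimes> e = t" and ea: "adj H e = e"
 shows "e \<otimes> t = t"
proof -
 interpret cstar_algebra H by (rule H)
 define S where "S = {t \<in> carrier H. e \<otimes> t = t & t \<otimes> e = t}"
 have lim: "e \<otimes> l = l & l \<otimes> e = l" if Y: "!!n. Y n \<in> S" and l: "l \<in> carrier H" "(%n. nrm H (Y n \<ominus> l)) \<longlonglongrightarrow> 0" for Y l
 proof -
  have Yc: "Y n \<in> carrier H" "e \<otimes> (Y n) = Y n" "(Y n) \<otimes> e = Y n" for n using Y[of n] by (simp_all add: S_def)
  have e0: "(%n. nrm H (e \<ominus> e)) \<longlonglongrightarrow> 0" using ec minus_eq_zero_iff[of e e] nrm_eq_0[of \<zero>] by simp
  have "(%n. nrm H (e \<otimes> Y n \<ominus> e \<otimes> l)) \<longlonglongrightarrow> 0" "(%n. nrm H (Y n \<otimes> e \<ominus> l \<otimes> e)) \<longlonglongrightarrow> 0"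
   by (rule lim_mult; use Yc l ec e0 in simp)+
  thus ?thesis using l lim_unique[of Y l "e \<otimes> l"] lim_unique[of Y l "l \<otimes> e"] by (simp add: Yc m_closed ec)
 qed
 have "cstar_subalgebra H S" unfolding cstar_subalgebra_def
 proof (intro conjI ballI allI)
  show "closedin (cstar_topology H) S" unfolding closedin_iff
  proof (intro conjI allI impI)
   show "S \<subseteq> carrier H" by (auto simp: S_def)
   fix Y l assume a: "(\<forall>n. Y n \<in> S) & l \<in> carrier H & (%n. nrm H (Y n \<ominus> l)) \<longlonglongrightarrow> 0"
   have "e \<otimes> l = l & l \<otimes> e = l" by (rule lim[of Y l]) (use a in \<open>elim conjE, simp\<close>)+
   thus "l \<in> S" using a unfolding S_def by simp
  qed
  show "\<zero> \<in> S" using ec by (simp add: S_def mult_zero)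
  fix x c assume x: "x \<in> S"
  hence xc: "x \<in> carrier H" "e \<otimes> x = x" "x \<otimes> e = x" by (simp_all add: S_def)
  have "e \<otimes> (adj H x) = adj H (x \<otimes> e)" "(adj H x) \<otimes> e = adj H (e \<otimes> x)"
   using adj_mult[OF xc(1) ec] adj_mult[OF ec xc(1)] by (simp_all only: ea)
  thus "adj H x \<in> S" unfolding S_def using xc adj_closed[OF xc(1)] by simp
  show "c \<odot> x \<in> S" unfolding S_def
   using smult_closed[OF xc(1)] smult_mult_left[OF xc(1) ec] smult_mult_right[OF ec xc(1)] by (simp only: xc mem_Collect_eq simp_thms)
  fix y assume y: "y \<in> S"
  hence yc: "y \<in> carrier H" "e \<otimes> y = y" "y \<otimes> e = y" by (simp_all add: S_def)
  show "x \<oplus> y \<in> S" unfolding S_def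
   using a_closed[OF xc(1) yc(1)] r_distr[OF xc(1) yc(1) ec] l_distr[OF xc(1) yc(1) ec] by (simp only: xc yc mem_Collect_eq simp_thms)
  show "x \<otimes> y \<in> S" unfolding S_def
   using m_closed[OF xc(1) yc(1)] m_assoc[OF ec xc(1) yc(1)] m_assoc[OF xc(1) yc(1) ec] by (simp only: xc yc mem_Collect_eq simp_thms)
 qed
 moreover have "G \<subseteq> S" using G u Ga by (auto simp: S_def)
 ultimately have "t \<in> S" using generated_minimal t by blast
 thus ?thesis by (simp add: S_def)
qed

section \<open>Absorption of the Jiang-Su algebra contradicts fullness\<close>

text \<open>The order of choices matters: \<delta> depends only on the embedded copy of Z and on
  \<xi>. It fixes the precision \<delta>/7 for commuting with three symmetries. This precision is
  reached by a test set, given by a finite set K and a tolerance d, and only then is an almost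
  central element picked for K and d.\<close>

lemma not_Z_absorbing:
 fixes A :: "'a cstar" (structure) and g :: "'a => wl operator"
 assumes A: "cstar_algebra A" "monoid A" and g: "star_hom A (BL2 UNIV) g" "inj_on g (carrier A)" "g ` carrier A = AC"
 shows "\<not> Z_absorbing A"
proof
 assume "Z_absorbing A"
 then obtain Z :: "real cstar" and \<pi> :: "'a => 'a operator" and \<rho> :: "real => real operator"
  where Z: "jiang_su Z" and \<pi>: "star_hom A (BL2 UNIV) \<pi>" "inj_on \<pi> (carrier A)"
   and \<rho>: "star_hom Z (BL2 UNIV) \<rho>" "inj_on \<rho> (carrier Z)"
   and iso: "isomorphic A (spatial_tensor UNIV UNIV \<pi> \<rho> A Z)"
  unfolding Z_absorbing_def faithful_rep_def by (elim exE conjE) (rule that)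
 have Z': "cstar_algebra Z" "monoid Z" using Z unfolding jiang_su_def by blast+
 interpret A: cstar_algebra A by (rule A(1))
 interpret A: monoid A by (rule A(2))
 interpret Z: cstar_algebra Z by (rule Z'(1))
 interpret Z: monoid Z by (rule Z'(2))
 note p = star_homD[OF \<pi>(1), unfolded carrier_BL2] and r = star_homD[OF \<rho>(1), unfolded carrier_BL2]
  and gD = star_homD[OF g(1), unfolded carrier_BL2]
 let ?o = "op_tensor UNIV UNIV :: 'a operator => real operator => _"
 let ?H = "BL2 (UNIV :: ('a \<times> real) set)"
 define G where "G = {?o (\<pi> a) (\<rho> b) |a b. a \<in> carrier A & b \<in> carrier Z}"
 define X where "X = cstar_generated ?H G"
 define T where "T = ?H\<lparr>carrier := X\<rparr>"
 have oG: "?o (\<pi> a) (\<rho> b) \<in> G" if "a \<in> carrier A" "b \<in> carrier Z" for a b using that unfolding G_def by blast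
 have ob: "?o (\<pi> a) (\<rho> b) \<in> bounded_operators UNIV" if "a \<in> carrier A" "b \<in> carrier Z" for a b
  using opr_op_tensor(1)[OF p(1)[OF that(1)] r(1)[OF that(2)]] by simp
 have om: "?o (\<pi> a) (\<rho> b) \<otimes>\<^bsub>?H\<^esub> ?o (\<pi> a') (\<rho> b') = ?o (\<pi> (a \<otimes> a')) (\<rho> (b \<otimes>\<^bsub>Z\<^esub> b'))"
  if "a \<in> carrier A" "b \<in> carrier Z" "a' \<in> carrier A" "b' \<in> carrier Z" for a b a' b'
  using op_tensor_mult[OF p(1)[OF that(1)] p(1)[OF that(3)] r(1)[OF that(2)] r(1)[OF that(4)]]
  by (simp add: p(4)[OF that(1,3)] r(4)[OF that(2,4)])
 have GH: "G \<subseteq> carrier ?H" using ob by (auto simp: G_def)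
 interpret H: cstar_algebra ?H by (rule cstar_algebra_BL2)
 have X: "cstar_subalgebra ?H X" unfolding X_def by (rule H.subalgebra_generated[OF GH])
 have GX: "G \<subseteq> X" unfolding X_def by (rule H.generated_superset)
 have oX: "?o (\<pi> a) (\<rho> b) \<in> X" if "a \<in> carrier A" "b \<in> carrier Z" for a b using oG[OF that] GX by blast
 have "spatial_tensor UNIV UNIV \<pi> \<rho> A Z = T" unfolding spatial_tensor_def T_def X_def G_def by simp
 then obtain f where f: "star_hom A T f" "bij_betw f (carrier A) (carrier T)" using iso unfolding isomorphic_def by auto
 define h where "h = the_inv_into (carrier A) f"
 note hI = star_hom_inv[OF f A.normed_star_algebra_axioms, folded h_def]
 have cT: "carrier T = X" by (simp add: T_def)
 \<comment> \<open>The tensor product, identified with A by the given isomorphism, in its action on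
   lists. Its image lies in \<open>AC\<close>, so \<open>fullness\<close> applies to it.\<close>
 define \<Phi> where "\<Phi> t = g (h t)" for t
 have \<Phi>: "star_hom T (BL2 UNIV) \<Phi>" unfolding \<Phi>_def by (rule star_hom_comp[OF hI(1) g(1)])
 note \<Phi>D = star_homD[OF \<Phi>, unfolded carrier_BL2 cT]
 have \<Phi>inj: "s = t" if "s \<in> X" "t \<in> X" "\<Phi> s = \<Phi> t" for s t
 proof -
  have hs: "h s \<in> carrier A" "f (h s) = s" using hI(3)[of s] that(1) unfolding cT by blast+
  have ht: "h t \<in> carrier A" "f (h t) = t" using hI(3)[of t] that(2) unfolding cT by blast+
  have "h s = h t" by (rule inj_onD[OF g(2) that(3)[unfolded \<Phi>_def] hs(1) ht(1)])
  hence "f (h s) = f (h t)" by (rule arg_cong)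
  thus ?thesis unfolding hs(2) ht(2) .
 qed
 have \<Phi>AC: "\<Phi> t \<in> AC" if "t \<in> X" for t using hI(3)[of t] that g(3) unfolding \<Phi>_def cT by blast
 define \<iota> where "\<iota> z = ?o (\<pi> \<one>) (\<rho> z)" for z
 have \<iota>: "star_hom Z ?H \<iota>" unfolding \<iota>_def[abs_def]
  by (rule op_tensor_star_hom[OF \<pi>(1) A(2,1) \<rho>(1) A.adj_unit[OF A(2)]])
 have \<iota>X: "\<iota> z \<in> X" if "z \<in> carrier Z" for z unfolding \<iota>_def by (rule oX[OF A.one_closed that])
 have \<iota>T: "star_hom Z T \<iota>" using \<iota> \<iota>X unfolding star_hom_def linear_map_def T_def by auto
 define \<eta> where "\<eta> z = \<Phi> (\<iota> z)" for z
 have \<eta>: "star_hom Z (BL2 UNIV) \<eta>" unfolding \<eta>_def by (rule star_hom_comp[OF \<iota>T \<Phi>])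
 note \<eta>D = star_homD[OF \<eta>, unfolded carrier_BL2]
 have AC0: "carrier A ~= {\<zero>}"
 proof
  assume a: "carrier A = {\<zero>}"
  obtain x y where "x \<in> AC" "y \<in> AC" "x \<otimes>\<^bsub>AA\<^esub> y ~= y \<otimes>\<^bsub>AA\<^esub> x" using noncommutative_AA by auto
  moreover have "AC = {g \<zero>}" using g(3) unfolding a by blast
  ultimately have "x = y" by (metis singletonD)
  thus False using \<open>x \<otimes>\<^bsub>AA\<^esub> y ~= y \<otimes>\<^bsub>AA\<^esub> x\<close> by simp
 qed
 have \<pi>1: "\<exists>v. opr UNIV (\<pi> \<one>) v ~= 0"
 proof (rule ccontr)
  assume n: "\<nexists>v. opr UNIV (\<pi> \<one>) v ~= 0"
  have "opr UNIV (\<pi> \<zero>) = (%v. 0)"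
   using p(3)[OF A.one_closed, of 0] opr_smult(2)[OF p(1)[OF A.one_closed], of 0] by (simp add: A.smult_zero_left)
  hence "\<pi> \<one> = \<pi> \<zero>" using n by (intro bo_eqI[OF p(1) p(1)]) auto
  hence "\<one> = \<zero>" using inj_onD[OF \<pi>(2)] by simp
  hence "x = \<zero>" if "x \<in> carrier A" for x using A.l_one[OF that] A.mult_zero(2)[OF that] by simp
  thus False using AC0 by auto
 qed
 have \<eta>inj: "inj_on \<eta> (carrier Z)"
 proof (rule inj_onI, rule ccontr)
  fix z w assume z: "z \<in> carrier Z" and w: "w \<in> carrier Z" and e: "\<eta> z = \<eta> w" and ne: "z ~= w"
  have i: "\<iota> z = \<iota> w" using \<Phi>inj[OF \<iota>X[OF z] \<iota>X[OF w]] e by (simp add: \<eta>_def)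
  have "\<rho> z ~= \<rho> w" using inj_onD[OF \<rho>(2) _ z w] ne by blast
  then obtain v where v: "opr UNIV (\<rho> z) v ~= opr UNIV (\<rho> w) v" using bo_eqI[OF r(1)[OF z] r(1)[OF w]] by blast
  obtain u where u: "opr UNIV (\<pi> \<one>) u ~= 0" using \<pi>1 ..
  note bz = cblinear_opr[OF r(1)[OF z]] and bw = cblinear_opr[OF r(1)[OF w]] and b1 = cblinear_opr[OF p(1)[OF A.one_closed]]
  let ?D = "%v. opr UNIV (\<rho> z) v + scaleC (- 1) (opr UNIV (\<rho> w) v)"
  have t: "tens (opr UNIV (\<pi> \<one>)) (opr UNIV (\<rho> z)) = tens (opr UNIV (\<pi> \<one>)) (opr UNIV (\<rho> w))"
   using i opr_op_tensor(2)[OF p(1)[OF A.one_closed] r(1)[OF z]] opr_op_tensor(2)[OF p(1)[OF A.one_closed] r(1)[OF w]]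
   by (simp add: \<iota>_def)
  have "tens (opr UNIV (\<pi> \<one>)) ?D = (%x. 0)"
   unfolding tens_add_right[OF b1 bz cblinear_smult[OF bw]] tens_scale_right[OF b1 bw] t by (simp add: scaleC_minus_one)
  moreover have "?D v ~= 0" using v by (simp add: scaleC_minus_one)
  ultimately show False using tens_nonzero[OF b1 cblinear_plus[OF bz cblinear_smult[OF bw]] u, of v] by blast
 qed
 \<comment> \<open>The embedding is unital: 1 tensor 1 is the unit of the tensor product although it
   may act as a proper projection there, and g maps the unit of A to the identity because
   \<open>AC\<close> contains the identity.\<close>
 have \<eta>1: "\<eta> \<one>\<^bsub>Z\<^esub> = \<one>\<^bsub>BL2 UNIV\<^esub>"
 proof -
  let ?e = "\<iota> \<one>\<^bsub>Z\<^esub>"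
  have eX: "?e \<in> X" by (rule \<iota>X[OF Z.one_closed])
  have unit: "?e \<otimes>\<^bsub>?H\<^esub> t = t" if "t \<in> X" for t
  proof (rule unit_of_generated[OF H.cstar_algebra_axioms GH])
   show "?e \<in> carrier ?H" unfolding \<iota>_def by (simp add: ob)
   show "adj ?H ?e = ?e" using star_homD(5)[OF \<iota> Z.one_closed] Z.adj_unit[OF Z'(2)] by simp
   show "?e \<otimes>\<^bsub>?H\<^esub> s = s" "s \<otimes>\<^bsub>?H\<^esub> ?e = s" if "s \<in> G" for s using that unfolding G_def \<iota>_def by (auto simp: om)
  qed (use that X_def in simp)
  have f1: "f \<one> \<in> X" using star_homD(1)[OF f(1) A.one_closed] by (simp add: cT)
  have "h ?e = h ?e \<otimes> h (f \<one>)" using hI(2)[OF A.one_closed] hI(3)[of ?e] eX by (simp add: cT)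
  also have "\<dots> = h (?e \<otimes>\<^bsub>?H\<^esub> f \<one>)" using star_homD(4)[OF hI(1), of ?e "f \<one>"] eX f1 by (simp add: T_def)
  also have "\<dots> = \<one>" unfolding unit[OF f1] by (rule hI(2)[OF A.one_closed])
  finally have he: "\<eta> \<one>\<^bsub>Z\<^esub> = g \<one>" by (simp add: \<eta>_def \<Phi>_def)
  have "\<one>\<^bsub>BL2 UNIV\<^esub> \<in> AC" using monoid.one_closed[OF monoid_AA] by (simp add: AA_def)
  hence "\<one>\<^bsub>BL2 UNIV\<^esub> \<in> g ` carrier A" unfolding g(3) .
  then obtain a where a: "a \<in> carrier A" "\<one>\<^bsub>BL2 UNIV\<^esub> = g a" by (elim imageE)
  have b1: "g \<one> \<in> carrier (BL2 UNIV)" using gD(1)[OF A.one_closed] by simp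
  have "g \<one> = g \<one> \<otimes>\<^bsub>BL2 UNIV\<^esub> \<one>\<^bsub>BL2 UNIV\<^esub>" by (simp only: monoid.r_one[OF monoid_BL2 b1])
  also have "\<dots> = \<one>\<^bsub>BL2 UNIV\<^esub>" unfolding a(2) gD(4)[OF A.one_closed a(1), symmetric] A.l_one[OF a(1)] ..
  finally show ?thesis using he by simp
 qed
 let ?n = "%z. opr UNIV (\<eta> z)"
 have nl: "cblinear (?n z)" if "z \<in> carrier Z" for z using \<eta>D(1)[OF that] by simp
 have nadj: "cadj (?n z) = ?n (adj Z z)" if "z \<in> carrier Z" for z
  unfolding \<eta>D(5)[OF that] opr_adj(2)[OF \<eta>D(1)[OF that]] ..
 \<comment> \<open>Contractions from the copy of Z that commute up to d with the images of
   \<open>K\<close>, together with their adjoints. Enlarging \<open>K\<close> and shrinking d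
   shrinks the set, so these sets form a filter base.\<close>
 define S where "S K d = {?n z |z. z \<in> carrier Z & (\<forall>v. norm (?n z v) <= norm v) &
   (\<forall>k\<in>K. \<forall>v. norm (comm (?n z) (?n k) v) <= d * norm v & norm (comm (cadj (?n z)) (?n k) v) <= d * norm v)}"
  for K and d :: real
 define W where "W = {S K d |K d. finite K & K \<subseteq> carrier Z & d > 0}"
 have Smono: "S (K \<union> K') (min d d') \<subseteq> S K d" "S (K \<union> K') (min d d') \<subseteq> S K' d'" for K K' d d'
 proof -
  have m: "x <= min d d' * norm v ==> x <= d * norm v" "x <= min d d' * norm v ==> x <= d' * norm v" for x and v :: "wl ell2"
   using mult_right_mono[of "min d d'" d "norm v"] mult_right_mono[of "min d d'" d' "norm v"] by auto
  show "S (K \<union> K') (min d d') \<subseteq> S K d" "S (K \<union> K') (min d d') \<subseteq> S K' d'" unfolding S_def using m by blast+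
 qed
 have WI: "S K d \<in> W" if "finite K" "K \<subseteq> carrier Z" "d > 0" for K d unfolding W_def using that by blast
 interpret W: test_family W
 proof
  show "W ~= {}" using WI[of "{}" 1] by auto
  fix R R' assume "R \<in> W" "R' \<in> W"
  then obtain K d K' d' where K: "R = S K d" "finite K" "K \<subseteq> carrier Z" "d > 0" "R' = S K' d'" "finite K'" "K' \<subseteq> carrier Z" "d' > 0"
   unfolding W_def by blast
  show "\<exists>R''\<in>W. R'' \<subseteq> R & R'' \<subseteq> R'"
   using WI[of "K \<union> K'" "min d d'"] Smono[of K K' d d'] K by (intro bexI[of _ "S (K \<union> K') (min d d')"]) auto
 next
  fix R B assume "R \<in> W" "B \<in> R"
  then obtain K d where "R = S K d" "B \<in> S K d" unfolding W_def by blast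
  then obtain z where z: "z \<in> carrier Z" "B = ?n z" "\<forall>v. norm (?n z v) <= norm v"
   "\<forall>k\<in>K. \<forall>v. norm (comm (?n z) (?n k) v) <= d * norm v & norm (comm (cadj (?n z)) (?n k) v) <= d * norm v"
   unfolding S_def by blast
  have "norm (cadj (?n z) v) <= norm v" for v using norm_cadj_le[OF nl[OF z(1)], of 1 v] z(3) by simp
  hence "cadj B \<in> S K d" unfolding S_def z(2) using z(1,3,4) Z.adj_closed[OF z(1)] cadj_cadj[OF nl[OF z(1)]]
   by (intro CollectI exI[of _ "adj Z z"]) (simp add: nadj[OF z(1), symmetric])
  thus "cblinear B & (\<forall>v. norm (B v) <= norm v) & cadj B \<in> R" using z nl \<open>R = S K d\<close> by blast
 qed
 have Wz: "\<exists>z\<in>carrier Z. B = ?n z" if "R \<in> W" "B \<in> R" for R B using that unfolding W_def S_def by blast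
 have asym_\<eta>: "W.asym (?n z)" if z: "z \<in> carrier Z" for z unfolding W.asym_def
 proof (intro conjI allI impI nl[OF z])
  fix e :: real assume "e > 0"
  hence "S {z} e \<in> W" unfolding W_def using z by blast
  moreover have "\<forall>B\<in>S {z} e. \<forall>v. norm (comm B (?n z) v) <= e * norm v" unfolding S_def by blast
  ultimately show "\<exists>R\<in>W. \<forall>B\<in>R. \<forall>v. norm (comm B (?n z) v) <= e * norm v" by blast
 qed
 have asym_G: "W.asym (opr UNIV (\<Phi> t))" if tG: "t \<in> G" for t
 proof -
  obtain a b where ab: "a \<in> carrier A" "b \<in> carrier Z" "t = ?o (\<pi> a) (\<rho> b)" using tG unfolding G_def by blast
  \<comment> \<open>a tensor b is the product of a tensor 1 and 1 tensor b. The first factor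
    commutes exactly with the copy of Z, the second asymptotically with the test operators by the
    choice of W.\<close>
  define t1 where "t1 = ?o (\<pi> a) (\<rho> \<one>\<^bsub>Z\<^esub>)"
  have t1: "t1 \<in> X" unfolding t1_def by (rule oX[OF ab(1) Z.one_closed])
  have mul: "\<Phi> (s \<otimes>\<^bsub>?H\<^esub> s') = \<Phi> s \<otimes>\<^bsub>BL2 UNIV\<^esub> \<Phi> s'" if "s \<in> X" "s' \<in> X" for s s'
   using \<Phi>D(4)[OF that] by (simp add: T_def)
  have c: "t1 \<otimes>\<^bsub>?H\<^esub> \<iota> z = ?o (\<pi> a) (\<rho> z)" "\<iota> z \<otimes>\<^bsub>?H\<^esub> t1 = ?o (\<pi> a) (\<rho> z)" if "z \<in> carrier Z" for z
   unfolding t1_def \<iota>_def using ab(1) that by (simp_all add: om)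
  have o1: "opr UNIV (\<Phi> (?o (\<pi> a) (\<rho> z))) = (%v. opr UNIV (\<Phi> t1) (?n z v))"
   "opr UNIV (\<Phi> (?o (\<pi> a) (\<rho> z))) = (%v. ?n z (opr UNIV (\<Phi> t1) v))" if "z \<in> carrier Z" for z
   using c[OF that] mul[OF t1 \<iota>X[OF that]] mul[OF \<iota>X[OF that] t1]
    opr_mult(2)[OF \<Phi>D(1)[OF t1] \<Phi>D(1)[OF \<iota>X[OF that]]] opr_mult(2)[OF \<Phi>D(1)[OF \<iota>X[OF that]] \<Phi>D(1)[OF t1]]
   by (simp_all add: \<eta>_def)
  have "W.asym (opr UNIV (\<Phi> t1))"
  proof (rule W.asym_exact)
   show "cblinear (opr UNIV (\<Phi> t1))" using \<Phi>D(1)[OF t1] by simp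
   fix R B v assume "R \<in> W" "B \<in> R"
   then obtain z where z: "z \<in> carrier Z" "B = ?n z" using Wz by blast
   show "comm B (opr UNIV (\<Phi> t1)) v = 0"
    using fun_cong[OF o1(1)[OF z(1)], of v] fun_cong[OF o1(2)[OF z(1)], of v] by (simp add: comm_def z(2))
  qed
  from W.asym_comp[OF this asym_\<eta>[OF ab(2)]] show ?thesis unfolding ab(3) o1(1)[OF ab(2)] .
 qed
 have "X \<subseteq> {t \<in> X. W.asym (opr UNIV (\<Phi> t))}" unfolding X_def
  by (rule H.generated_minimal[OF W.asym_subalgebra[OF H.cstar_algebra_axioms X[unfolded X_def] \<Phi>[unfolded T_def X_def]]])
   (use GX asym_G in \<open>auto simp: X_def\<close>)
 hence asym_X: "W.asym (opr UNIV (\<Phi> t))" if "t \<in> X" for t using that by blast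
 obtain \<delta> where \<delta>: "\<delta> > 0" and central: "!!K e. finite K ==> K \<subseteq> carrier Z ==> e > 0 ==>
  \<exists>z\<in>carrier Z. (\<forall>v. norm (?n z v) <= norm v) &
   (\<forall>k\<in>K. \<forall>v. norm (?n z (?n k v) - ?n k (?n z v)) <= e * norm v) & (\<forall>c. \<delta> < norm (?n z \<xi> - scaleC c \<xi>))"
  using jiang_su_approx_central[OF Z \<eta> \<eta>inj \<eta>1, of \<xi>] unfolding \<xi>_def by (auto simp: norm_ket)
 have u: "\<exists>R\<in>W. \<forall>B\<in>R. \<forall>v. norm (comm B (op1 (x + 2)) v) <= \<delta> / 7 * norm v" for x
 proof -
  have "elL [(1, [x + 2])] \<in> g ` carrier A" unfolding g(3) using elL(1) S0_AC by blast
  then obtain a where a: "a \<in> carrier A" "elL [(1, [x + 2])] = g a" by (elim imageE)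
  have fa: "f a \<in> X" using star_homD(1)[OF f(1) a(1)] by (simp add: cT)
  have "opr UNIV (\<Phi> (f a)) = op1 (x + 2)"
   unfolding \<Phi>_def hI(2)[OF a(1)] a(2)[symmetric] elL(2) opL_single by (simp add: fun_eq_iff)
  hence "W.asym (op1 (x + 2))" using asym_X[OF fa] by simp
  thus ?thesis by (rule W.asymD) (use \<delta> in simp)
 qed
 obtain R where R: "R \<in> W" "!!x B v. x < 3 ==> B \<in> R ==> norm (comm B (op1 (x + 2)) v) <= \<delta> / 7 * norm v"
 proof -
  obtain R0 where R0: "R0 \<in> W" "\<forall>B\<in>R0. \<forall>v. norm (comm B (op1 (0 + 2)) v) <= \<delta> / 7 * norm v" using u[of 0] ..
  obtain R1 where R1: "R1 \<in> W" "\<forall>B\<in>R1. \<forall>v. norm (comm B (op1 (1 + 2)) v) <= \<delta> / 7 * norm v" using u[of 1] ..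
  obtain R2 where R2: "R2 \<in> W" "\<forall>B\<in>R2. \<forall>v. norm (comm B (op1 (2 + 2)) v) <= \<delta> / 7 * norm v" using u[of 2] ..
  obtain R3 where R3: "R3 \<in> W" "R3 \<subseteq> R0" "R3 \<subseteq> R1" using W.directed[OF R0(1) R1(1)] by blast
  obtain R4 where R4: "R4 \<in> W" "R4 \<subseteq> R3" "R4 \<subseteq> R2" using W.directed[OF R3(1) R2(1)] by blast
  have "norm (comm B (op1 (x + 2)) v) <= \<delta> / 7 * norm v" if x: "x < 3" and B: "B \<in> R4" for x B v
  proof -
   have BB: "B \<in> R0" "B \<in> R1" "B \<in> R2" using B R3 R4 by blast+
   consider "x = 0" | "x = 1" | "x = 2" using x by linarith
   thus ?thesis
   proof cases
    case 1 show ?thesis unfolding 1 by (rule R0(2)[rule_format, OF BB(1)])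
   next
    case 2 show ?thesis unfolding 2 by (rule R1(2)[rule_format, OF BB(2)])
   next
    case 3 show ?thesis unfolding 3 by (rule R2(2)[rule_format, OF BB(3)])
   qed
  qed
  thus ?thesis using that[OF R4(1)] by blast
 qed
 obtain K d where K: "R = S K d" "finite K" "K \<subseteq> carrier Z" "d > 0" using R(1) unfolding W_def by blast
 \<comment> \<open>\<open>S K d\<close> also bounds commutators of the adjoint of the test operator
   with the images of \<open>K\<close>; these are controlled by commutators of the operator itself
   with the adjoints, which are therefore added.\<close>
 let ?K = "K \<union> adj Z ` K"
 have "finite ?K" "?K \<subseteq> carrier Z" using K Z.adj_closed by auto
 from central[OF this K(4)] obtain z where z: "z \<in> carrier Z" "\<forall>v. norm (?n z v) <= norm v"
  "\<forall>k\<in>?K. \<forall>v. norm (comm (?n z) (?n k) v) <= d * norm v" "\<forall>c. \<delta> < norm (?n z \<xi> - scaleC c \<xi>)"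
  unfolding comm_def by blast
 have "norm (comm (cadj (?n z)) (?n k) v) <= d * norm v" if k: "k \<in> K" for k v
 proof -
  have kc: "k \<in> carrier Z" using k K(3) by blast
  have "norm (comm (cadj (?n z)) (cadj (?n (adj Z k))) v) <= d * norm v"
   by (rule comm_adj[OF nl[OF z(1)] nl[OF Z.adj_closed[OF kc]]]) (use z(3) k K(4) in auto)
  thus ?thesis unfolding nadj[OF Z.adj_closed[OF kc]] Z.adj_adj[OF kc] .
 qed
 hence zR: "?n z \<in> R" unfolding K(1) S_def using z(1-3) by blast
 have zAC: "\<eta> z \<in> AC" unfolding \<eta>_def by (rule \<Phi>AC[OF \<iota>X[OF z(1)]])
 have "\<exists>c. norm (?n z \<xi> - scaleC c \<xi>) <= 7 * (\<delta> / 7)"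
  by (rule fullness[OF zAC]) (use \<delta> R(2)[OF _ zR] in \<open>auto simp: comm_def\<close>)
 then obtain c where "norm (?n z \<xi> - scaleC c \<xi>) <= \<delta>" by auto
 thus False using z(4)[rule_format, of c] by simp
qed

theorem theorem3:
  shows "\<exists>A :: real cstar. cstar_algebra A \<and> monoid A \<and> separable A \<and> simple A \<and>
    purely_infinite A \<and> tracially_Z_absorbing A \<and> \<not> Z_absorbing A"
proof -
 obtain A :: "real cstar" and g where A: "cstar_algebra A" "monoid A" "separable A" "pi_algebra A g"
  "inj_on g (carrier A)" "g ` carrier A = AC" by (rule pi_algebra_transport_AA)
 have "\<not> Z_absorbing A" by (rule not_Z_absorbing[OF A(1,2) pi_algebra.\<sigma>[OF A(4)] A(5,6)])
 thus ?thesis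
  using A pi_algebra.simple[OF A(4)] pi_algebra.purely_infinite[OF A(4)] pi_algebra.tracially_Z_absorbing[OF A(4)] by blast
qed

end
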